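(* Let $\mathbf t=(t^{(1)},\dots,t^{(h)})\in\mathbb R^h$ and $\nu>(r-1)d/2$. For each $\phi\in\Phi$, as $\mu\to\infty$, $$R^{\mu,\nu}\left(\phi,\delta^{\mu,\nu}_{\mathbf t}\right)=R^{\mu,\nu}\left(\phi,\delta^{\mu,\nu}_R\right)+\frac{\nu}{\mu^2}\left(\sum_{i=1}^h\frac12k^{(i)}\left(t^{(i)}-t_R^{(i)}\right)^2\right)+O\left(\mu^{-5/2}\right).$$
   Context: Let $d\in\{1,2\}$ and let $r$ be a positive integer. $E_r$ is the real vector space of symmetric real $r\times r$ matrices (if $d=1$) or Hermitian complex $r\times r$ matrices (if $d=2$), $E_r^+\subset E_r$ the cone of positive definite matrices, and $n=\dim E_r=r+r(r-1)d/2$. $|x|$ is the determinant, $x^*$ the (conjugate) transpose, $\langle x\mid y\rangle=\mathrm{tr}(xy)$, and $dx$ is Lebesgue measure in the coordinates given by the diagonal entries and the real (and, if $d=2$, imaginary) parts of the entries above the diagonal. $\Xi=E_r^+$. Wishart distribution. For $\mu>(r-1)d/2$, $\Gamma_r(\mu)=\int_{E_r^+}|x|^{\mu-n/r}e^{-\mathrm{tr}(x)}dx$, and $W_r(\mu,\xi)$, $\xi\in\Xi$, is the distribution on $E_r^+$ with density $p^\mu(x\mid\xi)=\frac{|x|^{\mu-n/r}}{\Gamma_r(\mu)}|\xi|^\mu e^{-\langle\xi\mid x\rangle}$. Partition and parameters. Let $h\ge2$ and let $\mathbf k=(k^{(1)},\dots,k^{(h)})$ be positive integers with $\sum_i k^{(i)}=r$;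 put $r_{(i)}=k^{(1)}+\dots+k^{(i)}$. For $\xi\in\Xi$ set $\zeta_{(h)}=\xi$ and, for $i=h,\dots,2$, write $\zeta_{(i)}\in E^+_{r_{(i)}}$ in blocks with respect to $r_{(i)}=r_{(i-1)}+k^{(i)}$ as $$\zeta_{(i)}=\begin{bmatrix}\xi_{(i-1)}&\xi^{(i)}_{1/2}\\ (\xi^{(i)}_{1/2})^*&\xi^{(i)}_0\end{bmatrix},\qquad \zeta_{(i-1)}:=\xi_{(i-1)}-\xi^{(i)}_{1/2}(\xi^{(i)}_0)^{-1}(\xi^{(i)}_{1/2})^*.$$ Put $\phi^{(1)}=\xi^{(1)}_0:=\zeta_{(1)}$ and $\phi^{(i)}=(\xi^{(i)}_{1/2},\xi^{(i)}_0)$ for $i\ge2$. The map $\xi\mapsto\phi=(\phi^{(1)},\dots,\phi^{(h)})$ is a bijection $\Xi\to\Phi$ with $d\xi=d\phi$, and $\xi$ and $\phi$ are identified. Priors. For $\mathbf t\in\mathbb R^h$, $\pi_{\mathbf t}(\phi)\,d\phi=\prod_{i=1}^h|\xi_0^{(i)}|^{t^{(i)}}d\phi^{(i)}$ (possibly improper). $\mathbf t_R=(t_R^{(1)},\dots,t_R^{(h)})$ with $t_R^{(i)}=-\left(\frac{2r_{(i)}-k^{(i)}-1}{2}d+1\right)$. Prediction. $X\sim W_r(\mu,\xi)$ and $Y\sim W_r(\nu,\xi)$ are independent. The Bayesian predictive density based on $\pi_{\mathbf t}$ is $\delta^{\mu,\nu}_{\mathbf t}(y\mid x)=\int_\Phi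 p^\nu(y\mid\phi)\,\pi^\mu_{\mathbf t}(\phi\mid x)\,d\phi$, where $\pi^\mu_{\mathbf t}(\phi\mid x)\propto p^\mu(x\mid\phi)\pi_{\mathbf t}(\phi)$ is the posterior density (proper for all large $\mu$); $\delta^{\mu,\nu}_R:=\delta^{\mu,\nu}_{\mathbf t_R}$. The risk of a predictive density $\delta$ at $\phi$ (equivalently at $\xi$) is $R^{\mu,\nu}(\phi,\delta)=E_{X,Y}\left[\log\frac{p^\nu(Y\mid\xi)}{\delta(Y\mid X)}\right]$. The $O(\cdot)$ is for fixed $\phi$, $\nu$, $\mathbf t$; its constant may depend on them. *)

theory Defs
  imports
    "HOL-Probability.Probability"
    "HOL-Library.Landau_Symbols"
    "Jordan_Normal_Form.Schur_Decomposition"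
    "Jordan_Normal_Form.Gauss_Jordan_Elimination"
begin

section \<open>Matrices over the reals (d = 1) or the complex numbers (d = 2)\<close>

text \<open>
  Both cases are treated with complex matrices of explicit dimension; for \<open>d = 1\<close> all entries
  are required to be real. On such matrices the adjoint is the transpose, and determinants and
  traces of Hermitian matrices (and traces of products of two of them) are real numbers, so that
  taking real parts loses nothing.
\<close>

definition scalars :: "nat \<Rightarrow> complex set" where
  "scalars d = (if d = 1 then \<real> else UNIV)"

definition mats :: "nat \<Rightarrow> nat \<Rightarrow> nat \<Rightarrow> complex mat set" where
  "mats d p q = {A \<in> carrier_mat p q. \<forall>a<p. \<forall>b<q. A $$ (a, b) \<in> scalars d}"

definition herm :: "nat \<Rightarrow> nat \<Rightarrow> complex mat set" where
  "herm d m = {A \<in> mats d m m. mat_adjoint A = A}"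

definition posdef :: "nat \<Rightarrow> nat \<Rightarrow> complex mat set" where
  "posdef d m = {A \<in> herm d m. \<forall>v \<in> carrier_vec m.
     (\<forall>a<m. vec_index v a \<in> scalars d) \<longrightarrow> v \<noteq> 0\<^sub>v m \<longrightarrow> 0 < Re ((A *\<^sub>v v) \<bullet>c v)}"

definition rdet :: "complex mat \<Rightarrow> real" where
  "rdet A = Re (Determinant.det A)"

definition rtrace :: "complex mat \<Rightarrow> real" where
  "rtrace A = Re (\<Sum>a<dim_row A. A $$ (a, a))"

definition minv :: "complex mat \<Rightarrow> complex mat" where
  "minv A = the (mat_inverse A)"


section \<open>Lebesgue measure on spaces of matrices\<close>

text \<open>
  Real coordinates are indexed by triples \<open>(a, b, c)\<close>: the entry in row \<open>a\<close> and column \<open>b\<close>, its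
  real part if \<open>c = 0\<close> and its imaginary part if \<open>c = 1\<close>. Given an index set \<open>I\<close> whose coordinates
  identify \<open>S\<close> with \<open>\<real>\<^sup>I\<close>, Lebesgue measure is transported from \<open>\<real>\<^sup>I\<close> to \<open>S\<close>.
\<close>

type_synonym coord_index = "nat \<times> nat \<times> nat"

definition coords :: "coord_index set \<Rightarrow> complex mat \<Rightarrow> coord_index \<Rightarrow> real" where
  "coords I A = restrict (\<lambda>(a, b, c). if c = 0 then Re (A $$ (a, b)) else Im (A $$ (a, b))) I"

definition lebesgue_via :: "complex mat set \<Rightarrow> coord_index set \<Rightarrow> complex mat measure" where
  "lebesgue_via S I =
     distr (\<Pi>\<^sub>M i\<in>I. lborel) (vimage_algebra S (coords I) (\<Pi>\<^sub>M i\<in>I. borel))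
       (the_inv_into S (coords I))"

definition mats_lebesgue :: "nat \<Rightarrow> nat \<Rightarrow> nat \<Rightarrow> complex mat measure" where
  "mats_lebesgue d p q = lebesgue_via (mats d p q) {(a, b, c). a < p \<and> b < q \<and> c < d}"

definition herm_lebesgue :: "nat \<Rightarrow> nat \<Rightarrow> complex mat measure" where
  "herm_lebesgue d m =
     lebesgue_via (herm d m) {(a, b, c). a \<le> b \<and> b < m \<and> c < d \<and> (a = b \<longrightarrow> c = 0)}"


section \<open>Wishart distributions\<close>

definition dimE :: "nat \<Rightarrow> nat \<Rightarrow> real" where
  "dimE d r = real r + real r * (real r - 1) * real d / 2"

definition Gamma_mat :: "nat \<Rightarrow> nat \<Rightarrow> real \<Rightarrow> real" where
  "Gamma_mat d r \<mu> =
     (LINT x:posdef d r|herm_lebesgue d r. rdet x powr (\<mu> - dimE d r / real r) * exp (- rtrace x))"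

definition wishart_density ::
    "nat \<Rightarrow> nat \<Rightarrow> real \<Rightarrow> complex mat \<Rightarrow> complex mat \<Rightarrow> real" where
  "wishart_density d r \<mu> \<xi> x =
     rdet x powr (\<mu> - dimE d r / real r) / Gamma_mat d r \<mu> * rdet \<xi> powr \<mu> * exp (- rtrace (\<xi> * x))"

definition wishart :: "nat \<Rightarrow> nat \<Rightarrow> real \<Rightarrow> complex mat \<Rightarrow> complex mat measure" where
  "wishart d r \<mu> \<xi> = density (restrict_space (herm_lebesgue d r) (posdef d r))
     (\<lambda>x. ennreal (wishart_density d r \<mu> \<xi> x))"


section \<open>The parametrization by blocks\<close>

text \<open>The partition is given by the values of \<open>k\<close> on \<open>{1..h}\<close>; \<open>rsum k i\<close> is the size of the
  matrix consisting of the first \<open>i\<close> diagonal blocks.\<close>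

definition rsum :: "(nat \<Rightarrow> nat) \<Rightarrow> nat \<Rightarrow> nat" where
  "rsum k i = (\<Sum>j=1..i. k j)"

definition schur_step :: "nat \<Rightarrow> complex mat \<Rightarrow> complex mat" where
  "schur_step p A = (case split_block A p p of
     (A11, A12, A21, A22) \<Rightarrow> A11 - A12 * minv A22 * mat_adjoint A12)"

primrec zeta_iter :: "(nat \<Rightarrow> nat) \<Rightarrow> nat \<Rightarrow> complex mat \<Rightarrow> nat \<Rightarrow> complex mat" where
  "zeta_iter k h \<xi> 0 = \<xi>"
| "zeta_iter k h \<xi> (Suc j) = schur_step (rsum k (h - Suc j)) (zeta_iter k h \<xi> j)"

definition zeta :: "(nat \<Rightarrow> nat) \<Rightarrow> nat \<Rightarrow> complex mat \<Rightarrow> nat \<Rightarrow> complex mat" where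
  "zeta k h \<xi> i = zeta_iter k h \<xi> (h - i)"

lemma zeta_top: "zeta k h \<xi> h = \<xi>"
  by (simp add: zeta_def)

lemma zeta_down:
  assumes "2 \<le> i" and "i \<le> h"
  shows "zeta k h \<xi> (i - 1) = schur_step (rsum k (i - 1)) (zeta k h \<xi> i)"
proof -
  have "h - (i - 1) = Suc (h - i)" and "h - Suc (h - i) = i - 1"
    using assms by linarith+
  then show ?thesis
    by (simp add: zeta_def)
qed

text \<open>The component with index \<open>i\<close> is the pair of the upper right and the lower right block of
  \<open>zeta k h \<xi> i\<close>. For \<open>i = 1\<close> the upper right block is the unique \<open>0 \<times> k 1\<close> matrix, so the pair
  carries the same information as the lower right block \<open>zeta k h \<xi> 1\<close>.\<close>

type_synonym param = "nat \<Rightarrow> complex mat \<times> complex mat"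

definition phi_of :: "(nat \<Rightarrow> nat) \<Rightarrow> nat \<Rightarrow> complex mat \<Rightarrow> param" where
  "phi_of k h \<xi> = (\<lambda>i\<in>{1..h}. case split_block (zeta k h \<xi> i) (rsum k (i - 1)) (rsum k (i - 1)) of
     (A11, A12, A21, A22) \<Rightarrow> (A12, A22))"

definition Phi :: "nat \<Rightarrow> (nat \<Rightarrow> nat) \<Rightarrow> nat \<Rightarrow> param set" where
  "Phi d k h = phi_of k h ` posdef d (rsum k h)"

definition xi_of :: "nat \<Rightarrow> (nat \<Rightarrow> nat) \<Rightarrow> nat \<Rightarrow> param \<Rightarrow> complex mat" where
  "xi_of d k h = the_inv_into (posdef d (rsum k h)) (phi_of k h)"

definition phi_lebesgue :: "nat \<Rightarrow> (nat \<Rightarrow> nat) \<Rightarrow> nat \<Rightarrow> param measure" where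
  "phi_lebesgue d k h =
     (\<Pi>\<^sub>M i\<in>{1..h}. mats_lebesgue d (rsum k (i - 1)) (k i) \<Otimes>\<^sub>M herm_lebesgue d (k i))"


section \<open>Priors, Bayesian predictive densities and risk\<close>

definition prior :: "nat \<Rightarrow> (nat \<Rightarrow> real) \<Rightarrow> param \<Rightarrow> real" where
  "prior h t \<phi> = (\<Prod>i=1..h. rdet (snd (\<phi> i)) powr t i)"

definition tR :: "nat \<Rightarrow> (nat \<Rightarrow> nat) \<Rightarrow> nat \<Rightarrow> real" where
  "tR d k i = - ((2 * real (rsum k i) - real (k i) - 1) / 2 * real d + 1)"

definition model_density ::
    "nat \<Rightarrow> (nat \<Rightarrow> nat) \<Rightarrow> nat \<Rightarrow> real \<Rightarrow> param \<Rightarrow> complex mat \<Rightarrow> real" where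
  "model_density d k h \<mu> \<phi> x = wishart_density d (rsum k h) \<mu> (xi_of d k h \<phi>) x"

definition posterior ::
    "nat \<Rightarrow> (nat \<Rightarrow> nat) \<Rightarrow> nat \<Rightarrow> (nat \<Rightarrow> real) \<Rightarrow> real \<Rightarrow> complex mat \<Rightarrow> param \<Rightarrow> real" where
  "posterior d k h t \<mu> x \<phi> = model_density d k h \<mu> \<phi> x * prior h t \<phi> /
     (LINT \<psi>:Phi d k h|phi_lebesgue d k h. model_density d k h \<mu> \<psi> x * prior h t \<psi>)"

text \<open>\<open>predictive d k h t \<mu> \<nu> x y\<close> is the predictive density at \<open>y\<close> given the observation \<open>x\<close>.\<close>

definition predictive ::
    "nat \<Rightarrow> (nat \<Rightarrow> nat) \<Rightarrow> nat \<Rightarrow> (nat \<Rightarrow> real) \<Rightarrow> real \<Rightarrow> real \<Rightarrow> complex mat \<Rightarrow> complex mat \<Rightarrow> real" where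
  "predictive d k h t \<mu> \<nu> x y =
     (LINT \<phi>:Phi d k h|phi_lebesgue d k h. model_density d k h \<nu> \<phi> y * posterior d k h t \<mu> x \<phi>)"

definition risk ::
    "nat \<Rightarrow> (nat \<Rightarrow> nat) \<Rightarrow> nat \<Rightarrow> real \<Rightarrow> real \<Rightarrow> param \<Rightarrow> (complex mat \<Rightarrow> complex mat \<Rightarrow> real) \<Rightarrow> real"
where
  "risk d k h \<mu> \<nu> \<phi> \<delta> =
     (LINT (x, y)|(wishart d (rsum k h) \<mu> (xi_of d k h \<phi>) \<Otimes>\<^sub>M
                   wishart d (rsum k h) \<nu> (xi_of d k h \<phi>)).
        ln (model_density d k h \<nu> \<phi> y / \<delta> x y))"

end

(*
The pivots s_j(x), quotients of successive leading principal minors, drive everything. Under a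
Wishart distribution they are gamma distributed with shape mu - j d / 2 and a rate that does not
depend on mu (peel off the last row and column), and sums of independent Wishart matrices are
again Wishart. Integrating the block parameters out one block at a time, the integral of
|xi|^lambda exp(-tr(xi x)) against the prior is a product of Gamma functions times powers of the
pivots of x, so that ln of a predictive density is linear in the ln s_j(x) and ln s_j(x + y).
The expectation of ln s_j is a Digamma value minus a constant that cancels. The difference of the
two risks thus becomes a sum over j of increments over [mu, mu + nu] of
ln Gamma(z + u) - ln Gamma(z) - u Digamma(z) with z = mu - j d / 2 and u = t(i) - t_R(i) on block i,
and a second order Taylor expansion of Digamma gives each of them up to O(mu^-3).
*)
theory Submission
  imports Defs "HOL-Real_Asymp.Real_Asymp"
begin

section \<open>Lebesgue measure on spaces of matrices\<close>

text \<open>The expansion works because \<open>tR\<close> is a reflection. A prior \<open>t\<close>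
  attaches to row l of block i a Gamma function of shape
  \<open>\<mu> + t i + (rsum k (i - 1) + l) * d / 2 + 1\<close>. For \<open>tR\<close> this is
  \<open>\<mu> - j * d / 2\<close>, where j is the row in mirrored position inside the same block.
  These are the shapes of the pivots of that block in reverse order, so after reversing the sum over
  the block each ln Gamma meets the Digamma at its own argument. What is left is minus an increment
  of D(z) = ln Gamma(z + u) - ln Gamma(z) - u Digamma(z). Its derivative is about - u^2 / (2 z^2),
  which gives nu u^2 / (2 mu^2) per row and the weight \<open>k i\<close> per block. The matrix
  measures are given by coordinates only. All changes of variables are built from reordering
  coordinates, translations, and scalings of single real coordinates: eliminating a block is a
  translation as long as the other blocks are fixed. The matrix integrals are nonnegative and
  extended-valued, so that Tonelli applies throughout and awkward constants can stay undetermined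
  until a total mass fixes them.\<close>

interpretation lborel_prod: product_sigma_finite "\<lambda>_::coord_index. lborel :: real measure"
  by standard

text \<open>Surjectivity matters as much as injectivity: only then does \<open>the_inv_into\<close>
  in \<open>lebesgue_via\<close> land in \<open>S\<close> at every point of the product
  space.\<close>

definition coord_sys :: "complex mat set \<Rightarrow> coord_index set \<Rightarrow> bool" where
  "coord_sys S I \<longleftrightarrow> finite I \<and> bij_betw (coords I) S (PiE I (\<lambda>_. UNIV))"

definition coord_box :: "complex mat set \<Rightarrow> coord_index set \<Rightarrow> (coord_index \<Rightarrow> real set) \<Rightarrow> complex mat set"
  where "coord_box S I A = {x \<in> S. \<forall>i\<in>I. coords I x i \<in> A i}"

lemma sets_PiM_borel_lborel:
  "sets (\<Pi>\<^sub>M i\<in>I. (borel :: real measure)) = sets (\<Pi>\<^sub>M i\<in>I. (lborel :: real measure))"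
  by (rule sets_PiM_cong) auto

lemma space_via [simp]: "space (lebesgue_via S I) = S"
  by (simp add: lebesgue_via_def)

lemma sets_via: "sets (lebesgue_via S I) = sets (vimage_algebra S (coords I) (\<Pi>\<^sub>M i\<in>I. lborel))"
  unfolding lebesgue_via_def sets_distr
  by (rule sets_vimage_algebra_cong) (rule sets_PiM_borel_lborel)

lemma coords_mem: "coord_sys S I \<Longrightarrow> x \<in> S \<Longrightarrow> coords I x \<in> space (\<Pi>\<^sub>M i\<in>I. (lborel :: real measure))"
  by (auto simp: coord_sys_def space_PiM dest: bij_betwE)

lemma coords_extensional: "coords I x \<in> extensional I"
  by (simp add: coords_def)

lemma measurable_coords:
  assumes "coord_sys S I"
  shows "coords I \<in> lebesgue_via S I \<rightarrow>\<^sub>M (\<Pi>\<^sub>M i\<in>I. lborel)"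
proof -
  have "coords I \<in> vimage_algebra S (coords I) (\<Pi>\<^sub>M i\<in>I. lborel) \<rightarrow>\<^sub>M (\<Pi>\<^sub>M i\<in>I. lborel)"
    using coords_mem[OF assms] by (intro measurable_vimage_algebra1) auto
  then show ?thesis
    by (subst measurable_cong_sets[OF sets_via refl])
qed

text \<open>The sigma-algebra of \<open>lebesgue_via\<close> is the initial one for
  \<open>coords I\<close>, so maps into it are tested after composition with the
  coordinates.\<close>

lemma measurable_via:
  assumes "f \<in> space N \<rightarrow> S" "(\<lambda>x. coords I (f x)) \<in> N \<rightarrow>\<^sub>M (\<Pi>\<^sub>M i\<in>I. lborel)"
  shows "f \<in> N \<rightarrow>\<^sub>M lebesgue_via S I"
  by (subst measurable_cong_sets[OF refl sets_via]) (rule measurable_vimage_algebra2[OF assms])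

lemma measurable_via_coord:
  assumes "coord_sys S I" "f \<in> space N \<rightarrow> S" "\<And>i. i \<in> I \<Longrightarrow> (\<lambda>x. coords I (f x) i) \<in> borel_measurable N"
  shows "f \<in> N \<rightarrow>\<^sub>M lebesgue_via S I"
proof (rule measurable_via[OF assms(2)])
  have "(\<lambda>x. \<lambda>i\<in>I. coords I (f x) i) \<in> N \<rightarrow>\<^sub>M (\<Pi>\<^sub>M i\<in>I. lborel)"
    using assms(3) by (intro measurable_restrict) simp
  moreover have "(\<lambda>i\<in>I. coords I (f x) i) = coords I (f x)" for x
    by (rule extensional_restrict[OF coords_extensional])
  ultimately show "(\<lambda>x. coords I (f x)) \<in> N \<rightarrow>\<^sub>M (\<Pi>\<^sub>M i\<in>I. lborel)" by simp
qed

lemma coord_inv: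
  assumes "coord_sys S I"
  shows "\<omega> \<in> space (\<Pi>\<^sub>M i\<in>I. (lborel :: real measure)) \<Longrightarrow> coords I (the_inv_into S (coords I) \<omega>) = \<omega>"
    and "\<omega> \<in> space (\<Pi>\<^sub>M i\<in>I. (lborel :: real measure)) \<Longrightarrow> the_inv_into S (coords I) \<omega> \<in> S"
    and "x \<in> S \<Longrightarrow> the_inv_into S (coords I) (coords I x) = x"
  using assms unfolding coord_sys_def bij_betw_def
  by (auto simp: space_PiM intro!: f_the_inv_into_f the_inv_into_into the_inv_into_f_f)

lemma measurable_coord_inv:
  assumes "coord_sys S I"
  shows "the_inv_into S (coords I) \<in> (\<Pi>\<^sub>M i\<in>I. lborel) \<rightarrow>\<^sub>M lebesgue_via S I"
proof (rule measurable_via)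
  show "the_inv_into S (coords I) \<in> space (\<Pi>\<^sub>M i\<in>I. lborel) \<rightarrow> S"
    using coord_inv[OF assms] by auto
  have "(\<lambda>x. x) \<in> (\<Pi>\<^sub>M i\<in>I. lborel) \<rightarrow>\<^sub>M (\<Pi>\<^sub>M i\<in>I. (lborel :: real measure))" by simp
  then show "(\<lambda>x. coords I (the_inv_into S (coords I) x)) \<in> (\<Pi>\<^sub>M i\<in>I. lborel) \<rightarrow>\<^sub>M (\<Pi>\<^sub>M i\<in>I. lborel)"
    by (subst measurable_cong[where g="\<lambda>x. x"]) (auto simp: coord_inv[OF assms])
qed

text \<open>Naming \<open>lebesgue_via S I\<close> itself as the target space gives the form to
  which \<open>distr_distr\<close> applies.\<close>

lemma via_eq_distr:
  "coord_sys S I \<Longrightarrow>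
    lebesgue_via S I = distr (\<Pi>\<^sub>M i\<in>I. lborel) (lebesgue_via S I) (the_inv_into S (coords I))"
  unfolding lebesgue_via_def by (rule distr_cong) (auto simp: )

lemma distr_coords:
  assumes "coord_sys S I"
  shows "distr (lebesgue_via S I) (\<Pi>\<^sub>M i\<in>I. lborel) (coords I) = (\<Pi>\<^sub>M i\<in>I. lborel)"
proof -
  have "distr (lebesgue_via S I) (\<Pi>\<^sub>M i\<in>I. lborel) (coords I) =
      distr (\<Pi>\<^sub>M i\<in>I. lborel) (\<Pi>\<^sub>M i\<in>I. lborel) (coords I \<circ> the_inv_into S (coords I))"
    by (subst via_eq_distr[OF assms])
       (rule distr_distr[OF measurable_coords[OF assms] measurable_coord_inv[OF assms]])
  also have "\<dots> = distr (\<Pi>\<^sub>M i\<in>I. lborel) (\<Pi>\<^sub>M i\<in>I. lborel) (\<lambda>x. x)"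
    by (rule distr_cong) (auto simp: coord_inv[OF assms])
  finally show ?thesis by (simp add: distr_id)
qed

lemma sigma_finite_via:
  assumes "coord_sys S I"
  shows "sigma_finite_measure (lebesgue_via S I)"
proof (rule sigma_finite_measure_distr[OF _ measurable_coords[OF assms]])
  interpret finite_product_sigma_finite "\<lambda>_. lborel" I
    using assms by unfold_locales (simp add: coord_sys_def)
  show "sigma_finite_measure (distr (lebesgue_via S I) (\<Pi>\<^sub>M i\<in>I. lborel) (coords I))"
    unfolding distr_coords[OF assms] by (rule sigma_finite_measure_axioms)
qed

lemma nn_integral_via:
  assumes "coord_sys S I" "f \<in> borel_measurable (lebesgue_via S I)"
  shows "(\<integral>\<^sup>+x. f x \<partial>lebesgue_via S I) = (\<integral>\<^sup>+\<omega>. f (the_inv_into S (coords I) \<omega>) \<partial>(\<Pi>\<^sub>M i\<in>I. lborel))"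
  by (subst via_eq_distr[OF assms(1)])
     (use assms(2) in \<open>simp add: nn_integral_distr[OF measurable_coord_inv[OF assms(1)]]\<close>)

lemma coord_box_sets:
  assumes "coord_sys S I" "\<And>i. i \<in> I \<Longrightarrow> A i \<in> sets borel"
  shows "coord_box S I A \<in> sets (lebesgue_via S I)"
    and "emeasure (lebesgue_via S I) (coord_box S I A) = (\<Prod>i\<in>I. emeasure lborel (A i))"
proof -
  have fin: "finite I" using assms(1) by (simp add: coord_sys_def)
  have eq: "coord_box S I A = coords I -` (PiE I A) \<inter> space (lebesgue_via S I)"
    by (rule Set.set_eqI) (simp add: coord_box_def PiE_iff coords_extensional conj_commute)
  have P: "PiE I A \<in> sets (\<Pi>\<^sub>M i\<in>I. lborel)"
    using assms(2) fin by (intro sets_PiM_I_finite) auto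
  show "coord_box S I A \<in> sets (lebesgue_via S I)"
    unfolding eq by (rule measurable_sets[OF measurable_coords[OF assms(1)] P])
  have "emeasure (lebesgue_via S I) (coord_box S I A) =
      emeasure (distr (lebesgue_via S I) (\<Pi>\<^sub>M i\<in>I. lborel) (coords I)) (PiE I A)"
    unfolding eq by (rule emeasure_distr[OF measurable_coords[OF assms(1)] P, symmetric])
  also have "\<dots> = (\<Prod>i\<in>I. emeasure lborel (A i))"
    unfolding distr_coords[OF assms(1)] using fin assms(2) by (intro lborel_prod.emeasure_PiM) auto
  finally show "emeasure (lebesgue_via S I) (coord_box S I A) = (\<Prod>i\<in>I. emeasure lborel (A i))" .
qed

text \<open>A finite product of sigma-finite measures is determined by its values on boxes. The test
  is made on the product space after \<open>coords I\<close>, and the result is carried back by the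
  inverse of the coordinates.\<close>

lemma distr_eq_via:
  assumes S: "coord_sys S I" and \<Phi>: "\<Phi> \<in> M \<rightarrow>\<^sub>M lebesgue_via S I"
    and eq: "\<And>A. (\<And>i. i \<in> I \<Longrightarrow> A i \<in> sets borel) \<Longrightarrow>
      emeasure M (\<Phi> -` coord_box S I A \<inter> space M) = (\<Prod>i\<in>I. emeasure lborel (A i))"
  shows "distr M (lebesgue_via S I) \<Phi> = lebesgue_via S I"
proof -
  let ?P = "\<Pi>\<^sub>M i\<in>I. (lborel :: real measure)"
  have fin: "finite I" using S by (simp add: coord_sys_def)
  have c\<Phi>: "coords I \<circ> \<Phi> \<in> M \<rightarrow>\<^sub>M ?P"
    using measurable_coords[OF S] \<Phi> by (rule measurable_comp[rotated])
  have "distr M ?P (coords I \<circ> \<Phi>) = ?P"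
  proof (rule lborel_prod.PiM_eqI[OF fin])
    fix A :: "coord_index \<Rightarrow> real set" assume A: "\<And>i. i \<in> I \<Longrightarrow> A i \<in> sets lborel"
    have *: "(coords I \<circ> \<Phi>) -` (PiE I A) \<inter> space M = \<Phi> -` coord_box S I A \<inter> space M"
      using measurable_space[OF \<Phi>] by (intro Set.set_eqI) (auto simp: coord_box_def PiE_iff coords_extensional)
    have "emeasure (distr M ?P (coords I \<circ> \<Phi>)) (PiE I A) = emeasure M (\<Phi> -` coord_box S I A \<inter> space M)"
      unfolding *[symmetric] using A fin by (intro emeasure_distr[OF c\<Phi>] sets_PiM_I_finite) auto
    also have "\<dots> = (\<Prod>i\<in>I. emeasure lborel (A i))" using A by (intro eq) auto
    finally show "emeasure (distr M ?P (coords I \<circ> \<Phi>)) (PiE I A) = (\<Prod>i\<in>I. emeasure lborel (A i))" .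
  qed simp
  then have "lebesgue_via S I =
      distr (distr M ?P (coords I \<circ> \<Phi>)) (lebesgue_via S I) (the_inv_into S (coords I))"
    using via_eq_distr[OF S] by simp
  also have "\<dots> = distr M (lebesgue_via S I) (the_inv_into S (coords I) \<circ> (coords I \<circ> \<Phi>))"
    by (rule distr_distr[OF measurable_coord_inv[OF S] c\<Phi>])
  also have "\<dots> = distr M (lebesgue_via S I) \<Phi>"
    using measurable_space[OF \<Phi>] by (intro distr_cong) (auto simp: coord_inv[OF S])
  finally show ?thesis by simp
qed

text \<open>Each coordinate is shifted by its own constant, so a box goes to a box and the claim
  reduces to translation invariance of \<open>lborel\<close> on the line, factor by factor.\<close>

lemma distr_translate_via:
  assumes S: "coord_sys S I" and T: "T \<in> S \<rightarrow> S"
    and c: "\<And>x i. x \<in> S \<Longrightarrow> i \<in> I \<Longrightarrow> coords I (T x) i = coords I x i + b i"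
  shows "T \<in> lebesgue_via S I \<rightarrow>\<^sub>M lebesgue_via S I"
    and "distr (lebesgue_via S I) (lebesgue_via S I) T = lebesgue_via S I"
proof -
  have 1: "(\<lambda>x. coords I x i) \<in> borel_measurable (lebesgue_via S I)" if "i \<in> I" for i
    using measurable_comp[OF measurable_coords[OF S] measurable_component_singleton[OF that]]
    by (simp add: o_def)
  have [measurable]: "(\<lambda>x. coords I (T x) i) \<in> borel_measurable (lebesgue_via S I)" if "i \<in> I" for i
    using 1[OF that] by (subst measurable_cong[OF c]) (auto simp: that)
  show meas: "T \<in> lebesgue_via S I \<rightarrow>\<^sub>M lebesgue_via S I"
    by (rule measurable_via_coord[OF S]) (use T in auto)
  show "distr (lebesgue_via S I) (lebesgue_via S I) T = lebesgue_via S I"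
  proof (rule distr_eq_via[OF S meas])
    fix A :: "coord_index \<Rightarrow> real set" assume A: "\<And>i. i \<in> I \<Longrightarrow> A i \<in> sets borel"
    have sets: "(\<lambda>t. t + b i) -` A i \<in> sets borel" if "i \<in> I" for i
      using measurable_sets[of "\<lambda>t::real. t + b i" borel borel, OF _ A[OF that]] by simp
    have "T -` coord_box S I A \<inter> space (lebesgue_via S I) = coord_box S I (\<lambda>i. (\<lambda>t. t + b i) -` A i)"
      using T c by (auto simp: coord_box_def)
    then have "emeasure (lebesgue_via S I) (T -` coord_box S I A \<inter> space (lebesgue_via S I)) =
        (\<Prod>i\<in>I. emeasure lborel ((\<lambda>t. t + b i) -` A i))"
      using coord_box_sets(2)[OF S, of "\<lambda>i. (\<lambda>t. t + b i) -` A i"] sets by simp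
    also have "\<dots> = (\<Prod>i\<in>I. emeasure lborel (A i))"
    proof (rule prod.cong[OF refl])
      fix i assume i: "i \<in> I"
      have "emeasure (lborel :: real measure) (A i) = emeasure (distr lborel borel (\<lambda>t. t + b i)) (A i)"
        using lborel_distr_plus[of "b i"] by (simp add: add.commute[of _ "b i"])
      also have "\<dots> = emeasure lborel ((\<lambda>t. t + b i) -` A i)"
        using A[OF i] by (subst emeasure_distr) auto
      finally show "emeasure lborel ((\<lambda>t. t + b i) -` A i) = emeasure lborel (A i)" by simp
    qed
    finally show "emeasure (lebesgue_via S I) (T -` coord_box S I A \<inter> space (lebesgue_via S I)) =
        (\<Prod>i\<in>I. emeasure lborel (A i))" .
  qed
qed

text \<open>A weak notion of being Lebesgue measure in the coordinates \<open>c\<close>: only the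
  masses of boxes are prescribed, nothing is said about injectivity of \<open>c\<close> or
  generation of the sigma-algebra. The index type is free, so that a product of measures gets the
  disjoint sum of the index sets.\<close>

definition leb_coords :: "'a measure \<Rightarrow> 'i set \<Rightarrow> ('a \<Rightarrow> 'i \<Rightarrow> real) \<Rightarrow> bool" where
  "leb_coords M J c \<longleftrightarrow> finite J \<and> sigma_finite_measure M \<and> (\<forall>i\<in>J. (\<lambda>x. c x i) \<in> borel_measurable M) \<and>
    (\<forall>A. (\<forall>i\<in>J. A i \<in> sets borel) \<longrightarrow>
      emeasure M {x \<in> space M. \<forall>i\<in>J. c x i \<in> A i} = (\<Prod>i\<in>J. emeasure lborel (A i)))"

lemma leb_coords_via:
  assumes S: "coord_sys S I"
  shows "leb_coords (lebesgue_via S I) I (coords I)"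
proof -
  have "(\<lambda>x. coords I x i) \<in> borel_measurable (lebesgue_via S I)" if "i \<in> I" for i
    using measurable_comp[OF measurable_coords[OF S] measurable_component_singleton[OF that]]
    by (simp add: o_def)
  then show ?thesis
    using S sigma_finite_via[OF S] coord_box_sets(2)[OF S]
    unfolding leb_coords_def coord_box_def by (simp add: coord_sys_def)
qed

lemma leb_coords_lborel: "leb_coords lborel {()} (\<lambda>x _. x)"
  by (simp add: leb_coords_def sigma_finite_lborel)

lemma leb_coords_pair:
  assumes M: "leb_coords M I c" and N: "leb_coords N J e"
  shows "leb_coords (M \<Otimes>\<^sub>M N) (I <+> J) (\<lambda>(x, y). case_sum (c x) (e y))"
proof -
  have fin [simp]: "finite I" "finite J" using M N by (simp_all add: leb_coords_def)
  interpret M: sigma_finite_measure M using M by (simp add: leb_coords_def)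
  interpret N: sigma_finite_measure N using N by (simp add: leb_coords_def)
  interpret MN: pair_sigma_finite M N ..
  have c [measurable]: "(\<lambda>x. c x i) \<in> borel_measurable M" if "i \<in> I" for i
    using M that by (simp add: leb_coords_def)
  have e [measurable]: "(\<lambda>x. e x i) \<in> borel_measurable N" if "i \<in> J" for i
    using N that by (simp add: leb_coords_def)
  have meas: "(\<lambda>x. case x of (x, y) \<Rightarrow> case_sum (c x) (e y) i) \<in> borel_measurable (M \<Otimes>\<^sub>M N)"
    if "i \<in> I <+> J" for i
    using that by (cases i) (auto simp: split_beta')
  have box: "emeasure (M \<Otimes>\<^sub>M N) {x \<in> space (M \<Otimes>\<^sub>M N). \<forall>i\<in>I <+> J.
      (case x of (x, y) \<Rightarrow> case_sum (c x) (e y)) i \<in> A i} = (\<Prod>i\<in>I <+> J. emeasure lborel (A i))"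
    if A: "\<forall>i\<in>I <+> J. A i \<in> sets borel" for A
  proof -
    let ?A = "{x \<in> space M. \<forall>i\<in>I. c x i \<in> A (Inl i)}" and ?B = "{x \<in> space N. \<forall>i\<in>J. e x i \<in> A (Inr i)}"
    have eq: "{x \<in> space (M \<Otimes>\<^sub>M N). \<forall>i\<in>I <+> J. (case x of (x, y) \<Rightarrow> case_sum (c x) (e y)) i \<in> A i} = ?A \<times> ?B"
    proof -
      have "(\<forall>i\<in>I <+> J. P i) \<longleftrightarrow> (\<forall>i\<in>I. P (Inl i)) \<and> (\<forall>j\<in>J. P (Inr j))" for P :: "_ \<Rightarrow> bool"
        by (auto simp: Plus_def)
      then show ?thesis by (auto simp: space_pair_measure)
    qed
    have "{x \<in> space M. c x i \<in> A (Inl i)} \<in> sets M" if "i \<in> I" for i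
      using measurable_sets[OF c[OF that], of "A (Inl i)"] A that
      by (auto simp: Plus_def vimage_def Int_def conj_commute)
    then have sA: "?A \<in> sets M" by (intro sets.sets_Collect_finite_All) auto
    have "{x \<in> space N. e x i \<in> A (Inr i)} \<in> sets N" if "i \<in> J" for i
      using measurable_sets[OF e[OF that], of "A (Inr i)"] A that
      by (auto simp: Plus_def vimage_def Int_def conj_commute)
    then have sB: "?B \<in> sets N" by (intro sets.sets_Collect_finite_All) auto
    have "emeasure (M \<Otimes>\<^sub>M N) (?A \<times> ?B) = emeasure M ?A * emeasure N ?B"
      by (rule N.emeasure_pair_measure_Times[OF sA sB])
    also have "emeasure M ?A = (\<Prod>i\<in>I. emeasure lborel (A (Inl i)))"
      using M A unfolding leb_coords_def by (auto simp: Plus_def dest!: spec[of _ "\<lambda>i. A (Inl i)"])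
    also have "emeasure N ?B = (\<Prod>i\<in>J. emeasure lborel (A (Inr i)))"
      using N A unfolding leb_coords_def by (auto simp: Plus_def dest!: spec[of _ "\<lambda>i. A (Inr i)"])
    finally show ?thesis unfolding eq by (simp add: prod.Plus)
  qed
  show ?thesis
    unfolding leb_coords_def using meas box MN.sigma_finite_measure_axioms by (auto simp: split_beta')
qed

text \<open>The common source of all block decompositions: a map that merely relabels coordinates
  along a bijection \<open>g\<close> carries Lebesgue measure to Lebesgue measure.\<close>

lemma distr_leb_coords:
  assumes S: "coord_sys S I" and M: "leb_coords M J c" and g: "bij_betw g J I"
    and \<Phi>: "\<And>x. x \<in> space M \<Longrightarrow> \<Phi> x \<in> S"
    and c: "\<And>x j. x \<in> space M \<Longrightarrow> j \<in> J \<Longrightarrow> coords I (\<Phi> x) (g j) = c x j"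
  shows "\<Phi> \<in> M \<rightarrow>\<^sub>M lebesgue_via S I" and "distr M (lebesgue_via S I) \<Phi> = lebesgue_via S I"
proof -
  have I: "I = g ` J" and inj: "inj_on g J" using g by (auto simp: bij_betw_def)
  show meas: "\<Phi> \<in> M \<rightarrow>\<^sub>M lebesgue_via S I"
  proof (rule measurable_via_coord[OF S])
    show "\<Phi> \<in> space M \<rightarrow> S" using \<Phi> by auto
    fix i assume "i \<in> I"
    then obtain j where j: "i = g j" "j \<in> J" using I by auto
    have "(\<lambda>x. c x j) \<in> borel_measurable M" using M j by (simp add: leb_coords_def)
    then show "(\<lambda>x. coords I (\<Phi> x) i) \<in> borel_measurable M"
      by (subst measurable_cong[where g="\<lambda>x. c x j"]) (auto simp: j c)
  qed
  show "distr M (lebesgue_via S I) \<Phi> = lebesgue_via S I"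
  proof (rule distr_eq_via[OF S meas])
    fix A :: "coord_index \<Rightarrow> real set" assume A: "\<And>i. i \<in> I \<Longrightarrow> A i \<in> sets borel"
    have "\<Phi> -` coord_box S I A \<inter> space M = {x \<in> space M. \<forall>i\<in>J. c x i \<in> A (g i)}"
    proof (rule Set.set_eqI)
      fix x
      have "(\<forall>i\<in>I. P i) \<longleftrightarrow> (\<forall>j\<in>J. P (g j))" for P using I by blast
      from this[of "\<lambda>i. coords I (\<Phi> x) i \<in> A i"]
      show "x \<in> \<Phi> -` coord_box S I A \<inter> space M \<longleftrightarrow> x \<in> {x \<in> space M. \<forall>i\<in>J. c x i \<in> A (g i)}"
        using \<Phi>[of x] c[of x] by (cases "x \<in> space M") (auto simp: coord_box_def simp del: split_paired_All)
    qed
    then have "emeasure M (\<Phi> -` coord_box S I A \<inter> space M) = (\<Prod>j\<in>J. emeasure lborel (A (g j)))"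
      using M A I unfolding leb_coords_def by (auto dest!: spec[of _ "\<lambda>i. A (g i)"])
    also have "\<dots> = (\<Prod>i\<in>I. emeasure lborel (A i))"
      unfolding I by (simp add: prod.reindex[OF inj])
    finally show "emeasure M (\<Phi> -` coord_box S I A \<inter> space M) = (\<Prod>i\<in>I. emeasure lborel (A i))" .
  qed
qed

section \<open>Real coordinates of rectangular and of Hermitian matrices\<close>

definition mat_index :: "nat \<Rightarrow> nat \<Rightarrow> nat \<Rightarrow> coord_index set" where
  "mat_index d p q = {(a, b, c). a < p \<and> b < q \<and> c < d}"

definition herm_index :: "nat \<Rightarrow> nat \<Rightarrow> coord_index set" where
  "herm_index d m = {(a, b, c). a \<le> b \<and> b < m \<and> c < d \<and> (a = b \<longrightarrow> c = 0)}"

lemma mats_lebesgue_eq: "mats_lebesgue d p q = lebesgue_via (mats d p q) (mat_index d p q)"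
  by (simp add: mats_lebesgue_def mat_index_def)

lemma herm_lebesgue_eq: "herm_lebesgue d m = lebesgue_via (herm d m) (herm_index d m)"
  by (simp add: herm_lebesgue_def herm_index_def)

lemma scalars_iff: "z \<in> scalars d \<longleftrightarrow> (d = 1 \<longrightarrow> Im z = 0)"
  by (auto simp: scalars_def complex_is_Real_iff)

lemma mat_adjoint_dim [simp]: "dim_row (mat_adjoint A) = dim_col A" "dim_col (mat_adjoint A) = dim_row A"
  by (auto simp: mat_adjoint_def)

lemma mat_adjoint_index [simp]:
  "i < dim_col A \<Longrightarrow> j < dim_row A \<Longrightarrow> mat_adjoint (A :: complex mat) $$ (i, j) = cnj (A $$ (j, i))"
  by (simp add: mat_adjoint_def mat_of_rows_def conjugate_complex_def)

lemma mat_adjoint_carrier [simp]: "A \<in> carrier_mat p q \<Longrightarrow> mat_adjoint (A :: complex mat) \<in> carrier_mat q p"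
  by (intro carrier_matI) auto

lemma herm_iff:
  "A \<in> herm d m \<longleftrightarrow> A \<in> mats d m m \<and> (\<forall>a<m. \<forall>b<m. A $$ (b, a) = cnj (A $$ (a, b)))"
proof -
  have "mat_adjoint A = A \<longleftrightarrow> (\<forall>a<m. \<forall>b<m. A $$ (b, a) = cnj (A $$ (a, b)))" if "A \<in> carrier_mat m m"
  proof
    assume *: "mat_adjoint A = A"
    have "A $$ (b, a) = cnj (A $$ (a, b))" if "a < m" "b < m" for a b
      using mat_adjoint_index[of b A a] * that \<open>A \<in> carrier_mat m m\<close> by simp
    then show "\<forall>a<m. \<forall>b<m. A $$ (b, a) = cnj (A $$ (a, b))" by blast
  next
    assume *: "\<forall>a<m. \<forall>b<m. A $$ (b, a) = cnj (A $$ (a, b))"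
    show "mat_adjoint A = A"
    proof (rule eq_matI)
      fix i j assume "i < dim_row A" "j < dim_col A"
      then show "mat_adjoint A $$ (i, j) = A $$ (i, j)"
        using *[rule_format, of j i] that by simp
    qed (use that in auto)
  qed
  then show ?thesis unfolding herm_def mats_def by blast
qed

lemma hermI:
  assumes "A \<in> carrier_mat m m" "\<And>a b. a < m \<Longrightarrow> b < m \<Longrightarrow> d = 1 \<Longrightarrow> Im (A $$ (a, b)) = 0"
    and "\<And>a b. a < m \<Longrightarrow> b < m \<Longrightarrow> A $$ (b, a) = cnj (A $$ (a, b))"
  shows "A \<in> herm d m"
  using assms unfolding herm_iff mats_def scalars_iff by blast

lemma herm_cnj: "A \<in> herm d m \<Longrightarrow> a < m \<Longrightarrow> b < m \<Longrightarrow> cnj (A $$ (a, b)) = A $$ (b, a)"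
  unfolding herm_iff by metis

lemma herm_Im: "A \<in> herm d m \<Longrightarrow> a < m \<Longrightarrow> b < m \<Longrightarrow> d = 1 \<Longrightarrow> Im (A $$ (a, b)) = 0"
  unfolding herm_iff mats_def scalars_iff by blast

lemma matsD: "A \<in> mats d p q \<Longrightarrow> A \<in> carrier_mat p q"
  by (simp add: mats_def)

lemma hermD: "A \<in> herm d m \<Longrightarrow> A \<in> mats d m m" "A \<in> herm d m \<Longrightarrow> A \<in> carrier_mat m m"
  "A \<in> herm d m \<Longrightarrow> mat_adjoint A = A"
  by (simp_all add: herm_def mats_def)

lemma coord_sys_mats:
  assumes d: "d \<in> {1, 2}"
  shows "coord_sys (mats d p q) (mat_index d p q)"
  unfolding coord_sys_def
proof
  have "mat_index d p q \<subseteq> {..<p} \<times> {..<q} \<times> {..<d}" by (auto simp: mat_index_def)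
  then show "finite (mat_index d p q)" by (rule finite_subset) auto
  \<comment> \<open>For \<open>d = 1\<close> the index \<open>(a, b, 1)\<close> lies outside the
    index set, where an extensional function is \<open>undefined\<close>; the imaginary part
    therefore has to be set to 0 by hand.\<close>
  let ?g = "\<lambda>\<omega>. mat p q (\<lambda>(a, b). Complex (\<omega> (a, b, 0)) (if d = 1 then 0 else \<omega> (a, b, 1)))"
  show "bij_betw (coords (mat_index d p q)) (mats d p q) (PiE (mat_index d p q) (\<lambda>_. UNIV))"
  proof (rule bij_betw_byWitness[where f'="?g"])
    show "\<forall>A\<in>mats d p q. ?g (coords (mat_index d p q) A) = A"
      using d by (auto simp: mats_def coords_def mat_index_def scalars_iff complex_eq_iff intro!: eq_matI)
    show "\<forall>\<omega>\<in>PiE (mat_index d p q) (\<lambda>_. UNIV). coords (mat_index d p q) (?g \<omega>) = \<omega>"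
    proof
      fix \<omega> :: "coord_index \<Rightarrow> real" assume \<omega>: "\<omega> \<in> PiE (mat_index d p q) (\<lambda>_. UNIV)"
      show "coords (mat_index d p q) (?g \<omega>) = \<omega>"
      proof (rule extensionalityI[OF coords_extensional])
        show "\<omega> \<in> extensional (mat_index d p q)" using \<omega> by (simp add: PiE_iff)
        fix i assume i: "i \<in> mat_index d p q"
        obtain a b c where [simp]: "i = (a, b, c)" by (cases i)
        show "coords (mat_index d p q) (?g \<omega>) i = \<omega> i"
          using i d by (cases "c = 0") (auto simp: coords_def mat_index_def less_2_cases_iff)
      qed
    qed
    show "coords (mat_index d p q) ` mats d p q \<subseteq> PiE (mat_index d p q) (\<lambda>_. UNIV)"
      by (simp add: image_subset_iff PiE_iff coords_extensional)
    show "?g ` PiE (mat_index d p q) (\<lambda>_. UNIV) \<subseteq> mats d p q"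
      by (auto simp: mats_def scalars_iff)
  qed
qed

lemma coord_sys_herm:
  assumes d: "d \<in> {1, 2}"
  shows "coord_sys (herm d m) (herm_index d m)"
  unfolding coord_sys_def
proof
  have "herm_index d m \<subseteq> {..<m} \<times> {..<m} \<times> {..<d}" by (auto simp: herm_index_def)
  then show "finite (herm_index d m)" by (rule finite_subset) auto
  let ?g = "\<lambda>\<omega>. mat m m (\<lambda>(a, b). if a = b then complex_of_real (\<omega> (a, b, 0))
      else if a < b then Complex (\<omega> (a, b, 0)) (if d = 1 then 0 else \<omega> (a, b, 1))
      else Complex (\<omega> (b, a, 0)) (if d = 1 then 0 else - \<omega> (b, a, 1)))"
  show "bij_betw (coords (herm_index d m)) (herm d m) (PiE (herm_index d m) (\<lambda>_. UNIV))"
  proof (rule bij_betw_byWitness[where f'="?g"])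
    show "\<forall>A\<in>herm d m. ?g (coords (herm_index d m) A) = A"
    proof
      fix A assume A: "A \<in> herm d m"
      have c: "A \<in> carrier_mat m m" and s: "\<And>a b. a < m \<Longrightarrow> b < m \<Longrightarrow> d = 1 \<Longrightarrow> Im (A $$ (a, b)) = 0"
        and h: "\<And>a b. a < m \<Longrightarrow> b < m \<Longrightarrow> A $$ (b, a) = cnj (A $$ (a, b))"
        using A unfolding herm_iff mats_def scalars_iff by blast+
      have h0: "Im (A $$ (a, a)) = 0" if "a < m" for a
        using h[OF that that] by (simp add: complex_eq_iff)
      show "?g (coords (herm_index d m) A) = A"
      proof (rule eq_matI)
        fix i j assume "i < dim_row A" "j < dim_col A"
        then have ij: "i < m" "j < m" using c by auto
        show "?g (coords (herm_index d m) A) $$ (i, j) = A $$ (i, j)"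
        proof (cases i j rule: linorder_cases)
          case less
          then show ?thesis using d ij s[OF ij] by (auto simp: coords_def herm_index_def complex_eq_iff)
        next
          case equal
          then show ?thesis using d ij h0[OF ij(1)] by (auto simp: coords_def herm_index_def complex_eq_iff)
        next
          case greater
          then show ?thesis using d ij s[OF ij(2) ij(1)]
            by (subst h[OF ij(2) ij(1)]) (auto simp: coords_def herm_index_def complex_eq_iff)
        qed
      qed (use c in auto)
    qed
    show "\<forall>\<omega>\<in>PiE (herm_index d m) (\<lambda>_. UNIV). coords (herm_index d m) (?g \<omega>) = \<omega>"
    proof
      fix \<omega> :: "coord_index \<Rightarrow> real" assume \<omega>: "\<omega> \<in> PiE (herm_index d m) (\<lambda>_. UNIV)"
      show "coords (herm_index d m) (?g \<omega>) = \<omega>"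
      proof (rule extensionalityI[OF coords_extensional])
        show "\<omega> \<in> extensional (herm_index d m)" using \<omega> by (simp add: PiE_iff)
        fix i assume i: "i \<in> herm_index d m"
        obtain a b c where [simp]: "i = (a, b, c)" by (cases i)
        show "coords (herm_index d m) (?g \<omega>) i = \<omega> i"
          using i d by (cases "c = 0") (auto simp: coords_def herm_index_def less_2_cases_iff)
      qed
    qed
    show "coords (herm_index d m) ` herm d m \<subseteq> PiE (herm_index d m) (\<lambda>_. UNIV)"
      by (simp add: image_subset_iff PiE_iff coords_extensional)
    show "?g ` PiE (herm_index d m) (\<lambda>_. UNIV) \<subseteq> herm d m"
      by (auto intro!: hermI simp: complex_eq_iff)
  qed
qed

lemma space_mats_lebesgue [simp]: "space (mats_lebesgue d p q) = mats d p q"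
  by (simp add: mats_lebesgue_eq)

lemma space_herm_lebesgue [simp]: "space (herm_lebesgue d m) = herm d m"
  by (simp add: herm_lebesgue_eq)

lemma sigma_finite_mats: "d \<in> {1, 2} \<Longrightarrow> sigma_finite_measure (mats_lebesgue d p q)"
  unfolding mats_lebesgue_eq by (intro sigma_finite_via coord_sys_mats)

lemma sigma_finite_herm: "d \<in> {1, 2} \<Longrightarrow> sigma_finite_measure (herm_lebesgue d m)"
  unfolding herm_lebesgue_eq by (intro sigma_finite_via coord_sys_herm)

lemma measurable_mats_entry:
  assumes d: "d \<in> {1, 2}" and ab: "a < p" "b < q"
  shows "(\<lambda>A. A $$ (a, b)) \<in> borel_measurable (mats_lebesgue d p q)"
proof -
  let ?I = "mat_index d p q"
  have S: "leb_coords (mats_lebesgue d p q) ?I (coords ?I)"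
    unfolding mats_lebesgue_eq by (rule leb_coords_via[OF coord_sys_mats[OF d]])
  have *: "(\<lambda>A. coords ?I A (a, b, c)) \<in> borel_measurable (mats_lebesgue d p q)" if "c < d" for c
    using S that ab by (simp add: leb_coords_def mat_index_def)
  have 0: "(\<lambda>A. coords ?I A (a, b, 0)) = (\<lambda>A. Re (A $$ (a, b)))"
    using ab d by (auto simp: coords_def mat_index_def fun_eq_iff)
  have re: "(\<lambda>A. Re (A $$ (a, b))) \<in> borel_measurable (mats_lebesgue d p q)"
    using *[of 0] d unfolding 0 by auto
  have im: "(\<lambda>A. Im (A $$ (a, b))) \<in> borel_measurable (mats_lebesgue d p q)"
  proof (cases "d = 1")
    case True
    show ?thesis by (subst measurable_cong[where g="\<lambda>_. 0"]) (use True ab in \<open>auto simp: mats_def scalars_iff\<close>)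
  next
    case False
    then have 1: "(\<lambda>A. coords ?I A (a, b, 1)) = (\<lambda>A. Im (A $$ (a, b)))"
      using ab d by (auto simp: coords_def mat_index_def fun_eq_iff)
    show ?thesis using *[of 1] d False unfolding 1 by auto
  qed
  show ?thesis using re im by (simp add: borel_measurable_complex_iff)
qed

text \<open>Only the upper triangle carries coordinates. Below it an entry is the conjugate of one
  above, and on the diagonal the imaginary part vanishes by symmetry even for
  \<open>d = 2\<close>.\<close>

lemma measurable_herm_entry:
  assumes d: "d \<in> {1, 2}" and ab: "a < m" "b < m"
  shows "(\<lambda>A. A $$ (a, b)) \<in> borel_measurable (herm_lebesgue d m)"
proof -
  let ?I = "herm_index d m"
  have S: "leb_coords (herm_lebesgue d m) ?I (coords ?I)"
    unfolding herm_lebesgue_eq by (rule leb_coords_via[OF coord_sys_herm[OF d]])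
  have upper: "(\<lambda>A. A $$ (a, b)) \<in> borel_measurable (herm_lebesgue d m)" if ab: "a \<le> b" "b < m" for a b
  proof -
    have *: "(\<lambda>A. coords ?I A (a, b, c)) \<in> borel_measurable (herm_lebesgue d m)"
      if "c < d" "a = b \<longrightarrow> c = 0" for c
      using S that ab by (simp add: leb_coords_def herm_index_def)
    have 0: "(\<lambda>A. coords ?I A (a, b, 0)) = (\<lambda>A. Re (A $$ (a, b)))"
      using ab d by (auto simp: coords_def herm_index_def fun_eq_iff)
    have re: "(\<lambda>A. Re (A $$ (a, b))) \<in> borel_measurable (herm_lebesgue d m)"
      using *[of 0] d unfolding 0 by auto
    have im: "(\<lambda>A. Im (A $$ (a, b))) \<in> borel_measurable (herm_lebesgue d m)"
    proof (cases "d = 1 \<or> a = b")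
      case True
      have "Im (A $$ (a, b)) = 0" if "A \<in> herm d m" for A
        using True
      proof
        assume "d = 1" then show ?thesis using that ab by (auto simp: herm_Im)
      next
        assume [simp]: "a = b"
        have "cnj (A $$ (a, a)) = A $$ (a, a)" using that ab by (simp add: herm_cnj)
        then show ?thesis by (simp add: complex_eq_iff)
      qed
      then show ?thesis by (subst measurable_cong[where g="\<lambda>_. 0"]) auto
    next
      case False
      then have 1: "(\<lambda>A. coords ?I A (a, b, 1)) = (\<lambda>A. Im (A $$ (a, b)))"
        using ab d by (auto simp: coords_def herm_index_def fun_eq_iff)
      show ?thesis using *[of 1] d False unfolding 1 by auto
    qed
    show ?thesis using re im by (simp add: borel_measurable_complex_iff)
  qed
  show ?thesis
  proof (cases "a \<le> b")
    case False
    have "(\<lambda>A. cnj (A $$ (b, a))) \<in> borel_measurable (herm_lebesgue d m)"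
      using upper[of b a] False ab by (simp add: borel_measurable_complex_iff)
    then show ?thesis using ab by (subst measurable_cong[where g="\<lambda>A. cnj (A $$ (b, a))"]) (auto simp: herm_cnj)
  qed (use upper ab in auto)
qed

lemma measurable_matsI:
  assumes d: "d \<in> {1, 2}" and f: "\<And>x. x \<in> space N \<Longrightarrow> f x \<in> mats d p q"
    and e: "\<And>a b. a < p \<Longrightarrow> b < q \<Longrightarrow> (\<lambda>x. f x $$ (a, b)) \<in> borel_measurable N"
  shows "f \<in> N \<rightarrow>\<^sub>M mats_lebesgue d p q"
  unfolding mats_lebesgue_eq
proof (rule measurable_via_coord[OF coord_sys_mats[OF d]])
  fix i assume i: "i \<in> mat_index d p q"
  obtain a b c where [simp]: "i = (a, b, c)" by (cases i)
  show "(\<lambda>x. coords (mat_index d p q) (f x) i) \<in> borel_measurable N"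
    using e[of a b] i by (cases "c = 0") (auto simp: coords_def mat_index_def borel_measurable_complex_iff)
qed (use f in auto)

lemma measurable_hermI:
  assumes d: "d \<in> {1, 2}" and f: "\<And>x. x \<in> space N \<Longrightarrow> f x \<in> herm d m"
    and e: "\<And>a b. a < m \<Longrightarrow> b < m \<Longrightarrow> (\<lambda>x. f x $$ (a, b)) \<in> borel_measurable N"
  shows "f \<in> N \<rightarrow>\<^sub>M herm_lebesgue d m"
  unfolding herm_lebesgue_eq
proof (rule measurable_via_coord[OF coord_sys_herm[OF d]])
  fix i assume i: "i \<in> herm_index d m"
  obtain a b c where [simp]: "i = (a, b, c)" by (cases i)
  show "(\<lambda>x. coords (herm_index d m) (f x) i) \<in> borel_measurable N"
    using e[of a b] i by (cases "c = 0") (auto simp: coords_def herm_index_def borel_measurable_complex_iff)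
qed (use f in auto)

subsection \<open>Splitting into blocks and translations\<close>

text \<open>Stacking \<open>u\<close> on top of \<open>v\<close> is written as a block matrix whose
  right-hand blocks have width 0, so that the rules for products and adjoints of four-block matrices
  apply to columns as well.\<close>

lemma stack_mats:
  assumes "u \<in> mats d p q" "v \<in> mats d p' q"
  shows "four_block_mat u (0\<^sub>m p 0) v (0\<^sub>m p' 0) \<in> mats d (p + p') q"
  using assms by (auto simp: mats_def)

lemma four_block_herm:
  assumes "X \<in> herm d p" "W \<in> mats d p k" "C \<in> herm d k"
  shows "four_block_mat X W (mat_adjoint W) C \<in> herm d (p + k)"
proof -
  have c: "X \<in> carrier_mat p p" "W \<in> carrier_mat p k" "C \<in> carrier_mat k k"
    using assms by (auto simp: herm_def mats_def)
  have W: "d = 1 \<Longrightarrow> a < p \<Longrightarrow> b < k \<Longrightarrow> Im (W $$ (a, b)) = 0" for a b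
    using assms(2) by (simp add: mats_def scalars_iff)
  show ?thesis
    by (rule hermI) (use c W in \<open>auto simp: herm_cnj[OF assms(1)] herm_cnj[OF assms(3)]
      herm_Im[OF assms(1)] herm_Im[OF assms(3)]\<close>)
qed

lemma nn_integral_mats_stack:
  assumes d: "d \<in> {1, 2}" and f: "f \<in> borel_measurable (mats_lebesgue d (p + p') q)"
  shows "(\<integral>\<^sup>+x. f x \<partial>mats_lebesgue d (p + p') q) =
    (\<integral>\<^sup>+u. (\<integral>\<^sup>+v. f (four_block_mat u (0\<^sub>m p 0) v (0\<^sub>m p' 0)) \<partial>mats_lebesgue d p' q) \<partial>mats_lebesgue d p q)"
    and "(\<lambda>(u, v). four_block_mat u (0\<^sub>m p 0) v (0\<^sub>m p' 0)) \<in>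
      mats_lebesgue d p q \<Otimes>\<^sub>M mats_lebesgue d p' q \<rightarrow>\<^sub>M mats_lebesgue d (p + p') q"
proof -
  let ?L1 = "mats_lebesgue d p q" and ?L2 = "mats_lebesgue d p' q" and ?L = "mats_lebesgue d (p + p') q"
  let ?\<Phi> = "\<lambda>(u, v). four_block_mat u (0\<^sub>m p 0) v (0\<^sub>m p' 0) :: complex mat"
  let ?J = "mat_index d p q <+> mat_index d p' q"
  let ?g = "case_sum (\<lambda>i. i) (\<lambda>(a, b, c). (p + a, b, c)) :: _ \<Rightarrow> coord_index"
  interpret L2: sigma_finite_measure ?L2 by (rule sigma_finite_mats[OF d])
  have M: "leb_coords (?L1 \<Otimes>\<^sub>M ?L2) ?J
      (\<lambda>(x, y). case_sum (coords (mat_index d p q) x) (coords (mat_index d p' q) y))"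
    unfolding mats_lebesgue_eq by (intro leb_coords_pair leb_coords_via coord_sys_mats d)
  have g: "bij_betw ?g ?J (mat_index d (p + p') q)"
    by (rule bij_betw_byWitness[where f'="\<lambda>(a, b, c). if a < p then Inl (a, b, c) else Inr (a - p, b, c)"])
       (auto simp: mat_index_def)
  have mem: "?\<Phi> x \<in> mats d (p + p') q" if "x \<in> space (?L1 \<Otimes>\<^sub>M ?L2)" for x
    using that by (auto simp: space_pair_measure intro: stack_mats)
  have crd: "coords (mat_index d (p + p') q) (?\<Phi> x) (?g j) =
      (case x of (x, y) \<Rightarrow> case_sum (coords (mat_index d p q) x) (coords (mat_index d p' q) y)) j"
    if "x \<in> space (?L1 \<Otimes>\<^sub>M ?L2)" "j \<in> ?J" for x j
    using that by (auto simp: space_pair_measure coords_def mat_index_def Plus_def mats_def)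
  note * = distr_leb_coords[OF coord_sys_mats[OF d] M g, folded mats_lebesgue_eq]
  show meas: "?\<Phi> \<in> ?L1 \<Otimes>\<^sub>M ?L2 \<rightarrow>\<^sub>M ?L"
    by (rule *(1), erule mem, erule (1) crd)
  have distr: "distr (?L1 \<Otimes>\<^sub>M ?L2) ?L ?\<Phi> = ?L"
    by (rule *(2), erule mem, erule (1) crd)
  have "(\<integral>\<^sup>+x. f x \<partial>?L) = (\<integral>\<^sup>+x. f x \<partial>distr (?L1 \<Otimes>\<^sub>M ?L2) ?L ?\<Phi>)"
    by (simp only: distr)
  also have "\<dots> = (\<integral>\<^sup>+x. f (?\<Phi> x) \<partial>(?L1 \<Otimes>\<^sub>M ?L2))"
    by (rule nn_integral_distr[OF meas]) (use f in simp)
  also have "\<dots> = (\<integral>\<^sup>+u. (\<integral>\<^sup>+v. f (?\<Phi> (u, v)) \<partial>?L2) \<partial>?L1)"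
    by (rule L2.nn_integral_fst[symmetric]) (rule measurable_compose[OF meas f])
  finally show "(\<integral>\<^sup>+x. f x \<partial>?L) = (\<integral>\<^sup>+u. (\<integral>\<^sup>+v. f (four_block_mat u (0\<^sub>m p 0) v (0\<^sub>m p' 0)) \<partial>?L2) \<partial>?L1)"
    by simp
qed

text \<open>The upper triangle of a matrix of size \<open>p + k\<close> is the disjoint union of the
  upper triangle of X, all entries of W, and the upper triangle of C. The lower left block carries
  no coordinates of its own.\<close>

lemma nn_integral_herm_blocks:
  assumes d: "d \<in> {1, 2}"
  shows "(\<lambda>(X, W, C). four_block_mat X W (mat_adjoint W) C) \<in>
      herm_lebesgue d p \<Otimes>\<^sub>M (mats_lebesgue d p k \<Otimes>\<^sub>M herm_lebesgue d k) \<rightarrow>\<^sub>M herm_lebesgue d (p + k)"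
    and "f \<in> borel_measurable (herm_lebesgue d (p + k)) \<Longrightarrow> (\<integral>\<^sup>+x. f x \<partial>herm_lebesgue d (p + k)) =
    (\<integral>\<^sup>+(X, W, C). f (four_block_mat X W (mat_adjoint W) C)
      \<partial>(herm_lebesgue d p \<Otimes>\<^sub>M (mats_lebesgue d p k \<Otimes>\<^sub>M herm_lebesgue d k)))"
proof -
  let ?L1 = "herm_lebesgue d p" and ?L2 = "mats_lebesgue d p k" and ?L3 = "herm_lebesgue d k"
    and ?L = "herm_lebesgue d (p + k)"
  let ?\<Phi> = "\<lambda>(X, W, C). four_block_mat X W (mat_adjoint W) C :: complex mat"
  let ?J = "herm_index d p <+> (mat_index d p k <+> herm_index d k)"
  let ?g = "case_sum (\<lambda>i. i) (case_sum (\<lambda>(a, b, c). (a, p + b, c)) (\<lambda>(a, b, c). (p + a, p + b, c))) :: _ \<Rightarrow> coord_index"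
  let ?c = "\<lambda>(x, y). case_sum (coords (herm_index d p) x) ((\<lambda>(x, y). case_sum (coords (mat_index d p k) x) (coords (herm_index d k) y)) y)"
  have M: "leb_coords (?L1 \<Otimes>\<^sub>M (?L2 \<Otimes>\<^sub>M ?L3)) ?J ?c"
    unfolding mats_lebesgue_eq herm_lebesgue_eq
    by (intro leb_coords_pair leb_coords_via coord_sys_mats coord_sys_herm d)
  have g: "bij_betw ?g ?J (herm_index d (p + k))"
    \<comment> \<open>Since a is at most b on the index set, \<open>b < p\<close> already places the
      entry in X, and entries below W do not occur.\<close>
    by (rule bij_betw_byWitness[where f'="\<lambda>(a, b, c). if b < p then Inl (a, b, c)
          else if a < p then Inr (Inl (a, b - p, c)) else Inr (Inr (a - p, b - p, c))"])
       (auto simp: mat_index_def herm_index_def split: if_splits)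
  have mem: "?\<Phi> x \<in> herm d (p + k)" if "x \<in> space (?L1 \<Otimes>\<^sub>M (?L2 \<Otimes>\<^sub>M ?L3))" for x
    using that by (auto simp: space_pair_measure intro: four_block_herm)
  have crd: "coords (herm_index d (p + k)) (?\<Phi> x) (?g j) = ?c x j"
    if "x \<in> space (?L1 \<Otimes>\<^sub>M (?L2 \<Otimes>\<^sub>M ?L3))" "j \<in> ?J" for x j
    using that by (auto simp: space_pair_measure coords_def mat_index_def herm_index_def Plus_def herm_def mats_def)
  note * = distr_leb_coords[OF coord_sys_herm[OF d] M g, folded herm_lebesgue_eq]
  show meas: "?\<Phi> \<in> ?L1 \<Otimes>\<^sub>M (?L2 \<Otimes>\<^sub>M ?L3) \<rightarrow>\<^sub>M ?L"
    by (rule *(1), erule mem, erule (1) crd)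
  have distr: "distr (?L1 \<Otimes>\<^sub>M (?L2 \<Otimes>\<^sub>M ?L3)) ?L ?\<Phi> = ?L"
    by (rule *(2), erule mem, erule (1) crd)
  assume f: "f \<in> borel_measurable ?L"
  have "(\<integral>\<^sup>+x. f x \<partial>?L) = (\<integral>\<^sup>+x. f x \<partial>distr (?L1 \<Otimes>\<^sub>M (?L2 \<Otimes>\<^sub>M ?L3)) ?L ?\<Phi>)"
    by (simp only: distr)
  also have "\<dots> = (\<integral>\<^sup>+x. f (?\<Phi> x) \<partial>(?L1 \<Otimes>\<^sub>M (?L2 \<Otimes>\<^sub>M ?L3)))"
    by (rule nn_integral_distr[OF meas]) (use f in simp)
  finally show "(\<integral>\<^sup>+x. f x \<partial>?L) = (\<integral>\<^sup>+(X, W, C). f (four_block_mat X W (mat_adjoint W) C) \<partial>(?L1 \<Otimes>\<^sub>M (?L2 \<Otimes>\<^sub>M ?L3)))"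
    by (simp add: split_beta')
qed

lemma mats_add: "A \<in> mats d p q \<Longrightarrow> B \<in> mats d p q \<Longrightarrow> A + B \<in> mats d p q"
  by (auto simp: mats_def scalars_iff)

lemma herm_add: "A \<in> herm d m \<Longrightarrow> B \<in> herm d m \<Longrightarrow> A + B \<in> herm d m"
  using hermD(2)[of A d m] hermD(2)[of B d m]
  by (intro hermI) (auto simp: herm_cnj[of A d m] herm_cnj[of B d m] herm_Im[of A d m] herm_Im[of B d m])

lemma nn_integral_mats_translate:
  assumes d: "d \<in> {1, 2}" and B: "B \<in> mats d p q" and f: "f \<in> borel_measurable (mats_lebesgue d p q)"
  shows "(\<integral>\<^sup>+x. f (x + B) \<partial>mats_lebesgue d p q) = (\<integral>\<^sup>+x. f x \<partial>mats_lebesgue d p q)"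
proof -
  have crd: "coords (mat_index d p q) (x + B) i = coords (mat_index d p q) x i + coords (mat_index d p q) B i"
    if "x \<in> mats d p q" "i \<in> mat_index d p q" for x i
    using that B by (auto simp: coords_def mat_index_def mats_def)
  have T: "(\<lambda>x. x + B) \<in> mats d p q \<rightarrow> mats d p q" using B by (auto intro: mats_add)
  note * = distr_translate_via[OF coord_sys_mats[OF d] T, folded mats_lebesgue_eq]
  have meas: "(\<lambda>x. x + B) \<in> mats_lebesgue d p q \<rightarrow>\<^sub>M mats_lebesgue d p q"
    by (rule *(1), erule (1) crd)
  have distr: "distr (mats_lebesgue d p q) (mats_lebesgue d p q) (\<lambda>x. x + B) = mats_lebesgue d p q"
    by (rule *(2), erule (1) crd)
  have "(\<integral>\<^sup>+x. f x \<partial>distr (mats_lebesgue d p q) (mats_lebesgue d p q) (\<lambda>x. x + B)) = (\<integral>\<^sup>+x. f (x + B) \<partial>mats_lebesgue d p q)"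
    by (rule nn_integral_distr[OF meas]) (use f in simp)
  then show ?thesis unfolding distr by simp
qed

lemma nn_integral_herm_translate:
  assumes d: "d \<in> {1, 2}" and B: "B \<in> herm d m" and f: "f \<in> borel_measurable (herm_lebesgue d m)"
  shows "(\<integral>\<^sup>+x. f (x + B) \<partial>herm_lebesgue d m) = (\<integral>\<^sup>+x. f x \<partial>herm_lebesgue d m)"
proof -
  have crd: "coords (herm_index d m) (x + B) i = coords (herm_index d m) x i + coords (herm_index d m) B i"
    if "x \<in> herm d m" "i \<in> herm_index d m" for x i
    using that B by (auto simp: coords_def herm_index_def herm_def mats_def)
  have T: "(\<lambda>x. x + B) \<in> herm d m \<rightarrow> herm d m" using B by (auto intro: herm_add)
  note * = distr_translate_via[OF coord_sys_herm[OF d] T, folded herm_lebesgue_eq]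
  have meas: "(\<lambda>x. x + B) \<in> herm_lebesgue d m \<rightarrow>\<^sub>M herm_lebesgue d m"
    by (rule *(1), erule (1) crd)
  have distr: "distr (herm_lebesgue d m) (herm_lebesgue d m) (\<lambda>x. x + B) = herm_lebesgue d m"
    by (rule *(2), erule (1) crd)
  have "(\<integral>\<^sup>+x. f x \<partial>distr (herm_lebesgue d m) (herm_lebesgue d m) (\<lambda>x. x + B)) = (\<integral>\<^sup>+x. f (x + B) \<partial>herm_lebesgue d m)"
    by (rule nn_integral_distr[OF meas]) (use f in simp)
  then show ?thesis unfolding distr by simp
qed

text \<open>For both values of \<open>d\<close> these are all the Hermitian 1 x 1 matrices
  (\<open>herm_1\<close>), so that a step by one row always brings in a single positive number as
  corner or pivot.\<close>

definition mat1 :: "real \<Rightarrow> complex mat" where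
  "mat1 t = mat 1 1 (\<lambda>_. complex_of_real t)"

lemma mat1_herm: "mat1 t \<in> herm d 1"
  by (auto simp: mat1_def intro!: hermI)

lemma herm_1: "C \<in> herm d 1 \<Longrightarrow> C = mat1 (Re (C $$ (0, 0)))"
  using herm_cnj[of C d 1 0 0] by (auto simp: mat1_def complex_eq_iff dest: hermD(2) intro!: eq_matI)

lemma measurable_mat1: "d \<in> {1, 2} \<Longrightarrow> mat1 \<in> borel \<rightarrow>\<^sub>M herm_lebesgue d 1"
  by (rule measurable_hermI[OF _ mat1_herm]) (auto simp: mat1_def)

lemma nn_integral_herm_1:
  assumes d: "d \<in> {1, 2}" and f: "f \<in> borel_measurable (herm_lebesgue d 1)"
  shows "(\<integral>\<^sup>+x. f x \<partial>herm_lebesgue d 1) = (\<integral>\<^sup>+t. f (mat1 t) \<partial>lborel)"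
proof -
  have g: "bij_betw (\<lambda>_. (0, 0, 0)) {()} (herm_index d 1)"
    using d by (auto simp: herm_index_def bij_betw_def)
  have crd: "coords (herm_index d 1) (mat1 x) (0, 0, 0) = x" for x
    using d by (auto simp: coords_def herm_index_def mat1_def)
  note * = distr_leb_coords[OF coord_sys_herm[OF d] leb_coords_lborel g mat1_herm, folded herm_lebesgue_eq]
  have meas: "mat1 \<in> lborel \<rightarrow>\<^sub>M herm_lebesgue d 1" by (rule *(1), rule crd)
  have distr: "distr lborel (herm_lebesgue d 1) mat1 = herm_lebesgue d 1" by (rule *(2), rule crd)
  have "(\<integral>\<^sup>+x. f x \<partial>distr lborel (herm_lebesgue d 1) mat1) = (\<integral>\<^sup>+t. f (mat1 t) \<partial>lborel)"
    by (rule nn_integral_distr[OF meas]) (use f in simp)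
  then show ?thesis unfolding distr by simp
qed

declare One_nat_def [simp del]

section \<open>Positive definite matrices and Schur complements\<close>

lemma adjoint_mult:
  assumes "A \<in> carrier_mat p q" "B \<in> carrier_mat q r"
  shows "mat_adjoint (A * B) = mat_adjoint B * mat_adjoint (A :: complex mat)"
  by (rule eq_matI) (use assms in \<open>auto simp: scalar_prod_def mult.commute intro!: sum.cong\<close>)

lemma adjoint_add:
  assumes "A \<in> carrier_mat p q" "B \<in> carrier_mat p q"
  shows "mat_adjoint (A + B) = mat_adjoint A + mat_adjoint (B :: complex mat)"
  by (rule eq_matI) (use assms in auto)

lemma adjoint_adjoint [simp]: "mat_adjoint (mat_adjoint A) = (A :: complex mat)"
  by (rule eq_matI) auto

lemma adjoint_one [simp]: "mat_adjoint (1\<^sub>m n :: complex mat) = 1\<^sub>m n"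
  by (rule eq_matI) auto

lemma adjoint_zero [simp]: "mat_adjoint (0\<^sub>m p q :: complex mat) = 0\<^sub>m q p"
  by (rule eq_matI) auto

lemma adjoint_mat1 [simp]: "mat_adjoint (mat1 c) = mat1 c"
  by (rule eq_matI) (auto simp: mat1_def)

lemma adjoint_four_block:
  assumes "A \<in> carrier_mat p q" "B \<in> carrier_mat p q'" "C \<in> carrier_mat p' q" "D \<in> carrier_mat p' q'"
  shows "mat_adjoint (four_block_mat A B C D) =
    four_block_mat (mat_adjoint A) (mat_adjoint C) (mat_adjoint B) (mat_adjoint (D :: complex mat))"
  by (rule eq_matI) (use assms in auto)

lemma mats_mult: "A \<in> mats d p q \<Longrightarrow> B \<in> mats d q r \<Longrightarrow> A * B \<in> mats d p r"
  by (auto simp: mats_def scalars_iff scalar_prod_def)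

lemma mats_adjoint: "A \<in> mats d p q \<Longrightarrow> mat_adjoint A \<in> mats d q p"
  by (auto simp: mats_def scalars_iff)

lemma mats_minus: "A \<in> mats d p q \<Longrightarrow> B \<in> mats d p q \<Longrightarrow> A - B \<in> mats d p q"
  by (auto simp: mats_def scalars_iff)

lemma mats_uminus: "A \<in> mats d p q \<Longrightarrow> - A \<in> mats d p q"
  by (auto simp: mats_def scalars_iff)

lemma herm_minus: "A \<in> herm d m \<Longrightarrow> B \<in> herm d m \<Longrightarrow> A - B \<in> herm d m"
  using hermD(2)[of A d m] hermD(2)[of B d m]
  by (intro hermI) (auto simp: herm_cnj[of A d m] herm_cnj[of B d m] herm_Im[of A d m] herm_Im[of B d m])

lemma herm_one: "1\<^sub>m m \<in> herm d m"
  by (rule hermI) auto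

lemma herm_congr:
  assumes "C \<in> herm d k" "W \<in> mats d p k"
  shows "W * C * mat_adjoint W \<in> herm d p"
proof -
  have W: "W \<in> carrier_mat p k" "mat_adjoint W \<in> carrier_mat k p" and C: "C \<in> carrier_mat k k" "mat_adjoint C = C"
    using assms by (auto simp: mats_def herm_def)
  have "mat_adjoint (W * C * mat_adjoint W) = W * (C * mat_adjoint W)"
    by (subst adjoint_mult[of _ p k _ p])
       (use W C in \<open>auto simp: adjoint_mult[OF W(1) C(1)]\<close>)
  also have "\<dots> = W * C * mat_adjoint W" by (rule assoc_mult_mat[symmetric]) (use W C in auto)
  finally show ?thesis
    using assms by (auto simp: herm_def intro!: mats_mult mats_adjoint)
qed

text \<open>Vectors are treated as m x 1 matrices, which keeps quadratic forms inside matrix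
  algebra: congruences and block factorizations act on them by associativity alone. The link to the
  vectors in the definition of \<open>posdef\<close> is \<open>qf_vec\<close>.\<close>

definition qf :: "complex mat \<Rightarrow> complex mat \<Rightarrow> real" where
  "qf A u = Re ((mat_adjoint u * A * u) $$ (0, 0))"

lemma qf_sum:
  assumes "A \<in> carrier_mat m m" "u \<in> carrier_mat m 1"
  shows "qf A u = (\<Sum>i<m. \<Sum>j<m. Re (cnj (u $$ (i, 0)) * A $$ (i, j) * u $$ (j, 0)))"
proof -
  have "qf A u = (\<Sum>j<m. \<Sum>i<m. Re (cnj (u $$ (i, 0)) * A $$ (i, j) * u $$ (j, 0)))"
    using assms unfolding qf_def
    by (simp add: scalar_prod_def sum_distrib_right lessThan_atLeast0 Re_sum)
  then show ?thesis by (subst sum.swap)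
qed

definition col_mat :: "nat \<Rightarrow> complex vec \<Rightarrow> complex mat" where
  "col_mat m v = mat m 1 (\<lambda>(i, j). vec_index v i)"

lemma col_mat_carrier [simp]: "col_mat m v \<in> carrier_mat m 1"
  by (simp add: col_mat_def)

lemma col_mat_col:
  assumes "u \<in> carrier_mat m 1"
  shows "col_mat m (col u 0) = u"
  by (rule eq_matI) (use assms in \<open>auto simp: col_mat_def\<close>)

lemma col_mat_eq_0:
  assumes "v \<in> carrier_vec m"
  shows "col_mat m v = 0\<^sub>m m 1 \<longleftrightarrow> v = 0\<^sub>v m"
proof
  assume *: "col_mat m v = 0\<^sub>m m 1"
  show "v = 0\<^sub>v m"
  proof (rule eq_vecI)
    fix i assume "i < dim_vec (0\<^sub>v m :: complex vec)"
    then show "vec_index v i = vec_index (0\<^sub>v m) i"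
      using arg_cong[OF *, of "\<lambda>M. M $$ (i, 0)"] by (simp add: col_mat_def)
  qed (use assms in simp)
next
  assume "v = 0\<^sub>v m"
  then show "col_mat m v = 0\<^sub>m m 1" by (intro eq_matI) (simp_all add: col_mat_def)
qed

lemma col_mat_mats: "col_mat m v \<in> mats d m 1 \<longleftrightarrow> (\<forall>a<m. vec_index v a \<in> scalars d)"
  by (simp add: mats_def col_mat_def)

lemma qf_vec:
  assumes "A \<in> carrier_mat m m" "v \<in> carrier_vec m"
  shows "Re ((A *\<^sub>v v) \<bullet>c v) = qf A (col_mat m v)"
proof -
  have "Re ((A *\<^sub>v v) \<bullet>c v) = (\<Sum>i<m. \<Sum>j<m. Re (cnj (v $ i) * A $$ (i, j) * v $ j))"
    using assms by (simp add: scalar_prod_def sum_distrib_left sum_distrib_right lessThan_atLeast0 conjugate_complex_def mult_ac)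
  also have "\<dots> = qf A (col_mat m v)"
    unfolding qf_sum[OF assms(1) col_mat_carrier] by (simp add: col_mat_def)
  finally show ?thesis .
qed

lemma posdef_iff_qf:
  "A \<in> posdef d m \<longleftrightarrow> A \<in> herm d m \<and> (\<forall>u\<in>mats d m 1. u \<noteq> 0\<^sub>m m 1 \<longrightarrow> 0 < qf A u)"
proof (cases "A \<in> herm d m")
  case True
  then have A: "A \<in> carrier_mat m m" by (rule hermD)
  have "(\<forall>v\<in>carrier_vec m. (\<forall>a<m. vec_index v a \<in> scalars d) \<longrightarrow> v \<noteq> 0\<^sub>v m \<longrightarrow> 0 < Re ((A *\<^sub>v v) \<bullet>c v)) \<longleftrightarrow>
      (\<forall>v\<in>carrier_vec m. col_mat m v \<in> mats d m 1 \<longrightarrow> col_mat m v \<noteq> 0\<^sub>m m 1 \<longrightarrow> 0 < qf A (col_mat m v))"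
    by (rule ball_cong[OF refl]) (simp add: qf_vec[OF A] col_mat_mats col_mat_eq_0)
  also have "\<dots> \<longleftrightarrow> (\<forall>u\<in>mats d m 1. u \<noteq> 0\<^sub>m m 1 \<longrightarrow> 0 < qf A u)"
  proof
    assume *: "\<forall>v\<in>carrier_vec m. col_mat m v \<in> mats d m 1 \<longrightarrow> col_mat m v \<noteq> 0\<^sub>m m 1 \<longrightarrow> 0 < qf A (col_mat m v)"
    show "\<forall>u\<in>mats d m 1. u \<noteq> 0\<^sub>m m 1 \<longrightarrow> 0 < qf A u"
    proof (intro ballI impI)
      fix u assume u: "u \<in> mats d m 1" "u \<noteq> 0\<^sub>m m 1"
      have "col u 0 \<in> carrier_vec m" using matsD[OF u(1)] by (intro carrier_vecI) simp
      from bspec[OF * this] show "0 < qf A u" using u by (simp add: col_mat_col[OF matsD[OF u(1)]])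
    qed
  qed simp
  finally show ?thesis using True by (simp add: posdef_def)
qed (simp add: posdef_def)

lemma posdef_herm: "A \<in> posdef d m \<Longrightarrow> A \<in> herm d m"
  by (simp add: posdef_def)

lemma posdef_carrier: "A \<in> posdef d m \<Longrightarrow> A \<in> carrier_mat m m"
  by (simp add: posdef_def herm_def mats_def)

text \<open>For \<open>d = 1\<close> positivity on real vectors extends to complex ones by splitting into real and
  imaginary parts.\<close>

lemma posdef_qf:
  assumes d: "d \<in> {1, 2}" and A: "A \<in> posdef d m" and u: "u \<in> carrier_mat m 1" "u \<noteq> 0\<^sub>m m 1"
  shows "0 < qf A u"
proof (cases "d = 1")
  case False
  then have "u \<in> mats d m 1" using u d by (simp add: mats_def scalars_iff)
  then show ?thesis using A u by (simp add: posdef_iff_qf)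
next
  case True
  let ?a = "mat m 1 (\<lambda>ij. complex_of_real (Re (u $$ ij)))" and ?b = "mat m 1 (\<lambda>ij. complex_of_real (Im (u $$ ij)))"
  have Ac: "A \<in> carrier_mat m m" by (rule posdef_carrier[OF A])
  have real: "Im (A $$ (i, j)) = 0" if "i < m" "j < m" for i j
    using A that True by (auto simp: posdef_def herm_def mats_def scalars_iff)
  have "qf A u = qf A ?a + qf A ?b"
    unfolding qf_sum[OF Ac u(1)] qf_sum[OF Ac mat_carrier] sum.distrib[symmetric]
    by (intro sum.cong refl) (simp add: real algebra_simps)
  moreover have ab: "?a \<in> mats d m 1" "?b \<in> mats d m 1" by (auto simp: mats_def scalars_iff)
  have "?a \<noteq> 0\<^sub>m m 1 \<or> ?b \<noteq> 0\<^sub>m m 1"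
  proof (rule ccontr)
    assume "\<not> (?a \<noteq> 0\<^sub>m m 1 \<or> ?b \<noteq> 0\<^sub>m m 1)"
    then have *: "?a = 0\<^sub>m m 1" "?b = 0\<^sub>m m 1" by auto
    have "u $$ (i, 0) = 0" if "i < m" for i
      using arg_cong[OF *(1), of "\<lambda>M. M $$ (i, 0)"] arg_cong[OF *(2), of "\<lambda>M. M $$ (i, 0)"] that
      by (simp add: complex_eq_iff)
    then have "u = 0\<^sub>m m 1" using u(1) by (intro eq_matI) auto
    then show False using u(2) by simp
  qed
  moreover have "0 \<le> qf A x" if "x \<in> mats d m 1" for x
    using A that by (cases "x = 0\<^sub>m m 1") (auto simp: posdef_iff_qf qf_sum[OF Ac] less_imp_le)
  moreover have "0 < qf A x" if "x \<in> mats d m 1" "x \<noteq> 0\<^sub>m m 1" for x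
    using A that by (simp add: posdef_iff_qf)
  ultimately show ?thesis using ab by (metis add_nonneg_pos add_pos_nonneg)
qed

text \<open>The kernel vector of a singular matrix is found over the complex numbers. This is the
  place where positivity on all complex vectors is used, also for \<open>d = 1\<close>.\<close>

lemma posdef_det_nz:
  assumes d: "d \<in> {1, 2}" and A: "A \<in> posdef d m"
  shows "det A \<noteq> 0"
proof
  have Ac: "A \<in> carrier_mat m m" by (rule posdef_carrier[OF A])
  assume "det A = 0"
  then obtain v where v: "v \<in> carrier_vec m" "v \<noteq> 0\<^sub>v m" "A *\<^sub>v v = 0\<^sub>v m"
    using det_0_iff_vec_prod_zero_field[OF Ac] by auto
  let ?u = "col_mat m v"
  have "?u \<noteq> 0\<^sub>m m 1" using v by (simp add: col_mat_eq_0)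
  then have "0 < qf A ?u" by (intro posdef_qf[OF d A]) auto
  then show False using v unfolding qf_vec[OF Ac v(1), symmetric] by simp
qed

lemma mat_inverse_unique:
  assumes "A \<in> carrier_mat m m" "B \<in> carrier_mat m m" "C \<in> carrier_mat m m" "B * A = 1\<^sub>m m" "A * C = 1\<^sub>m m"
  shows "B = (C :: complex mat)"
proof -
  have "B = B * (A * C)" using assms by simp
  also have "\<dots> = (B * A) * C" using assms by (intro assoc_mult_mat[symmetric]) auto
  finally show ?thesis using assms by simp
qed

text \<open>Invertibility ensures that \<open>mat_inverse\<close> is not \<open>None\<close>, so
  that \<open>the\<close> in \<open>minv\<close> is meaningful. The adjugate formula later makes
  \<open>minv\<close> measurable.\<close>

lemma minv_det:
  assumes A: "A \<in> carrier_mat m m" and "det A \<noteq> 0"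
  shows "minv A \<in> carrier_mat m m" "A * minv A = 1\<^sub>m m" "minv A * A = 1\<^sub>m m"
    "minv A = (1 / det A) \<cdot>\<^sub>m adj_mat A"
proof -
  let ?B = "(1 / det A) \<cdot>\<^sub>m adj_mat A"
  have B: "?B \<in> carrier_mat m m" "A * ?B = 1\<^sub>m m" "?B * A = 1\<^sub>m m"
    using adj_mat[OF A] assms by (auto simp: mult_smult_distrib[of _ m m _ m] mult_smult_assoc_mat[of _ m m _ m])
  have "A \<in> Units (ring_mat TYPE(complex) m ())"
    using A B by (auto simp: Units_def ring_mat_def)
  then obtain C where C: "mat_inverse A = Some C"
    using mat_inverse(1)[OF A, where b="()"] by (cases "mat_inverse A") auto
  then have *: "A * C = 1\<^sub>m m" "C * A = 1\<^sub>m m" "C \<in> carrier_mat m m" using mat_inverse(2)[OF A C] by auto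
  then show "minv A \<in> carrier_mat m m" "A * minv A = 1\<^sub>m m" "minv A * A = 1\<^sub>m m" using C by (simp_all add: minv_def)
  show "minv A = ?B" using C mat_inverse_unique[OF A *(3) B(1) *(2) B(2)] by (simp add: minv_def)
qed

lemma minv_posdef_carrier:
  assumes d: "d \<in> {1, 2}" and A: "A \<in> posdef d m"
  shows "minv A \<in> carrier_mat m m" "A * minv A = 1\<^sub>m m" "minv A * A = 1\<^sub>m m"
  using minv_det[OF posdef_carrier[OF A] posdef_det_nz[OF d A]] by auto

text \<open>Uniqueness of the inverse does everything: the adjoint of \<open>minv A\<close> is again
  an inverse of \<open>A\<close>, and for \<open>d = 1\<close> so is its entrywise conjugate, which
  forces real entries.\<close>

lemma minv_herm:
  assumes d: "d \<in> {1, 2}" and A: "A \<in> posdef d m"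
  shows "minv A \<in> herm d m"
proof -
  have Ac: "A \<in> carrier_mat m m" and adj: "mat_adjoint A = A"
    using A by (auto simp: posdef_def herm_def mats_def)
  note B = minv_posdef_carrier[OF d A]
  have 1: "mat_adjoint (minv A) * A = 1\<^sub>m m"
    using adjoint_mult[OF Ac B(1)] B(2) adj by simp
  have h: "mat_adjoint (minv A) = minv A"
    by (rule mat_inverse_unique[OF Ac _ B(1) _ B(2)]) (use B 1 in auto)
  have "minv A \<in> mats d m m"
  proof (cases "d = 1")
    case True
    interpret cnj: semiring_hom cnj by standard auto
    have "map_mat cnj A = A"
      by (rule eq_matI) (use A True in \<open>auto simp: posdef_def herm_def mats_def scalars_iff complex_eq_iff\<close>)
    then have 2: "map_mat cnj (minv A) * A = 1\<^sub>m m"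
      using cnj.mat_hom_mult[OF B(1) Ac] B(3) by (simp add: cnj.mat_hom_one)
    have *: "map_mat cnj (minv A) = minv A"
      by (rule mat_inverse_unique[OF Ac _ B(1) _ B(2)]) (use B 2 in auto)
    have "cnj (minv A $$ (i, j)) = minv A $$ (i, j)" if "i < m" "j < m" for i j
      using arg_cong[OF *, of "\<lambda>M. M $$ (i, j)"] that B(1) by simp
    then show ?thesis using B(1) by (auto simp: mats_def scalars_iff complex_eq_iff)
  next
    case False
    then show ?thesis using B(1) d by (auto simp: mats_def scalars_iff)
  qed
  then show ?thesis using h by (simp add: herm_def)
qed

lemma qf_congr:
  assumes "T \<in> carrier_mat p m" "D \<in> carrier_mat m m" "u \<in> carrier_mat p 1"
  shows "qf (T * D * mat_adjoint T) u = qf D (mat_adjoint T * u)"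
proof -
  have c: "mat_adjoint u \<in> carrier_mat 1 p" "mat_adjoint T \<in> carrier_mat m p" using assms by auto
  have "mat_adjoint (mat_adjoint T * u) * D * (mat_adjoint T * u) = (mat_adjoint u * T) * D * (mat_adjoint T * u)"
    using adjoint_mult[OF c(2) assms(3)] by simp
  also have "\<dots> = (mat_adjoint u * T * D * mat_adjoint T) * u"
    by (rule assoc_mult_mat[symmetric, of _ 1 m _ p _ 1]) (use assms c in auto)
  also have "mat_adjoint u * T * D * mat_adjoint T = mat_adjoint u * T * (D * mat_adjoint T)"
    by (rule assoc_mult_mat[of _ 1 m _ m _ p]) (use assms c in auto)
  also have "\<dots> = mat_adjoint u * (T * (D * mat_adjoint T))"
    by (rule assoc_mult_mat[of _ 1 p _ m _ p]) (use assms c in auto)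
  also have "T * (D * mat_adjoint T) = T * D * mat_adjoint T"
    by (rule assoc_mult_mat[symmetric, of _ p m _ m _ p]) (use assms c in auto)
  finally show ?thesis by (simp add: qf_def)
qed

text \<open>The left inverse \<open>S\<close> only serves to show that the adjoint of
  \<open>T\<close> kills no nonzero column; positivity is then read off from
  \<open>qf_congr\<close>.\<close>

lemma posdef_congr:
  assumes D: "D \<in> posdef d m" and T: "T \<in> mats d m m" and S: "S \<in> carrier_mat m m" "S * mat_adjoint T = 1\<^sub>m m"
  shows "T * D * mat_adjoint T \<in> posdef d m"
  unfolding posdef_iff_qf
proof (intro conjI ballI impI)
  have Tc: "T \<in> carrier_mat m m" using T by (rule matsD)
  show "T * D * mat_adjoint T \<in> herm d m" by (rule herm_congr[OF posdef_herm[OF D] T])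
  fix u assume u: "u \<in> mats d m 1" "u \<noteq> 0\<^sub>m m 1"
  have uc: "u \<in> carrier_mat m 1" using u by (simp add: mats_def)
  have "mat_adjoint T * u \<noteq> 0\<^sub>m m 1"
  proof
    assume "mat_adjoint T * u = 0\<^sub>m m 1"
    then have "S * (mat_adjoint T * u) = 0\<^sub>m m 1" using S by simp
    moreover have "S * (mat_adjoint T * u) = (S * mat_adjoint T) * u"
      using S Tc uc by (intro assoc_mult_mat[symmetric]) auto
    ultimately show False using u uc S by simp
  qed
  then show "0 < qf (T * D * mat_adjoint T) u"
    using D u T qf_congr[OF Tc posdef_carrier[OF D] uc]
    by (auto simp: posdef_iff_qf intro!: mats_mult mats_adjoint)
qed

text \<open>The inverse is congruent to \<open>A\<close> itself: it equals
  \<open>minv A * A * minv A\<close>, and \<open>minv A\<close> is self-adjoint.\<close>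

lemma minv_posdef:
  assumes d: "d \<in> {1, 2}" and A: "A \<in> posdef d m"
  shows "minv A \<in> posdef d m"
proof -
  note B = minv_posdef_carrier[OF d A] and h = minv_herm[OF d A]
  have "minv A * A * mat_adjoint (minv A) \<in> posdef d m"
    by (rule posdef_congr[OF A, where S=A]) (use h B A in \<open>auto simp: herm_def posdef_carrier\<close>)
  then show ?thesis using h B by (simp add: herm_def)
qed

lemma qf_diag:
  assumes "X \<in> carrier_mat p p" "S \<in> carrier_mat k k" "u \<in> carrier_mat p 1" "v \<in> carrier_mat k 1"
  shows "qf (four_block_mat X (0\<^sub>m p k) (0\<^sub>m k p) S) (four_block_mat u (0\<^sub>m p 0) v (0\<^sub>m k 0)) = qf X u + qf S v"
proof -
  let ?U = "four_block_mat (mat_adjoint u) (mat_adjoint v) (0\<^sub>m 0 p) (0\<^sub>m 0 k)"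
  have c: "mat_adjoint u \<in> carrier_mat 1 p" "mat_adjoint v \<in> carrier_mat 1 k"
    "mat_adjoint u * X \<in> carrier_mat 1 p" "mat_adjoint v * S \<in> carrier_mat 1 k"
    using assms by auto
  have U: "mat_adjoint (four_block_mat u (0\<^sub>m p 0) v (0\<^sub>m k 0)) = ?U"
    using adjoint_four_block[OF assms(3) zero_carrier_mat assms(4) zero_carrier_mat] by simp
  have 1: "?U * four_block_mat X (0\<^sub>m p k) (0\<^sub>m k p) S =
      four_block_mat (mat_adjoint u * X) (mat_adjoint v * S) (0\<^sub>m 0 p) (0\<^sub>m 0 k)"
    using assms c by (subst mult_four_block_mat[of _ 1 p _ k _ 0 _ _ p _ k]) simp_all
  have 2: "mat_adjoint (four_block_mat u (0\<^sub>m p 0) v (0\<^sub>m k 0)) * four_block_mat X (0\<^sub>m p k) (0\<^sub>m k p) S *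
      four_block_mat u (0\<^sub>m p 0) v (0\<^sub>m k 0) =
      four_block_mat (mat_adjoint u * X * u + mat_adjoint v * S * v) (0\<^sub>m 1 0) (0\<^sub>m 0 1) (0\<^sub>m 0 0)"
    unfolding U 1 using assms c by (subst mult_four_block_mat[of _ 1 p _ k _ 0 _ _ 1 _ 0]) simp_all
  show ?thesis unfolding qf_def 2 using assms c by simp
qed

lemma stack_cases:
  assumes "w \<in> mats d (p + k) 1"
  obtains u v where "u \<in> mats d p 1" "v \<in> mats d k 1" "w = four_block_mat u (0\<^sub>m p 0) v (0\<^sub>m k 0)"
proof
  show "mat p 1 (\<lambda>(i, j). w $$ (i, j)) \<in> mats d p 1" "mat k 1 (\<lambda>(i, j). w $$ (p + i, j)) \<in> mats d k 1"
    "w = four_block_mat (mat p 1 (\<lambda>(i, j). w $$ (i, j))) (0\<^sub>m p 0) (mat k 1 (\<lambda>(i, j). w $$ (p + i, j))) (0\<^sub>m k 0)"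
    using assms by (auto simp: mats_def intro!: eq_matI)
qed

lemma stack_eq_0:
  assumes "u \<in> carrier_mat p 1" "v \<in> carrier_mat k 1"
  shows "four_block_mat u (0\<^sub>m p 0) v (0\<^sub>m k 0) = 0\<^sub>m (p + k) 1 \<longleftrightarrow> u = 0\<^sub>m p 1 \<and> v = (0\<^sub>m k 1 :: complex mat)"
proof
  assume *: "four_block_mat u (0\<^sub>m p 0) v (0\<^sub>m k 0) = 0\<^sub>m (p + k) 1"
  have "u $$ (i, 0) = 0" if "i < p" for i using arg_cong[OF *, of "\<lambda>M. M $$ (i, 0)"] that assms by simp
  moreover have "v $$ (i, 0) = 0" if "i < k" for i using arg_cong[OF *, of "\<lambda>M. M $$ (p + i, 0)"] that assms by simp
  ultimately show "u = 0\<^sub>m p 1 \<and> v = 0\<^sub>m k 1" using assms by (auto intro!: eq_matI)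
next
  assume "u = 0\<^sub>m p 1 \<and> v = 0\<^sub>m k 1"
  then show "four_block_mat u (0\<^sub>m p 0) v (0\<^sub>m k 0) = 0\<^sub>m (p + k) 1" by (intro eq_matI) simp_all
qed

text \<open>The carrier conditions belong to the left-hand side because the size of the assembled
  matrix does not determine where it is split.\<close>

lemma posdef_diag:
  "four_block_mat X (0\<^sub>m p k) (0\<^sub>m k p) S \<in> posdef d (p + k) \<and> X \<in> carrier_mat p p \<and> S \<in> carrier_mat k k \<longleftrightarrow>
    X \<in> posdef d p \<and> S \<in> posdef d k"
proof (intro iffI conjI)
  assume *: "X \<in> posdef d p \<and> S \<in> posdef d k"
  then have c: "X \<in> carrier_mat p p" "S \<in> carrier_mat k k" by (auto simp: posdef_carrier)
  then show "X \<in> carrier_mat p p" "S \<in> carrier_mat k k" .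
  have h: "four_block_mat X (0\<^sub>m p k) (0\<^sub>m k p) S \<in> herm d (p + k)"
    using four_block_herm[of X d p "0\<^sub>m p k" k S] * by (simp add: posdef_herm mats_def scalars_iff)
  have "0 < qf (four_block_mat X (0\<^sub>m p k) (0\<^sub>m k p) S) w" if w: "w \<in> mats d (p + k) 1" "w \<noteq> 0\<^sub>m (p + k) 1" for w
  proof -
    obtain u v where uv: "u \<in> mats d p 1" "v \<in> mats d k 1" "w = four_block_mat u (0\<^sub>m p 0) v (0\<^sub>m k 0)"
      using stack_cases[OF w(1)] by blast
    have z: "u \<noteq> 0\<^sub>m p 1 \<or> v \<noteq> 0\<^sub>m k 1" using w uv stack_eq_0[of u p v k] by (auto simp: mats_def)
    have "0 \<le> qf X u" using * uv c by (cases "u = 0\<^sub>m p 1") (auto simp: posdef_iff_qf qf_sum less_imp_le)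
    moreover have "0 \<le> qf S v" using * uv c by (cases "v = 0\<^sub>m k 1") (auto simp: posdef_iff_qf qf_sum less_imp_le)
    moreover have "0 < qf X u \<or> 0 < qf S v" using z * uv by (auto simp: posdef_iff_qf)
    ultimately show ?thesis using uv c by (auto simp: qf_diag matsD)
  qed
  then show "four_block_mat X (0\<^sub>m p k) (0\<^sub>m k p) S \<in> posdef d (p + k)" using h by (simp add: posdef_iff_qf)
next
  assume *: "four_block_mat X (0\<^sub>m p k) (0\<^sub>m k p) S \<in> posdef d (p + k) \<and> X \<in> carrier_mat p p \<and> S \<in> carrier_mat k k"
  then have c: "X \<in> carrier_mat p p" "S \<in> carrier_mat k k" by auto
  have h: "four_block_mat X (0\<^sub>m p k) (0\<^sub>m k p) S \<in> herm d (p + k)" using * by (simp add: posdef_herm)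
  then have e: "\<And>a b. a < p + k \<Longrightarrow> b < p + k \<Longrightarrow> four_block_mat X (0\<^sub>m p k) (0\<^sub>m k p) S $$ (a, b) \<in> scalars d"
    and e': "\<And>a b. a < p + k \<Longrightarrow> b < p + k \<Longrightarrow> four_block_mat X (0\<^sub>m p k) (0\<^sub>m k p) S $$ (b, a) =
      cnj (four_block_mat X (0\<^sub>m p k) (0\<^sub>m k p) S $$ (a, b))"
    unfolding herm_iff mats_def by blast+
  have hX: "X \<in> herm d p"
    unfolding herm_iff mats_def
  proof (intro conjI CollectI allI impI)
    fix a b assume "a < p" "b < p"
    then show "X $$ (a, b) \<in> scalars d" "X $$ (b, a) = cnj (X $$ (a, b))"
      using e[of a b] e'[of a b] c by auto
  qed (use c in auto)
  have hS: "S \<in> herm d k"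
    unfolding herm_iff mats_def
  proof (intro conjI CollectI allI impI)
    fix a b assume "a < k" "b < k"
    then show "S $$ (a, b) \<in> scalars d" "S $$ (b, a) = cnj (S $$ (a, b))"
      using e[of "p + a" "p + b"] e'[of "p + a" "p + b"] c by auto
  qed (use c in auto)
  have pos: "0 < qf X u + qf S v" if uv: "u \<in> mats d p 1" "v \<in> mats d k 1" "u \<noteq> 0\<^sub>m p 1 \<or> v \<noteq> 0\<^sub>m k 1" for u v
  proof -
    let ?w = "four_block_mat u (0\<^sub>m p 0) v (0\<^sub>m k 0)"
    have "?w \<noteq> 0\<^sub>m (p + k) 1" using stack_eq_0[OF uv(1,2)[THEN matsD]] uv(3) by blast
    then have "0 < qf (four_block_mat X (0\<^sub>m p k) (0\<^sub>m k p) S) ?w"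
      using * stack_mats[OF uv(1,2)] unfolding posdef_iff_qf by blast
    then show ?thesis using qf_diag[OF c uv(1,2)[THEN matsD]] by simp
  qed
  have z: "0\<^sub>m a 1 \<in> mats d a 1" "qf Y (0\<^sub>m a 1) = 0" if "Y \<in> carrier_mat a a" for a Y
    using that by (auto simp: mats_def scalars_iff qf_sum)
  have "0 < qf X u" if "u \<in> mats d p 1" "u \<noteq> 0\<^sub>m p 1" for u
    using pos[OF that(1) z(1)[OF c(2)]] that(2) z(2)[OF c(2)] by simp
  then show "X \<in> posdef d p" using hX unfolding posdef_iff_qf by blast
  have "0 < qf S u" if "u \<in> mats d k 1" "u \<noteq> 0\<^sub>m k 1" for u
    using pos[OF z(1)[OF c(1)] that(1)] that(2) z(2)[OF c(1)] by simp
  then show "S \<in> posdef d k" using hS unfolding posdef_iff_qf by blast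
qed

section \<open>Blocks, Schur complements and unipotent congruences\<close>

definition ul :: "nat \<Rightarrow> complex mat \<Rightarrow> complex mat" where
  "ul p x = mat p p (\<lambda>ij. x $$ ij)"

definition ur :: "nat \<Rightarrow> nat \<Rightarrow> complex mat \<Rightarrow> complex mat" where
  "ur p k x = mat p k (\<lambda>(i, j). x $$ (i, p + j))"

definition lr :: "nat \<Rightarrow> nat \<Rightarrow> complex mat \<Rightarrow> complex mat" where
  "lr p k x = mat k k (\<lambda>(i, j). x $$ (p + i, p + j))"

lemma blocks_carrier [simp]: "ul p x \<in> carrier_mat p p" "ur p k x \<in> carrier_mat p k" "lr p k x \<in> carrier_mat k k"
  by (simp_all add: ul_def ur_def lr_def)

lemma blocks_four_block:
  assumes "X \<in> carrier_mat p p" "W \<in> carrier_mat p k" "V \<in> carrier_mat k p" "C \<in> carrier_mat k k"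
  shows "ul p (four_block_mat X W V C) = X" "ur p k (four_block_mat X W V C) = W"
    "lr p k (four_block_mat X W V C) = C"
  using assms by (auto simp: ul_def ur_def lr_def intro!: eq_matI)

lemma herm_blocks:
  assumes x: "x \<in> herm d (p + k)"
  shows "ul p x \<in> herm d p" "ur p k x \<in> mats d p k" "lr p k x \<in> herm d k"
    "x = four_block_mat (ul p x) (ur p k x) (mat_adjoint (ur p k x)) (lr p k x)"
proof -
  note e = herm_cnj[OF x] herm_Im[OF x]
  show "ul p x \<in> herm d p" by (rule hermI) (simp_all add: e, simp_all add: ul_def e)
  show "lr p k x \<in> herm d k" by (rule hermI) (simp_all add: e, simp_all add: lr_def e)
  show "ur p k x \<in> mats d p k" by (simp add: mats_def scalars_iff) (simp add: ur_def e)
  have c: "x \<in> carrier_mat (p + k) (p + k)" by (rule hermD(2)[OF x])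
  show "x = four_block_mat (ul p x) (ur p k x) (mat_adjoint (ur p k x)) (lr p k x)"
  proof (rule eq_matI)
    fix i j assume "i < dim_row (four_block_mat (ul p x) (ur p k x) (mat_adjoint (ur p k x)) (lr p k x))"
      "j < dim_col (four_block_mat (ul p x) (ur p k x) (mat_adjoint (ur p k x)) (lr p k x))"
    then have "i < p + k" "j < p + k" by (simp_all add: ul_def lr_def)
    then show "x $$ (i, j) = four_block_mat (ul p x) (ur p k x) (mat_adjoint (ur p k x)) (lr p k x) $$ (i, j)"
      by (simp add: ul_def lr_def ur_def e)
  qed (use c in \<open>simp_all add: ul_def lr_def\<close>)
qed

lemma qf_four_block:
  assumes "X \<in> carrier_mat p p" "W \<in> carrier_mat p k" "V \<in> carrier_mat k p" "C \<in> carrier_mat k k"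
    and "u \<in> carrier_mat p 1" "v \<in> carrier_mat k 1"
  shows "qf (four_block_mat X W V C) (four_block_mat u (0\<^sub>m p 0) v (0\<^sub>m k 0)) =
    qf X u + Re ((mat_adjoint v * V * u) $$ (0, 0)) + (Re ((mat_adjoint u * W * v) $$ (0, 0)) + qf C v)"
proof -
  let ?U = "four_block_mat (mat_adjoint u) (mat_adjoint v) (0\<^sub>m 0 p) (0\<^sub>m 0 k)"
  have c: "mat_adjoint u \<in> carrier_mat 1 p" "mat_adjoint v \<in> carrier_mat 1 k"
    "mat_adjoint u * X \<in> carrier_mat 1 p" "mat_adjoint v * C \<in> carrier_mat 1 k"
    "mat_adjoint u * W \<in> carrier_mat 1 k" "mat_adjoint v * V \<in> carrier_mat 1 p"
    using assms by auto
  have U: "mat_adjoint (four_block_mat u (0\<^sub>m p 0) v (0\<^sub>m k 0)) = ?U"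
    using adjoint_four_block[OF assms(5) zero_carrier_mat assms(6) zero_carrier_mat] by simp
  have 1: "?U * four_block_mat X W V C =
      four_block_mat (mat_adjoint u * X + mat_adjoint v * V) (mat_adjoint u * W + mat_adjoint v * C) (0\<^sub>m 0 p) (0\<^sub>m 0 k)"
    using assms c by (subst mult_four_block_mat[of _ 1 p _ k _ 0 _ _ p _ k]) simp_all
  have "mat_adjoint (four_block_mat u (0\<^sub>m p 0) v (0\<^sub>m k 0)) * four_block_mat X W V C *
      four_block_mat u (0\<^sub>m p 0) v (0\<^sub>m k 0) =
      four_block_mat ((mat_adjoint u * X + mat_adjoint v * V) * u + (mat_adjoint u * W + mat_adjoint v * C) * v)
        (0\<^sub>m 1 0) (0\<^sub>m 0 1) (0\<^sub>m 0 0)"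
    unfolding U 1 using assms c by (subst mult_four_block_mat[of _ 1 p _ k _ 0 _ _ 1 _ 0]) simp_all
  moreover have "(mat_adjoint u * X + mat_adjoint v * V) * u = mat_adjoint u * X * u + mat_adjoint v * V * u"
    by (rule add_mult_distrib_mat[of _ 1 p]) (use assms c in auto)
  moreover have "(mat_adjoint u * W + mat_adjoint v * C) * v = mat_adjoint u * W * v + mat_adjoint v * C * v"
    by (rule add_mult_distrib_mat[of _ 1 k]) (use assms c in auto)
  ultimately have 2: "mat_adjoint (four_block_mat u (0\<^sub>m p 0) v (0\<^sub>m k 0)) * four_block_mat X W V C *
      four_block_mat u (0\<^sub>m p 0) v (0\<^sub>m k 0) =
      four_block_mat (mat_adjoint u * X * u + mat_adjoint v * V * u + (mat_adjoint u * W * v + mat_adjoint v * C * v))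
        (0\<^sub>m 1 0) (0\<^sub>m 0 1) (0\<^sub>m 0 0)" by simp
  show ?thesis unfolding qf_def 2 using assms c by simp
qed

lemma posdef_principal:
  assumes x: "four_block_mat X W (mat_adjoint W) C \<in> posdef d (p + k)"
    and c: "X \<in> herm d p" "W \<in> mats d p k" "C \<in> herm d k"
  shows "X \<in> posdef d p" "C \<in> posdef d k"
proof -
  have cc: "X \<in> carrier_mat p p" "W \<in> carrier_mat p k" "mat_adjoint W \<in> carrier_mat k p" "C \<in> carrier_mat k k"
    using c by (auto simp: hermD matsD)
  have z: "0\<^sub>m a 1 \<in> mats d a 1" "qf Y (0\<^sub>m a 1) = 0" if "Y \<in> carrier_mat a a" for a Y
    using that by (auto simp: mats_def scalars_iff qf_sum)
  have *: "0 < qf (four_block_mat X W (mat_adjoint W) C) (four_block_mat u (0\<^sub>m p 0) v (0\<^sub>m k 0))"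
    if uv: "u \<in> mats d p 1" "v \<in> mats d k 1" "u \<noteq> 0\<^sub>m p 1 \<or> v \<noteq> 0\<^sub>m k 1" for u v
    using x stack_mats[OF uv(1,2)] stack_eq_0[OF uv(1,2)[THEN matsD]] uv(3) unfolding posdef_iff_qf by blast
  have "0 < qf X u" if u: "u \<in> mats d p 1" "u \<noteq> 0\<^sub>m p 1" for u
    using *[OF u(1) z(1)[OF cc(4)]] u(2) qf_four_block[OF cc matsD[OF u(1)] matsD[OF z(1)[OF cc(4)]]]
      z(2)[OF cc(4)] cc matsD[OF u(1)] by simp
  then show "X \<in> posdef d p" using c unfolding posdef_iff_qf by blast
  have "0 < qf C u" if u: "u \<in> mats d k 1" "u \<noteq> 0\<^sub>m k 1" for u
    using *[OF z(1)[OF cc(1)] u(1)] u(2) qf_four_block[OF cc matsD[OF z(1)[OF cc(1)]] matsD[OF u(1)]]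
      z(2)[OF cc(1)] cc matsD[OF u(1)] by simp
  then show "C \<in> posdef d k" using c unfolding posdef_iff_qf by blast
qed

text \<open>Converse of \<open>posdef_congr\<close>. Here \<open>S\<close> must have entries in the
  scalar field, because \<open>S * u\<close> is used as a test vector for the positivity of the
  congruent matrix.\<close>

lemma posdef_congr_imp:
  assumes D: "D \<in> herm d m" and T: "T \<in> mats d m m" and S: "S \<in> mats d m m" "mat_adjoint T * S = 1\<^sub>m m"
    and x: "T * D * mat_adjoint T \<in> posdef d m"
  shows "D \<in> posdef d m"
  unfolding posdef_iff_qf
proof (intro conjI ballI impI)
  show "D \<in> herm d m" by (rule D)
  fix u assume u: "u \<in> mats d m 1" "u \<noteq> 0\<^sub>m m 1"
  have c: "T \<in> carrier_mat m m" "D \<in> carrier_mat m m" "S \<in> carrier_mat m m" "u \<in> carrier_mat m 1" "S * u \<in> carrier_mat m 1"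
    using T D S u by (auto simp: matsD hermD intro!: mult_carrier_mat[of S m m])
  have eq: "mat_adjoint T * (S * u) = u"
    using assoc_mult_mat[of "mat_adjoint T" m m S m u 1] c S(2) by simp
  then have "S * u \<noteq> 0\<^sub>m m 1" using u c by auto
  then have "0 < qf (T * D * mat_adjoint T) (S * u)"
    using x mats_mult[OF S(1) u(1)] unfolding posdef_iff_qf by blast
  then show "0 < qf D u" unfolding qf_congr[OF c(1,2,5)] eq .
qed

text \<open>Two opposite ways to complete a square. In \<open>blkA Z W C\<close> the matrix Z is the
  Schur complement of the lower right block, so this undoes one step of the recursion for zeta; it
  is the chart used for the parameter. In \<open>blkB X W S\<close> the matrix S is the Schur
  complement of the upper left block, so X is a leading block and a 1 x 1 S is a pivot; it is the
  chart used for observations.\<close>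

definition blkA :: "complex mat \<Rightarrow> complex mat \<Rightarrow> complex mat \<Rightarrow> complex mat" where
  "blkA Z W C = four_block_mat (Z + W * minv C * mat_adjoint W) W (mat_adjoint W) C"

definition blkB :: "complex mat \<Rightarrow> complex mat \<Rightarrow> complex mat \<Rightarrow> complex mat" where
  "blkB X W S = four_block_mat X W (mat_adjoint W) (S + mat_adjoint W * minv X * W)"

text \<open>The unipotent factors that block-diagonalize \<open>blkA\<close> and \<open>blkB\<close>
  by congruence. They have determinant 1, so determinants multiply over the diagonal blocks.\<close>

definition trA :: "nat \<Rightarrow> nat \<Rightarrow> complex mat \<Rightarrow> complex mat \<Rightarrow> complex mat" where
  "trA p k W C = four_block_mat (1\<^sub>m p) (W * minv C) (0\<^sub>m k p) (1\<^sub>m k)"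

definition trB :: "nat \<Rightarrow> nat \<Rightarrow> complex mat \<Rightarrow> complex mat \<Rightarrow> complex mat" where
  "trB p k W X = four_block_mat (1\<^sub>m p) (0\<^sub>m p k) (mat_adjoint W * minv X) (1\<^sub>m k)"

lemma unipotent_inverse:
  assumes "M \<in> carrier_mat p k"
  shows "four_block_mat (1\<^sub>m p) M (0\<^sub>m k p) (1\<^sub>m k) * four_block_mat (1\<^sub>m p) (- M) (0\<^sub>m k p) (1\<^sub>m k) = (1\<^sub>m (p + k) :: complex mat)"
    and "four_block_mat (1\<^sub>m k) (0\<^sub>m k p) M (1\<^sub>m p) * four_block_mat (1\<^sub>m k) (0\<^sub>m k p) (- M) (1\<^sub>m p) = (1\<^sub>m (k + p) :: complex mat)"
proof -
  have M: "- M + M = 0\<^sub>m p k" "M + - M = 0\<^sub>m p k" using assms by (auto intro!: eq_matI)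
  have z: "- 0\<^sub>m k k + 1\<^sub>m k = (1\<^sub>m k :: complex mat)" "- 0\<^sub>m p p + 1\<^sub>m p = (1\<^sub>m p :: complex mat)"
    "1\<^sub>m k + - 0\<^sub>m k k = (1\<^sub>m k :: complex mat)" "1\<^sub>m p + - 0\<^sub>m p p = (1\<^sub>m p :: complex mat)"
    by (auto intro!: eq_matI)
  show "four_block_mat (1\<^sub>m p) M (0\<^sub>m k p) (1\<^sub>m k) * four_block_mat (1\<^sub>m p) (- M) (0\<^sub>m k p) (1\<^sub>m k) = (1\<^sub>m (p + k) :: complex mat)"
    using assms by (subst mult_four_block_mat[of _ p p _ k _ k _ _ p _ k]) (simp_all add: M z)
  show "four_block_mat (1\<^sub>m k) (0\<^sub>m k p) M (1\<^sub>m p) * four_block_mat (1\<^sub>m k) (0\<^sub>m k p) (- M) (1\<^sub>m p) = (1\<^sub>m (k + p) :: complex mat)"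
    using assms by (subst mult_four_block_mat[of _ k k _ p _ p _ _ k _ p]) (simp_all add: M z)
qed

locale field_dim =
  fixes d :: nat
  assumes d: "d \<in> {1, 2}"
begin

lemma blkA_factor:
  assumes "Z \<in> carrier_mat p p" "W \<in> carrier_mat p k" and C: "C \<in> posdef d k"
  shows "blkA Z W C = trA p k W C * four_block_mat Z (0\<^sub>m p k) (0\<^sub>m k p) C * mat_adjoint (trA p k W C)"
    and "mat_adjoint (trA p k W C) = four_block_mat (1\<^sub>m p) (0\<^sub>m p k) (minv C * mat_adjoint W) (1\<^sub>m k)"
proof -
  note i = minv_posdef_carrier[OF d C] and Cc = posdef_carrier[OF C]
  have h: "mat_adjoint (minv C) = minv C" by (rule hermD(3)[OF minv_herm[OF d C]])
  have c: "W * minv C \<in> carrier_mat p k" "mat_adjoint W \<in> carrier_mat k p" "minv C * mat_adjoint W \<in> carrier_mat k p"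
    using assms i by auto
  show A: "mat_adjoint (trA p k W C) = four_block_mat (1\<^sub>m p) (0\<^sub>m p k) (minv C * mat_adjoint W) (1\<^sub>m k)"
    unfolding trA_def
    by (subst adjoint_four_block[of _ p p _ k _ k]) (use c in \<open>simp_all add: adjoint_mult[OF assms(2) i(1)] h\<close>)
  have WC: "W * minv C * C = W"
    using assoc_mult_mat[OF assms(2) i(1) Cc] assms i by simp
  have 1: "trA p k W C * four_block_mat Z (0\<^sub>m p k) (0\<^sub>m k p) C = four_block_mat Z W (0\<^sub>m k p) C"
    unfolding trA_def using assms c Cc WC by (subst mult_four_block_mat[of _ p p _ k _ k _ _ p _ k]) (simp_all add: right_mult_zero_mat[OF c(1)] del: assoc_mult_mat)
  have CW: "C * (minv C * mat_adjoint W) = mat_adjoint W"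
    using assoc_mult_mat[OF Cc i(1) c(2)] left_mult_one_mat[OF c(2)] i(2) by simp
  have 2: "W * (minv C * mat_adjoint W) = W * minv C * mat_adjoint W"
    using assoc_mult_mat[OF assms(2) i(1) c(2)] by simp
  show "blkA Z W C = trA p k W C * four_block_mat Z (0\<^sub>m p k) (0\<^sub>m k p) C * mat_adjoint (trA p k W C)"
    unfolding 1 A blkA_def using assms c Cc
    by (subst mult_four_block_mat[of _ p p _ k _ k _ _ p _ k]) (simp_all add: CW 2 del: assoc_mult_mat)
qed

lemma blkB_factor:
  assumes X: "X \<in> posdef d p" and "W \<in> carrier_mat p k" "S \<in> carrier_mat k k"
  shows "blkB X W S = trB p k W X * four_block_mat X (0\<^sub>m p k) (0\<^sub>m k p) S * mat_adjoint (trB p k W X)"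
    and "mat_adjoint (trB p k W X) = four_block_mat (1\<^sub>m p) (minv X * W) (0\<^sub>m k p) (1\<^sub>m k)"
proof -
  note i = minv_posdef_carrier[OF d X] and Xc = posdef_carrier[OF X]
  have h: "mat_adjoint (minv X) = minv X" by (rule hermD(3)[OF minv_herm[OF d X]])
  have c: "minv X * W \<in> carrier_mat p k" "mat_adjoint W \<in> carrier_mat k p" "mat_adjoint W * minv X \<in> carrier_mat k p"
    using assms i by auto
  show A: "mat_adjoint (trB p k W X) = four_block_mat (1\<^sub>m p) (minv X * W) (0\<^sub>m k p) (1\<^sub>m k)"
    unfolding trB_def
    by (subst adjoint_four_block[of _ p p _ k _ k]) (use c in \<open>simp_all add: adjoint_mult[OF c(2) i(1)] h\<close>)
  have WX: "mat_adjoint W * minv X * X = mat_adjoint W"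
    using assoc_mult_mat[OF c(2) i(1) Xc] right_mult_one_mat[OF c(2)] i by simp
  have 1: "trB p k W X * four_block_mat X (0\<^sub>m p k) (0\<^sub>m k p) S = four_block_mat X (0\<^sub>m p k) (mat_adjoint W) S"
    unfolding trB_def using assms c Xc WX by (subst mult_four_block_mat[of _ p p _ k _ k _ _ p _ k]) (simp_all add: right_mult_zero_mat[OF c(3)] del: assoc_mult_mat)
  have XW: "X * (minv X * W) = W"
    using assoc_mult_mat[OF Xc i(1) assms(2)] left_mult_one_mat[OF assms(2)] i(2) by simp
  have 2: "mat_adjoint W * (minv X * W) = mat_adjoint W * minv X * W"
    using assoc_mult_mat[OF c(2) i(1) assms(2)] by simp
  have 3: "mat_adjoint W * minv X * W + S = S + mat_adjoint W * minv X * W"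
    by (rule comm_add_mat[of _ k k]) (use assms c in auto)
  show "blkB X W S = trB p k W X * four_block_mat X (0\<^sub>m p k) (0\<^sub>m k p) S * mat_adjoint (trB p k W X)"
    unfolding 1 A blkB_def using assms c Xc
    by (subst mult_four_block_mat[of _ p p _ k _ k _ _ p _ k]) (simp_all add: XW 2 3 del: assoc_mult_mat)
qed

lemma mats_unipotent:
  assumes "M \<in> mats d p k" "M' \<in> mats d k p"
  shows "four_block_mat (1\<^sub>m p) M M' (1\<^sub>m k) \<in> mats d (p + k) (p + k)"
  using assms by (auto simp: mats_def scalars_iff)

lemma mats_zero: "0\<^sub>m p k \<in> mats d p k"
  by (simp add: mats_def scalars_iff)

lemma diag_herm: "X \<in> herm d p \<Longrightarrow> C \<in> herm d k \<Longrightarrow> four_block_mat X (0\<^sub>m p k) (0\<^sub>m k p) C \<in> herm d (p + k)"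
  using four_block_herm[of X d p "0\<^sub>m p k" k C] mats_zero by simp

text \<open>A congruence by the unipotent \<open>trA\<close> reduces the claim to the block diagonal
  matrix of Z and C. The equivalence says that, once W and C are fixed, the range of Z is the whole
  cone.\<close>

lemma posdef_blkA_iff:
  assumes Z: "Z \<in> herm d p" and W: "W \<in> mats d p k" and C: "C \<in> posdef d k"
  shows "blkA Z W C \<in> posdef d (p + k) \<longleftrightarrow> Z \<in> posdef d p"
proof -
  let ?D = "four_block_mat Z (0\<^sub>m p k) (0\<^sub>m k p) C" and ?T = "trA p k W C"
  have i: "minv C \<in> mats d k k" by (rule hermD(1)[OF minv_herm[OF d C]])
  have c: "Z \<in> carrier_mat p p" "W \<in> carrier_mat p k" "C \<in> carrier_mat k k"
    using Z W C by (auto simp: hermD matsD posdef_carrier)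
  have T: "?T \<in> mats d (p + k) (p + k)"
    unfolding trA_def by (intro mats_unipotent mats_zero mats_mult[OF W i])
  have M: "minv C * mat_adjoint W \<in> mats d k p" by (intro mats_mult[OF i] mats_adjoint W)
  let ?S = "four_block_mat (1\<^sub>m p) (0\<^sub>m p k) (- (minv C * mat_adjoint W)) (1\<^sub>m k)"
  have S: "?S \<in> mats d (p + k) (p + k)" by (intro mats_unipotent mats_zero mats_uminus M)
  have TS: "mat_adjoint ?T * ?S = 1\<^sub>m (p + k)"
    unfolding blkA_factor(2)[OF c(1,2) C] by (rule unipotent_inverse(2)[OF matsD[OF M]])
  have Tc: "?T \<in> carrier_mat (p + k) (p + k)" and Sc: "?S \<in> carrier_mat (p + k) (p + k)" using T S by (auto simp: matsD)
  have ST: "?S * mat_adjoint ?T = 1\<^sub>m (p + k)"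
    using mat_mult_left_right_inverse[OF mat_adjoint_carrier[OF Tc] Sc TS] .
  have "blkA Z W C \<in> posdef d (p + k) \<longleftrightarrow> ?D \<in> posdef d (p + k)"
    unfolding blkA_factor(1)[OF c(1,2) C]
    using posdef_congr[OF _ T Sc ST] posdef_congr_imp[OF diag_herm[OF Z posdef_herm[OF C]] T S TS] by blast
  also have "\<dots> \<longleftrightarrow> Z \<in> posdef d p" using posdef_diag[of Z p k C d] c C by blast
  finally show ?thesis .
qed

lemma posdef_blkB_iff:
  assumes X: "X \<in> posdef d p" and W: "W \<in> mats d p k" and S: "S \<in> herm d k"
  shows "blkB X W S \<in> posdef d (p + k) \<longleftrightarrow> S \<in> posdef d k"
proof -
  let ?D = "four_block_mat X (0\<^sub>m p k) (0\<^sub>m k p) S" and ?T = "trB p k W X"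
  have i: "minv X \<in> mats d p p" by (rule hermD(1)[OF minv_herm[OF d X]])
  have c: "X \<in> carrier_mat p p" "W \<in> carrier_mat p k" "S \<in> carrier_mat k k"
    using X W S by (auto simp: hermD matsD posdef_carrier)
  have T: "?T \<in> mats d (p + k) (p + k)"
    unfolding trB_def by (intro mats_unipotent mats_zero mats_mult[OF mats_adjoint[OF W] i])
  have M: "minv X * W \<in> mats d p k" by (intro mats_mult[OF i] W)
  let ?S = "four_block_mat (1\<^sub>m p) (- (minv X * W)) (0\<^sub>m k p) (1\<^sub>m k)"
  have S': "?S \<in> mats d (p + k) (p + k)" by (intro mats_unipotent mats_zero mats_uminus M)
  have TS: "mat_adjoint ?T * ?S = 1\<^sub>m (p + k)"
    unfolding blkB_factor(2)[OF X c(2,3)] by (rule unipotent_inverse(1)[OF matsD[OF M]])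
  have Tc: "?T \<in> carrier_mat (p + k) (p + k)" and Sc: "?S \<in> carrier_mat (p + k) (p + k)" using T S' by (auto simp: matsD)
  have ST: "?S * mat_adjoint ?T = 1\<^sub>m (p + k)"
    using mat_mult_left_right_inverse[OF mat_adjoint_carrier[OF Tc] Sc TS] .
  have "blkB X W S \<in> posdef d (p + k) \<longleftrightarrow> ?D \<in> posdef d (p + k)"
    unfolding blkB_factor(1)[OF X c(2,3)]
    using posdef_congr[OF _ T Sc ST] posdef_congr_imp[OF diag_herm[OF posdef_herm[OF X] S] T S' TS] by blast
  also have "\<dots> \<longleftrightarrow> S \<in> posdef d k" using posdef_diag[of X p k S d] c X by blast
  finally show ?thesis .
qed

lemma four_block_blkA:
  assumes "X \<in> carrier_mat p p" "W \<in> carrier_mat p k" "C \<in> posdef d k"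
  shows "four_block_mat X W (mat_adjoint W) C = blkA (X - W * minv C * mat_adjoint W) W C"
proof -
  have "W * minv C * mat_adjoint W \<in> carrier_mat p p"
    using assms minv_posdef_carrier[OF d assms(3)] by (auto simp del: assoc_mult_mat)
  then have "X - W * minv C * mat_adjoint W + W * minv C * mat_adjoint W = X"
    using assms(1) by (intro eq_matI) auto
  then show ?thesis by (simp add: blkA_def)
qed

lemma four_block_blkB:
  assumes "X \<in> posdef d p" "W \<in> carrier_mat p k" "C \<in> carrier_mat k k"
  shows "four_block_mat X W (mat_adjoint W) C = blkB X W (C - mat_adjoint W * minv X * W)"
proof -
  have "mat_adjoint W * minv X * W \<in> carrier_mat k k"
    using assms minv_posdef_carrier[OF d assms(1)] by (auto simp del: assoc_mult_mat)
  then have "C - mat_adjoint W * minv X * W + mat_adjoint W * minv X * W = C"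
    using assms(3) by (intro eq_matI) auto
  then show ?thesis by (simp add: blkB_def)
qed

lemma herm_quad: "C \<in> herm d k \<Longrightarrow> W \<in> mats d k p \<Longrightarrow> mat_adjoint W * C * W \<in> herm d p"
  using herm_congr[of C d k "mat_adjoint W" p] by (simp add: mats_adjoint)

lemma posdef_blkA_cases:
  assumes x: "x \<in> posdef d (p + k)"
  obtains Z W C where "Z \<in> posdef d p" "W \<in> mats d p k" "C \<in> posdef d k" "x = blkA Z W C"
proof -
  note h = herm_blocks[OF posdef_herm[OF x]]
  let ?W = "ur p k x" and ?C = "lr p k x"
  let ?Z = "ul p x - ?W * minv ?C * mat_adjoint ?W"
  have C: "?C \<in> posdef d k" using posdef_principal(2)[OF _ h(1,2,3)] x h(4) by simp
  have Z: "?Z \<in> herm d p" by (intro herm_minus h herm_congr[OF minv_herm[OF d C]])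
  have eq: "x = blkA ?Z ?W ?C"
    using h(4) four_block_blkA[of "ul p x" p ?W k ?C] C by simp
  then have "?Z \<in> posdef d p" using x posdef_blkA_iff[OF Z h(2) C] by simp
  then show ?thesis using that h(2) C eq by blast
qed

lemma posdef_blkB_cases:
  assumes x: "x \<in> posdef d (p + k)"
  obtains X W S where "X \<in> posdef d p" "W \<in> mats d p k" "S \<in> posdef d k" "x = blkB X W S"
proof -
  note h = herm_blocks[OF posdef_herm[OF x]]
  let ?W = "ur p k x" and ?X = "ul p x"
  let ?S = "lr p k x - mat_adjoint ?W * minv ?X * ?W"
  have X: "?X \<in> posdef d p" using posdef_principal(1)[OF _ h(1,2,3)] x h(4) by simp
  have S: "?S \<in> herm d k" by (intro herm_minus h herm_quad[OF minv_herm[OF d X]])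
  have eq: "x = blkB ?X ?W ?S"
    using h(4) four_block_blkB[of ?X p ?W k "lr p k x"] X by simp
  then have "?S \<in> posdef d k" using x posdef_blkB_iff[OF X h(2) S] by simp
  then show ?thesis using that h(2) X eq by blast
qed

section \<open>Determinants, pivots and Sylvester's criterion\<close>

lemma det_herm_real: "A \<in> herm d m \<Longrightarrow> complex_of_real (rdet A) = det A"
proof -
  assume A: "A \<in> herm d m"
  have c: "A \<in> carrier_mat m m" by (rule hermD(2)[OF A])
  interpret cnj: comm_ring_hom cnj by standard auto
  have "A = map_mat cnj (transpose_mat A)"
    by (rule eq_matI) (use c in \<open>auto simp: herm_cnj[OF A]\<close>)
  then have "det A = det (map_mat cnj (transpose_mat A))" by simp
  also have "\<dots> = cnj (det A)" using det_transpose[OF c] by simp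
  finally show ?thesis unfolding rdet_def by (simp add: complex_eq_iff)
qed

lemma det_blkA:
  assumes Z: "Z \<in> herm d p" and W: "W \<in> carrier_mat p k" and C: "C \<in> posdef d k"
  shows "det (blkA Z W C) = det Z * det C" "rdet (blkA Z W C) = rdet Z * rdet C"
proof -
  have c: "Z \<in> carrier_mat p p" "C \<in> carrier_mat k k" "minv C \<in> carrier_mat k k"
    using hermD(2)[OF Z] posdef_carrier[OF C] minv_posdef_carrier[OF d C] by auto
  have cc: "W * minv C \<in> carrier_mat p k" "minv C * mat_adjoint W \<in> carrier_mat k p" using c W by auto
  let ?D = "four_block_mat Z (0\<^sub>m p k) (0\<^sub>m k p) C"
  have T: "trA p k W C \<in> carrier_mat (p + k) (p + k)" unfolding trA_def by auto
  have D: "?D \<in> carrier_mat (p + k) (p + k)" using c by auto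
  have "det (trA p k W C) = 1"
    unfolding trA_def using det_four_block_mat_lower_left_zero[OF one_carrier_mat cc(1) refl one_carrier_mat] by simp
  moreover have "det (mat_adjoint (trA p k W C)) = 1"
    unfolding blkA_factor(2)[OF c(1) W C]
    using det_four_block_mat_upper_right_zero[OF one_carrier_mat refl cc(2) one_carrier_mat] by simp
  moreover have "det ?D = det Z * det C"
    using det_four_block_mat_lower_left_zero[OF c(1) zero_carrier_mat refl c(2)] by simp
  ultimately show 1: "det (blkA Z W C) = det Z * det C"
    unfolding blkA_factor(1)[OF c(1) W C] using T D
    by (simp add: det_mult[of _ "p + k"] del: assoc_mult_mat)
  show "rdet (blkA Z W C) = rdet Z * rdet C"
    unfolding rdet_def 1 using det_herm_real[OF Z] det_herm_real[OF posdef_herm[OF C]]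
    by (metis Re_complex_of_real of_real_mult rdet_def)
qed

lemma det_blkB:
  assumes X: "X \<in> posdef d p" and W: "W \<in> carrier_mat p k" and S: "S \<in> herm d k"
  shows "det (blkB X W S) = det X * det S" "rdet (blkB X W S) = rdet X * rdet S"
proof -
  have c: "X \<in> carrier_mat p p" "S \<in> carrier_mat k k" "minv X \<in> carrier_mat p p"
    using hermD(2)[OF S] posdef_carrier[OF X] minv_posdef_carrier[OF d X] by auto
  have cc: "mat_adjoint W * minv X \<in> carrier_mat k p" "minv X * W \<in> carrier_mat p k" using c W by auto
  let ?D = "four_block_mat X (0\<^sub>m p k) (0\<^sub>m k p) S"
  have T: "trB p k W X \<in> carrier_mat (p + k) (p + k)" unfolding trB_def by auto
  have D: "?D \<in> carrier_mat (p + k) (p + k)" using c by auto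
  have "det (trB p k W X) = 1"
    unfolding trB_def using det_four_block_mat_upper_right_zero[OF one_carrier_mat refl cc(1) one_carrier_mat] by simp
  moreover have "det (mat_adjoint (trB p k W X)) = 1"
    unfolding blkB_factor(2)[OF X W c(2)]
    using det_four_block_mat_lower_left_zero[OF one_carrier_mat cc(2) refl one_carrier_mat] by simp
  moreover have "det ?D = det X * det S"
    using det_four_block_mat_lower_left_zero[OF c(1) zero_carrier_mat refl c(2)] by simp
  ultimately show 1: "det (blkB X W S) = det X * det S"
    unfolding blkB_factor(1)[OF X W c(2)] using T D
    by (simp add: det_mult[of _ "p + k"] del: assoc_mult_mat)
  show "rdet (blkB X W S) = rdet X * rdet S"
    unfolding rdet_def 1 using det_herm_real[OF S] det_herm_real[OF posdef_herm[OF X]]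
    by (metis Re_complex_of_real of_real_mult rdet_def)
qed

lemma qf_mat1: "u \<in> carrier_mat 1 1 \<Longrightarrow> qf (mat1 c) u = c * (cmod (u $$ (0, 0)))\<^sup>2"
  by (subst qf_sum[of _ 1]) (simp_all add: mat1_def cmod_power2, simp add: power2_eq_square algebra_simps One_nat_def)

lemma mat1_posdef_iff: "mat1 c \<in> posdef d 1 \<longleftrightarrow> 0 < c"
proof
  assume "mat1 c \<in> posdef d 1"
  moreover have "1\<^sub>m 1 \<in> mats d 1 1" "1\<^sub>m 1 \<noteq> (0\<^sub>m 1 1 :: complex mat)"
    using herm_one[of 1 d] by (auto simp: hermD dest!: arg_cong[of _ _ "\<lambda>M. M $$ (0, 0)"])
  ultimately have "0 < qf (mat1 c) (1\<^sub>m 1)" unfolding posdef_iff_qf by blast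
  then show "0 < c" by (simp add: qf_mat1)
next
  assume "0 < c"
  have "0 < qf (mat1 c) u" if u: "u \<in> mats d 1 1" "u \<noteq> 0\<^sub>m 1 1" for u
  proof -
    have "u $$ (0, 0) \<noteq> 0"
    proof
      assume "u $$ (0, 0) = 0"
      then have "u = 0\<^sub>m 1 1" using matsD[OF u(1)] by (intro eq_matI) auto
      then show False using u by simp
    qed
    then show ?thesis using \<open>0 < c\<close> matsD[OF u(1)] by (simp add: qf_mat1)
  qed
  then show "mat1 c \<in> posdef d 1" unfolding posdef_iff_qf using mat1_herm by blast
qed

lemma posdef_1_cases:
  assumes "C \<in> posdef d 1"
  obtains c where "0 < c" "C = mat1 c"
  using herm_1[OF posdef_herm[OF assms]] mat1_posdef_iff assms by metis

lemma rdet_mat1 [simp]: "rdet (mat1 c) = c"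
  by (simp add: rdet_def mat1_def det_single)

lemma rdet_pos: "A \<in> posdef d m \<Longrightarrow> 0 < rdet A"
proof (induction m arbitrary: A)
  case 0
  then show ?case using posdef_carrier[OF 0] by (simp add: rdet_def)
next
  case (Suc m)
  then have "A \<in> posdef d (m + 1)" by (simp only: Suc_eq_plus1)
  then obtain Z W C where *: "Z \<in> posdef d m" "W \<in> mats d m 1" "C \<in> posdef d 1" "A = blkA Z W C"
    by (rule posdef_blkA_cases)
  obtain c where "0 < c" "C = mat1 c" using posdef_1_cases[OF *(3)] .
  then show ?case using Suc.IH[OF *(1)] det_blkA(2)[OF posdef_herm[OF *(1)] matsD[OF *(2)] *(3)] *(4) by simp
qed

text \<open>The matrix is \<open>blkB\<close> of its leading block with a 1 x 1 Schur complement s,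
  and \<open>rdet x\<close> is the leading determinant times s. This describes the cone by
  measurable inequalities, which is its purpose in \<open>posdef_sets\<close>.\<close>

lemma posdef_sylvester:
  "x \<in> posdef d (Suc m) \<longleftrightarrow> x \<in> herm d (Suc m) \<and> ul m x \<in> posdef d m \<and> 0 < rdet x"
proof
  assume x: "x \<in> posdef d (Suc m)"
  then have x1: "x \<in> posdef d (m + 1)" by (simp only: Suc_eq_plus1)
  note h = herm_blocks[OF posdef_herm[OF x1]]
  have "ul m x \<in> posdef d m" using posdef_principal(1)[OF _ h(1,2,3)] x1 h(4) by simp
  then show "x \<in> herm d (Suc m) \<and> ul m x \<in> posdef d m \<and> 0 < rdet x" using x rdet_pos posdef_herm by blast
next
  assume *: "x \<in> herm d (Suc m) \<and> ul m x \<in> posdef d m \<and> 0 < rdet x"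
  then have x: "x \<in> herm d (m + 1)" and X: "ul m x \<in> posdef d m" by (simp_all only: Suc_eq_plus1)
  note h = herm_blocks[OF x]
  let ?W = "ur m 1 x" and ?X = "ul m x"
  let ?S = "lr m 1 x - mat_adjoint ?W * minv ?X * ?W"
  have S: "?S \<in> herm d 1" by (intro herm_minus h herm_quad[OF minv_herm[OF d X]])
  have eq: "x = blkB ?X ?W ?S"
    using h(4) four_block_blkB[of ?X m ?W 1 "lr m 1 x"] X by simp
  obtain s where s: "?S = mat1 s" using herm_1[OF S] by blast
  have "rdet x = rdet ?X * s" using det_blkB(2)[OF X matsD[OF h(2)] S] eq s by simp
  then have "0 < s" using * rdet_pos[OF X] by (simp add: zero_less_mult_iff)
  then have "?S \<in> posdef d 1" using s mat1_posdef_iff by simp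
  then have "blkB ?X ?W ?S \<in> posdef d (m + 1)" using posdef_blkB_iff[OF X h(2) S] by simp
  then show "x \<in> posdef d (Suc m)" using eq by (simp only: Suc_eq_plus1)
qed

end

section \<open>Measurability and changes of variables\<close>

text \<open>Working on the cone as a measure space of its own makes inverses and pivots total
  measurable maps, with no case distinction for singular matrices.\<close>

definition PD :: "nat \<Rightarrow> nat \<Rightarrow> complex mat measure" where
  "PD d m = restrict_space (herm_lebesgue d m) (posdef d m)"

context field_dim
begin

section \<open>Measurability of the matrix operations\<close>

lemma space_PD [simp]: "space (PD d m) = posdef d m"
  by (auto simp: PD_def space_restrict_space posdef_herm)

lemma meas_mats_entry:
  "f \<in> N \<rightarrow>\<^sub>M mats_lebesgue d p q \<Longrightarrow> a < p \<Longrightarrow> b < q \<Longrightarrow> (\<lambda>x. f x $$ (a, b)) \<in> borel_measurable N"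
  using measurable_compose[OF _ measurable_mats_entry[OF d]] by blast

lemma meas_herm_entry:
  "f \<in> N \<rightarrow>\<^sub>M herm_lebesgue d m \<Longrightarrow> a < m \<Longrightarrow> b < m \<Longrightarrow> (\<lambda>x. f x $$ (a, b)) \<in> borel_measurable N"
  using measurable_compose[OF _ measurable_herm_entry[OF d]] by blast

lemma meas_mats_space: "f \<in> N \<rightarrow>\<^sub>M mats_lebesgue d p q \<Longrightarrow> x \<in> space N \<Longrightarrow> f x \<in> mats d p q"
  using measurable_space[of f N "mats_lebesgue d p q" x] by simp

lemma meas_herm_space: "f \<in> N \<rightarrow>\<^sub>M herm_lebesgue d m \<Longrightarrow> x \<in> space N \<Longrightarrow> f x \<in> herm d m"
  using measurable_space[of f N "herm_lebesgue d m" x] by simp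

lemma borel_cong:
  fixes f g :: "'a \<Rightarrow> 'b::topological_space"
  assumes "\<And>x. x \<in> space N \<Longrightarrow> f x = g x" "g \<in> borel_measurable N"
  shows "f \<in> borel_measurable N"
  using measurable_cong[of N f g borel] assms by blast

lemma meas_mult:
  assumes A: "A \<in> N \<rightarrow>\<^sub>M mats_lebesgue d p q" and B: "B \<in> N \<rightarrow>\<^sub>M mats_lebesgue d q r"
  shows "(\<lambda>x. A x * B x) \<in> N \<rightarrow>\<^sub>M mats_lebesgue d p r"
proof (rule measurable_matsI[OF d])
  fix x assume "x \<in> space N"
  then show "A x * B x \<in> mats d p r" by (intro mats_mult[where q=q] meas_mats_space[OF A] meas_mats_space[OF B])
next
  fix a b assume ab: "a < p" "b < r"
  have eq: "(A x * B x) $$ (a, b) = (\<Sum>c<q. A x $$ (a, c) * B x $$ (c, b))" if "x \<in> space N" for x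
    using ab meas_mats_space[OF A that, THEN matsD] meas_mats_space[OF B that, THEN matsD]
    by (auto simp: scalar_prod_def lessThan_atLeast0 intro!: sum.cong)
  show "(\<lambda>x. (A x * B x) $$ (a, b)) \<in> borel_measurable N"
    by (rule borel_cong, erule eq, intro borel_measurable_sum borel_measurable_times meas_mats_entry[OF A] meas_mats_entry[OF B] ab) auto
qed

lemma meas_cnj: "f \<in> borel_measurable N \<Longrightarrow> (\<lambda>x. cnj (f x)) \<in> borel_measurable N"
  by (simp add: borel_measurable_complex_iff)

lemma meas_adjoint:
  assumes A: "A \<in> N \<rightarrow>\<^sub>M mats_lebesgue d p q"
  shows "(\<lambda>x. mat_adjoint (A x)) \<in> N \<rightarrow>\<^sub>M mats_lebesgue d q p"
proof (rule measurable_matsI[OF d])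
  fix x assume "x \<in> space N"
  then show "mat_adjoint (A x) \<in> mats d q p" by (intro mats_adjoint meas_mats_space[OF A])
next
  fix a b assume ab: "a < q" "b < p"
  have eq: "mat_adjoint (A x) $$ (a, b) = cnj (A x $$ (b, a))" if "x \<in> space N" for x
    using ab meas_mats_space[OF A that, THEN matsD] by simp
  show "(\<lambda>x. mat_adjoint (A x) $$ (a, b)) \<in> borel_measurable N"
    by (rule borel_cong, erule eq, intro meas_cnj meas_mats_entry[OF A] ab)
qed

lemma meas_add:
  assumes A: "A \<in> N \<rightarrow>\<^sub>M mats_lebesgue d p q" and B: "B \<in> N \<rightarrow>\<^sub>M mats_lebesgue d p q"
  shows "(\<lambda>x. A x + B x) \<in> N \<rightarrow>\<^sub>M mats_lebesgue d p q"
proof (rule measurable_matsI[OF d])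
  fix x assume "x \<in> space N"
  then show "A x + B x \<in> mats d p q" by (intro mats_add meas_mats_space[OF A] meas_mats_space[OF B])
next
  fix a b assume ab: "a < p" "b < q"
  have eq: "(A x + B x) $$ (a, b) = A x $$ (a, b) + B x $$ (a, b)" if "x \<in> space N" for x
    using ab meas_mats_space[OF A that, THEN matsD] meas_mats_space[OF B that, THEN matsD] by simp
  show "(\<lambda>x. (A x + B x) $$ (a, b)) \<in> borel_measurable N"
    by (rule borel_cong, erule eq, intro borel_measurable_add meas_mats_entry[OF A] meas_mats_entry[OF B] ab)
qed

lemma meas_mats_of_herm:
  assumes A: "A \<in> N \<rightarrow>\<^sub>M herm_lebesgue d m"
  shows "A \<in> N \<rightarrow>\<^sub>M mats_lebesgue d m m"
  by (rule measurable_matsI[OF d]) (auto intro: meas_herm_entry[OF A] hermD meas_herm_space[OF A])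

lemma meas_herm_of_mats:
  assumes A: "A \<in> N \<rightarrow>\<^sub>M mats_lebesgue d m m" and "\<And>x. x \<in> space N \<Longrightarrow> A x \<in> herm d m"
  shows "A \<in> N \<rightarrow>\<^sub>M herm_lebesgue d m"
  by (rule measurable_hermI[OF d]) (auto intro: meas_mats_entry[OF A] assms(2))

lemma meas_four_block:
  assumes X: "X \<in> N \<rightarrow>\<^sub>M herm_lebesgue d p" and W: "W \<in> N \<rightarrow>\<^sub>M mats_lebesgue d p k"
    and C: "C \<in> N \<rightarrow>\<^sub>M herm_lebesgue d k"
  shows "(\<lambda>x. four_block_mat (X x) (W x) (mat_adjoint (W x)) (C x)) \<in> N \<rightarrow>\<^sub>M herm_lebesgue d (p + k)"
  using measurable_compose[OF measurable_Pair[OF X measurable_Pair[OF W C]] nn_integral_herm_blocks(1)[OF d]]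
  by simp

lemma meas_det:
  assumes A: "A \<in> N \<rightarrow>\<^sub>M mats_lebesgue d m m"
  shows "(\<lambda>x. det (A x)) \<in> borel_measurable N"
proof -
  have eq: "det (A x) = (\<Sum>\<pi>\<in>{\<pi>. \<pi> permutes {0..<m}}. signof \<pi> * (\<Prod>i = 0..<m. A x $$ (i, \<pi> i)))"
    if "x \<in> space N" for x
    by (rule det_def'[OF matsD[OF meas_mats_space[OF A that]]])
  have "(\<lambda>x. A x $$ (i, \<pi> i)) \<in> borel_measurable N" if "\<pi> permutes {0..<m}" "i < m" for i \<pi>
    using permutes_in_image[OF that(1), of i] that(2) by (intro meas_mats_entry[OF A]) auto
  then have "(\<lambda>x. \<Sum>\<pi>\<in>{\<pi>. \<pi> permutes {0..<m}}. signof \<pi> * (\<Prod>i = 0..<m. A x $$ (i, \<pi> i))) \<in> borel_measurable N"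
    by (intro borel_measurable_sum borel_measurable_times borel_measurable_prod) auto
  then show ?thesis by (rule borel_cong[rotated]) (erule eq)
qed

lemma meas_Re: "f \<in> borel_measurable N \<Longrightarrow> (\<lambda>x. Re (f x)) \<in> borel_measurable N"
  by (simp add: borel_measurable_complex_iff)

lemma meas_rdet: "A \<in> N \<rightarrow>\<^sub>M mats_lebesgue d m m \<Longrightarrow> (\<lambda>x. rdet (A x)) \<in> borel_measurable N"
  unfolding rdet_def by (intro meas_Re meas_det)

lemma meas_rtrace:
  assumes A: "A \<in> N \<rightarrow>\<^sub>M mats_lebesgue d m m"
  shows "(\<lambda>x. rtrace (A x)) \<in> borel_measurable N"
proof -
  have eq: "rtrace (A x) = Re (\<Sum>a<m. A x $$ (a, a))" if "x \<in> space N" for x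
    using matsD[OF meas_mats_space[OF A that]] by (simp add: rtrace_def)
  show ?thesis
    by (rule borel_cong, erule eq, intro meas_Re borel_measurable_sum meas_mats_entry[OF A]) auto
qed

lemma meas_qf:
  assumes "A \<in> N \<rightarrow>\<^sub>M mats_lebesgue d m m" "u \<in> N \<rightarrow>\<^sub>M mats_lebesgue d m 1"
  shows "(\<lambda>x. qf (A x) (u x)) \<in> borel_measurable N"
proof -
  have "(\<lambda>x. mat_adjoint (u x) * A x * u x) \<in> N \<rightarrow>\<^sub>M mats_lebesgue d 1 1"
    by (intro meas_mult[where q=m] meas_adjoint assms)
  then show ?thesis unfolding qf_def by (intro meas_Re meas_mats_entry) auto
qed

lemma meas_ul:
  assumes A: "A \<in> N \<rightarrow>\<^sub>M herm_lebesgue d (p + k)"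
  shows "(\<lambda>x. ul p (A x)) \<in> N \<rightarrow>\<^sub>M herm_lebesgue d p"
proof (rule measurable_hermI[OF d])
  show "ul p (A x) \<in> herm d p" if "x \<in> space N" for x
    using herm_blocks(1) meas_herm_space[OF A that] by blast
  show "(\<lambda>x. ul p (A x) $$ (a, b)) \<in> borel_measurable N" if "a < p" "b < p" for a b
    using that meas_herm_entry[OF A, of a b] by (simp add: ul_def)
qed

lemma meas_lr:
  assumes A: "A \<in> N \<rightarrow>\<^sub>M herm_lebesgue d (p + k)"
  shows "(\<lambda>x. lr p k (A x)) \<in> N \<rightarrow>\<^sub>M herm_lebesgue d k"
proof (rule measurable_hermI[OF d])
  show "lr p k (A x) \<in> herm d k" if "x \<in> space N" for x
    using herm_blocks(3) meas_herm_space[OF A that] by blast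
  show "(\<lambda>x. lr p k (A x) $$ (a, b)) \<in> borel_measurable N" if "a < k" "b < k" for a b
    using that meas_herm_entry[OF A, of "p + a" "p + b"] by (simp add: lr_def)
qed

lemma posdef_0: "posdef d 0 = herm d 0"
proof -
  have "u = 0\<^sub>m 0 1" if "u \<in> mats d 0 1" for u using matsD[OF that] by (intro eq_matI) auto
  then show ?thesis unfolding Set.set_eq_iff posdef_iff_qf by blast
qed

lemma posdef_sets: "posdef d m \<in> sets (herm_lebesgue d m)"
proof (induction m)
  case 0
  then show ?case using sets.top[of "herm_lebesgue d 0"] by (simp add: posdef_0)
next
  case (Suc m)
  let ?H = "herm_lebesgue d (Suc m)"
  have id: "(\<lambda>x. x) \<in> ?H \<rightarrow>\<^sub>M herm_lebesgue d (m + 1)" unfolding Suc_eq_plus1 by simp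
  have 1: "(\<lambda>x. ul m x) -` posdef d m \<inter> space ?H \<in> sets ?H"
    by (rule measurable_sets[OF meas_ul[OF id] Suc.IH])
  have "(\<lambda>x. rdet x) \<in> borel_measurable ?H"
    using meas_rdet[OF meas_mats_of_herm[OF id]] by simp
  then have 2: "{x \<in> space ?H. 0 < rdet x} \<in> sets ?H" by measurable
  have "posdef d (Suc m) = ((\<lambda>x. ul m x) -` posdef d m \<inter> space ?H) \<inter> {x \<in> space ?H. 0 < rdet x}"
    by (auto simp: posdef_sylvester)
  then show ?case using 1 2 by (simp only: sets.Int)
qed

lemma posdef_Int_sets [simp]: "posdef d m \<inter> herm d m \<in> sets (herm_lebesgue d m)"
proof -
  have "posdef d m \<inter> herm d m = posdef d m" by (auto simp: posdef_herm)
  then show ?thesis using posdef_sets by simp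
qed

lemma meas_herm_of_PD: "A \<in> N \<rightarrow>\<^sub>M PD d m \<Longrightarrow> A \<in> N \<rightarrow>\<^sub>M herm_lebesgue d m"
  unfolding PD_def by (simp add: measurable_restrict_space2_iff)

lemma meas_PD_of_herm:
  "A \<in> N \<rightarrow>\<^sub>M herm_lebesgue d m \<Longrightarrow> (\<And>x. x \<in> space N \<Longrightarrow> A x \<in> posdef d m) \<Longrightarrow> A \<in> N \<rightarrow>\<^sub>M PD d m"
  unfolding PD_def by (simp add: measurable_restrict_space2_iff)

lemma meas_PD_space: "f \<in> N \<rightarrow>\<^sub>M PD d m \<Longrightarrow> x \<in> space N \<Longrightarrow> f x \<in> posdef d m"
  using measurable_space[of f N "PD d m" x] by simp

lemmas meas_mats_of_PD = meas_mats_of_herm[OF meas_herm_of_PD]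

lemma sigma_finite_PD: "sigma_finite_measure (PD d m)"
  unfolding PD_def by (rule sigma_finite_measure_restrict_space[OF sigma_finite_herm[OF d] posdef_sets])

text \<open>The entries of the inverse are quotients of minors by the determinant, hence quotients
  of polynomials in the entries.\<close>

lemma meas_minv:
  assumes A: "A \<in> N \<rightarrow>\<^sub>M PD d m"
  shows "(\<lambda>x. minv (A x)) \<in> N \<rightarrow>\<^sub>M PD d m"
proof (rule meas_PD_of_herm)
  note A' = meas_mats_of_PD[OF A]
  show "minv (A x) \<in> posdef d m" if "x \<in> space N" for x
    by (rule minv_posdef[OF d meas_PD_space[OF A that]])
  show "(\<lambda>x. minv (A x)) \<in> N \<rightarrow>\<^sub>M herm_lebesgue d m"
  proof (rule measurable_hermI[OF d])
    show "minv (A x) \<in> herm d m" if "x \<in> space N" for x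
      by (rule minv_herm[OF d meas_PD_space[OF A that]])
    fix a b assume ab: "a < m" "b < m"
    have eq: "minv (A x) $$ (a, b) = 1 / det (A x) * ((-1) ^ (b + a) * det (mat_delete (A x) b a))" if "x \<in> space N" for x
    proof -
      have c: "A x \<in> carrier_mat m m" and nz: "det (A x) \<noteq> 0"
        using meas_PD_space[OF A that] posdef_carrier posdef_det_nz[OF d] by blast+
      show ?thesis using minv_det(4)[OF c nz] ab c adj_mat(1)[OF c] by (simp add: adj_mat_def cofactor_def)
    qed
    have "(\<lambda>x. mat_delete (A x) b a) \<in> N \<rightarrow>\<^sub>M mats_lebesgue d (m - 1) (m - 1)"
    proof (rule measurable_matsI[OF d])
      fix x assume x: "x \<in> space N"
      have c: "A x \<in> mats d m m" by (rule meas_mats_space[OF A' x])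
      show "mat_delete (A x) b a \<in> mats d (m - 1) (m - 1)"
        using c by (auto simp: mats_def mat_delete_def)
    next
      fix i j assume ij: "i < m - 1" "j < m - 1"
      have eq: "mat_delete (A x) b a $$ (i, j) = A x $$ (if i < b then i else Suc i, if j < a then j else Suc j)"
        if "x \<in> space N" for x
        using ij matsD[OF meas_mats_space[OF A' that]] by (simp add: mat_delete_def)
      have "(\<lambda>x. A x $$ (if i < b then i else Suc i, if j < a then j else Suc j)) \<in> borel_measurable N"
        using ij by (intro meas_mats_entry[OF A']) auto
      then show "(\<lambda>x. mat_delete (A x) b a $$ (i, j)) \<in> borel_measurable N"
        by (rule borel_cong[rotated]) (erule eq)
    qed
    then have "(\<lambda>x. 1 / det (A x) * ((-1) ^ (b + a) * det (mat_delete (A x) b a))) \<in> borel_measurable N"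
      by (intro borel_measurable_times borel_measurable_divide borel_measurable_const meas_det[OF A']) (rule meas_det)
    then show "(\<lambda>x. minv (A x) $$ (a, b)) \<in> borel_measurable N"
      by (rule borel_cong[rotated]) (erule eq)
  qed
qed

lemma meas_blkA:
  assumes Z: "Z \<in> N \<rightarrow>\<^sub>M herm_lebesgue d p" and W: "W \<in> N \<rightarrow>\<^sub>M mats_lebesgue d p k" and C: "C \<in> N \<rightarrow>\<^sub>M PD d k"
  shows "(\<lambda>x. blkA (Z x) (W x) (C x)) \<in> N \<rightarrow>\<^sub>M herm_lebesgue d (p + k)"
  unfolding blkA_def
proof (intro meas_four_block meas_herm_of_PD[OF C] W)
  show "(\<lambda>x. Z x + W x * minv (C x) * mat_adjoint (W x)) \<in> N \<rightarrow>\<^sub>M herm_lebesgue d p"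
  proof (rule meas_herm_of_mats)
    show "(\<lambda>x. Z x + W x * minv (C x) * mat_adjoint (W x)) \<in> N \<rightarrow>\<^sub>M mats_lebesgue d p p"
      by (intro meas_add meas_mult[where q=k] meas_adjoint W meas_mats_of_PD[OF meas_minv[OF C]] meas_mats_of_herm Z)
    show "Z x + W x * minv (C x) * mat_adjoint (W x) \<in> herm d p" if "x \<in> space N" for x
      by (intro herm_add herm_congr[where k=k] meas_herm_space[OF Z that] meas_mats_space[OF W that] minv_herm[OF d]
          meas_PD_space[OF C that])
  qed
qed

lemma meas_blkB:
  assumes X: "X \<in> N \<rightarrow>\<^sub>M PD d p" and W: "W \<in> N \<rightarrow>\<^sub>M mats_lebesgue d p k" and S: "S \<in> N \<rightarrow>\<^sub>M herm_lebesgue d k"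
  shows "(\<lambda>x. blkB (X x) (W x) (S x)) \<in> N \<rightarrow>\<^sub>M herm_lebesgue d (p + k)"
  unfolding blkB_def
proof (intro meas_four_block meas_herm_of_PD[OF X] W)
  show "(\<lambda>x. S x + mat_adjoint (W x) * minv (X x) * W x) \<in> N \<rightarrow>\<^sub>M herm_lebesgue d k"
  proof (rule meas_herm_of_mats)
    show "(\<lambda>x. S x + mat_adjoint (W x) * minv (X x) * W x) \<in> N \<rightarrow>\<^sub>M mats_lebesgue d k k"
      by (intro meas_add meas_mult[where q=p] meas_adjoint W meas_mats_of_PD[OF meas_minv[OF X]] meas_mats_of_herm S)
    show "S x + mat_adjoint (W x) * minv (X x) * W x \<in> herm d k" if "x \<in> space N" for x
      by (intro herm_add herm_quad[where k=p] meas_herm_space[OF S that] meas_mats_space[OF W that] minv_herm[OF d]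
          meas_PD_space[OF X that])
  qed
qed

lemma meas_blkA_PD:
  assumes Z: "Z \<in> N \<rightarrow>\<^sub>M PD d p" and W: "W \<in> N \<rightarrow>\<^sub>M mats_lebesgue d p k" and C: "C \<in> N \<rightarrow>\<^sub>M PD d k"
  shows "(\<lambda>x. blkA (Z x) (W x) (C x)) \<in> N \<rightarrow>\<^sub>M PD d (p + k)"
  by (rule meas_PD_of_herm[OF meas_blkA[OF meas_herm_of_PD[OF Z] W C]])
     (use posdef_blkA_iff posdef_herm meas_PD_space[OF Z] meas_mats_space[OF W] meas_PD_space[OF C] in blast)

lemma meas_blkB_PD:
  assumes X: "X \<in> N \<rightarrow>\<^sub>M PD d p" and W: "W \<in> N \<rightarrow>\<^sub>M mats_lebesgue d p k" and S: "S \<in> N \<rightarrow>\<^sub>M PD d k"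
  shows "(\<lambda>x. blkB (X x) (W x) (S x)) \<in> N \<rightarrow>\<^sub>M PD d (p + k)"
  by (rule meas_PD_of_herm[OF meas_blkB[OF X W meas_herm_of_PD[OF S]]])
     (use posdef_blkB_iff posdef_herm meas_PD_space[OF X] meas_mats_space[OF W] meas_PD_space[OF S] in blast)

lemma meas_mat1: "f \<in> borel_measurable N \<Longrightarrow> (\<lambda>x. mat1 (f x)) \<in> N \<rightarrow>\<^sub>M herm_lebesgue d 1"
  by (rule measurable_compose[OF _ measurable_mat1[OF d]])

section \<open>Integration over the cone in Schur complement coordinates\<close>

lemma nn_integral_PD: "(\<integral>\<^sup>+x. f x \<partial>PD d m) = (\<integral>\<^sup>+x. f x * indicator (posdef d m) x \<partial>herm_lebesgue d m)"
  unfolding PD_def by (rule nn_integral_restrict_space) simp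

lemma borel_PD:
  fixes f :: "complex mat \<Rightarrow> ennreal"
  shows "f \<in> borel_measurable (PD d m) \<longleftrightarrow> (\<lambda>x. f x * indicator (posdef d m) x) \<in> borel_measurable (herm_lebesgue d m)"
  unfolding PD_def by (rule borel_measurable_restrict_space_iff_ennreal) simp

lemma nn_integral_PD_1:
  assumes f: "f \<in> borel_measurable (PD d 1)"
  shows "(\<integral>\<^sup>+x. f x \<partial>PD d 1) = (\<integral>\<^sup>+t. f (mat1 t) * indicator {0<..} t \<partial>lborel)"
  unfolding nn_integral_PD nn_integral_herm_1[OF d iffD1[OF borel_PD f]]
  by (intro nn_integral_cong) (auto simp: indicator_def mat1_posdef_iff)

text \<open>For fixed W and C the passage from the upper left block X to Z is a translation, hence
  of Jacobian 1; this is why Z is innermost. If C is not positive definite then neither is the whole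
  matrix, and the integrand vanishes.\<close>

lemma nn_integral_PD_blkA:
  assumes f: "f \<in> borel_measurable (PD d (p + k))"
  shows "(\<integral>\<^sup>+x. f x \<partial>PD d (p + k)) =
    (\<integral>\<^sup>+W. (\<integral>\<^sup>+C. (\<integral>\<^sup>+Z. f (blkA Z W C) \<partial>PD d p) \<partial>PD d k) \<partial>mats_lebesgue d p k)"
proof -
  let ?H = "herm_lebesgue d p" and ?M = "mats_lebesgue d p k" and ?K = "herm_lebesgue d k"
  let ?g = "\<lambda>x. f x * indicator (posdef d (p + k)) x"
  let ?b = "\<lambda>X W C. four_block_mat X W (mat_adjoint W) C"
  interpret H: sigma_finite_measure ?H by (rule sigma_finite_herm[OF d])
  interpret M: sigma_finite_measure ?M by (rule sigma_finite_mats[OF d])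
  interpret K: sigma_finite_measure ?K by (rule sigma_finite_herm[OF d])
  interpret MK: pair_sigma_finite ?M ?K ..
  interpret HMK: pair_sigma_finite ?H "?M \<Otimes>\<^sub>M ?K" ..
  have g: "?g \<in> borel_measurable (herm_lebesgue d (p + k))" using f by (simp only: borel_PD)
  have gb: "(\<lambda>(X, W, C). ?g (?b X W C)) \<in> borel_measurable (?H \<Otimes>\<^sub>M (?M \<Otimes>\<^sub>M ?K))"
    using measurable_compose[OF nn_integral_herm_blocks(1)[OF d] g] by (simp add: split_beta')
  have "(\<integral>\<^sup>+x. f x \<partial>PD d (p + k)) = (\<integral>\<^sup>+(X, W, C). ?g (?b X W C) \<partial>(?H \<Otimes>\<^sub>M (?M \<Otimes>\<^sub>M ?K)))"
    unfolding nn_integral_PD by (rule nn_integral_herm_blocks(2)[OF d g])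
  also have "\<dots> = (\<integral>\<^sup>+y. (\<integral>\<^sup>+X. (\<lambda>(X, W, C). ?g (?b X W C)) (X, y) \<partial>?H) \<partial>(?M \<Otimes>\<^sub>M ?K))"
    by (rule HMK.nn_integral_snd[symmetric, OF gb])
  also have "\<dots> = (\<integral>\<^sup>+W. (\<integral>\<^sup>+C. (\<integral>\<^sup>+X. (\<lambda>(X, W, C). ?g (?b X W C)) (X, (W, C)) \<partial>?H) \<partial>?K) \<partial>?M)"
  proof (rule K.nn_integral_fst[symmetric])
    have "(\<lambda>(y, X). (\<lambda>(X, W, C). ?g (?b X W C)) (X, y)) \<in> borel_measurable ((?M \<Otimes>\<^sub>M ?K) \<Otimes>\<^sub>M ?H)"
      using measurable_pair_swap[OF gb] by simp
    then show "(\<lambda>y. \<integral>\<^sup>+X. (\<lambda>(X, W, C). ?g (?b X W C)) (X, y) \<partial>?H) \<in> borel_measurable (?M \<Otimes>\<^sub>M ?K)"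
      by (rule H.borel_measurable_nn_integral)
  qed
  also have "\<dots> = (\<integral>\<^sup>+W. (\<integral>\<^sup>+C. (\<integral>\<^sup>+Z. f (blkA Z W C) \<partial>PD d p) * indicator (posdef d k) C \<partial>?K) \<partial>?M)"
  proof (intro nn_integral_cong)
    fix W C assume "W \<in> space ?M" "C \<in> space ?K"
    then have W: "W \<in> mats d p k" and C: "C \<in> herm d k" by auto
    show "(\<integral>\<^sup>+X. (\<lambda>(X, W, C). ?g (?b X W C)) (X, (W, C)) \<partial>?H) =
        (\<integral>\<^sup>+Z. f (blkA Z W C) \<partial>PD d p) * indicator (posdef d k) C"
    proof (cases "C \<in> posdef d k")
      case False
      have "?g (?b X W C) = 0" if "X \<in> herm d p" for X
        using posdef_principal(2)[OF _ that W C] False by (auto simp: indicator_def)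
      then have "(\<integral>\<^sup>+X. ?g (?b X W C) \<partial>?H) = (\<integral>\<^sup>+X. 0 \<partial>?H)" by (intro nn_integral_cong) simp
      then show ?thesis using False by simp
    next
      case True
      let ?N = "W * minv C * mat_adjoint W"
      have N: "?N \<in> herm d p" by (rule herm_congr[OF minv_herm[OF d True] W])
      have "(\<lambda>X. ?g (?b X W C)) \<in> borel_measurable ?H"
        by (rule measurable_compose[OF meas_four_block g]) (use W C in auto)
      from nn_integral_herm_translate[OF d N this]
      have "(\<integral>\<^sup>+X. ?g (?b X W C) \<partial>?H) = (\<integral>\<^sup>+Z. ?g (blkA Z W C) \<partial>?H)" unfolding blkA_def by simp
      also have "\<dots> = (\<integral>\<^sup>+Z. f (blkA Z W C) \<partial>PD d p)"
        unfolding nn_integral_PD using W True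
        by (intro nn_integral_cong) (simp add: indicator_def posdef_blkA_iff)
      finally show ?thesis using True by simp
    qed
  qed
  also have "\<dots> = (\<integral>\<^sup>+W. (\<integral>\<^sup>+C. (\<integral>\<^sup>+Z. f (blkA Z W C) \<partial>PD d p) \<partial>PD d k) \<partial>?M)"
    by (simp only: nn_integral_PD[where m=k])
  finally show ?thesis .
qed

text \<open>As for \<open>blkA\<close>, but the translation acts on the lower right block.
  Afterwards W is moved to the innermost place, since a Gaussian integral over W is to be carried
  out first.\<close>

lemma nn_integral_PD_blkB:
  assumes f: "f \<in> borel_measurable (PD d (p + k))"
  shows "(\<integral>\<^sup>+x. f x \<partial>PD d (p + k)) =
    (\<integral>\<^sup>+X. (\<integral>\<^sup>+S. (\<integral>\<^sup>+W. f (blkB X W S) \<partial>mats_lebesgue d p k) \<partial>PD d k) \<partial>PD d p)"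
proof -
  let ?H = "herm_lebesgue d p" and ?M = "mats_lebesgue d p k" and ?K = "herm_lebesgue d k"
  let ?g = "\<lambda>x. f x * indicator (posdef d (p + k)) x"
  let ?b = "\<lambda>X W C. four_block_mat X W (mat_adjoint W) C"
  interpret M: sigma_finite_measure ?M by (rule sigma_finite_mats[OF d])
  interpret K: sigma_finite_measure ?K by (rule sigma_finite_herm[OF d])
  interpret PK: sigma_finite_measure "PD d k" by (rule sigma_finite_PD)
  interpret MK: pair_sigma_finite ?M ?K ..
  interpret PM: pair_sigma_finite "PD d k" ?M ..
  have g: "?g \<in> borel_measurable (herm_lebesgue d (p + k))" using f by (simp only: borel_PD)
  have gb: "(\<lambda>(X, W, C). ?g (?b X W C)) \<in> borel_measurable (?H \<Otimes>\<^sub>M (?M \<Otimes>\<^sub>M ?K))"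
    using measurable_compose[OF nn_integral_herm_blocks(1)[OF d] g] by (simp add: split_beta')
  have "(\<integral>\<^sup>+x. f x \<partial>PD d (p + k)) = (\<integral>\<^sup>+(X, W, C). ?g (?b X W C) \<partial>(?H \<Otimes>\<^sub>M (?M \<Otimes>\<^sub>M ?K)))"
    unfolding nn_integral_PD by (rule nn_integral_herm_blocks(2)[OF d g])
  also have "\<dots> = (\<integral>\<^sup>+X. (\<integral>\<^sup>+y. (\<lambda>(X, W, C). ?g (?b X W C)) (X, y) \<partial>(?M \<Otimes>\<^sub>M ?K)) \<partial>?H)"
    by (rule MK.nn_integral_fst[symmetric, OF gb])
  also have "\<dots> = (\<integral>\<^sup>+X. (\<integral>\<^sup>+S. (\<integral>\<^sup>+W. f (blkB X W S) \<partial>?M) \<partial>PD d k) * indicator (posdef d p) X \<partial>?H)"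
  proof (rule nn_integral_cong)
    fix X assume "X \<in> space ?H"
    then have X: "X \<in> herm d p" by simp
    have m: "(\<lambda>y. (\<lambda>(X, W, C). ?g (?b X W C)) (X, y)) \<in> borel_measurable (?M \<Otimes>\<^sub>M ?K)"
      using measurable_compose[OF measurable_Pair1' gb, of X] X by simp
    have "(\<integral>\<^sup>+y. (\<lambda>(X, W, C). ?g (?b X W C)) (X, y) \<partial>(?M \<Otimes>\<^sub>M ?K)) = (\<integral>\<^sup>+W. (\<integral>\<^sup>+C. ?g (?b X W C) \<partial>?K) \<partial>?M)"
      using K.nn_integral_fst[OF m] by simp
    also have "\<dots> = (\<integral>\<^sup>+S. (\<integral>\<^sup>+W. f (blkB X W S) \<partial>?M) \<partial>PD d k) * indicator (posdef d p) X"
    proof (cases "X \<in> posdef d p")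
      case False
      have "?g (?b X W C) = 0" if "W \<in> mats d p k" "C \<in> herm d k" for W C
        using posdef_principal(1)[OF _ X that] False by (auto simp: indicator_def)
      then have "(\<integral>\<^sup>+W. (\<integral>\<^sup>+C. ?g (?b X W C) \<partial>?K) \<partial>?M) = (\<integral>\<^sup>+W. (\<integral>\<^sup>+C. 0 \<partial>?K) \<partial>?M)"
        by (intro nn_integral_cong) simp
      then show ?thesis using False by simp
    next
      case True
      have "(\<integral>\<^sup>+W. (\<integral>\<^sup>+C. ?g (?b X W C) \<partial>?K) \<partial>?M) = (\<integral>\<^sup>+W. (\<integral>\<^sup>+S. f (blkB X W S) \<partial>PD d k) \<partial>?M)"
      proof (rule nn_integral_cong)
        fix W assume "W \<in> space ?M"
        then have W: "W \<in> mats d p k" by simp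
        let ?N = "mat_adjoint W * minv X * W"
        have N: "?N \<in> herm d k" by (rule herm_quad[OF minv_herm[OF d True] W])
        have "(\<lambda>C. ?g (?b X W C)) \<in> borel_measurable ?K"
          by (rule measurable_compose[OF meas_four_block g]) (use W X in auto)
        from nn_integral_herm_translate[OF d N this]
        have "(\<integral>\<^sup>+C. ?g (?b X W C) \<partial>?K) = (\<integral>\<^sup>+S. ?g (blkB X W S) \<partial>?K)" unfolding blkB_def by simp
        also have "\<dots> = (\<integral>\<^sup>+S. f (blkB X W S) \<partial>PD d k)"
          unfolding nn_integral_PD using W True
          by (intro nn_integral_cong) (simp add: indicator_def posdef_blkB_iff)
        finally show "(\<integral>\<^sup>+C. ?g (?b X W C) \<partial>?K) = (\<integral>\<^sup>+S. f (blkB X W S) \<partial>PD d k)" .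
      qed
      also have "\<dots> = (\<integral>\<^sup>+S. (\<integral>\<^sup>+W. f (blkB X W S) \<partial>?M) \<partial>PD d k)"
      proof (rule PM.Fubini')
        show "(\<lambda>(S, W). f (blkB X W S)) \<in> borel_measurable (PD d k \<Otimes>\<^sub>M ?M)"
          unfolding split_beta'
          by (rule measurable_compose[OF meas_blkB_PD f]) (use True in auto)
      qed
      finally show ?thesis using True by simp
    qed
    finally show "(\<integral>\<^sup>+y. (\<lambda>(X, W, C). ?g (?b X W C)) (X, y) \<partial>(?M \<Otimes>\<^sub>M ?K)) =
        (\<integral>\<^sup>+S. (\<integral>\<^sup>+W. f (blkB X W S) \<partial>?M) \<partial>PD d k) * indicator (posdef d p) X" .
  qed
  also have "\<dots> = (\<integral>\<^sup>+X. (\<integral>\<^sup>+S. (\<integral>\<^sup>+W. f (blkB X W S) \<partial>?M) \<partial>PD d k) \<partial>PD d p)"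
    by (simp only: nn_integral_PD[where m=p])
  finally show ?thesis .
qed

end

section \<open>Quadratic forms and Gaussian integrals\<close>

lemma nn_integral_square_scale:
  fixes h :: "real \<Rightarrow> ennreal"
  assumes [measurable]: "h \<in> borel_measurable borel" and c: "0 < c"
  shows "(\<integral>\<^sup>+x. h (c * x\<^sup>2) \<partial>lborel) = ennreal (c powr (- 1 / 2)) * (\<integral>\<^sup>+x. h (x\<^sup>2) \<partial>lborel)"
proof -
  have "(\<integral>\<^sup>+x. h (x\<^sup>2) \<partial>lborel) = ennreal (sqrt c) * (\<integral>\<^sup>+x. h ((0 + sqrt c * x)\<^sup>2) \<partial>lborel)"
    using nn_integral_real_affine[of "\<lambda>x. h (x\<^sup>2)" "sqrt c" 0] c by simp
  also have "(\<integral>\<^sup>+x. h ((0 + sqrt c * x)\<^sup>2) \<partial>lborel) = (\<integral>\<^sup>+x. h (c * x\<^sup>2) \<partial>lborel)"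
    using c by (simp add: power_mult_distrib)
  finally have "ennreal (c powr (- 1 / 2)) * (\<integral>\<^sup>+x. h (x\<^sup>2) \<partial>lborel) =
      ennreal (c powr (- 1 / 2) * sqrt c) * (\<integral>\<^sup>+x. h (c * x\<^sup>2) \<partial>lborel)"
    using c by (simp add: ennreal_mult mult.assoc)
  also have "c powr (- 1 / 2) * sqrt c = 1"
    using c by (simp add: powr_half_sqrt[symmetric] powr_add[symmetric])
  finally show ?thesis by simp
qed

lemma nn_integral_gamma:
  assumes "-1 < \<kappa>" "0 < c"
  shows "(\<integral>\<^sup>+s. ennreal (s powr \<kappa> * exp (- (c * s))) * indicator {0<..} s \<partial>lborel) =
    ennreal (Gamma (\<kappa> + 1) * c powr (- (\<kappa> + 1)))"
proof -
  let ?f = "\<lambda>s. ennreal (s powr \<kappa> * exp (- s)) * indicator {0<..} s"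
  have "ennreal (Gamma (\<kappa> + 1)) = (\<integral>\<^sup>+s. ?f s \<partial>lborel)"
    using assms Gamma_conv_nn_integral_real[of "\<kappa> + 1"]
    by (auto intro!: nn_integral_cong simp: indicator_def exp_minus field_simps powr_def)
  also have "\<dots> = ennreal c * (\<integral>\<^sup>+s. ?f (0 + c * s) \<partial>lborel)"
    using nn_integral_real_affine[of ?f c 0] assms by simp
  also have "(\<integral>\<^sup>+s. ?f (0 + c * s) \<partial>lborel) =
      (\<integral>\<^sup>+s. ennreal (c powr \<kappa>) * (ennreal (s powr \<kappa> * exp (- (c * s))) * indicator {0<..} s) \<partial>lborel)"
    using assms by (intro nn_integral_cong)
      (auto simp: indicator_def powr_mult ennreal_mult[symmetric] mult.assoc zero_less_mult_iff)
  also have "\<dots> = ennreal (c powr \<kappa>) * (\<integral>\<^sup>+s. ennreal (s powr \<kappa> * exp (- (c * s))) * indicator {0<..} s \<partial>lborel)"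
    by (rule nn_integral_cmult) measurable
  finally have "ennreal (c powr (- (\<kappa> + 1))) * ennreal (Gamma (\<kappa> + 1)) =
      ennreal (c powr (- (\<kappa> + 1)) * (c * c powr \<kappa>)) * (\<integral>\<^sup>+s. ennreal (s powr \<kappa> * exp (- (c * s))) * indicator {0<..} s \<partial>lborel)"
    using assms by (simp add: ennreal_mult mult.assoc)
  also have "c powr (- (\<kappa> + 1)) * (c * c powr \<kappa>) = 1"
    using assms by (simp add: powr_mult_base powr_add[symmetric])
  finally show ?thesis using assms Gamma_real_pos[of "\<kappa> + 1"]
    by (simp add: ennreal_mult[symmetric] mult.commute)
qed

lemma minv_mat1: "c \<noteq> 0 \<Longrightarrow> minv (mat1 c) = mat1 (1 / c)"
proof -
  assume c: "c \<noteq> 0"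
  have m: "mat1 c \<in> carrier_mat 1 1" "mat1 (1 / c) \<in> carrier_mat 1 1" by (simp_all add: mat1_def)
  have nz: "det (mat1 c) \<noteq> 0" using c by (simp add: mat1_def det_single)
  have "mat1 c * mat1 (1 / c) = 1\<^sub>m 1"
    by (rule eq_matI) (use c in \<open>auto simp: mat1_def scalar_prod_def One_nat_def\<close>)
  then show ?thesis using mat_inverse_unique[OF m(1) minv_det(1)[OF m(1) nz] m(2) minv_det(3)[OF m(1) nz]] by simp
qed

lemma mat1_carrier [simp]: "mat1 c \<in> carrier_mat 1 1"
  by (simp add: mat1_def)

lemma one_mat_1: "1\<^sub>m 1 = mat1 1"
  by (rule eq_matI) (auto simp: mat1_def)

lemma qf_scale_arg:
  assumes "A \<in> carrier_mat m m" "w \<in> carrier_mat m 1"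
  shows "qf A (w * mat1 c) = c\<^sup>2 * qf A w"
proof -
  have e: "(w * mat1 c) $$ (i, 0) = complex_of_real c * w $$ (i, 0)" if "i < m" for i
    using assms that by (simp add: mat1_def scalar_prod_def One_nat_def)
  have wc: "w * mat1 c \<in> carrier_mat m 1" using assms by (intro mult_carrier_mat[of _ _ 1]) auto
  show ?thesis
    unfolding qf_sum[OF assms(1) wc] qf_sum[OF assms] sum_distrib_left
    by (intro sum.cong refl) (simp add: e power2_eq_square algebra_simps)
qed

lemma qf_one_nonneg: "u \<in> carrier_mat m 1 \<Longrightarrow> qf (1\<^sub>m m) u = (\<Sum>i<m. (cmod (u $$ (i, 0)))\<^sup>2)"
proof -
  assume u: "u \<in> carrier_mat m 1"
  have "qf (1\<^sub>m m) u = (\<Sum>i<m. \<Sum>j<m. if i = j then (cmod (u $$ (i, 0)))\<^sup>2 else 0)"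
    unfolding qf_sum[OF one_carrier_mat u]
    by (intro sum.cong refl) (auto simp: cmod_power2, simp add: power2_eq_square)
  then show ?thesis by simp
qed

lemma qf_smult: "A \<in> carrier_mat m m \<Longrightarrow> u \<in> carrier_mat m 1 \<Longrightarrow> qf (complex_of_real c \<cdot>\<^sub>m A) u = c * qf A u"
  by (subst (1 2) qf_sum[of _ m]) (auto simp: sum_distrib_left algebra_simps intro!: sum.cong)

lemma rtrace_comm:
  assumes "A \<in> carrier_mat n m" "B \<in> carrier_mat m n"
  shows "rtrace (A * B) = rtrace (B * A)"
proof -
  have "(\<Sum>a<n. (A * B) $$ (a, a)) = (\<Sum>a<n. \<Sum>b<m. A $$ (a, b) * B $$ (b, a))"
    using assms by (intro sum.cong refl) (auto simp: scalar_prod_def lessThan_atLeast0)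
  also have "\<dots> = (\<Sum>b<m. \<Sum>a<n. B $$ (b, a) * A $$ (a, b))"
    by (subst sum.swap) (simp add: mult.commute)
  also have "\<dots> = (\<Sum>b<m. (B * A) $$ (b, b))"
    using assms by (intro sum.cong refl) (auto simp: scalar_prod_def lessThan_atLeast0)
  finally show ?thesis using assms by (simp add: rtrace_def)
qed

lemma rtrace_add: "A \<in> carrier_mat n n \<Longrightarrow> B \<in> carrier_mat n n \<Longrightarrow> rtrace (A + B) = rtrace A + rtrace B"
  by (simp add: rtrace_def sum.distrib)

lemma sum_lessThan_split:
  fixes f :: "nat \<Rightarrow> 'a::comm_monoid_add"
  shows "(\<Sum>a<p + k. f a) = (\<Sum>a<p. f a) + (\<Sum>a<k. f (p + a))"
  by (induction k) (simp_all add: add.assoc)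

lemma rtrace_four_block:
  assumes "A \<in> carrier_mat p p" "D \<in> carrier_mat k k"
  shows "rtrace (four_block_mat A B C D) = rtrace A + rtrace D"
proof -
  have "(\<Sum>a<p + k. four_block_mat A B C D $$ (a, a)) = (\<Sum>a<p. A $$ (a, a)) + (\<Sum>a<k. D $$ (a, a))"
    using assms by (simp add: sum_lessThan_split)
  then show ?thesis using assms by (simp add: rtrace_def)
qed

context field_dim
begin

section \<open>Integrals of functions of a quadratic form\<close>

lemma nn_integral_mats_11:
  assumes f: "f \<in> borel_measurable (mats_lebesgue d 1 1)"
  shows "(\<integral>\<^sup>+u. f u \<partial>mats_lebesgue d 1 1) = (if d = 1 then (\<integral>\<^sup>+x. f (mat 1 1 (\<lambda>_. Complex x 0)) \<partial>lborel)
    else (\<integral>\<^sup>+x. (\<integral>\<^sup>+y. f (mat 1 1 (\<lambda>_. Complex x y)) \<partial>lborel) \<partial>lborel))"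
proof (cases "d = 1")
  case True
  let ?\<Phi> = "\<lambda>x. mat 1 1 (\<lambda>_. Complex x 0)"
  have g: "bij_betw (\<lambda>_. (0, 0, 0)) {()} (mat_index d 1 1)"
    using True by (auto simp: mat_index_def bij_betw_def)
  have mem: "?\<Phi> x \<in> mats d 1 1" for x by (simp add: mats_def scalars_iff)
  have crd: "coords (mat_index d 1 1) (?\<Phi> x) (0, 0, 0) = x" for x
    using True by (simp add: coords_def mat_index_def)
  note * = distr_leb_coords[OF coord_sys_mats[OF d] leb_coords_lborel g mem, folded mats_lebesgue_eq]
  have meas: "?\<Phi> \<in> lborel \<rightarrow>\<^sub>M mats_lebesgue d 1 1" by (rule *(1), rule crd)
  have distr: "distr lborel (mats_lebesgue d 1 1) ?\<Phi> = mats_lebesgue d 1 1" by (rule *(2), rule crd)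
  have "(\<integral>\<^sup>+x. f x \<partial>distr lborel (mats_lebesgue d 1 1) ?\<Phi>) = (\<integral>\<^sup>+t. f (?\<Phi> t) \<partial>lborel)"
    by (rule nn_integral_distr[OF meas]) (use f in simp)
  then show ?thesis unfolding distr using True by simp
next
  case False
  then have d2: "d = 2" using d by simp
  let ?\<Phi> = "\<lambda>(x, y). mat 1 1 (\<lambda>_. Complex x y)"
  let ?J = "{()} <+> {()}" and ?g = "case_sum (\<lambda>_. (0, 0, 0)) (\<lambda>_. (0, 0, 1)) :: unit + unit \<Rightarrow> coord_index"
  have g: "bij_betw ?g ?J (mat_index d 1 1)"
    by (rule bij_betw_byWitness[where f'="\<lambda>(a, b, c). if c = 0 then Inl () else Inr ()"])
       (auto simp: mat_index_def d2 less_2_cases_iff)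
  have mem: "?\<Phi> x \<in> mats d 1 1" for x using d2 by (simp add: mats_def scalars_iff split_beta')
  have crd: "coords (mat_index d 1 1) (?\<Phi> x) (?g j) = (\<lambda>(x, y). case_sum ((\<lambda>x _. x) x) ((\<lambda>x _. x) y)) x j"
    if "j \<in> ?J" for x j
    using that d2 by (cases x) (auto simp: coords_def mat_index_def)
  have M: "leb_coords (lborel \<Otimes>\<^sub>M lborel) ?J (\<lambda>(x, y). case_sum ((\<lambda>x _. x) x) ((\<lambda>x _. x) y))"
    by (rule leb_coords_pair[OF leb_coords_lborel leb_coords_lborel])
  note * = distr_leb_coords[OF coord_sys_mats[OF d] M g mem, folded mats_lebesgue_eq]
  have meas: "?\<Phi> \<in> lborel \<Otimes>\<^sub>M lborel \<rightarrow>\<^sub>M mats_lebesgue d 1 1" by (rule *(1), rule crd)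
  have distr: "distr (lborel \<Otimes>\<^sub>M lborel) (mats_lebesgue d 1 1) ?\<Phi> = mats_lebesgue d 1 1" by (rule *(2), rule crd)
  have "(\<integral>\<^sup>+x. f x \<partial>distr (lborel \<Otimes>\<^sub>M lborel) (mats_lebesgue d 1 1) ?\<Phi>) = (\<integral>\<^sup>+t. f (?\<Phi> t) \<partial>(lborel \<Otimes>\<^sub>M lborel))"
    by (rule nn_integral_distr[OF meas]) (use f in simp)
  also have "\<dots> = (\<integral>\<^sup>+x. (\<integral>\<^sup>+y. f (?\<Phi> (x, y)) \<partial>lborel) \<partial>lborel)"
    by (rule lborel.nn_integral_fst[symmetric]) (rule measurable_compose[OF meas f])
  finally show ?thesis unfolding distr using False by simp
qed

lemma meas_qf_const:
  assumes "A \<in> herm d m" "f \<in> borel_measurable borel"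
  shows "(\<lambda>u. f (qf A u)) \<in> borel_measurable (mats_lebesgue d m 1)"
proof -
  have "(\<lambda>u. A) \<in> mats_lebesgue d m 1 \<rightarrow>\<^sub>M mats_lebesgue d m m"
    using hermD(1)[OF assms(1)] by (intro measurable_const) simp
  from measurable_compose[OF meas_qf[OF this measurable_ident] assms(2)] show ?thesis by simp
qed

lemma mats_11_borel:
  assumes [measurable]: "f \<in> borel_measurable borel"
  shows "(\<lambda>u. f (qf (mat1 c) u)) \<in> borel_measurable (mats_lebesgue d 1 1)"
  by (rule meas_qf_const[OF mat1_herm assms])

lemma nn_integral_qf_11:
  fixes f :: "real \<Rightarrow> ennreal"
  assumes [measurable]: "f \<in> borel_measurable borel"
  shows "(\<integral>\<^sup>+u. f (qf (mat1 c) u) \<partial>mats_lebesgue d 1 1) = (if d = 1 then (\<integral>\<^sup>+x. f (c * x\<^sup>2) \<partial>lborel)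
    else (\<integral>\<^sup>+x. (\<integral>\<^sup>+y. f (c * (x\<^sup>2 + y\<^sup>2)) \<partial>lborel) \<partial>lborel))"
  by (subst nn_integral_mats_11[OF mats_11_borel[OF assms]]) (simp add: qf_mat1 cmod_power2)

text \<open>Every real coordinate of the 1 x 1 matrix contributes a factor
  \<open>c powr (- 1 / 2)\<close>. In the complex case the two coordinates are rescaled one after
  the other, each with the other one frozen.\<close>

lemma nn_integral_qf_11_scale:
  fixes f :: "real \<Rightarrow> ennreal"
  assumes [measurable]: "f \<in> borel_measurable borel" and c: "0 < c"
  shows "(\<integral>\<^sup>+u. f (qf (mat1 c) u) \<partial>mats_lebesgue d 1 1) =
    ennreal (c powr (- (real d / 2))) * (\<integral>\<^sup>+u. f (qf (mat1 1) u) \<partial>mats_lebesgue d 1 1)"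
proof (cases "d = 1")
  case True
  then show ?thesis unfolding nn_integral_qf_11[OF assms(1)]
    using nn_integral_square_scale[OF assms] by simp
next
  case False
  then have d2: "d = 2" using d by simp
  have "(\<integral>\<^sup>+x. (\<integral>\<^sup>+y. f (c * (x\<^sup>2 + y\<^sup>2)) \<partial>lborel) \<partial>lborel) =
      (\<integral>\<^sup>+x. ennreal (c powr (- 1 / 2)) * (\<integral>\<^sup>+y. f (c * x\<^sup>2 + y\<^sup>2) \<partial>lborel) \<partial>lborel)"
  proof (rule nn_integral_cong)
    fix x
    show "(\<integral>\<^sup>+y. f (c * (x\<^sup>2 + y\<^sup>2)) \<partial>lborel) = ennreal (c powr (- 1 / 2)) * (\<integral>\<^sup>+y. f (c * x\<^sup>2 + y\<^sup>2) \<partial>lborel)"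
      using nn_integral_square_scale[of "\<lambda>t. f (c * x\<^sup>2 + t)" c] c by (simp add: algebra_simps)
  qed
  also have "\<dots> = ennreal (c powr (- 1 / 2)) * (\<integral>\<^sup>+x. (\<integral>\<^sup>+y. f (c * x\<^sup>2 + y\<^sup>2) \<partial>lborel) \<partial>lborel)"
    by (rule nn_integral_cmult) measurable
  also have "(\<integral>\<^sup>+x. (\<integral>\<^sup>+y. f (c * x\<^sup>2 + y\<^sup>2) \<partial>lborel) \<partial>lborel) =
      ennreal (c powr (- 1 / 2)) * (\<integral>\<^sup>+x. (\<integral>\<^sup>+y. f (x\<^sup>2 + y\<^sup>2) \<partial>lborel) \<partial>lborel)"
    by (rule nn_integral_square_scale[where h="\<lambda>t. \<integral>\<^sup>+y. f (t + y\<^sup>2) \<partial>lborel"]) (use c in measurable)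
  finally show ?thesis
    unfolding nn_integral_qf_11[OF assms(1)]
    using c by (simp add: d2 mult.assoc[symmetric] ennreal_mult[symmetric] powr_add[symmetric])
qed

lemma trace_one_zero: "1\<^sub>m 0 = (A :: complex mat)" if "A \<in> carrier_mat 0 0"
  using that by (intro eq_matI) auto

text \<open>Completing the square: after the factorization of \<open>blkA\<close> the form is a sum
  of two independent forms, at the price of shifting v by an amount linear in u.\<close>

lemma qf_blkA:
  assumes Z: "Z \<in> posdef d m" and W: "W \<in> mats d m k" and C: "C \<in> posdef d k"
    and u: "u \<in> carrier_mat m 1" and v: "v \<in> carrier_mat k 1"
  shows "qf (blkA Z W C) (four_block_mat u (0\<^sub>m m 0) v (0\<^sub>m k 0)) = qf Z u + qf C (v + minv C * mat_adjoint W * u)"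
proof -
  note c = posdef_carrier[OF Z] matsD[OF W] posdef_carrier[OF C] minv_posdef_carrier(1)[OF d C]
  have M: "minv C * mat_adjoint W \<in> carrier_mat k m" using c by (intro mult_carrier_mat[of _ _ k]) auto
  have Mu: "minv C * mat_adjoint W * u \<in> carrier_mat k 1" by (rule mult_carrier_mat[OF M u])
  have T: "trA m k W C \<in> carrier_mat (m + k) (m + k)" unfolding trA_def by auto
  have D: "four_block_mat Z (0\<^sub>m m k) (0\<^sub>m k m) C \<in> carrier_mat (m + k) (m + k)" using c by auto
  have uv: "four_block_mat u (0\<^sub>m m 0) v (0\<^sub>m k 0) \<in> carrier_mat (m + k) 1"
    using four_block_carrier_mat[OF u, of "0\<^sub>m k 0" k 0 "0\<^sub>m m 0" v] by simp
  have comm: "minv C * mat_adjoint W * u + v = v + minv C * mat_adjoint W * u"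
    by (rule comm_add_mat[OF Mu v])
  have "mat_adjoint (trA m k W C) * four_block_mat u (0\<^sub>m m 0) v (0\<^sub>m k 0) =
      four_block_mat u (0\<^sub>m m 0) (v + minv C * mat_adjoint W * u) (0\<^sub>m k 0)"
    unfolding blkA_factor(2)[OF c(1,2) C] using c M Mu u v
    by (subst mult_four_block_mat[of _ m m _ k _ k _ _ 1 _ 0]) (simp_all add: comm left_mult_zero_mat[OF v] del: assoc_mult_mat)
  then show ?thesis
    unfolding blkA_factor(1)[OF c(1,2) C] qf_congr[OF T D uv]
    using qf_diag[OF c(1,3) u, of "v + minv C * mat_adjoint W * u"] v Mu by simp
qed

text \<open>This is the substitution that turns A into the unit matrix, obtained by peeling off one
  coordinate at a time: a translation removes the shift of \<open>qf_blkA\<close>, a scaling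
  produces the power of the corner entry, and \<open>det_blkA\<close> collects the powers into
  \<open>rdet A\<close>. The function \<open>f\<close> is arbitrary because the convolution of
  Wishart densities applies it to functions other than Gaussians.\<close>

lemma nn_integral_qf:
  assumes "A \<in> posdef d m" "f \<in> borel_measurable borel"
  shows "(\<integral>\<^sup>+u. f (qf A u) \<partial>mats_lebesgue d m 1) =
    ennreal (rdet A powr (- (real d / 2))) * (\<integral>\<^sup>+u. f (qf (1\<^sub>m m) u) \<partial>mats_lebesgue d m 1)"
  using assms
proof (induction m arbitrary: A f)
  case 0
  have "A = 1\<^sub>m 0" using trace_one_zero[OF posdef_carrier[OF 0(1)]] by simp
  then show ?case by (simp add: rdet_def)
next
  case (Suc m)
  note [measurable] = Suc.prems(2)
  let ?M = "mats_lebesgue d m 1" and ?K = "mats_lebesgue d 1 1"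
  interpret M: sigma_finite_measure ?M by (rule sigma_finite_mats[OF d])
  interpret K: sigma_finite_measure ?K by (rule sigma_finite_mats[OF d])
  have A: "A \<in> posdef d (m + 1)" using Suc.prems(1) by (simp only: Suc_eq_plus1)
  then obtain Z W C where *: "Z \<in> posdef d m" "W \<in> mats d m 1" "C \<in> posdef d 1" "A = blkA Z W C"
    by (rule posdef_blkA_cases)
  obtain c where c: "0 < c" "C = mat1 c" using posdef_1_cases[OF *(3)] .
  have [measurable]: "(\<lambda>u. qf (mat1 a) u) \<in> borel_measurable ?K" for a
    using mats_11_borel[of "\<lambda>x. x"] by simp
  \<comment> \<open>The induction hypothesis is used for this function of t: the inner integral over
    the last coordinate is again a Borel function of the value of the smaller form.\<close>
  have int1: "(\<lambda>t. \<integral>\<^sup>+v. f (t + qf (mat1 1) v) \<partial>?K) \<in> borel_measurable borel" by measurable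
  have meas: "(\<lambda>u. f (qf B u)) \<in> borel_measurable (mats_lebesgue d (m + 1) 1)" if "B \<in> herm d (m + 1)" for B
    by (rule meas_qf_const[OF that Suc.prems(2)])
  have one: "1\<^sub>m (m + 1) = four_block_mat (1\<^sub>m m) (0\<^sub>m m 1) (0\<^sub>m 1 m) (mat1 1)"
    by (simp add: one_mat_1[symmetric])
  have "(\<integral>\<^sup>+u. f (qf A u) \<partial>mats_lebesgue d (m + 1) 1) =
      (\<integral>\<^sup>+u. (\<integral>\<^sup>+v. f (qf Z u + qf (mat1 c) (v + minv C * mat_adjoint W * u)) \<partial>?K) \<partial>?M)"
    unfolding nn_integral_mats_stack(1)[OF d meas[OF posdef_herm[OF A]]]
    by (intro nn_integral_cong) (simp add: *(4) qf_blkA[OF *(1-3)] matsD c(2)[symmetric])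
  also have "\<dots> = (\<integral>\<^sup>+u. ennreal (c powr (- (real d / 2))) * (\<integral>\<^sup>+v. f (qf Z u + qf (mat1 1) v) \<partial>?K) \<partial>?M)"
  proof (rule nn_integral_cong)
    fix u assume "u \<in> space ?M"
    then have u: "u \<in> mats d m 1" by simp
    have b: "minv C * mat_adjoint W * u \<in> mats d 1 1"
      by (intro mats_mult[where q=m] mats_mult[where q=1] mats_adjoint * u hermD(1)[OF minv_herm[OF d *(3)]])
    have "(\<integral>\<^sup>+v. f (qf Z u + qf (mat1 c) (v + minv C * mat_adjoint W * u)) \<partial>?K) =
        (\<integral>\<^sup>+v. f (qf Z u + qf (mat1 c) v) \<partial>?K)"
      by (rule nn_integral_mats_translate[OF d b]) measurable
    also have "\<dots> = ennreal (c powr (- (real d / 2))) * (\<integral>\<^sup>+v. f (qf Z u + qf (mat1 1) v) \<partial>?K)"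
      by (rule nn_integral_qf_11_scale[OF _ c(1), of "\<lambda>t. f (qf Z u + t)"]) measurable
    finally show "(\<integral>\<^sup>+v. f (qf Z u + qf (mat1 c) (v + minv C * mat_adjoint W * u)) \<partial>?K) =
        ennreal (c powr (- (real d / 2))) * (\<integral>\<^sup>+v. f (qf Z u + qf (mat1 1) v) \<partial>?K)" .
  qed
  also have "\<dots> = ennreal (c powr (- (real d / 2))) * (\<integral>\<^sup>+u. (\<integral>\<^sup>+v. f (qf Z u + qf (mat1 1) v) \<partial>?K) \<partial>?M)"
  proof (rule nn_integral_cmult)
    show "(\<lambda>u. \<integral>\<^sup>+v. f (qf Z u + qf (mat1 1) v) \<partial>?K) \<in> borel_measurable ?M"
      by (rule meas_qf_const[OF posdef_herm[OF *(1)] int1])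
  qed
  also have "(\<integral>\<^sup>+u. (\<integral>\<^sup>+v. f (qf Z u + qf (mat1 1) v) \<partial>?K) \<partial>?M) =
      ennreal (rdet Z powr (- (real d / 2))) * (\<integral>\<^sup>+u. (\<integral>\<^sup>+v. f (qf (1\<^sub>m m) u + qf (mat1 1) v) \<partial>?K) \<partial>?M)"
    by (rule Suc.IH[OF *(1) int1])
  also have "(\<integral>\<^sup>+u. (\<integral>\<^sup>+v. f (qf (1\<^sub>m m) u + qf (mat1 1) v) \<partial>?K) \<partial>?M) = (\<integral>\<^sup>+u. f (qf (1\<^sub>m (m + 1)) u) \<partial>mats_lebesgue d (m + 1) 1)"
    unfolding nn_integral_mats_stack(1)[OF d meas[OF herm_one]]
    by (intro nn_integral_cong) (simp add: one qf_diag matsD)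
  also have "ennreal (c powr (- (real d / 2))) * (ennreal (rdet Z powr (- (real d / 2))) * (\<integral>\<^sup>+u. f (qf (1\<^sub>m (m + 1)) u) \<partial>mats_lebesgue d (m + 1) 1)) =
      ennreal (rdet A powr (- (real d / 2))) * (\<integral>\<^sup>+u. f (qf (1\<^sub>m (m + 1)) u) \<partial>mats_lebesgue d (m + 1) 1)"
  proof -
    have "rdet A = rdet Z * c"
      using det_blkA(2)[OF posdef_herm[OF *(1)] matsD[OF *(2)] *(3)] *(4) c(2) by simp
    then show ?thesis
      using rdet_pos[OF *(1)] c(1) by (simp add: powr_mult ennreal_mult mult_ac)
  qed
  finally show ?case by (simp only: Suc_eq_plus1)
qed

text \<open>The Gaussian integral of exp(- |u|^2) over columns of length m, that is over m * d real
  dimensions; see \<open>nn_integral_gauss_one\<close>.\<close>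

definition gauss :: "nat \<Rightarrow> real" where
  "gauss m = sqrt pi ^ (m * d)"

lemma gauss_pos: "0 < gauss m"
  by (simp add: gauss_def)

lemma nn_integral_exp_square: "(\<integral>\<^sup>+x. ennreal (exp (- x\<^sup>2)) \<partial>lborel) = ennreal (sqrt pi)"
proof -
  have "(\<integral>\<^sup>+x. ennreal (normal_density 0 (1 / sqrt 2) x) \<partial>lborel) = 1"
    by (subst nn_integral_eq_integral) (auto intro!: integrable_normal_density simp: integral_normal_density)
  moreover have "normal_density 0 (1 / sqrt 2) x = 1 / sqrt pi * exp (- x\<^sup>2)" for x
    by (simp add: normal_density_def power_divide)
  ultimately have "1 = (\<integral>\<^sup>+x. ennreal (1 / sqrt pi) * ennreal (exp (- x\<^sup>2)) \<partial>lborel)"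
    by (simp add: ennreal_mult[symmetric])
  also have "\<dots> = ennreal (1 / sqrt pi) * (\<integral>\<^sup>+x. ennreal (exp (- x\<^sup>2)) \<partial>lborel)"
    by (rule nn_integral_cmult) measurable
  finally have "ennreal (sqrt pi) * 1 = ennreal (sqrt pi * (1 / sqrt pi)) * (\<integral>\<^sup>+x. ennreal (exp (- x\<^sup>2)) \<partial>lborel)"
    by (simp only: ennreal_mult mult.assoc real_sqrt_ge_zero pi_ge_zero zero_le_divide_iff zero_le_one simp_thms)
  then show ?thesis by simp
qed

lemma nn_integral_gauss_one: "(\<integral>\<^sup>+u. ennreal (exp (- qf (1\<^sub>m m) u)) \<partial>mats_lebesgue d m 1) = ennreal (gauss m)"
proof (induction m)
  case 0
  \<comment> \<open>Without coordinates the space is a single point of mass 1.\<close>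
  have empty: "mat_index d 0 1 = {}" by (auto simp: mat_index_def)
  have c: "coord_sys (mats d 0 1) (mat_index d 0 1)" by (rule coord_sys_mats[OF d])
  have "qf (1\<^sub>m 0) u = 0" if "u \<in> mats d 0 1" for u using qf_one_nonneg[OF matsD[OF that]] by simp
  then have "(\<integral>\<^sup>+u. ennreal (exp (- qf (1\<^sub>m 0) u)) \<partial>mats_lebesgue d 0 1) = (\<integral>\<^sup>+u. 1 \<partial>mats_lebesgue d 0 1)"
    by (intro nn_integral_cong) simp
  also have "\<dots> = (\<integral>\<^sup>+u. 1 \<partial>(\<Pi>\<^sub>M i\<in>({} :: coord_index set). (lborel :: real measure)))"
    unfolding mats_lebesgue_eq by (subst nn_integral_via[OF c]) (simp_all add: empty)
  finally show ?case by (simp add: gauss_def space_PiM_empty)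
next
  case (Suc m)
  let ?M = "mats_lebesgue d m 1" and ?K = "mats_lebesgue d 1 1"
  have one: "1\<^sub>m (m + 1) = four_block_mat (1\<^sub>m m) (0\<^sub>m m 1) (0\<^sub>m 1 m) (mat1 1)"
    by (simp add: one_mat_1[symmetric])
  have meas: "(\<lambda>u. ennreal (exp (- qf (1\<^sub>m k) u))) \<in> borel_measurable (mats_lebesgue d k 1)" for k
    by (rule meas_qf_const[OF herm_one, where f="\<lambda>x. ennreal (exp (- x))"]) measurable
  have meas1: "(\<lambda>u. ennreal (exp (- qf (mat1 1) u))) \<in> borel_measurable ?K"
    by (rule mats_11_borel[where f="\<lambda>x. ennreal (exp (- x))"]) measurable
  have K: "(\<integral>\<^sup>+v. ennreal (exp (- qf (mat1 1) v)) \<partial>?K) = ennreal (sqrt pi ^ d)"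
  proof (cases "d = 1")
    case True
    then show ?thesis using nn_integral_exp_square by (subst nn_integral_qf_11) simp_all
  next
    case False
    then have d2: "d = 2" using d by simp
    have "(\<integral>\<^sup>+v. ennreal (exp (- qf (mat1 1) v)) \<partial>?K) =
        (\<integral>\<^sup>+x. (\<integral>\<^sup>+y. ennreal (exp (- x\<^sup>2)) * ennreal (exp (- y\<^sup>2)) \<partial>lborel) \<partial>lborel)"
      using False by (subst nn_integral_qf_11) (simp_all add: ennreal_mult[symmetric] exp_add[symmetric])
    also have "\<dots> = ennreal (sqrt pi) * ennreal (sqrt pi)"
      by (simp add: nn_integral_cmult nn_integral_multc nn_integral_exp_square)
    finally show ?thesis by (simp add: d2 ennreal_mult[symmetric])
  qed
  have "(\<integral>\<^sup>+u. ennreal (exp (- qf (1\<^sub>m (m + 1)) u)) \<partial>mats_lebesgue d (m + 1) 1) =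
      (\<integral>\<^sup>+u. (\<integral>\<^sup>+v. ennreal (exp (- qf (1\<^sub>m m) u)) * ennreal (exp (- qf (mat1 1) v)) \<partial>?K) \<partial>?M)"
    unfolding nn_integral_mats_stack(1)[OF d meas]
    by (intro nn_integral_cong) (simp add: one qf_diag matsD ennreal_mult[symmetric] exp_add[symmetric])
  also have "\<dots> = (\<integral>\<^sup>+u. ennreal (exp (- qf (1\<^sub>m m) u)) \<partial>?M) * ennreal (sqrt pi ^ d)"
    using meas1 meas[of m] by (simp add: nn_integral_cmult nn_integral_multc K)
  also have "\<dots> = ennreal (gauss (m + 1))"
    unfolding Suc.IH by (simp add: gauss_def ennreal_mult[symmetric] power_add[symmetric] add.commute algebra_simps)
  finally show ?case by (simp only: Suc_eq_plus1)
qed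

lemma one_smult_posdef:
  assumes c: "0 < c"
  shows "complex_of_real c \<cdot>\<^sub>m 1\<^sub>m m \<in> posdef d m" "rdet (complex_of_real c \<cdot>\<^sub>m 1\<^sub>m m) = c ^ m"
proof -
  have "complex_of_real c \<cdot>\<^sub>m 1\<^sub>m m \<in> herm d m" by (rule hermI) auto
  moreover have "0 < qf (complex_of_real c \<cdot>\<^sub>m 1\<^sub>m m) u" if u: "u \<in> mats d m 1" "u \<noteq> 0\<^sub>m m 1" for u
  proof -
    have "\<exists>i<m. u $$ (i, 0) \<noteq> 0"
    proof (rule ccontr)
      assume "\<not> (\<exists>i<m. u $$ (i, 0) \<noteq> 0)"
      then have "u = 0\<^sub>m m 1" using matsD[OF u(1)] by (intro eq_matI) (auto simp: One_nat_def)
      then show False using u by simp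
    qed
    then obtain i where "i < m" "u $$ (i, 0) \<noteq> 0" by blast
    then have "0 < (\<Sum>i<m. (cmod (u $$ (i, 0)))\<^sup>2)" by (intro sum_pos2[of _ i]) auto
    then show ?thesis using c by (simp add: qf_smult[OF one_carrier_mat matsD[OF u(1)]] qf_one_nonneg[OF matsD[OF u(1)]])
  qed
  ultimately show "complex_of_real c \<cdot>\<^sub>m 1\<^sub>m m \<in> posdef d m" unfolding posdef_iff_qf by blast
  show "rdet (complex_of_real c \<cdot>\<^sub>m 1\<^sub>m m) = c ^ m" by (simp add: rdet_def det_smult flip: of_real_power)
qed

text \<open>The factor c is absorbed into the form: c times the unit form is the form of c times the
  unit matrix, whose determinant is \<open>c ^ m\<close>, so the determinant rule gives the scaling
  as well.\<close>

lemma nn_integral_qf_scale: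
  assumes A: "A \<in> posdef d m" and f: "f \<in> borel_measurable borel" and c: "0 < c"
  shows "(\<integral>\<^sup>+u. f (c * qf A u) \<partial>mats_lebesgue d m 1) =
    ennreal (rdet A powr (- (real d / 2)) * c powr (- (real m * real d / 2))) *
      (\<integral>\<^sup>+u. f (qf (1\<^sub>m m) u) \<partial>mats_lebesgue d m 1)"
proof -
  have "(\<integral>\<^sup>+u. f (c * qf A u) \<partial>mats_lebesgue d m 1) =
      ennreal (rdet A powr (- (real d / 2))) * (\<integral>\<^sup>+u. f (c * qf (1\<^sub>m m) u) \<partial>mats_lebesgue d m 1)"
    by (rule nn_integral_qf[OF A]) (use f in measurable)
  also have "(\<integral>\<^sup>+u. f (c * qf (1\<^sub>m m) u) \<partial>mats_lebesgue d m 1) = (\<integral>\<^sup>+u. f (qf (complex_of_real c \<cdot>\<^sub>m 1\<^sub>m m) u) \<partial>mats_lebesgue d m 1)"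
    by (intro nn_integral_cong) (simp add: qf_smult[OF one_carrier_mat] matsD)
  also have "\<dots> = ennreal ((c ^ m) powr (- (real d / 2))) * (\<integral>\<^sup>+u. f (qf (1\<^sub>m m) u) \<partial>mats_lebesgue d m 1)"
    using nn_integral_qf[OF one_smult_posdef(1)[OF c] f] by (simp add: one_smult_posdef(2)[OF c])
  also have "(c ^ m) powr (- (real d / 2)) = c powr (- (real m * real d / 2))"
    using c by (simp add: powr_realpow[symmetric] powr_powr)
  finally show ?thesis by (simp add: ennreal_mult mult.assoc)
qed

lemma nn_integral_gauss:
  assumes A: "A \<in> posdef d m" and c: "0 < c" and b: "b \<in> mats d m 1"
  shows "(\<integral>\<^sup>+u. ennreal (exp (- (c * qf A (u + b)))) \<partial>mats_lebesgue d m 1) =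
    ennreal (rdet A powr (- (real d / 2)) * c powr (- (real m * real d / 2)) * gauss m)"
proof -
  have "(\<lambda>u. ennreal (exp (- (c * qf A u)))) \<in> borel_measurable (mats_lebesgue d m 1)"
    by (rule meas_qf_const[OF posdef_herm[OF A], where f="\<lambda>x. ennreal (exp (- (c * x)))"]) measurable
  then have "(\<integral>\<^sup>+u. ennreal (exp (- (c * qf A (u + b)))) \<partial>mats_lebesgue d m 1) =
      (\<integral>\<^sup>+u. ennreal (exp (- (c * qf A u))) \<partial>mats_lebesgue d m 1)"
    by (rule nn_integral_mats_translate[OF d b])
  also have "\<dots> = ennreal (rdet A powr (- (real d / 2)) * c powr (- (real m * real d / 2))) * ennreal (gauss m)"
    using nn_integral_qf_scale[OF A _ c, of "\<lambda>x. ennreal (exp (- x))"] by (simp add: nn_integral_gauss_one)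
  finally show ?thesis using gauss_pos[of m] by (simp add: ennreal_mult)
qed

end

section \<open>Wishart distributions\<close>

definition HL :: "real measure" where
  "HL = restrict_space lborel {0<..}"

lemma space_HL [simp]: "space HL = {0<..}"
  by (simp add: HL_def space_restrict_space)

lemma sigma_finite_HL: "sigma_finite_measure HL"
  unfolding HL_def by (rule sigma_finite_measure_restrict_space) (auto intro: sigma_finite_lborel)

lemma nn_integral_HL: "(\<integral>\<^sup>+s. f s \<partial>HL) = (\<integral>\<^sup>+s. f s * indicator {0<..} s \<partial>lborel)"
  unfolding HL_def by (rule nn_integral_restrict_space) simp

lemma borel_HL: "f \<in> borel_measurable borel \<Longrightarrow> f \<in> borel_measurable HL"
  unfolding HL_def by (rule measurable_restrict_space1) simp

lemma meas_HL_real: "f \<in> N \<rightarrow>\<^sub>M HL \<Longrightarrow> f \<in> borel_measurable N"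
  unfolding HL_def by (simp add: measurable_restrict_space2_iff)

text \<open>Substituting s = \<sigma> t at a fixed sum \<sigma> separates the variables, and C is
  the Beta integral, possibly infinite. It is left anonymous because the constant of the convolution
  is fixed at the end by a total mass.\<close>

lemma nn_integral_HL_add:
  obtains C where "\<And>g. g \<in> borel_measurable borel \<Longrightarrow>
    (\<integral>\<^sup>+s. (\<integral>\<^sup>+t. ennreal (s powr a * t powr b) * g (s + t) \<partial>HL) \<partial>HL) =
      C * (\<integral>\<^sup>+\<sigma>. ennreal (\<sigma> powr (a + b + 1)) * g \<sigma> \<partial>HL)"
proof
  let ?C = "\<integral>\<^sup>+t. ennreal (t powr a * (1 - t) powr b) * indicator {0<..<1} t \<partial>lborel"
  fix g :: "real \<Rightarrow> ennreal" assume [measurable]: "g \<in> borel_measurable borel"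
  have "(\<integral>\<^sup>+s. (\<integral>\<^sup>+t. ennreal (s powr a * t powr b) * g (s + t) \<partial>HL) \<partial>HL) =
      (\<integral>\<^sup>+s. (\<integral>\<^sup>+\<sigma>. ennreal (s powr a * (\<sigma> - s) powr b) * g \<sigma> * indicator {0<..<\<sigma>} s \<partial>lborel) \<partial>lborel)"
    unfolding nn_integral_HL
  proof (rule nn_integral_cong)
    fix s :: real
    have "(\<integral>\<^sup>+t. ennreal (s powr a * t powr b) * g (s + t) * indicator {0<..} t \<partial>lborel) =
        (\<integral>\<^sup>+\<sigma>. ennreal (s powr a * (\<sigma> - s) powr b) * g \<sigma> * indicator {0<..} (\<sigma> - s) \<partial>lborel)"
      by (subst nn_integral_real_affine[of _ 1 "- s"]) (simp_all add: algebra_simps)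
    then have "(\<integral>\<^sup>+t. ennreal (s powr a * t powr b) * g (s + t) * indicator {0<..} t \<partial>lborel) * indicator {0<..} s =
        (\<integral>\<^sup>+\<sigma>. ennreal (s powr a * (\<sigma> - s) powr b) * g \<sigma> * indicator {0<..} (\<sigma> - s) * indicator {0<..} s \<partial>lborel)"
      by (simp add: nn_integral_multc)
    also have "\<dots> = (\<integral>\<^sup>+\<sigma>. ennreal (s powr a * (\<sigma> - s) powr b) * g \<sigma> * indicator {0<..<\<sigma>} s \<partial>lborel)"
      by (intro nn_integral_cong) (auto simp: indicator_def)
    finally show "(\<integral>\<^sup>+t. ennreal (s powr a * t powr b) * g (s + t) * indicator {0<..} t \<partial>lborel) * indicator {0<..} s =
        (\<integral>\<^sup>+\<sigma>. ennreal (s powr a * (\<sigma> - s) powr b) * g \<sigma> * indicator {0<..<\<sigma>} s \<partial>lborel)" .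
  qed
  also have "\<dots> = (\<integral>\<^sup>+\<sigma>. (\<integral>\<^sup>+s. ennreal (s powr a * (\<sigma> - s) powr b) * g \<sigma> * indicator {0<..<\<sigma>} s \<partial>lborel) \<partial>lborel)"
  proof (rule lborel_pair.Fubini')
    have "(\<lambda>(\<sigma>, s). ennreal (s powr a * (\<sigma> - s) powr b) * g \<sigma> * (if 0 < s \<and> s < \<sigma> then 1 else 0)) \<in>
        borel_measurable (lborel \<Otimes>\<^sub>M lborel)" by measurable
    then show "(\<lambda>(\<sigma>, s). ennreal (s powr a * (\<sigma> - s) powr b) * g \<sigma> * indicator {0<..<\<sigma>} s) \<in>
        borel_measurable (lborel \<Otimes>\<^sub>M lborel)" by (simp add: indicator_def of_bool_def)
  qed
  also have "\<dots> = (\<integral>\<^sup>+\<sigma>. ?C * (ennreal (\<sigma> powr (a + b + 1)) * g \<sigma> * indicator {0<..} \<sigma>) \<partial>lborel)"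
  proof (rule nn_integral_cong)
    fix \<sigma> :: real
    show "(\<integral>\<^sup>+s. ennreal (s powr a * (\<sigma> - s) powr b) * g \<sigma> * indicator {0<..<\<sigma>} s \<partial>lborel) =
        ?C * (ennreal (\<sigma> powr (a + b + 1)) * g \<sigma> * indicator {0<..} \<sigma>)"
    proof (cases "0 < \<sigma>")
      case False
      then have "(\<integral>\<^sup>+s. ennreal (s powr a * (\<sigma> - s) powr b) * g \<sigma> * indicator {0<..<\<sigma>} s \<partial>lborel) = (\<integral>\<^sup>+s. 0 \<partial>(lborel :: real measure))"
        by (intro nn_integral_cong) (auto simp: indicator_def)
      then show ?thesis using False by simp
    next
      case True
      have "(\<integral>\<^sup>+s. ennreal (s powr a * (\<sigma> - s) powr b) * g \<sigma> * indicator {0<..<\<sigma>} s \<partial>lborel) =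
          ennreal \<sigma> * (\<integral>\<^sup>+t. ennreal ((0 + \<sigma> * t) powr a * (\<sigma> - (0 + \<sigma> * t)) powr b) * g \<sigma> * indicator {0<..<\<sigma>} (0 + \<sigma> * t) \<partial>lborel)"
        using nn_integral_real_affine[of "\<lambda>s. ennreal (s powr a * (\<sigma> - s) powr b) * g \<sigma> * indicator {0<..<\<sigma>} s" \<sigma> 0] True
        by simp
      also have "(\<integral>\<^sup>+t. ennreal ((0 + \<sigma> * t) powr a * (\<sigma> - (0 + \<sigma> * t)) powr b) * g \<sigma> * indicator {0<..<\<sigma>} (0 + \<sigma> * t) \<partial>lborel) =
          (\<integral>\<^sup>+t. (ennreal (\<sigma> powr (a + b)) * g \<sigma>) * (ennreal (t powr a * (1 - t) powr b) * indicator {0<..<1} t) \<partial>lborel)"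
      proof (rule nn_integral_cong)
        fix t :: real
        show "ennreal ((0 + \<sigma> * t) powr a * (\<sigma> - (0 + \<sigma> * t)) powr b) * g \<sigma> * indicator {0<..<\<sigma>} (0 + \<sigma> * t) =
            (ennreal (\<sigma> powr (a + b)) * g \<sigma>) * (ennreal (t powr a * (1 - t) powr b) * indicator {0<..<1} t)"
        proof (cases "0 < t \<and> t < 1")
          case t: True
          have "\<sigma> - (0 + \<sigma> * t) = \<sigma> * (1 - t)" by (simp add: algebra_simps)
          then have "(0 + \<sigma> * t) powr a * (\<sigma> - (0 + \<sigma> * t)) powr b = \<sigma> powr (a + b) * (t powr a * (1 - t) powr b)"
            using True t by (simp add: powr_mult powr_add)
          then show ?thesis using True t by (simp add: ennreal_mult mult_ac)
        next
          case False
          then have "\<not> (0 < \<sigma> * t \<and> \<sigma> * t < \<sigma>)" using True by (auto simp: zero_less_mult_iff)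
          then show ?thesis using False by (auto simp: indicator_def)
        qed
      qed
      also have "\<dots> = (ennreal (\<sigma> powr (a + b)) * g \<sigma>) * ?C" by (rule nn_integral_cmult) measurable
      also have "ennreal \<sigma> * ((ennreal (\<sigma> powr (a + b)) * g \<sigma>) * ?C) = ?C * (ennreal (\<sigma> * \<sigma> powr (a + b)) * g \<sigma>)"
        using True by (simp add: ennreal_mult mult_ac)
      also have "\<sigma> * \<sigma> powr (a + b) = \<sigma> powr (a + b + 1)" using True by (simp add: powr_mult_base add_ac)
      finally show ?thesis using True by simp
    qed
  qed
  also have "\<dots> = ?C * (\<integral>\<^sup>+\<sigma>. ennreal (\<sigma> powr (a + b + 1)) * g \<sigma> * indicator {0<..} \<sigma> \<partial>lborel)"
    by (rule nn_integral_cmult) measurable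
  finally show "(\<integral>\<^sup>+s. (\<integral>\<^sup>+t. ennreal (s powr a * t powr b) * g (s + t) \<partial>HL) \<partial>HL) =
      ?C * (\<integral>\<^sup>+\<sigma>. ennreal (\<sigma> powr (a + b + 1)) * g \<sigma> \<partial>HL)" by (simp only: nn_integral_HL)
qed

lemma rtrace_mat1_mult: "B \<in> carrier_mat 1 1 \<Longrightarrow> rtrace (mat1 a * B) = a * Re (B $$ (0, 0))"
  by (simp add: rtrace_def mat1_def scalar_prod_def One_nat_def)

lemma ennreal_mult_assoc: "0 \<le> w \<Longrightarrow> 0 \<le> r \<Longrightarrow> (A * ennreal w) * ennreal r = A * ennreal (w * r)"
  by (simp add: mult.assoc ennreal_mult)

lemma ennreal_mult_assoc': "0 \<le> w \<Longrightarrow> 0 \<le> r \<Longrightarrow> ennreal w * (ennreal r * A) = ennreal (w * r) * A"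
  by (simp add: mult.assoc ennreal_mult)

lemma ennreal_mult_swap: "0 \<le> w \<Longrightarrow> 0 \<le> r \<Longrightarrow> ennreal w * (A * ennreal r) = A * ennreal (w * r)"
  by (simp add: ennreal_mult mult_ac)

lemma ul_ul: "j \<le> m \<Longrightarrow> ul j (ul m x) = ul j x"
  by (rule eq_matI) (simp_all add: ul_def)

lemma ul_self: "x \<in> carrier_mat m m \<Longrightarrow> ul m x = x"
  by (rule eq_matI) (auto simp: ul_def)

text \<open>Indices start at 0: this is the Schur complement of the leading j x j block inside the
  leading block of size j + 1, or the square of a diagonal entry of the Cholesky factor.\<close>

definition pivot :: "nat \<Rightarrow> complex mat \<Rightarrow> real" where
  "pivot j x = rdet (ul (Suc j) x) / rdet (ul j x)"

definition gamma_dens :: "real \<Rightarrow> real \<Rightarrow> real \<Rightarrow> real" where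
  "gamma_dens a c s = s powr (a - 1) * exp (- (c * s)) * c powr a / Gamma a"

lemma gamma_dens_borel [measurable]: "gamma_dens a c \<in> borel_measurable borel"
  unfolding gamma_dens_def by measurable

lemma nn_integral_gamma_dens:
  assumes "0 < a" "0 < c"
  shows "(\<integral>\<^sup>+s. ennreal (gamma_dens a c s) \<partial>HL) = 1"
proof -
  have "(\<integral>\<^sup>+s. ennreal (gamma_dens a c s) \<partial>HL) =
      (\<integral>\<^sup>+s. ennreal (c powr a / Gamma a) * (ennreal (s powr (a - 1) * exp (- (c * s))) * indicator {0<..} s) \<partial>lborel)"
    unfolding nn_integral_HL gamma_dens_def using Gamma_real_pos[of a] assms
    by (intro nn_integral_cong) (simp add: ennreal_mult[symmetric] mult_ac indicator_def)
  also have "\<dots> = ennreal (c powr a / Gamma a) * ennreal (Gamma a * c powr (- a))"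
    using nn_integral_gamma[of "a - 1" c] assms by (simp add: nn_integral_cmult)
  also have "\<dots> = 1"
  proof -
    have "Gamma a \<noteq> 0" using Gamma_real_pos[OF assms(1)] by (metis less_irrefl)
    then show ?thesis using assms by (simp add: ennreal_mult[symmetric] powr_minus field_simps)
  qed
  finally show ?thesis .
qed

context field_dim
begin

section \<open>Traces and quadratic forms in block coordinates\<close>

lemma ul_blkB: "X \<in> carrier_mat m m \<Longrightarrow> W \<in> carrier_mat m k \<Longrightarrow> S \<in> carrier_mat k k \<Longrightarrow>
    minv X \<in> carrier_mat m m \<Longrightarrow> ul m (blkB X W S) = X"
  unfolding blkB_def
  by (rule blocks_four_block(1)[where k=k]) (auto intro!: add_carrier_mat mult_carrier_mat[of _ _ m])

lemma rdet_minv: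
  assumes A: "A \<in> posdef d m"
  shows "rdet (minv A) = 1 / rdet A"
proof -
  note i = minv_posdef_carrier[OF d A]
  have "det A * det (minv A) = 1"
    using det_mult[OF posdef_carrier[OF A] i(1)] i(2) by simp
  then have "complex_of_real (rdet A * rdet (minv A)) = 1"
    using det_herm_real[OF posdef_herm[OF A]] det_herm_real[OF minv_herm[OF d A]] by simp
  then have "rdet A * rdet (minv A) = 1" using of_real_eq_1_iff by blast
  then show ?thesis using rdet_pos[OF A] by (simp add: field_simps)
qed

lemma qf_blkB:
  assumes X: "X \<in> posdef d m" and W: "W \<in> mats d m k" and S: "S \<in> herm d k"
    and u: "u \<in> carrier_mat m 1" and v: "v \<in> carrier_mat k 1"
  shows "qf (blkB X W S) (four_block_mat u (0\<^sub>m m 0) v (0\<^sub>m k 0)) = qf X (u + minv X * W * v) + qf S v"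
proof -
  note c = posdef_carrier[OF X] matsD[OF W] hermD(2)[OF S] minv_posdef_carrier(1)[OF d X]
  have M: "minv X * W \<in> carrier_mat m k" by (rule mult_carrier_mat[OF c(4,2)])
  have Mv: "minv X * W * v \<in> carrier_mat m 1" by (rule mult_carrier_mat[OF M v])
  have T: "trB m k W X \<in> carrier_mat (m + k) (m + k)" unfolding trB_def by auto
  have D: "four_block_mat X (0\<^sub>m m k) (0\<^sub>m k m) S \<in> carrier_mat (m + k) (m + k)" using c by auto
  have uv: "four_block_mat u (0\<^sub>m m 0) v (0\<^sub>m k 0) \<in> carrier_mat (m + k) 1"
    using four_block_carrier_mat[OF u, of "0\<^sub>m k 0" k 0 "0\<^sub>m m 0" v] by simp
  have "mat_adjoint (trB m k W X) * four_block_mat u (0\<^sub>m m 0) v (0\<^sub>m k 0) =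
      four_block_mat (u + minv X * W * v) (0\<^sub>m m 0) v (0\<^sub>m k 0)"
    unfolding blkB_factor(2)[OF X c(2,3)] using c M Mv u v
    by (subst mult_four_block_mat[of _ m m _ k _ k _ _ 1 _ 0]) (simp_all add: left_mult_zero_mat[OF u] del: assoc_mult_mat)
  then show ?thesis
    unfolding blkB_factor(1)[OF X c(2,3)] qf_congr[OF T D uv]
    using qf_diag[OF c(1,3) _ v, of "u + minv X * W * v"] u Mv by simp
qed

text \<open>Z enters \<open>blkA\<close> additively and only in the upper left corner, so its share
  of the trace sees only the leading block X. The remainder depends on W and C but no longer on Z,
  which lets the integrals over the blocks of the parameter factorize.\<close>

lemma rtrace_blkA_split:
  assumes Z: "Z \<in> carrier_mat m m" and W: "W \<in> carrier_mat m k" and C: "C \<in> posdef d k"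
    and x: "X \<in> carrier_mat m m" "U \<in> carrier_mat m k" "V \<in> carrier_mat k m" "S \<in> carrier_mat k k"
  shows "rtrace (blkA Z W C * four_block_mat X U V S) =
    rtrace (Z * X) + rtrace (blkA (0\<^sub>m m m) W C * four_block_mat X U V S)"
proof -
  have N: "W * minv C * mat_adjoint W \<in> carrier_mat m m"
    using W minv_posdef_carrier(1)[OF d C] by (intro mult_carrier_mat[of _ _ k]) auto
  let ?P = "four_block_mat Z (0\<^sub>m m k) (0\<^sub>m k m) (0\<^sub>m k k)" and ?x = "four_block_mat X U V S"
  have c: "blkA (0\<^sub>m m m) W C \<in> carrier_mat (m + k) (m + k)" "?P \<in> carrier_mat (m + k) (m + k)"
    "?x \<in> carrier_mat (m + k) (m + k)"
    unfolding blkA_def using Z W posdef_carrier[OF C] N x by auto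
  have eq: "blkA Z W C = ?P + blkA (0\<^sub>m m m) W C"
    unfolding blkA_def using Z W posdef_carrier[OF C] N
    by (subst add_four_block_mat[of _ m m _ k _ k]) (auto simp del: assoc_mult_mat)
  have "?P * ?x = four_block_mat (Z * X) (Z * U) (0\<^sub>m k m) (0\<^sub>m k k)"
    using Z x by (subst mult_four_block_mat[of _ m m _ k _ k _ _ m _ k])
      (auto simp: left_mult_zero_mat[OF x(1)] left_mult_zero_mat[OF x(2)] left_mult_zero_mat[OF x(3)] left_mult_zero_mat[OF x(4)] mult_carrier_mat[OF Z x(1)] mult_carrier_mat[OF Z x(2)])
  then have "rtrace (?P * ?x) = rtrace (Z * X)"
    using Z x by (simp add: rtrace_four_block[of _ m _ k] mult_carrier_mat[OF Z x(1)]) (simp add: rtrace_def)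
  moreover have "rtrace (blkA Z W C * ?x) = rtrace (?P * ?x) + rtrace (blkA (0\<^sub>m m m) W C * ?x)"
    unfolding eq add_mult_distrib_mat[OF c(2,1,3)]
    by (rule rtrace_add[where n="m + k"]) (intro mult_carrier_mat[where n="m + k"] c)+
  ultimately show ?thesis by simp
qed

text \<open>With Z = 0 and a 1 x 1 corner the matrix has rank one: it is V times 1/c times the
  adjoint of V, where V stacks q on top of c. Cyclicity of the trace then gives the quadratic form
  of x at V.\<close>

lemma rtrace_rank_one:
  assumes q: "q \<in> carrier_mat m 1" and c: "0 < c" and x: "x \<in> carrier_mat (m + 1) (m + 1)"
  shows "rtrace (blkA (0\<^sub>m m m) q (mat1 c) * x) = 1 / c * qf x (four_block_mat q (0\<^sub>m m 0) (mat1 c) (0\<^sub>m 1 0))"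
proof -
  let ?V = "four_block_mat q (0\<^sub>m m 0) (mat1 c) (0\<^sub>m 1 0)" and ?K = "mat1 (1 / c)"
  have V: "?V \<in> carrier_mat (m + 1) 1"
    using four_block_carrier_mat[OF q, of "0\<^sub>m 1 0" 1 0 "0\<^sub>m m 0" "mat1 c"] by simp
  have V': "mat_adjoint ?V \<in> carrier_mat 1 (m + 1)" using V by simp
  have e: "(A * ?K * mat_adjoint B) $$ (i, j) = A $$ (i, 0) * complex_of_real (1 / c) * cnj (B $$ (j, 0))"
    if "A \<in> carrier_mat n 1" "B \<in> carrier_mat n 1" "i < n" "j < n" for A B n i j
    using that by (simp add: scalar_prod_def One_nat_def mat1_def)
  have N: "q * ?K * mat_adjoint q \<in> carrier_mat m m"
    using q by (intro mult_carrier_mat[of _ _ 1]) auto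
  have "blkA (0\<^sub>m m m) q (mat1 c) = ?V * ?K * mat_adjoint ?V"
  proof (rule eq_matI)
    have dims: "dim_row (?V * ?K * mat_adjoint ?V) = m + 1" "dim_col (?V * ?K * mat_adjoint ?V) = m + 1"
      using V q by simp_all
    fix i j assume "i < dim_row (?V * ?K * mat_adjoint ?V)" "j < dim_col (?V * ?K * mat_adjoint ?V)"
    then have ij: "i < m + 1" "j < m + 1" unfolding dims .
    show "blkA (0\<^sub>m m m) q (mat1 c) $$ (i, j) = (?V * ?K * mat_adjoint ?V) $$ (i, j)"
    proof -
      have mi: "minv (mat1 c) = mat1 (1 / c)" using c by (intro minv_mat1) simp
      have ij': "\<not> i < m \<Longrightarrow> i = m" "\<not> j < m \<Longrightarrow> j = m" using ij by auto
      have [simp]: "dim_row (mat1 c) = 1" "dim_col (mat1 c) = 1" "mat1 c $$ (0, 0) = complex_of_real c"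
        by (simp_all add: mat1_def)
      show ?thesis
      proof (cases "i < m")
        case i: True
        show ?thesis
        proof (cases "j < m")
          case True
          then show ?thesis unfolding e[OF V V ij] blkA_def mi using i ij q N e[OF q q i True] by (simp del: assoc_mult_mat index_mult_mat)
        next
          case False
          then show ?thesis unfolding e[OF V V ij] blkA_def mi using i ij' ij q N c by (simp del: assoc_mult_mat index_mult_mat)
        qed
      next
        case i: False
        show ?thesis
        proof (cases "j < m")
          case True
          then show ?thesis unfolding e[OF V V ij] blkA_def mi using i ij' ij q N c by (simp del: assoc_mult_mat index_mult_mat)
        next
          case False
          then show ?thesis unfolding e[OF V V ij] blkA_def mi using i ij' ij q N c by (simp del: assoc_mult_mat index_mult_mat)
        qed
      qed
    qed
  next
    have mi: "minv (mat1 c) = mat1 (1 / c)" using c by (intro minv_mat1) simp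
    have "blkA (0\<^sub>m m m) q (mat1 c) \<in> carrier_mat (m + 1) (m + 1)"
      unfolding blkA_def mi using N by (intro four_block_carrier_mat add_carrier_mat) auto
    moreover have "?V * ?K * mat_adjoint ?V \<in> carrier_mat (m + 1) (m + 1)"
      by (rule mult_carrier_mat[OF mult_carrier_mat[OF V mat1_carrier] V'])
    ultimately show "dim_row (blkA (0\<^sub>m m m) q (mat1 c)) = dim_row (?V * ?K * mat_adjoint ?V)"
      "dim_col (blkA (0\<^sub>m m m) q (mat1 c)) = dim_col (?V * ?K * mat_adjoint ?V)" by (metis carrier_matD)+
  qed
  then have "rtrace (blkA (0\<^sub>m m m) q (mat1 c) * x) = rtrace (?V * ?K * mat_adjoint ?V * x)" by simp
  also have "?V * ?K * mat_adjoint ?V * x = ?V * (?K * (mat_adjoint ?V * x))"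
    unfolding assoc_mult_mat[OF mult_carrier_mat[OF V mat1_carrier] V' x]
    by (rule assoc_mult_mat[OF V mat1_carrier mult_carrier_mat[OF V' x]])
  also have "rtrace \<dots> = rtrace (?K * (mat_adjoint ?V * x) * ?V)"
    by (rule rtrace_comm[OF V mult_carrier_mat[OF mat1_carrier mult_carrier_mat[OF V' x]]])
  also have "?K * (mat_adjoint ?V * x) * ?V = ?K * (mat_adjoint ?V * x * ?V)"
    by (rule assoc_mult_mat[OF mat1_carrier mult_carrier_mat[OF V' x] V])
  also have "rtrace (?K * (mat_adjoint ?V * x * ?V)) = 1 / c * qf x ?V"
  proof -
    have "mat_adjoint ?V * x * ?V \<in> carrier_mat 1 1"
      by (rule mult_carrier_mat[OF mult_carrier_mat[OF V' x] V])
    from rtrace_mat1_mult[OF this] show ?thesis unfolding qf_def .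
  qed
  finally show ?thesis .
qed

text \<open>The same exponent with the square completed in two ways. The first is centred in the
  border q of the parameter and is used to integrate against a prior; the second is centred in the
  border u of the observation and is used to integrate the Wishart density.\<close>

lemma rtrace_blkA_blkB:
  assumes Z: "Z \<in> herm d m" and q: "q \<in> mats d m 1" and c: "0 < c"
    and X: "X \<in> posdef d m" and u: "u \<in> mats d m 1"
  shows "rtrace (blkA Z q (mat1 c) * blkB X u (mat1 s)) =
      rtrace (Z * X) + c * s + 1 / c * qf X (q + minv X * u * mat1 c)" (is "?l = ?r")
    and "rtrace (blkA Z q (mat1 c) * blkB X u (mat1 s)) =
      rtrace (Z * X) + c * s + c * qf (minv X) (u + X * q * mat1 (1 / c))"
proof -
  note k = hermD(2)[OF Z] matsD[OF q] posdef_carrier[OF X] matsD[OF u] minv_posdef_carrier[OF d X]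
  have C: "mat1 c \<in> posdef d 1" using c by (simp add: mat1_posdef_iff)
  have N: "mat1 s + mat_adjoint u * minv X * u \<in> carrier_mat 1 1"
    using k by (intro add_carrier_mat mult_carrier_mat[of _ _ m]) auto
  have x: "blkB X u (mat1 s) \<in> carrier_mat (m + 1) (m + 1)" unfolding blkB_def using k N by auto
  have "?l = rtrace (Z * X) + rtrace (blkA (0\<^sub>m m m) q (mat1 c) * blkB X u (mat1 s))"
    unfolding blkB_def
    by (rule rtrace_blkA_split[OF k(1,2) C k(3,4) _ N]) (use k in simp)
  also have "\<dots> = ?r"
    unfolding rtrace_rank_one[OF k(2) c x] qf_blkB[OF X u mat1_herm k(2) mat1_carrier] qf_mat1[OF mat1_carrier]
    using c by (simp add: mat1_def power2_eq_square field_simps)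
  finally show 1: "?l = ?r" .
  let ?w = "u + X * q * mat1 (1 / c)"
  have Xq1: "X * q \<in> carrier_mat m 1" by (rule mult_carrier_mat[OF k(3,2)])
  note Xq = Xq1 mult_carrier_mat[OF Xq1 mat1_carrier[of "1 / c"]]
  have w: "?w \<in> carrier_mat m 1" using k Xq by auto
  have "minv X * ?w * mat1 c = q + minv X * u * mat1 c"
  proof -
    have 2: "minv X * (X * q * mat1 (1 / c)) = q * mat1 (1 / c)"
    proof -
      have "minv X * (X * q * mat1 (1 / c)) = (minv X * (X * q)) * mat1 (1 / c)"
        by (rule assoc_mult_mat[symmetric, OF k(5) Xq(1) mat1_carrier])
      also have "minv X * (X * q) = minv X * X * q" by (rule assoc_mult_mat[symmetric, OF k(5,3,2)])
      finally show ?thesis using k by simp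
    qed
    have "q * mat1 (1 / c) * mat1 c = q * (mat1 (1 / c) * mat1 c)"
      by (rule assoc_mult_mat[OF k(2) mat1_carrier mat1_carrier])
    also have "mat1 (1 / c) * mat1 c = 1\<^sub>m 1"
      by (rule eq_matI) (use c in \<open>auto simp: mat1_def scalar_prod_def One_nat_def\<close>)
    finally have 3: "q * mat1 (1 / c) * mat1 c = q" using k by simp
    have ku1: "minv X * u \<in> carrier_mat m 1" by (rule mult_carrier_mat[OF k(5,4)])
    note ku = ku1 mult_carrier_mat[OF k(2) mat1_carrier[of "1 / c"]] mult_carrier_mat[OF ku1 mat1_carrier[of c]]
    have "minv X * ?w * mat1 c = (minv X * u + q * mat1 (1 / c)) * mat1 c"
      unfolding mult_add_distrib_mat[OF k(5,4) Xq(2)] 2 ..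
    also have "\<dots> = minv X * u * mat1 c + q"
      unfolding add_mult_distrib_mat[OF ku(1,2) mat1_carrier] 3 ..
    also have "\<dots> = q + minv X * u * mat1 c" by (rule comm_add_mat[OF ku(3) k(2)])
    finally show ?thesis .
  qed
  then have "qf X (q + minv X * u * mat1 c) = c\<^sup>2 * qf X (minv X * ?w)"
    using qf_scale_arg[OF k(3), of "minv X * ?w" c] k w by simp
  also have "qf X (minv X * ?w) = qf (minv X) ?w"
  proof -
    have "qf (minv X * X * mat_adjoint (minv X)) ?w = qf X (mat_adjoint (minv X) * ?w)"
      by (rule qf_congr[OF k(5,3) w])
    then show ?thesis using k hermD(3)[OF minv_herm[OF d X]] by simp
  qed
  finally show "?l = rtrace (Z * X) + c * s + c * qf (minv X) ?w"
    unfolding 1 using c by (simp add: power2_eq_square)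
qed

lemma meas_mat1_PD:
  assumes f: "f \<in> N \<rightarrow>\<^sub>M HL"
  shows "(\<lambda>x. mat1 (f x)) \<in> N \<rightarrow>\<^sub>M PD d 1"
  by (rule meas_PD_of_herm[OF meas_mat1[OF meas_HL_real[OF f]]])
     (use measurable_space[OF f] in \<open>simp add: mat1_posdef_iff\<close>)

lemma nn_integral_PD_Suc:
  assumes f: "f \<in> borel_measurable (PD d (m + 1))"
  shows "(\<integral>\<^sup>+x. f x \<partial>PD d (m + 1)) =
    (\<integral>\<^sup>+X. (\<integral>\<^sup>+s. (\<integral>\<^sup>+u. f (blkB X u (mat1 s)) \<partial>mats_lebesgue d m 1) \<partial>HL) \<partial>PD d m)"
  unfolding nn_integral_PD_blkB[OF f]
proof (rule nn_integral_cong)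
  interpret M: sigma_finite_measure "mats_lebesgue d m 1" by (rule sigma_finite_mats[OF d])
  fix X assume X: "X \<in> space (PD d m)"
  have "(\<lambda>S. \<integral>\<^sup>+u. f (blkB X u S) \<partial>mats_lebesgue d m 1) \<in> borel_measurable (PD d 1)"
    by (rule M.borel_measurable_nn_integral, unfold split_beta', rule measurable_compose[OF meas_blkB_PD f]) (use X in auto)
  then show "(\<integral>\<^sup>+S. (\<integral>\<^sup>+W. f (blkB X W S) \<partial>mats_lebesgue d m 1) \<partial>PD d 1) =
      (\<integral>\<^sup>+s. (\<integral>\<^sup>+u. f (blkB X u (mat1 s)) \<partial>mats_lebesgue d m 1) \<partial>HL)"
    unfolding nn_integral_HL by (rule nn_integral_PD_1)
qed

lemma ul_posdef: "x \<in> posdef d m \<Longrightarrow> j \<le> m \<Longrightarrow> ul j x \<in> posdef d j"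
proof -
  assume x: "x \<in> posdef d m" and j: "j \<le> m"
  then have x1: "x \<in> posdef d (j + (m - j))" by simp
  note h = herm_blocks[OF posdef_herm[OF x1]]
  show ?thesis using posdef_principal(1)[OF _ h(1,2,3)] x1 h(4) by simp
qed

lemma pivot_pos: "x \<in> posdef d m \<Longrightarrow> j < m \<Longrightarrow> 0 < pivot j x"
  unfolding pivot_def by (intro divide_pos_pos rdet_pos[OF ul_posdef[of x m]]) auto

lemma meas_ul_PD: "A \<in> N \<rightarrow>\<^sub>M PD d m \<Longrightarrow> j \<le> m \<Longrightarrow> (\<lambda>x. ul j (A x)) \<in> N \<rightarrow>\<^sub>M PD d j"
proof (rule meas_PD_of_herm)
  assume A: "A \<in> N \<rightarrow>\<^sub>M PD d m" and j: "j \<le> m"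
  have "A \<in> N \<rightarrow>\<^sub>M herm_lebesgue d (j + (m - j))" using meas_herm_of_PD[OF A] j by simp
  then show "(\<lambda>x. ul j (A x)) \<in> N \<rightarrow>\<^sub>M herm_lebesgue d j" by (rule meas_ul)
  show "ul j (A x) \<in> posdef d j" if "x \<in> space N" for x by (rule ul_posdef[OF meas_PD_space[OF A that] j])
qed

lemma meas_pivot: "A \<in> N \<rightarrow>\<^sub>M PD d m \<Longrightarrow> j < m \<Longrightarrow> (\<lambda>x. pivot j (A x)) \<in> N \<rightarrow>\<^sub>M HL"
proof -
  assume A: "A \<in> N \<rightarrow>\<^sub>M PD d m" and j: "j < m"
  have "(\<lambda>x. pivot j (A x)) \<in> borel_measurable N"
    unfolding pivot_def
    by (intro borel_measurable_divide meas_rdet[OF meas_mats_of_PD[OF meas_ul_PD[OF A]]]) (use j in auto)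
  moreover have "(\<lambda>x. pivot j (A x)) \<in> space N \<rightarrow> {0<..}"
    using pivot_pos[OF meas_PD_space[OF A] j] by auto
  ultimately show ?thesis unfolding HL_def by (simp add: measurable_restrict_space2_iff)
qed

section \<open>The Wishart density, one row at a time\<close>

definition wkernel :: "real \<Rightarrow> complex mat \<Rightarrow> complex mat \<Rightarrow> real" where
  "wkernel \<kappa> \<xi> x = rdet x powr \<kappa> * exp (- rtrace (\<xi> * x))"

lemma wkernel_nonneg [simp]: "0 \<le> wkernel \<kappa> \<xi> x"
  by (simp add: wkernel_def)

lemma meas_trace_prod:
  assumes "A \<in> N \<rightarrow>\<^sub>M mats_lebesgue d m m" "B \<in> N \<rightarrow>\<^sub>M mats_lebesgue d m m"
  shows "(\<lambda>x. rtrace (A x * B x)) \<in> borel_measurable N"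
  by (intro meas_rtrace[where m=m] meas_mult[where q=m] assms)

lemma meas_wkernel:
  assumes "\<xi> \<in> N \<rightarrow>\<^sub>M PD d m" "A \<in> N \<rightarrow>\<^sub>M PD d m"
  shows "(\<lambda>x. wkernel \<kappa> (\<xi> x) (A x)) \<in> borel_measurable N"
proof -
  have [measurable]: "(\<lambda>x. rdet (A x)) \<in> borel_measurable N" by (rule meas_rdet[OF meas_mats_of_PD[OF assms(2)]])
  have [measurable]: "(\<lambda>x. rtrace (\<xi> x * A x)) \<in> borel_measurable N"
    by (rule meas_trace_prod[OF meas_mats_of_PD[OF assms(1)] meas_mats_of_PD[OF assms(2)]])
  show ?thesis unfolding wkernel_def by measurable
qed

lemma meas_wkernel_const:
  assumes "\<xi> \<in> posdef d m"
  shows "(\<lambda>x. ennreal (wkernel \<kappa> \<xi> x)) \<in> borel_measurable (PD d m)"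
proof -
  have 1: "(\<lambda>_. \<xi>) \<in> PD d m \<rightarrow>\<^sub>M PD d m" using assms by (intro measurable_const) simp
  have 2: "(\<lambda>x. x) \<in> PD d m \<rightarrow>\<^sub>M PD d m" by simp
  show ?thesis by (rule measurable_compose[OF meas_wkernel[OF 1 2] measurable_ennreal])
qed

text \<open>Given the leading block X and the pivot s, the border u of x is Gaussian with quadratic
  form c times the inverse of X. Integrating it out leaves a power of c and
  \<open>rdet X powr (d / 2)\<close>, which raises the exponent of the smaller kernel; X and s no
  longer interact except through F.\<close>

lemma nn_integral_wkernel_Suc:
  assumes Z: "Z \<in> posdef d m" and q: "q \<in> mats d m 1" and c: "0 < c"
    and F: "(\<lambda>(X, s). F X s) \<in> borel_measurable (PD d m \<Otimes>\<^sub>M HL)"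
  shows "(\<integral>\<^sup>+x. F (ul m x) (pivot m x) * ennreal (wkernel \<kappa> (blkA Z q (mat1 c)) x) \<partial>PD d (m + 1)) =
    ennreal (c powr (- (real m * real d / 2)) * gauss m) *
      (\<integral>\<^sup>+X. (\<integral>\<^sup>+s. F X s * ennreal (s powr \<kappa> * exp (- (c * s))) \<partial>HL) * ennreal (wkernel (\<kappa> + real d / 2) Z X) \<partial>PD d m)"
proof -
  let ?M = "mats_lebesgue d m 1" and ?\<xi> = "blkA Z q (mat1 c)"
  let ?k = "c powr (- (real m * real d / 2)) * gauss m"
  interpret HL: sigma_finite_measure HL by (rule sigma_finite_HL)
  have C: "mat1 c \<in> posdef d 1" using c by (simp add: mat1_posdef_iff)
  have \<xi>: "?\<xi> \<in> posdef d (m + 1)" using posdef_blkA_iff[OF posdef_herm[OF Z] q C] Z by simp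
  have id: "(\<lambda>x. x) \<in> PD d k \<rightarrow>\<^sub>M PD d k" for k by simp
  have FP: "(\<lambda>x. F (ul m x) (pivot m x)) \<in> borel_measurable (PD d (m + 1))"
    using measurable_compose[OF measurable_Pair[OF meas_ul_PD[OF id[of "m + 1"], of m] meas_pivot[OF id[of "m + 1"], of m]] F] by simp
  have f: "(\<lambda>x. F (ul m x) (pivot m x) * ennreal (wkernel \<kappa> ?\<xi> x)) \<in> borel_measurable (PD d (m + 1))"
    by (intro borel_measurable_times_ennreal FP meas_wkernel_const \<xi>)
  have kp: "0 \<le> ?k" using gauss_pos[of m] by simp
  have Fs: "(\<lambda>s. F X s) \<in> borel_measurable HL" if "X \<in> posdef d m" for X
    using measurable_compose[OF measurable_Pair1' F, of X] that by simp
  have es: "(\<lambda>s. ennreal (s powr \<kappa> * exp (- (c * s)))) \<in> borel_measurable HL" by (rule borel_HL) measurable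
  have "(\<integral>\<^sup>+x. F (ul m x) (pivot m x) * ennreal (wkernel \<kappa> ?\<xi> x) \<partial>PD d (m + 1)) =
      (\<integral>\<^sup>+X. (\<integral>\<^sup>+s. (\<integral>\<^sup>+u. F (ul m (blkB X u (mat1 s))) (pivot m (blkB X u (mat1 s))) *
        ennreal (wkernel \<kappa> ?\<xi> (blkB X u (mat1 s))) \<partial>?M) \<partial>HL) \<partial>PD d m)"
    by (rule nn_integral_PD_Suc[OF f])
  also have "\<dots> = (\<integral>\<^sup>+X. ennreal ?k * ((\<integral>\<^sup>+s. F X s * ennreal (s powr \<kappa> * exp (- (c * s))) \<partial>HL) *
      ennreal (wkernel (\<kappa> + real d / 2) Z X)) \<partial>PD d m)"
  proof (rule nn_integral_cong)
    fix X assume "X \<in> space (PD d m)"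
    then have X: "X \<in> posdef d m" by simp
    note Xc = posdef_carrier[OF X] minv_posdef_carrier(1)[OF d X]
    have "(\<integral>\<^sup>+s. (\<integral>\<^sup>+u. F (ul m (blkB X u (mat1 s))) (pivot m (blkB X u (mat1 s))) *
        ennreal (wkernel \<kappa> ?\<xi> (blkB X u (mat1 s))) \<partial>?M) \<partial>HL) =
        (\<integral>\<^sup>+s. F X s * ennreal (s powr \<kappa> * exp (- (c * s))) * ennreal (?k * wkernel (\<kappa> + real d / 2) Z X) \<partial>HL)"
    proof (rule nn_integral_cong)
      fix s assume "s \<in> space HL"
      then have s: "0 < s" by simp
      let ?b = "X * q * mat1 (1 / c)"
      have b: "?b \<in> mats d m 1"
        by (intro mats_mult[where q=1] mats_mult[where q=m] q hermD(1)[OF posdef_herm[OF X]] hermD(1)[OF mat1_herm])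
      have eq: "F (ul m (blkB X u (mat1 s))) (pivot m (blkB X u (mat1 s))) * ennreal (wkernel \<kappa> ?\<xi> (blkB X u (mat1 s))) =
          (F X s * ennreal (s powr \<kappa> * exp (- (c * s))) * ennreal (wkernel \<kappa> Z X)) * ennreal (exp (- (c * qf (minv X) (u + ?b))))"
        if u: "u \<in> mats d m 1" for u
      proof -
        note uc = matsD[OF u]
        have ul: "ul m (blkB X u (mat1 s)) = X" by (rule ul_blkB[OF Xc(1) uc mat1_carrier Xc(2)])
        have x: "blkB X u (mat1 s) \<in> posdef d (m + 1)"
          using posdef_blkB_iff[OF X u mat1_herm] mat1_posdef_iff s by simp
        have det: "rdet (blkB X u (mat1 s)) = rdet X * s"
          using det_blkB(2)[OF X uc mat1_herm] by simp
        have "pivot m (blkB X u (mat1 s)) = s"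
          unfolding pivot_def ul using ul_self[OF posdef_carrier[OF x]] det rdet_pos[OF X] by (simp add: Suc_eq_plus1)
        moreover have "wkernel \<kappa> ?\<xi> (blkB X u (mat1 s)) =
            (s powr \<kappa> * exp (- (c * s))) * wkernel \<kappa> Z X * exp (- (c * qf (minv X) (u + ?b)))"
          unfolding wkernel_def det rtrace_blkA_blkB(2)[OF posdef_herm[OF Z] q c X u]
          using rdet_pos[OF X] s by (simp add: powr_mult exp_add[symmetric] exp_minus field_simps)
        ultimately show ?thesis unfolding ul by (simp add: ennreal_mult mult_ac)
      qed
      have "(\<integral>\<^sup>+u. F (ul m (blkB X u (mat1 s))) (pivot m (blkB X u (mat1 s))) *
          ennreal (wkernel \<kappa> ?\<xi> (blkB X u (mat1 s))) \<partial>?M) =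
          (\<integral>\<^sup>+u. (F X s * ennreal (s powr \<kappa> * exp (- (c * s))) * ennreal (wkernel \<kappa> Z X)) *
            ennreal (exp (- (c * qf (minv X) (u + ?b)))) \<partial>?M)"
        by (rule nn_integral_cong) (simp add: eq)
      also have "\<dots> = (F X s * ennreal (s powr \<kappa> * exp (- (c * s))) * ennreal (wkernel \<kappa> Z X)) *
          (\<integral>\<^sup>+u. ennreal (exp (- (c * qf (minv X) (u + ?b)))) \<partial>?M)"
      proof (rule nn_integral_cmult)
        have "(\<lambda>u. u + ?b) \<in> ?M \<rightarrow>\<^sub>M ?M" by (rule meas_add) (use b in auto)
        from measurable_compose[OF this meas_qf_const[OF minv_herm[OF d X], of "\<lambda>x. ennreal (exp (- (c * x)))"]]
        show "(\<lambda>u. ennreal (exp (- (c * qf (minv X) (u + ?b))))) \<in> borel_measurable ?M" by simp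
      qed
      also have "(\<integral>\<^sup>+u. ennreal (exp (- (c * qf (minv X) (u + ?b)))) \<partial>?M) =
          ennreal (rdet (minv X) powr (- (real d / 2)) * c powr (- (real m * real d / 2)) * gauss m)"
        by (rule nn_integral_gauss[OF minv_posdef[OF d X] c b])
      also have "rdet (minv X) powr (- (real d / 2)) = rdet X powr (real d / 2)"
        unfolding rdet_minv[OF X] using rdet_pos[OF X] by (simp add: powr_divide powr_minus_divide)
      also have "(F X s * ennreal (s powr \<kappa> * exp (- (c * s))) * ennreal (wkernel \<kappa> Z X)) *
          ennreal (rdet X powr (real d / 2) * c powr (- (real m * real d / 2)) * gauss m) =
          F X s * ennreal (s powr \<kappa> * exp (- (c * s))) * ennreal (?k * wkernel (\<kappa> + real d / 2) Z X)"
      proof -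
        have "wkernel \<kappa> Z X * (rdet X powr (real d / 2) * c powr (- (real m * real d / 2)) * gauss m) =
            ?k * wkernel (\<kappa> + real d / 2) Z X"
          by (simp add: wkernel_def powr_add)
        moreover have "0 \<le> rdet X powr (real d / 2) * c powr (- (real m * real d / 2)) * gauss m"
          using gauss_pos[of m] by simp
        ultimately show ?thesis by (simp only: ennreal_mult_assoc[OF wkernel_nonneg])
      qed
      finally show "(\<integral>\<^sup>+u. F (ul m (blkB X u (mat1 s))) (pivot m (blkB X u (mat1 s))) *
          ennreal (wkernel \<kappa> ?\<xi> (blkB X u (mat1 s))) \<partial>?M) =
          F X s * ennreal (s powr \<kappa> * exp (- (c * s))) * ennreal (?k * wkernel (\<kappa> + real d / 2) Z X)" .
    qed
    also have "\<dots> = (\<integral>\<^sup>+s. F X s * ennreal (s powr \<kappa> * exp (- (c * s))) \<partial>HL) * ennreal (?k * wkernel (\<kappa> + real d / 2) Z X)"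
      by (intro nn_integral_multc borel_measurable_times_ennreal Fs[OF X] es)
    finally show "(\<integral>\<^sup>+s. (\<integral>\<^sup>+u. F (ul m (blkB X u (mat1 s))) (pivot m (blkB X u (mat1 s))) *
        ennreal (wkernel \<kappa> ?\<xi> (blkB X u (mat1 s))) \<partial>?M) \<partial>HL) =
        ennreal ?k * ((\<integral>\<^sup>+s. F X s * ennreal (s powr \<kappa> * exp (- (c * s))) \<partial>HL) * ennreal (wkernel (\<kappa> + real d / 2) Z X))"
      by (simp only: ennreal_mult_swap[OF kp wkernel_nonneg])
  qed
  also have "\<dots> = ennreal ?k * (\<integral>\<^sup>+X. (\<integral>\<^sup>+s. F X s * ennreal (s powr \<kappa> * exp (- (c * s))) \<partial>HL) *
      ennreal (wkernel (\<kappa> + real d / 2) Z X) \<partial>PD d m)"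
  proof (rule nn_integral_cmult)
    have "(\<lambda>(X, s). F X s * ennreal (s powr \<kappa> * exp (- (c * s)))) \<in> borel_measurable (PD d m \<Otimes>\<^sub>M HL)"
      unfolding split_beta'
      by (intro borel_measurable_times_ennreal measurable_compose[OF measurable_snd es]) (use F in \<open>simp add: split_beta'\<close>)
    then show "(\<lambda>X. (\<integral>\<^sup>+s. F X s * ennreal (s powr \<kappa> * exp (- (c * s))) \<partial>HL) *
      ennreal (wkernel (\<kappa> + real d / 2) Z X)) \<in> borel_measurable (PD d m)"
      by (intro borel_measurable_times_ennreal HL.borel_measurable_nn_integral meas_wkernel_const Z) simp
  qed
  finally show ?thesis .
qed

text \<open>The product formula of the multivariate Gamma function, which the one-row recursion
  produces directly. \<open>Gamma_mat_eq\<close> identifies it with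
  \<open>Gamma_mat\<close>.\<close>

definition wconst :: "nat \<Rightarrow> real \<Rightarrow> real" where
  "wconst m \<mu> = (\<Prod>j<m. gauss j * Gamma (\<mu> - real j * real d / 2))"

text \<open>The exponent of the determinant is \<mu> - n / m with n the dimension of the matrix
  space, written in a form that passes from m to m + 1 uniformly, starting from m = 0.\<close>

definition wdens :: "nat \<Rightarrow> real \<Rightarrow> complex mat \<Rightarrow> complex mat \<Rightarrow> real" where
  "wdens m \<mu> \<xi> x = wkernel (\<mu> - 1 - (real m - 1) * real d / 2) \<xi> x * rdet \<xi> powr \<mu> / wconst m \<mu>"

text \<open>Positivity of all the gamma shapes that occur. In this form it is inherited by leading
  blocks and makes sense for m = 0.\<close>

definition wparam :: "nat \<Rightarrow> real \<Rightarrow> bool" where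
  "wparam m \<mu> \<longleftrightarrow> (\<forall>j<m. 0 < \<mu> - real j * real d / 2)"

lemma wparamI: "(real m - 1) * real d / 2 < \<mu> \<Longrightarrow> wparam m \<mu>"
  unfolding wparam_def
proof (intro allI impI)
  fix j assume "(real m - 1) * real d / 2 < \<mu>" "j < m"
  moreover have "real j * real d \<le> (real m - 1) * real d" using \<open>j < m\<close> by (intro mult_right_mono) auto
  ultimately show "0 < \<mu> - real j * real d / 2" by linarith
qed

lemma wparam_Suc: "wparam (m + 1) \<mu> \<Longrightarrow> wparam m \<mu> \<and> 0 < \<mu> - real m * real d / 2"
  by (simp add: wparam_def)

lemma wconst_pos: "wparam m \<mu> \<Longrightarrow> 0 < wconst m \<mu>"
  unfolding wconst_def wparam_def by (intro prod_pos) (auto intro!: mult_pos_pos gauss_pos Gamma_real_pos)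

lemma wdens_nonneg: "wparam m \<mu> \<Longrightarrow> 0 \<le> wdens m \<mu> \<xi> x"
  using wconst_pos[of m \<mu>] by (simp add: wdens_def)

lemma meas_wdens:
  assumes "\<xi> \<in> posdef d m" "A \<in> N \<rightarrow>\<^sub>M PD d m"
  shows "(\<lambda>x. wdens m \<mu> \<xi> (A x)) \<in> borel_measurable N"
  unfolding wdens_def
  by (intro borel_measurable_divide borel_measurable_times borel_measurable_const meas_wkernel[OF _ assms(2)] measurable_const)
     (use assms in simp)

text \<open>Bartlett's decomposition for one row: the last pivot is gamma distributed and
  independent of the leading block, and the leading block is again Wishart, its parameter being the
  Schur complement Z of the corner of \<xi>.\<close>

lemma nn_integral_wdens_Suc:
  assumes Z: "Z \<in> posdef d m" and q: "q \<in> mats d m 1" and c: "0 < c" and \<mu>: "wparam (m + 1) \<mu>"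
    and F: "(\<lambda>(X, s). F X s) \<in> borel_measurable (PD d m \<Otimes>\<^sub>M HL)"
  shows "(\<integral>\<^sup>+x. F (ul m x) (pivot m x) * ennreal (wdens (m + 1) \<mu> (blkA Z q (mat1 c)) x) \<partial>PD d (m + 1)) =
    (\<integral>\<^sup>+X. (\<integral>\<^sup>+s. F X s * ennreal (gamma_dens (\<mu> - real m * real d / 2) c s) \<partial>HL) * ennreal (wdens m \<mu> Z X) \<partial>PD d m)"
proof -
  interpret HL: sigma_finite_measure HL by (rule sigma_finite_HL)
  let ?\<xi> = "blkA Z q (mat1 c)" and ?a = "\<mu> - real m * real d / 2"
  note \<mu>' = wparam_Suc[OF \<mu>, THEN conjunct1] wparam_Suc[OF \<mu>, THEN conjunct2]
  have C: "mat1 c \<in> posdef d 1" using c by (simp add: mat1_posdef_iff)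
  have det: "rdet ?\<xi> = rdet Z * c"
    using det_blkA(2)[OF posdef_herm[OF Z] matsD[OF q] C] by simp
  let ?\<kappa> = "?a - 1"
  let ?L = "rdet ?\<xi> powr \<mu> / wconst (m + 1) \<mu>" and ?K = "c powr (- (real m * real d / 2)) * gauss m"
  have w1: "wconst (m + 1) \<mu> = wconst m \<mu> * (gauss m * Gamma ?a)"
    unfolding Suc_eq_plus1[symmetric] wconst_def by simp
  have pos: "0 < wconst m \<mu>" "0 < gauss m" "0 < Gamma ?a" "0 < rdet Z"
    using wconst_pos[OF \<mu>'(1)] gauss_pos[of m] Gamma_real_pos[OF \<mu>'(2)] rdet_pos[OF Z] by auto
  have L: "0 \<le> ?L" using pos by (simp add: w1)
  have id: "(\<lambda>x. x) \<in> PD d k \<rightarrow>\<^sub>M PD d k" for k by simp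
  have \<xi>: "?\<xi> \<in> posdef d (m + 1)" using posdef_blkA_iff[OF posdef_herm[OF Z] q C] Z by simp
  have es: "(\<lambda>s. ennreal (s powr ?\<kappa> * exp (- (c * s)))) \<in> borel_measurable HL" by (rule borel_HL) measurable
  have Fs: "(\<lambda>s. F X s) \<in> borel_measurable HL" if "X \<in> posdef d m" for X
    using measurable_compose[OF measurable_Pair1' F, of X] that by simp
  have exp1: "\<mu> - 1 - (real (m + 1) - 1) * real d / 2 = ?\<kappa>" by (simp add: algebra_simps)
  have exp2: "\<mu> - 1 - (real m - 1) * real d / 2 = ?\<kappa> + real d / 2" by (simp add: field_simps)
  have "(\<integral>\<^sup>+x. F (ul m x) (pivot m x) * ennreal (wdens (m + 1) \<mu> ?\<xi> x) \<partial>PD d (m + 1)) =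
      (\<integral>\<^sup>+x. ennreal ?L * (F (ul m x) (pivot m x) * ennreal (wkernel ?\<kappa> ?\<xi> x)) \<partial>PD d (m + 1))"
    unfolding wdens_def exp1 using L
    by (intro nn_integral_cong) (simp add: ennreal_mult[symmetric] mult_ac flip: times_divide_eq_right)
  also have "\<dots> = ennreal ?L * (\<integral>\<^sup>+x. F (ul m x) (pivot m x) * ennreal (wkernel ?\<kappa> ?\<xi> x) \<partial>PD d (m + 1))"
  proof (rule nn_integral_cmult)
    have "(\<lambda>x. F (ul m x) (pivot m x)) \<in> borel_measurable (PD d (m + 1))"
      using measurable_compose[OF measurable_Pair[OF meas_ul_PD[OF id[of "m + 1"], of m] meas_pivot[OF id[of "m + 1"], of m]] F] by simp
    then show "(\<lambda>x. F (ul m x) (pivot m x) * ennreal (wkernel ?\<kappa> ?\<xi> x)) \<in> borel_measurable (PD d (m + 1))"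
      by (intro borel_measurable_times_ennreal meas_wkernel_const \<xi>)
  qed
  also have "\<dots> = ennreal (?L * ?K) * (\<integral>\<^sup>+X. (\<integral>\<^sup>+s. F X s * ennreal (s powr ?\<kappa> * exp (- (c * s))) \<partial>HL) *
      ennreal (wkernel (?\<kappa> + real d / 2) Z X) \<partial>PD d m)"
    unfolding nn_integral_wkernel_Suc[OF Z q c F]
    by (rule ennreal_mult_assoc'[OF L]) (use pos in simp)
  also have "\<dots> = (\<integral>\<^sup>+X. ennreal (?L * ?K) * ((\<integral>\<^sup>+s. F X s * ennreal (s powr ?\<kappa> * exp (- (c * s))) \<partial>HL) *
      ennreal (wkernel (?\<kappa> + real d / 2) Z X)) \<partial>PD d m)"
  proof (rule nn_integral_cmult[symmetric])
    have "(\<lambda>(X, s). F X s * ennreal (s powr ?\<kappa> * exp (- (c * s)))) \<in> borel_measurable (PD d m \<Otimes>\<^sub>M HL)"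
      unfolding split_beta'
      by (intro borel_measurable_times_ennreal measurable_compose[OF measurable_snd es]) (use F in \<open>simp add: split_beta'\<close>)
    then show "(\<lambda>X. (\<integral>\<^sup>+s. F X s * ennreal (s powr ?\<kappa> * exp (- (c * s))) \<partial>HL) *
      ennreal (wkernel (?\<kappa> + real d / 2) Z X)) \<in> borel_measurable (PD d m)"
      by (intro borel_measurable_times_ennreal HL.borel_measurable_nn_integral meas_wkernel_const Z) simp
  qed
  also have "\<dots> = (\<integral>\<^sup>+X. (\<integral>\<^sup>+s. F X s * ennreal (gamma_dens ?a c s) \<partial>HL) * ennreal (wdens m \<mu> Z X) \<partial>PD d m)"
  proof (rule nn_integral_cong)
    fix X assume "X \<in> space (PD d m)"
    then have X: "X \<in> posdef d m" by simp
    have g: "F X s * ennreal (gamma_dens ?a c s) =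
        (F X s * ennreal (s powr ?\<kappa> * exp (- (c * s)))) * ennreal (c powr ?a / Gamma ?a)" for s
      using pos by (simp add: gamma_dens_def mult.assoc ennreal_mult[symmetric])
    have eq1: "(\<integral>\<^sup>+s. F X s * ennreal (gamma_dens ?a c s) \<partial>HL) =
        (\<integral>\<^sup>+s. F X s * ennreal (s powr ?\<kappa> * exp (- (c * s))) \<partial>HL) * ennreal (c powr ?a / Gamma ?a)"
      unfolding g by (intro nn_integral_multc borel_measurable_times_ennreal Fs[OF X] es)
    \<comment> \<open>This balances the powers of c: \<open>c powr \<mu>\<close> from the
      determinant of the parameter and \<open>c powr (- (m * d / 2))\<close> from the Gaussian
      integral make up exactly the power required by the gamma density.\<close>
    have eq2: "?L * ?K * wkernel (?\<kappa> + real d / 2) Z X = c powr ?a / Gamma ?a * wdens m \<mu> Z X"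
    proof -
      have "c powr ?a = c powr \<mu> * c powr (- (real m * real d / 2))"
        by (simp add: powr_add[symmetric])
      then show ?thesis unfolding wdens_def exp2 w1 det using pos c
        by (simp add: powr_mult field_simps)
    qed
    show "ennreal (?L * ?K) * ((\<integral>\<^sup>+s. F X s * ennreal (s powr ?\<kappa> * exp (- (c * s))) \<partial>HL) *
        ennreal (wkernel (?\<kappa> + real d / 2) Z X)) =
        (\<integral>\<^sup>+s. F X s * ennreal (gamma_dens ?a c s) \<partial>HL) * ennreal (wdens m \<mu> Z X)"
    proof -
      have 1: "0 \<le> ?L * ?K" by (rule mult_nonneg_nonneg[OF L]) (use pos in simp)
      have 2: "0 \<le> c powr ?a / Gamma ?a" using pos by simp
      show ?thesis
        unfolding eq1 ennreal_mult_swap[OF 1 wkernel_nonneg] ennreal_mult_assoc[OF 2 wdens_nonneg[OF \<mu>'(1)]]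
        by (simp only: eq2)
    qed
  qed
  finally show ?thesis .
qed

lemma posdef_Suc_cases:
  assumes "\<xi> \<in> posdef d (m + 1)"
  obtains Z q c where "Z \<in> posdef d m" "q \<in> mats d m 1" "0 < c" "\<xi> = blkA Z q (mat1 c)"
  using posdef_blkA_cases[OF assms] posdef_1_cases by metis

lemma nn_integral_wdens:
  "\<xi> \<in> posdef d m \<Longrightarrow> wparam m \<mu> \<Longrightarrow> (\<integral>\<^sup>+x. ennreal (wdens m \<mu> \<xi> x) \<partial>PD d m) = 1"
proof (induction m arbitrary: \<xi>)
  case 0
  have w: "wdens 0 \<mu> \<xi> x = 1" if "x \<in> posdef d 0" for x
    using posdef_carrier[OF that] posdef_carrier[OF 0(1)]
    by (simp add: wdens_def wkernel_def wconst_def rdet_def rtrace_def)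
  have empty: "herm_index d 0 = {}" by (auto simp: herm_index_def)
  have "(\<integral>\<^sup>+x. ennreal (wdens 0 \<mu> \<xi> x) \<partial>PD d 0) = (\<integral>\<^sup>+x. 1 \<partial>herm_lebesgue d 0)"
    unfolding nn_integral_PD by (intro nn_integral_cong) (simp add: posdef_0 w indicator_def)
  also have "\<dots> = (\<integral>\<^sup>+u. 1 \<partial>(\<Pi>\<^sub>M i\<in>({} :: coord_index set). (lborel :: real measure)))"
    unfolding herm_lebesgue_eq by (subst nn_integral_via[OF coord_sys_herm[OF d]]) (simp_all add: empty)
  finally show ?case by (simp add: space_PiM_empty)
next
  case (Suc m)
  have \<xi>: "\<xi> \<in> posdef d (m + 1)" and \<mu>: "wparam (m + 1) \<mu>" using Suc.prems by (simp_all only: Suc_eq_plus1)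
  obtain Z q c where *: "Z \<in> posdef d m" "q \<in> mats d m 1" "0 < c" "\<xi> = blkA Z q (mat1 c)"
    using posdef_Suc_cases[OF \<xi>] .
  have "(\<integral>\<^sup>+x. ennreal (wdens (m + 1) \<mu> \<xi> x) \<partial>PD d (m + 1)) = (\<integral>\<^sup>+X. ennreal (wdens m \<mu> Z X) \<partial>PD d m)"
    using nn_integral_wdens_Suc[OF *(1-3) \<mu>, of "\<lambda>_ _. 1"] wparam_Suc[OF \<mu>] *(3,4)
    by (simp add: nn_integral_gamma_dens)
  then show ?case using Suc.IH[OF *(1)] wparam_Suc[OF \<mu>] by (simp add: Suc_eq_plus1)
qed

text \<open>The rate c is the corner of what is left of \<xi> after all rows beyond j have been
  eliminated. It is quantified before \<mu>, so that the same c serves x and x + y and its logarithm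
  drops out of differences of expectations.\<close>

lemma pivot_distribution:
  assumes "\<xi> \<in> posdef d m" "j < m"
  shows "\<exists>c>0. \<forall>\<mu> g. wparam m \<mu> \<longrightarrow> g \<in> borel_measurable borel \<longrightarrow>
    (\<integral>\<^sup>+x. g (pivot j x) * ennreal (wdens m \<mu> \<xi> x) \<partial>PD d m) =
    (\<integral>\<^sup>+s. g s * ennreal (gamma_dens (\<mu> - real j * real d / 2) c s) \<partial>HL)"
  using assms
proof (induction m arbitrary: \<xi>)
  case (Suc m)
  have \<xi>: "\<xi> \<in> posdef d (m + 1)" using Suc.prems by (simp only: Suc_eq_plus1)
  obtain Z q c where *: "Z \<in> posdef d m" "q \<in> mats d m 1" "0 < c" "\<xi> = blkA Z q (mat1 c)"
    using posdef_Suc_cases[OF \<xi>] .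
  have id: "(\<lambda>x. x) \<in> PD d k \<rightarrow>\<^sub>M PD d k" for k by simp
  show ?case
  proof (cases "j = m")
    case True
    have "(\<integral>\<^sup>+x. g (pivot j x) * ennreal (wdens (m + 1) \<mu> \<xi> x) \<partial>PD d (m + 1)) =
        (\<integral>\<^sup>+s. g s * ennreal (gamma_dens (\<mu> - real j * real d / 2) c s) \<partial>HL)"
      if \<mu>: "wparam (m + 1) \<mu>" and g: "g \<in> borel_measurable borel" for \<mu> and g :: "real \<Rightarrow> ennreal"
    proof -
      have F: "(\<lambda>(X, s). g s) \<in> borel_measurable (PD d m \<Otimes>\<^sub>M HL)"
        unfolding split_beta' by (rule measurable_compose[OF measurable_snd borel_HL[OF g]])
      have "(\<lambda>X. ennreal (wdens m \<mu> Z X)) \<in> borel_measurable (PD d m)"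
        by (intro measurable_compose[OF meas_wdens[OF *(1) id] measurable_ennreal])
      then show ?thesis
        using nn_integral_wdens_Suc[OF *(1-3) \<mu> F] *(4) True wparam_Suc[OF \<mu>] nn_integral_wdens[OF *(1), of \<mu>]
        by (simp add: nn_integral_cmult)
    qed
    then show ?thesis using *(3) by (auto simp: Suc_eq_plus1)
  next
    case False
    then have j: "j < m" using Suc.prems by simp
    obtain c' where c': "0 < c'" "\<And>\<mu> g. wparam m \<mu> \<Longrightarrow> g \<in> borel_measurable borel \<Longrightarrow>
        (\<integral>\<^sup>+x. g (pivot j x) * ennreal (wdens m \<mu> Z x) \<partial>PD d m) =
        (\<integral>\<^sup>+s. g s * ennreal (gamma_dens (\<mu> - real j * real d / 2) c' s) \<partial>HL)"
      using Suc.IH[OF *(1) j] by blast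
    have "(\<integral>\<^sup>+x. g (pivot j x) * ennreal (wdens (m + 1) \<mu> \<xi> x) \<partial>PD d (m + 1)) =
        (\<integral>\<^sup>+s. g s * ennreal (gamma_dens (\<mu> - real j * real d / 2) c' s) \<partial>HL)"
      if \<mu>: "wparam (m + 1) \<mu>" and g: "g \<in> borel_measurable borel" for \<mu> and g :: "real \<Rightarrow> ennreal"
    proof -
      have F: "(\<lambda>(X, s). g (pivot j X)) \<in> borel_measurable (PD d m \<Otimes>\<^sub>M HL)"
        unfolding split_beta' by (rule measurable_compose[OF meas_pivot[OF measurable_fst j] borel_HL[OF g]])
      have p: "pivot j (ul m x) = pivot j x" for x using j by (simp add: pivot_def ul_ul)
      \<comment> \<open>A pivot of the leading block does not see the last pivot, whose density
        integrates to 1.\<close>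
      have gd: "(\<integral>\<^sup>+s. g (pivot j X) * ennreal (gamma_dens (\<mu> - real m * real d / 2) c s) \<partial>HL) = g (pivot j X)" for X
        using nn_integral_gamma_dens[of "\<mu> - real m * real d / 2" c] wparam_Suc[OF \<mu>] *(3) borel_HL[OF measurable_compose[OF gamma_dens_borel measurable_ennreal]]
        by (simp add: nn_integral_cmult)
      show ?thesis
        using nn_integral_wdens_Suc[OF *(1-3) \<mu> F] c'(2)[OF _ g, of \<mu>] wparam_Suc[OF \<mu>]
        by (simp add: p gd *(4))
    qed
    then show ?thesis using c'(1) by (auto simp: Suc_eq_plus1)
  qed
qed simp

subsection \<open>Sums of independent Wishart matrices\<close>

lemma qf_add:
  assumes "A \<in> carrier_mat m m" "B \<in> carrier_mat m m" "u \<in> carrier_mat m 1"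
  shows "qf (A + B) u = qf A u + qf B u"
  using assms by (subst (1 2 3) qf_sum[of _ m]) (auto simp: sum.distrib[symmetric] algebra_simps)

lemma posdef_add: "A \<in> posdef d m \<Longrightarrow> B \<in> posdef d m \<Longrightarrow> A + B \<in> posdef d m"
  unfolding posdef_iff_qf
  by (auto simp: herm_add qf_add[OF hermD(2) hermD(2) matsD] intro!: add_pos_pos)

lemma qf_uminus:
  assumes "A \<in> carrier_mat m m" "e \<in> carrier_mat m 1"
  shows "qf A (- e) = qf A e"
  using assms by (subst (1 2) qf_sum[of _ m]) auto

lemma index_add4:
  assumes "A \<in> carrier_mat 1 1" "B \<in> carrier_mat 1 1" "C \<in> carrier_mat 1 1" "D \<in> carrier_mat 1 1"
    and "Re (B $$ (0, 0)) = Re (C $$ (0, 0))"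
  shows "Re ((A + B + (C + D)) $$ (0, 0)) = Re (A $$ (0, 0)) + 2 * Re (C $$ (0, 0)) + Re (D $$ (0, 0))"
  using assms by simp

lemma mat_diff_rearrange:
  assumes "u \<in> carrier_mat m n" "a \<in> carrier_mat m n" "b \<in> carrier_mat m n"
  shows "a + (u + - a) = (u :: complex mat)" "(a + b) - u = b + - (u + - a)"
  using assms by (auto intro!: eq_matI)

lemma qf_minv_shift:
  assumes A: "A \<in> posdef d m" and p: "p \<in> carrier_mat m 1" and e: "e \<in> carrier_mat m 1"
  shows "qf (minv A) (A * p + e) = qf A p + 2 * Re ((mat_adjoint p * e) $$ (0, 0)) + qf (minv A) e"
proof -
  note i = minv_posdef_carrier[OF d A] and Ac = posdef_carrier[OF A]
  have Ap: "A * p \<in> carrier_mat m 1" by (rule mult_carrier_mat[OF Ac p])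
  have p': "mat_adjoint p \<in> carrier_mat 1 m" and e': "mat_adjoint e \<in> carrier_mat 1 m" using p e by auto
  have ie: "minv A * e \<in> carrier_mat m 1" by (rule mult_carrier_mat[OF i(1) e])
  have pA: "mat_adjoint p * A \<in> carrier_mat 1 m" by (rule mult_carrier_mat[OF p' Ac])
  have 1: "mat_adjoint (A * p + e) = mat_adjoint p * A + mat_adjoint e"
    using adjoint_add[OF Ap e] adjoint_mult[OF Ac p] hermD(3)[OF posdef_herm[OF A]] by simp
  have 2: "minv A * (A * p + e) = p + minv A * e"
    using mult_add_distrib_mat[OF i(1) Ap e] assoc_mult_mat[OF i(1) Ac p] i(3) p by simp
  have s: "mat_adjoint p * A + mat_adjoint e \<in> carrier_mat 1 m" using pA e' by auto
  have 3: "mat_adjoint p * A * (minv A * e) = mat_adjoint p * e"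
    using assoc_mult_mat[OF p' Ac ie] assoc_mult_mat[OF Ac i(1) e] i(2) e by simp
  have "mat_adjoint (A * p + e) * minv A * (A * p + e) = (mat_adjoint p * A + mat_adjoint e) * (p + minv A * e)"
    unfolding 1 using assoc_mult_mat[OF s i(1), of "A * p + e" 1] 2 Ap e by simp
  also have "\<dots> = (mat_adjoint p * A + mat_adjoint e) * p + (mat_adjoint p * A + mat_adjoint e) * (minv A * e)"
    by (rule mult_add_distrib_mat[OF s p ie])
  also have "\<dots> = (mat_adjoint p * A * p + mat_adjoint e * p) + (mat_adjoint p * e + mat_adjoint e * (minv A * e))"
    unfolding add_mult_distrib_mat[OF pA e' p] add_mult_distrib_mat[OF pA e' ie] 3 ..
  finally have eq: "mat_adjoint (A * p + e) * minv A * (A * p + e) =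
      (mat_adjoint p * A * p + mat_adjoint e * p) + (mat_adjoint p * e + mat_adjoint e * (minv A * e))" .
  have "Re ((mat_adjoint e * p) $$ (0, 0)) = Re ((mat_adjoint p * e) $$ (0, 0))"
    using p e by (simp add: scalar_prod_def Re_sum) (auto intro!: sum.cong simp: mult.commute)
  moreover have "mat_adjoint e * (minv A * e) = mat_adjoint e * minv A * e"
    by (rule assoc_mult_mat[symmetric, OF e' i(1) e])
  moreover have c: "mat_adjoint p * A * p \<in> carrier_mat 1 1" "mat_adjoint e * p \<in> carrier_mat 1 1"
    "mat_adjoint p * e \<in> carrier_mat 1 1" "mat_adjoint e * minv A * e \<in> carrier_mat 1 1"
    by (rule mult_carrier_mat[OF pA p] mult_carrier_mat[OF e' p] mult_carrier_mat[OF p' e]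
        mult_carrier_mat[OF mult_carrier_mat[OF e' i(1)] e])+
  ultimately show ?thesis unfolding qf_def eq by (simp only: index_add4)
qed

lemma Re_inner_uminus:
  assumes "p \<in> carrier_mat m 1" "e \<in> carrier_mat m 1"
  shows "Re ((mat_adjoint p * - e) $$ (0, 0)) = - Re ((mat_adjoint p * e) $$ (0, 0))"
  using assms by (simp add: scalar_prod_def Re_sum flip: sum_negf) (simp flip: sum.distrib)

text \<open>As a function of u, the left-hand side is minimal at u = X p with p the inverse of X + Y
  applied to w. Writing u = X p + e and w - u = Y p - e makes the terms linear in e cancel; the
  minimum is the form of the inverse of X + Y, and the deviation e is measured by the sum of the two
  inverses.\<close>

lemma parallel_sum:
  assumes X: "X \<in> posdef d m" and Y: "Y \<in> posdef d m" and u: "u \<in> carrier_mat m 1" and w: "w \<in> carrier_mat m 1"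
  shows "qf (minv X) u + qf (minv Y) (w - u) =
    qf (minv (X + Y)) w + qf (minv X + minv Y) (u + - (X * (minv (X + Y) * w)))"
proof -
  let ?Z = "X + Y"
  have Z: "?Z \<in> posdef d m" by (rule posdef_add[OF X Y])
  note c = posdef_carrier[OF X] posdef_carrier[OF Y] posdef_carrier[OF Z]
  note i = minv_posdef_carrier[OF d X] minv_posdef_carrier[OF d Y] minv_posdef_carrier[OF d Z]
  let ?p = "minv ?Z * w"
  have p: "?p \<in> carrier_mat m 1" by (rule mult_carrier_mat[OF i(7) w])
  have Xp: "X * ?p \<in> carrier_mat m 1" and Yp: "Y * ?p \<in> carrier_mat m 1"
    by (rule mult_carrier_mat[OF c(1) p] mult_carrier_mat[OF c(2) p])+
  have Zp: "?Z * ?p = w" using assoc_mult_mat[OF c(3) i(7) w] i(8) w by simp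
  then have wXY: "w = X * ?p + Y * ?p" using add_mult_distrib_mat[OF c(1,2) p] by simp
  let ?e = "u + - (X * ?p)"
  have e: "?e \<in> carrier_mat m 1" "- ?e \<in> carrier_mat m 1" using u Xp by auto
  have 1: "u = X * ?p + ?e" by (rule mat_diff_rearrange(1)[OF u Xp Yp, symmetric])
  have 2: "w - u = Y * ?p + - ?e"
    using mat_diff_rearrange(2)[OF u Xp Yp] wXY by simp
  have neg: "Re ((mat_adjoint ?p * - ?e) $$ (0, 0)) = - Re ((mat_adjoint ?p * ?e) $$ (0, 0))"
    by (rule Re_inner_uminus[OF p e(1)])
  have a: "qf (minv X) u = qf X ?p + 2 * Re ((mat_adjoint ?p * ?e) $$ (0, 0)) + qf (minv X) ?e"
    by (subst 1) (rule qf_minv_shift[OF X p e(1)])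
  have b: "qf (minv Y) (w - u) = qf Y ?p - 2 * Re ((mat_adjoint ?p * ?e) $$ (0, 0)) + qf (minv Y) ?e"
    unfolding 2 qf_minv_shift[OF Y p e(2)] neg qf_uminus[OF i(4) e(1)] by simp
  have z: "qf (minv ?Z) w = qf ?Z ?p"
  proof -
    have "qf (minv ?Z) (?Z * ?p + 0\<^sub>m m 1) = qf ?Z ?p + 2 * Re ((mat_adjoint ?p * 0\<^sub>m m 1) $$ (0, 0)) + qf (minv ?Z) (0\<^sub>m m 1)"
      by (rule qf_minv_shift[OF Z p]) simp
    moreover have "qf (minv ?Z) (0\<^sub>m m 1) = 0" using i by (simp add: qf_sum[of _ m])
    moreover have "mat_adjoint ?p * 0\<^sub>m m 1 = 0\<^sub>m 1 1" by (rule right_mult_zero_mat[OF mat_adjoint_carrier[OF p]])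
    ultimately show ?thesis unfolding Zp using w by simp
  qed
  show ?thesis unfolding a b z qf_add[OF c(1,2) p] qf_add[OF i(1,4) e(1)] by simp
qed

lemma adjoint_quad_mat1:
  assumes A: "A \<in> herm d m" and u: "u \<in> mats d m 1"
  shows "mat_adjoint u * A * u = mat1 (qf A u)"
  using herm_1[OF herm_quad[OF A u]] by (simp add: qf_def)

lemma mat1_add: "mat1 a + mat1 b = mat1 (a + b)"
  by (rule eq_matI) (auto simp: mat1_def)

text \<open>Leading blocks and borders simply add up, but pivots do not: the sum gains the
  nonnegative defect of \<open>parallel_sum\<close>. This is what the convolution has to integrate
  out.\<close>

lemma blkB_add:
  assumes X: "X \<in> posdef d m" and Y: "Y \<in> posdef d m" and u: "u \<in> mats d m 1" and w: "w \<in> mats d m 1"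
  shows "blkB X u (mat1 s) + blkB Y (w - u) (mat1 t) =
    blkB (X + Y) w (mat1 (s + t + qf (minv X + minv Y) (u + - (X * (minv (X + Y) * w)))))"
proof -
  have Z: "X + Y \<in> posdef d m" by (rule posdef_add[OF X Y])
  have v: "w - u \<in> mats d m 1" by (rule mats_minus[OF w u])
  note uc = matsD[OF u] and wc = matsD[OF w] and vc = matsD[OF v]
  have uv: "u + (w - u) = w" using uc wc by (intro eq_matI) auto
  have "mat_adjoint u + mat_adjoint (w - u) = mat_adjoint w" using adjoint_add[OF uc vc] uv by simp
  then show ?thesis
    unfolding blkB_def adjoint_quad_mat1[OF minv_herm[OF d X] u] adjoint_quad_mat1[OF minv_herm[OF d Y] v]
      adjoint_quad_mat1[OF minv_herm[OF d Z] w] mat1_add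
    using parallel_sum[OF X Y uc wc] uc vc posdef_carrier[OF X] posdef_carrier[OF Y]
    by (subst add_four_block_mat[of _ m m _ 1 _ 1]) (simp_all add: uv mat1_add add_ac)
qed

text \<open>The sum of the inverses equals \<open>minv X * (X + Y) * minv Y\<close>.\<close>

lemma rdet_minv_add:
  assumes X: "X \<in> posdef d m" and Y: "Y \<in> posdef d m"
  shows "minv X + minv Y \<in> posdef d m" "rdet (minv X + minv Y) = rdet (X + Y) / (rdet X * rdet Y)"
proof -
  have Z: "X + Y \<in> posdef d m" by (rule posdef_add[OF X Y])
  show M: "minv X + minv Y \<in> posdef d m" by (intro posdef_add minv_posdef[OF d] X Y)
  note c = posdef_carrier[OF X] posdef_carrier[OF Y]
  note i = minv_posdef_carrier[OF d X] minv_posdef_carrier[OF d Y]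
  have "minv X * (X + Y) * minv Y = (1\<^sub>m m + minv X * Y) * minv Y"
    using mult_add_distrib_mat[OF i(1) c] i(3) by simp
  also have "\<dots> = minv Y + minv X * Y * minv Y"
    using add_mult_distrib_mat[OF one_carrier_mat mult_carrier_mat[OF i(1) c(2)] i(4)] i(4) by simp
  also have "minv X * Y * minv Y = minv X" using assoc_mult_mat[OF i(1) c(2) i(4)] i(1,5) by simp
  also have "minv Y + minv X = minv X + minv Y" by (rule comm_add_mat[OF i(4,1)])
  finally have eq: "minv X + minv Y = minv X * (X + Y) * minv Y" by simp
  have "det (minv X + minv Y) = det (minv X) * det (X + Y) * det (minv Y)"
    unfolding eq using i c by (simp add: det_mult[of _ m] mult_carrier_mat[of _ m m] del: assoc_mult_mat)
  then have "complex_of_real (rdet (minv X + minv Y)) = complex_of_real (rdet (minv X) * rdet (X + Y) * rdet (minv Y))"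
    using det_herm_real[OF posdef_herm[OF M]] det_herm_real[OF posdef_herm[OF Z]]
      det_herm_real[OF minv_herm[OF d X]] det_herm_real[OF minv_herm[OF d Y]] by simp
  then have "rdet (minv X + minv Y) = rdet (minv X) * rdet (X + Y) * rdet (minv Y)" using of_real_eq_iff by blast
  then show "rdet (minv X + minv Y) = rdet (X + Y) / (rdet X * rdet Y)" by (simp add: rdet_minv[OF X] rdet_minv[OF Y])
qed

lemma one_posdef: "1\<^sub>m m \<in> posdef d m" "rdet (1\<^sub>m m) = 1"
proof -
  have "complex_of_real 1 \<cdot>\<^sub>m 1\<^sub>m m = 1\<^sub>m m" by (rule eq_matI) auto
  then show "1\<^sub>m m \<in> posdef d m" "rdet (1\<^sub>m m) = 1" using one_smult_posdef[of 1 m] by simp_all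
qed

text \<open>Adding the squared length of a column with m * d real coordinates to t raises the
  exponent by m * d / 2, just as adding a chi-square variable raises the shape of a gamma
  variable.\<close>

lemma nn_integral_HL_qf:
  obtains C where "\<And>g. g \<in> borel_measurable borel \<Longrightarrow>
    (\<integral>\<^sup>+t. (\<integral>\<^sup>+u. ennreal (t powr b) * g (t + qf (1\<^sub>m m) u) \<partial>mats_lebesgue d m 1) \<partial>HL) =
      C * (\<integral>\<^sup>+\<sigma>. ennreal (\<sigma> powr (b + real m * real d / 2)) * g \<sigma> \<partial>HL)"
proof
  let ?M = "mats_lebesgue d m 1" and ?q = "qf (1\<^sub>m m)"
  \<comment> \<open>For a fixed sum \<sigma> the column is rescaled by the square root of \<sigma>;
    this is the integrand that remains on the unit ball, and its integral is the constant C.\<close>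
  define \<phi> :: "real \<Rightarrow> ennreal" where "\<phi> t = ennreal ((1 - t) powr b) * (if t < 1 then 1 else 0)" for t
  have [measurable]: "\<phi> \<in> borel_measurable borel" unfolding \<phi>_def by measurable
  let ?C = "\<integral>\<^sup>+u. \<phi> (?q u) \<partial>?M"
  interpret M: sigma_finite_measure ?M by (rule sigma_finite_mats[OF d])
  interpret LM: pair_sigma_finite lborel ?M ..
  interpret MQ: pair_sigma_finite ?M lborel ..
  have q [measurable]: "?q \<in> borel_measurable ?M" using meas_qf_const[OF herm_one, of "\<lambda>x. x"] by simp
  fix g :: "real \<Rightarrow> ennreal" assume [measurable]: "g \<in> borel_measurable borel"
  have "(\<integral>\<^sup>+t. (\<integral>\<^sup>+u. ennreal (t powr b) * g (t + ?q u) \<partial>?M) \<partial>HL) =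
      (\<integral>\<^sup>+t. (\<integral>\<^sup>+u. ennreal (t powr b) * g (t + ?q u) * indicator {0<..} t \<partial>?M) \<partial>lborel)"
    unfolding nn_integral_HL by (simp add: nn_integral_multc)
  also have "\<dots> = (\<integral>\<^sup>+u. (\<integral>\<^sup>+t. ennreal (t powr b) * g (t + ?q u) * indicator {0<..} t \<partial>lborel) \<partial>?M)"
    by (rule MQ.Fubini') measurable
  also have "\<dots> = (\<integral>\<^sup>+u. (\<integral>\<^sup>+\<sigma>. ennreal ((\<sigma> - ?q u) powr b) * g \<sigma> * indicator {0<..} (\<sigma> - ?q u) \<partial>lborel) \<partial>?M)"
  proof (rule nn_integral_cong)
    fix u
    show "(\<integral>\<^sup>+t. ennreal (t powr b) * g (t + ?q u) * indicator {0<..} t \<partial>lborel) =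
        (\<integral>\<^sup>+\<sigma>. ennreal ((\<sigma> - ?q u) powr b) * g \<sigma> * indicator {0<..} (\<sigma> - ?q u) \<partial>lborel)"
      by (subst nn_integral_real_affine[of _ 1 "- ?q u"]) (simp_all add: algebra_simps)
  qed
  also have "\<dots> = (\<integral>\<^sup>+\<sigma>. (\<integral>\<^sup>+u. ennreal ((\<sigma> - ?q u) powr b) * g \<sigma> * indicator {0<..} (\<sigma> - ?q u) \<partial>?M) \<partial>lborel)"
    by (rule LM.Fubini') measurable
  also have "\<dots> = (\<integral>\<^sup>+\<sigma>. ?C * (ennreal (\<sigma> powr (b + real m * real d / 2)) * g \<sigma> * indicator {0<..} \<sigma>) \<partial>lborel)"
  proof (rule nn_integral_cong)
    fix \<sigma> :: real
    show "(\<integral>\<^sup>+u. ennreal ((\<sigma> - ?q u) powr b) * g \<sigma> * indicator {0<..} (\<sigma> - ?q u) \<partial>?M) =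
        ?C * (ennreal (\<sigma> powr (b + real m * real d / 2)) * g \<sigma> * indicator {0<..} \<sigma>)"
    proof (cases "0 < \<sigma>")
      case False
      have "indicator {0<..} (\<sigma> - ?q u) = (0 :: ennreal)" if "u \<in> mats d m 1" for u
      proof -
        have "0 \<le> ?q u" unfolding qf_one_nonneg[OF matsD[OF that]] by (intro sum_nonneg) simp
        then show ?thesis using False by simp
      qed
      then have "(\<integral>\<^sup>+u. ennreal ((\<sigma> - ?q u) powr b) * g \<sigma> * indicator {0<..} (\<sigma> - ?q u) \<partial>?M) = (\<integral>\<^sup>+u. 0 \<partial>?M)"
        by (intro nn_integral_cong) simp
      then show ?thesis using False by simp
    next
      case True
      have "(\<integral>\<^sup>+u. ennreal ((\<sigma> - ?q u) powr b) * g \<sigma> * indicator {0<..} (\<sigma> - ?q u) \<partial>?M) =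
          (\<integral>\<^sup>+u. (ennreal (\<sigma> powr b) * g \<sigma>) * \<phi> ((1 / \<sigma>) * ?q u) \<partial>?M)"
      proof (rule nn_integral_cong)
        fix u
        show "ennreal ((\<sigma> - ?q u) powr b) * g \<sigma> * indicator {0<..} (\<sigma> - ?q u) =
            (ennreal (\<sigma> powr b) * g \<sigma>) * \<phi> ((1 / \<sigma>) * ?q u)"
        proof (cases "?q u < \<sigma>")
          case t: True
          have "\<sigma> - ?q u = \<sigma> * (1 - (1 / \<sigma>) * ?q u)" using True by (simp add: field_simps)
          then have "(\<sigma> - ?q u) powr b = \<sigma> powr b * (1 - (1 / \<sigma>) * ?q u) powr b"
            using True t by (metis powr_mult)
          then show ?thesis using True t by (simp add: \<phi>_def ennreal_mult mult_ac)
        next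
          case False
          then show ?thesis using True by (simp add: \<phi>_def)
        qed
      qed
      also have "\<dots> = (ennreal (\<sigma> powr b) * g \<sigma>) * (\<integral>\<^sup>+u. \<phi> ((1 / \<sigma>) * ?q u) \<partial>?M)"
        by (rule nn_integral_cmult) measurable
      also have "(\<integral>\<^sup>+u. \<phi> ((1 / \<sigma>) * ?q u) \<partial>?M) = ennreal (\<sigma> powr (real m * real d / 2)) * ?C"
      proof -
        note 1 = one_posdef[of m]
        have "(1 / \<sigma>) powr (- (real m * real d / 2)) = \<sigma> powr (real m * real d / 2)"
          using True by (simp add: powr_divide powr_minus_divide)
        then show ?thesis using nn_integral_qf_scale[OF 1(1), of \<phi> "1 / \<sigma>"] True 1(2) by simp
      qed
      finally show ?thesis using True by (simp add: powr_add ennreal_mult mult_ac)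
    qed
  qed
  also have "\<dots> = ?C * (\<integral>\<^sup>+\<sigma>. ennreal (\<sigma> powr (b + real m * real d / 2)) * g \<sigma> * indicator {0<..} \<sigma> \<partial>lborel)"
    by (rule nn_integral_cmult) measurable
  finally show "(\<integral>\<^sup>+t. (\<integral>\<^sup>+u. ennreal (t powr b) * g (t + ?q u) \<partial>?M) \<partial>HL) =
      ?C * (\<integral>\<^sup>+\<sigma>. ennreal (\<sigma> powr (b + real m * real d / 2)) * g \<sigma> \<partial>HL)" by (simp only: nn_integral_HL)
qed

lemma nn_integral_HL_HL_qf:
  obtains C where "\<And>g. g \<in> borel_measurable borel \<Longrightarrow>
    (\<integral>\<^sup>+s. (\<integral>\<^sup>+t. ennreal (s powr a * t powr b) * (\<integral>\<^sup>+u. g (s + t + qf (1\<^sub>m m) u) \<partial>mats_lebesgue d m 1) \<partial>HL) \<partial>HL) =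
      C * (\<integral>\<^sup>+\<sigma>. ennreal (\<sigma> powr (a + b + 1 + real m * real d / 2)) * g \<sigma> \<partial>HL)"
proof -
  let ?M = "mats_lebesgue d m 1" and ?q = "qf (1\<^sub>m m)"
  interpret HL: sigma_finite_measure HL by (rule sigma_finite_HL)
  obtain C where C: "\<And>g. g \<in> borel_measurable borel \<Longrightarrow>
    (\<integral>\<^sup>+t. (\<integral>\<^sup>+u. ennreal (t powr b) * g (t + qf (1\<^sub>m m) u) \<partial>mats_lebesgue d m 1) \<partial>HL) =
      C * (\<integral>\<^sup>+\<sigma>. ennreal (\<sigma> powr (b + real m * real d / 2)) * g \<sigma> \<partial>HL)"
    using nn_integral_HL_qf[where b=b and m=m] by blast
  obtain C' where C': "\<And>g. g \<in> borel_measurable borel \<Longrightarrow>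
    (\<integral>\<^sup>+s. (\<integral>\<^sup>+t. ennreal (s powr a * t powr (b + real m * real d / 2)) * g (s + t) \<partial>HL) \<partial>HL) =
      C' * (\<integral>\<^sup>+\<sigma>. ennreal (\<sigma> powr (a + (b + real m * real d / 2) + 1)) * g \<sigma> \<partial>HL)"
    using nn_integral_HL_add[where a=a and b="b + real m * real d / 2"] by blast
  have q [measurable]: "?q \<in> borel_measurable ?M" using meas_qf_const[OF herm_one, of "\<lambda>x. x"] by simp
  interpret M: sigma_finite_measure ?M by (rule sigma_finite_mats[OF d])
  have "(\<integral>\<^sup>+s. (\<integral>\<^sup>+t. ennreal (s powr a * t powr b) * (\<integral>\<^sup>+u. g (s + t + ?q u) \<partial>?M) \<partial>HL) \<partial>HL) =
      (C * C') * (\<integral>\<^sup>+\<sigma>. ennreal (\<sigma> powr (a + b + 1 + real m * real d / 2)) * g \<sigma> \<partial>HL)"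
    if g [measurable]: "g \<in> borel_measurable borel" for g
  proof -
    have "(\<integral>\<^sup>+s. (\<integral>\<^sup>+t. ennreal (s powr a * t powr b) * (\<integral>\<^sup>+u. g (s + t + ?q u) \<partial>?M) \<partial>HL) \<partial>HL) =
        (\<integral>\<^sup>+s. C * (\<integral>\<^sup>+t. ennreal (s powr a * t powr (b + real m * real d / 2)) * g (s + t) \<partial>HL) \<partial>HL)"
    proof (rule nn_integral_cong)
      fix s assume "s \<in> space HL"
      then have s: "0 < s" by simp
      have m1: "(\<lambda>t. \<integral>\<^sup>+u. ennreal (t powr b) * g (s + (t + ?q u)) \<partial>?M) \<in> borel_measurable HL"
        by (rule borel_HL) measurable
      have m2: "(\<lambda>t. ennreal (t powr (b + real m * real d / 2)) * g (s + t)) \<in> borel_measurable HL"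
        by (rule borel_HL) measurable
      have "(\<integral>\<^sup>+t. ennreal (s powr a * t powr b) * (\<integral>\<^sup>+u. g (s + t + ?q u) \<partial>?M) \<partial>HL) =
          (\<integral>\<^sup>+t. ennreal (s powr a) * (\<integral>\<^sup>+u. ennreal (t powr b) * g (s + (t + ?q u)) \<partial>?M) \<partial>HL)"
        by (intro nn_integral_cong) (simp add: nn_integral_cmult ennreal_mult mult.assoc add.assoc)
      also have "\<dots> = ennreal (s powr a) * (\<integral>\<^sup>+t. (\<integral>\<^sup>+u. ennreal (t powr b) * g (s + (t + ?q u)) \<partial>?M) \<partial>HL)"
        by (rule nn_integral_cmult[OF m1])
      also have "(\<integral>\<^sup>+t. (\<integral>\<^sup>+u. ennreal (t powr b) * g (s + (t + ?q u)) \<partial>?M) \<partial>HL) =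
          C * (\<integral>\<^sup>+t. ennreal (t powr (b + real m * real d / 2)) * g (s + t) \<partial>HL)"
        by (rule C[of "\<lambda>x. g (s + x)"]) measurable
      also have "ennreal (s powr a) * (C * (\<integral>\<^sup>+t. ennreal (t powr (b + real m * real d / 2)) * g (s + t) \<partial>HL)) =
          C * (\<integral>\<^sup>+t. ennreal (s powr a) * (ennreal (t powr (b + real m * real d / 2)) * g (s + t)) \<partial>HL)"
        unfolding nn_integral_cmult[OF m2] by (simp add: mult_ac)
      finally show "(\<integral>\<^sup>+t. ennreal (s powr a * t powr b) * (\<integral>\<^sup>+u. g (s + t + ?q u) \<partial>?M) \<partial>HL) =
          C * (\<integral>\<^sup>+t. ennreal (s powr a * t powr (b + real m * real d / 2)) * g (s + t) \<partial>HL)"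
        by (simp add: ennreal_mult mult.assoc)
    qed
    also have "\<dots> = C * (\<integral>\<^sup>+s. (\<integral>\<^sup>+t. ennreal (s powr a * t powr (b + real m * real d / 2)) * g (s + t) \<partial>HL) \<partial>HL)"
    proof (rule nn_integral_cmult)
      have "(\<lambda>(s, t). ennreal (s powr a * t powr (b + real m * real d / 2)) * g (s + t)) \<in> borel_measurable (HL \<Otimes>\<^sub>M HL)"
      proof -
        have 1: "(\<lambda>p. (fst p, snd p)) \<in> HL \<Otimes>\<^sub>M HL \<rightarrow>\<^sub>M borel \<Otimes>\<^sub>M borel"
          by (intro measurable_Pair meas_HL_real[OF measurable_fst] meas_HL_real[OF measurable_snd])
        have 2: "(\<lambda>p. ennreal (fst p powr a * snd p powr (b + real m * real d / 2)) * g (fst p + snd p)) \<in> borel_measurable (borel \<Otimes>\<^sub>M borel)"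
          by measurable
        show ?thesis unfolding split_beta' using measurable_compose[OF 1 2] by simp
      qed
      then show "(\<lambda>s. \<integral>\<^sup>+t. ennreal (s powr a * t powr (b + real m * real d / 2)) * g (s + t) \<partial>HL) \<in> borel_measurable HL"
        by (rule HL.borel_measurable_nn_integral)
    qed
    finally show ?thesis unfolding C'[OF g] by (simp add: mult.assoc add_ac)
  qed
  then show thesis by (rule that)
qed

lemma PD_0: "x \<in> posdef d 0 \<Longrightarrow> x = 1\<^sub>m 0"
  using posdef_carrier[of x d 0] by (intro eq_matI) auto

lemma nn_integral_PD_0: "(\<integral>\<^sup>+x. f x \<partial>PD d 0) = f (1\<^sub>m 0)"
proof -
  note one = one_posdef(1)[of 0]
  have "(\<integral>\<^sup>+x. f x \<partial>PD d 0) = (\<integral>\<^sup>+x. f (1\<^sub>m 0) * ennreal (wdens 0 1 (1\<^sub>m 0) x) \<partial>PD d 0)"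
    by (intro nn_integral_cong) (auto dest!: PD_0 simp: wdens_def wkernel_def wconst_def rdet_def rtrace_def)
  also have "\<dots> = f (1\<^sub>m 0) * (\<integral>\<^sup>+x. ennreal (wdens 0 1 (1\<^sub>m 0) x) \<partial>PD d 0)"
  proof (rule nn_integral_cmult)
    have "(\<lambda>x. x) \<in> PD d 0 \<rightarrow>\<^sub>M PD d 0" by simp
    then show "(\<lambda>x. ennreal (wdens 0 1 (1\<^sub>m 0) x)) \<in> borel_measurable (PD d 0)"
      by (intro measurable_compose[OF meas_wdens[OF one] measurable_ennreal])
  qed
  also have "\<dots> = f (1\<^sub>m 0)" using nn_integral_wdens[OF one, of 1] by (simp add: wparam_def)
  finally show ?thesis .
qed

lemma meas_add_PD:
  assumes A: "A \<in> N \<rightarrow>\<^sub>M PD d m" and B: "B \<in> N \<rightarrow>\<^sub>M PD d m"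
  shows "(\<lambda>x. A x + B x) \<in> N \<rightarrow>\<^sub>M PD d m"
  by (rule meas_PD_of_herm[OF meas_herm_of_mats[OF meas_add[OF meas_mats_of_PD[OF A] meas_mats_of_PD[OF B]]]])
     (auto intro!: posdef_herm posdef_add meas_PD_space[OF A] meas_PD_space[OF B])

text \<open>The exponential in the density depends on x + y only, so all that has to be convolved
  are powers of determinants. In the coordinates of \<open>blkB\<close> the pivots and the borders
  form a scalar convolution, and the leading blocks are left to the induction hypothesis with both
  exponents raised by d / 2. The constant is not tracked.\<close>

lemma wishart_convolution_kernel:
  "\<exists>C. \<forall>f\<in>borel_measurable (PD d m).
    (\<integral>\<^sup>+x. (\<integral>\<^sup>+y. ennreal (rdet x powr a * rdet y powr b) * f (x + y) \<partial>PD d m) \<partial>PD d m) =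
    C * (\<integral>\<^sup>+z. ennreal (rdet z powr (a + b + 1 + (real m - 1) * real d / 2)) * f z \<partial>PD d m)"
proof (induction m arbitrary: a b)
  case 0
  have "1\<^sub>m 0 + 1\<^sub>m 0 = (1\<^sub>m 0 :: complex mat)" by (rule eq_matI) auto
  then show ?case by (intro exI[of _ 1]) (simp add: nn_integral_PD_0 one_posdef)
next
  case (Suc m)
  let ?M = "mats_lebesgue d m 1" and ?P = "PD d m" and ?P1 = "PD d (m + 1)" and ?q = "qf (1\<^sub>m m)"
  let ?e = "a + b + 1 + real m * real d / 2"
  interpret M: sigma_finite_measure ?M by (rule sigma_finite_mats[OF d])
  interpret P: sigma_finite_measure ?P by (rule sigma_finite_PD)
  interpret P1: sigma_finite_measure ?P1 by (rule sigma_finite_PD)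
  interpret HL: sigma_finite_measure HL by (rule sigma_finite_HL)
  interpret PM: pair_sigma_finite ?P ?M ..
  interpret HM: pair_sigma_finite HL ?M ..
  interpret MM: pair_sigma_finite ?M ?M ..
  interpret PH: pair_sigma_finite ?P HL ..
  obtain C where C: "\<And>f. f \<in> borel_measurable ?P \<Longrightarrow>
    (\<integral>\<^sup>+x. (\<integral>\<^sup>+y. ennreal (rdet x powr (a + real d / 2) * rdet y powr (b + real d / 2)) * f (x + y) \<partial>?P) \<partial>?P) =
    C * (\<integral>\<^sup>+z. ennreal (rdet z powr (a + real d / 2 + (b + real d / 2) + 1 + (real m - 1) * real d / 2)) * f z \<partial>?P)"
    using Suc.IH[of "a + real d / 2" "b + real d / 2"] by blast
  obtain C' where C': "\<And>g. g \<in> borel_measurable borel \<Longrightarrow>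
    (\<integral>\<^sup>+s. (\<integral>\<^sup>+t. ennreal (s powr a * t powr b) * (\<integral>\<^sup>+u. g (s + t + ?q u) \<partial>?M) \<partial>HL) \<partial>HL) =
      C' * (\<integral>\<^sup>+\<sigma>. ennreal (\<sigma> powr ?e) * g \<sigma> \<partial>HL)"
    using nn_integral_HL_HL_qf[where a=a and b=b and m=m] by blast
  have "(\<integral>\<^sup>+x. (\<integral>\<^sup>+y. ennreal (rdet x powr a * rdet y powr b) * f (x + y) \<partial>?P1) \<partial>?P1) =
    (C * C') * (\<integral>\<^sup>+z. ennreal (rdet z powr ?e) * f z \<partial>?P1)" if f: "f \<in> borel_measurable ?P1" for f
  proof -
    have rdet: "(\<lambda>x. rdet (A x)) \<in> borel_measurable N" if "A \<in> N \<rightarrow>\<^sub>M PD d k" for A k and N :: "'z measure"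
      by (rule meas_rdet[OF meas_mats_of_PD[OF that]])
    \<comment> \<open>The integrand with both matrices in block coordinates: x is given by X, s, u
      and y by Y, t, v.\<close>
    define H where "H X s u Y t v = ennreal (rdet (blkB X u (mat1 s)) powr a * rdet (blkB Y v (mat1 t)) powr b) *
      f (blkB X u (mat1 s) + blkB Y v (mat1 t))" for X s u Y t v
    have measH: "(\<lambda>p. H (X p) (s p) (u p) (Y p) (t p) (v p)) \<in> borel_measurable N"
      if "X \<in> N \<rightarrow>\<^sub>M ?P" "s \<in> N \<rightarrow>\<^sub>M HL" "u \<in> N \<rightarrow>\<^sub>M ?M" "Y \<in> N \<rightarrow>\<^sub>M ?P" "t \<in> N \<rightarrow>\<^sub>M HL" "v \<in> N \<rightarrow>\<^sub>M ?M"
      for X s u Y t v and N :: "'z measure"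
    proof -
      have x: "(\<lambda>p. blkB (X p) (u p) (mat1 (s p))) \<in> N \<rightarrow>\<^sub>M ?P1" by (intro meas_blkB_PD meas_mat1_PD that)
      have y: "(\<lambda>p. blkB (Y p) (v p) (mat1 (t p))) \<in> N \<rightarrow>\<^sub>M ?P1" by (intro meas_blkB_PD meas_mat1_PD that)
      note [measurable] = rdet[OF x] rdet[OF y] measurable_compose[OF meas_add_PD[OF x y] f]
      show ?thesis unfolding H_def by measurable
    qed
    have fG: "(\<lambda>y. ennreal (rdet x powr a * rdet y powr b) * f (x + y)) \<in> borel_measurable ?P1" if x: "x \<in> posdef d (m + 1)" for x
    proof -
      have 1: "(\<lambda>_. x) \<in> ?P1 \<rightarrow>\<^sub>M ?P1" and 2: "(\<lambda>y. y) \<in> ?P1 \<rightarrow>\<^sub>M ?P1" using x by simp_all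
      note [measurable] = rdet[OF 2] measurable_compose[OF meas_add_PD[OF 1 2] f]
      show ?thesis by measurable
    qed
    have fG2: "(\<lambda>x. \<integral>\<^sup>+y. ennreal (rdet x powr a * rdet y powr b) * f (x + y) \<partial>?P1) \<in> borel_measurable ?P1"
    proof (rule P1.borel_measurable_nn_integral)
      note [measurable] = rdet[OF measurable_fst] rdet[OF measurable_snd] measurable_compose[OF meas_add_PD[OF measurable_fst measurable_snd] f]
      show "(\<lambda>(x, y). ennreal (rdet x powr a * rdet y powr b) * f (x + y)) \<in> borel_measurable (?P1 \<Otimes>\<^sub>M ?P1)"
        unfolding split_beta' by measurable
    qed
    \<comment> \<open>The value of f averaged over the border w of the sum. The indicator makes it a
      Borel function on the whole line, as required by the scalar convolution and by
      \<open>nn_integral_qf\<close>.\<close>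
    define g where "g Z \<sigma> = (\<integral>\<^sup>+w. f (blkB Z w (mat1 \<sigma>)) \<partial>?M) * indicator {0<..} \<sigma>" for Z \<sigma>
    have gHL: "(\<lambda>p. \<integral>\<^sup>+w. f (blkB (Z p) w (mat1 (\<sigma> p))) \<partial>?M) \<in> borel_measurable N"
      if "Z \<in> N \<rightarrow>\<^sub>M ?P" "\<sigma> \<in> N \<rightarrow>\<^sub>M HL" for Z \<sigma> and N :: "'z measure"
      by (rule M.borel_measurable_nn_integral, unfold split_beta', rule measurable_compose[OF meas_blkB_PD f])
         (use that in \<open>auto intro!: meas_mat1_PD measurable_compose[OF measurable_fst]\<close>)
    have g_borel: "g Z \<in> borel_measurable borel" if Z: "Z \<in> posdef d m" for Z
    proof -
      have "(\<lambda>\<sigma>. \<integral>\<^sup>+w. f (blkB Z w (mat1 \<sigma>)) \<partial>?M) \<in> borel_measurable HL" by (rule gHL) (use Z in simp_all)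
      then show ?thesis unfolding HL_def g_def
        by (subst (asm) borel_measurable_restrict_space_iff_ennreal) simp_all
    qed
    let ?w = "\<lambda>X s Y t. ennreal ((rdet X * s) powr a * (rdet Y * t) powr b)"
    have "(\<integral>\<^sup>+x. (\<integral>\<^sup>+y. ennreal (rdet x powr a * rdet y powr b) * f (x + y) \<partial>?P1) \<partial>?P1) =
        (\<integral>\<^sup>+X. (\<integral>\<^sup>+s. (\<integral>\<^sup>+u. (\<integral>\<^sup>+Y. (\<integral>\<^sup>+t. (\<integral>\<^sup>+v. H X s u Y t v \<partial>?M) \<partial>HL) \<partial>?P) \<partial>?M) \<partial>HL) \<partial>?P)"
      unfolding nn_integral_PD_Suc[OF fG2] H_def
      by (intro nn_integral_cong nn_integral_PD_Suc fG) (simp add: posdef_blkB_iff mat1_herm mat1_posdef_iff)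
    \<comment> \<open>The border u is moved past Y and t, so that the two borders can be transformed
      together while X, s, Y, t are fixed.\<close>
    also have "\<dots> = (\<integral>\<^sup>+X. (\<integral>\<^sup>+s. (\<integral>\<^sup>+Y. (\<integral>\<^sup>+t. (\<integral>\<^sup>+u. (\<integral>\<^sup>+v. H X s u Y t v \<partial>?M) \<partial>?M) \<partial>HL) \<partial>?P) \<partial>HL) \<partial>?P)"
    proof (intro nn_integral_cong)
      fix X s assume X: "X \<in> space ?P" and s: "s \<in> space HL"
      have "(\<integral>\<^sup>+u. (\<integral>\<^sup>+Y. (\<integral>\<^sup>+t. (\<integral>\<^sup>+v. H X s u Y t v \<partial>?M) \<partial>HL) \<partial>?P) \<partial>?M) =
          (\<integral>\<^sup>+Y. (\<integral>\<^sup>+u. (\<integral>\<^sup>+t. (\<integral>\<^sup>+v. H X s u Y t v \<partial>?M) \<partial>HL) \<partial>?M) \<partial>?P)"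
        apply (rule PM.Fubini')
        apply (unfold split_beta')
        apply (rule HL.borel_measurable_nn_integral, unfold split_beta')
        apply (rule M.borel_measurable_nn_integral, unfold split_beta')
        by (rule measH) (use X s in \<open>auto intro!: measurable_const\<close>)
      also have "\<dots> = (\<integral>\<^sup>+Y. (\<integral>\<^sup>+t. (\<integral>\<^sup>+u. (\<integral>\<^sup>+v. H X s u Y t v \<partial>?M) \<partial>?M) \<partial>HL) \<partial>?P)"
      proof (rule nn_integral_cong)
        fix Y assume Y: "Y \<in> space ?P"
        show "(\<integral>\<^sup>+u. (\<integral>\<^sup>+t. (\<integral>\<^sup>+v. H X s u Y t v \<partial>?M) \<partial>HL) \<partial>?M) = (\<integral>\<^sup>+t. (\<integral>\<^sup>+u. (\<integral>\<^sup>+v. H X s u Y t v \<partial>?M) \<partial>?M) \<partial>HL)"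
          apply (rule HM.Fubini')
          apply (unfold split_beta')
          apply (rule M.borel_measurable_nn_integral, unfold split_beta')
          by (rule measH) (use X s Y in \<open>auto intro!: measurable_const\<close>)
      qed
      finally show "(\<integral>\<^sup>+u. (\<integral>\<^sup>+Y. (\<integral>\<^sup>+t. (\<integral>\<^sup>+v. H X s u Y t v \<partial>?M) \<partial>HL) \<partial>?P) \<partial>?M) =
          (\<integral>\<^sup>+Y. (\<integral>\<^sup>+t. (\<integral>\<^sup>+u. (\<integral>\<^sup>+v. H X s u Y t v \<partial>?M) \<partial>?M) \<partial>HL) \<partial>?P)" .
    qed
    also have "\<dots> = (\<integral>\<^sup>+X. (\<integral>\<^sup>+s. (\<integral>\<^sup>+Y. (\<integral>\<^sup>+t. ennreal (rdet X powr (a + real d / 2) * rdet Y powr (b + real d / 2)) *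
        (ennreal (rdet (X + Y) powr (- (real d / 2))) * (ennreal (s powr a * t powr b) *
          (\<integral>\<^sup>+u. g (X + Y) (s + t + ?q u) \<partial>?M))) \<partial>HL) \<partial>?P) \<partial>HL) \<partial>?P)"
    proof (intro nn_integral_cong)
      fix X s Y t assume "X \<in> space ?P" "s \<in> space HL" "Y \<in> space ?P" "t \<in> space HL"
      then have X: "X \<in> posdef d m" and s: "0 < s" and Y: "Y \<in> posdef d m" and t: "0 < t" by auto
      let ?Z = "X + Y" and ?N = "minv X + minv Y"
      have Z: "?Z \<in> posdef d m" by (rule posdef_add[OF X Y])
      note N = rdet_minv_add[OF X Y]
      have dx: "rdet (blkB X u (mat1 s)) = rdet X * s" if "u \<in> mats d m 1" for u s
        using det_blkB(2)[OF X matsD[OF that] mat1_herm] by simp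
      have dy: "rdet (blkB Y u (mat1 s)) = rdet Y * s" if "u \<in> mats d m 1" for u s
        using det_blkB(2)[OF Y matsD[OF that] mat1_herm] by simp
      let ?c = "\<lambda>w. - (X * (minv ?Z * w))"
      have cm: "?c w \<in> mats d m 1" if "w \<in> mats d m 1" for w
        by (intro mats_uminus mats_mult[where q=m] that hermD(1)[OF posdef_herm[OF X]] hermD(1)[OF minv_herm[OF d Z]])
      let ?F = "\<lambda>w \<sigma>. f (blkB ?Z w (mat1 \<sigma>))"
      have qN: "0 \<le> qf ?N u" if "u \<in> mats d m 1" for u
        using N(1) that posdef_carrier[OF N(1)] by (cases "u = 0\<^sub>m m 1") (auto simp: posdef_iff_qf less_imp_le qf_sum)
      have Fm: "(\<lambda>p. ?F (w p) (s + t + qf ?N (u p))) \<in> borel_measurable N'"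
        if w: "w \<in> N' \<rightarrow>\<^sub>M ?M" and u: "u \<in> N' \<rightarrow>\<^sub>M ?M" for w u and N' :: "'z measure"
      proof -
        have nn: "(\<lambda>_. ?N) \<in> N' \<rightarrow>\<^sub>M mats_lebesgue d m m" by (intro measurable_const) (simp add: hermD(1)[OF posdef_herm[OF N(1)]])
        have "(\<lambda>p. s + t + qf ?N (u p)) \<in> borel_measurable N'" using meas_qf[OF nn u] by simp
        then have "(\<lambda>p. s + t + qf ?N (u p)) \<in> N' \<rightarrow>\<^sub>M HL"
          unfolding HL_def using qN[OF meas_mats_space[OF u]] s t
          by (simp add: measurable_restrict_space2_iff Pi_iff add_pos_nonneg)
        then show ?thesis
          by (intro measurable_compose[OF meas_blkB_PD f] meas_mat1_PD w measurable_const) (use Z in simp)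
      qed
      have Fb: "(\<lambda>p. ?F (w p) (s + t + qf ?N (u p + ?c (w p)))) \<in> borel_measurable N'"
        if w: "w \<in> N' \<rightarrow>\<^sub>M ?M" and u: "u \<in> N' \<rightarrow>\<^sub>M ?M" for w u and N' :: "'z measure"
      proof (rule Fm[OF w meas_add[OF u]])
        have "(\<lambda>p. - X * (minv ?Z * w p)) \<in> N' \<rightarrow>\<^sub>M ?M"
          by (intro meas_mult[where q=m] w measurable_const)
             (simp_all add: mats_uminus hermD(1)[OF posdef_herm[OF X]] hermD(1)[OF minv_herm[OF d Z]])
        moreover have "- X * (minv ?Z * w p) = ?c (w p)" if "p \<in> space N'" for p
          using uminus_mult_left_mat[of X "minv ?Z * w p"] posdef_carrier[OF X] minv_posdef_carrier(1)[OF d Z]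
            matsD[OF meas_mats_space[OF w that]] by simp
        ultimately show "(\<lambda>p. ?c (w p)) \<in> N' \<rightarrow>\<^sub>M ?M" by (subst measurable_cong[where g="\<lambda>p. - X * (minv ?Z * w p)"]) auto
      qed
      have id: "(\<lambda>w. w) \<in> ?M \<rightarrow>\<^sub>M ?M" by simp
      have cst: "(\<lambda>_. u) \<in> ?M \<rightarrow>\<^sub>M ?M" if "u \<in> mats d m 1" for u using that by simp
      \<comment> \<open>For fixed u the variable v is replaced by w = u + v, the border of the sum.
        By \<open>blkB_add\<close> the function f then sees only X + Y, w and a pivot s + t +
        defect.\<close>
      have "(\<integral>\<^sup>+u. (\<integral>\<^sup>+v. H X s u Y t v \<partial>?M) \<partial>?M) =
          (\<integral>\<^sup>+u. (\<integral>\<^sup>+w. ?w X s Y t * ?F w (s + t + qf ?N (u + ?c w)) \<partial>?M) \<partial>?M)"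
      proof (rule nn_integral_cong)
        fix u assume "u \<in> space ?M"
        then have u: "u \<in> mats d m 1" by simp
        have mH: "(\<lambda>v. H X s u Y t v) \<in> borel_measurable ?M"
          by (rule measH) (use X s Y t u in auto)
        have "(\<integral>\<^sup>+v. H X s u Y t v \<partial>?M) = (\<integral>\<^sup>+w. H X s u Y t (w + - u) \<partial>?M)"
          by (rule nn_integral_mats_translate[OF d mats_uminus[OF u] mH, symmetric])
        also have "\<dots> = (\<integral>\<^sup>+w. ?w X s Y t * ?F w (s + t + qf ?N (u + ?c w)) \<partial>?M)"
        proof (rule nn_integral_cong)
          fix w assume "w \<in> space ?M"
          then have w: "w \<in> mats d m 1" by simp
          have wu: "w + - u = w - u" using matsD[OF u] matsD[OF w] by (intro eq_matI) auto
          show "H X s u Y t (w + - u) = ?w X s Y t * ?F w (s + t + qf ?N (u + ?c w))"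
            unfolding H_def wu dx[OF u] dy[OF mats_minus[OF w u]] blkB_add[OF X Y u w] ..
        qed
        finally show "(\<integral>\<^sup>+v. H X s u Y t v \<partial>?M) = (\<integral>\<^sup>+w. ?w X s Y t * ?F w (s + t + qf ?N (u + ?c w)) \<partial>?M)" .
      qed
      also have "\<dots> = (\<integral>\<^sup>+u. ?w X s Y t * (\<integral>\<^sup>+w. ?F w (s + t + qf ?N (u + ?c w)) \<partial>?M) \<partial>?M)"
        by (intro nn_integral_cong nn_integral_cmult Fb[OF id cst]) simp
      also have "\<dots> = ?w X s Y t * (\<integral>\<^sup>+u. (\<integral>\<^sup>+w. ?F w (s + t + qf ?N (u + ?c w)) \<partial>?M) \<partial>?M)"
        by (intro nn_integral_cmult M.borel_measurable_nn_integral, unfold split_beta', rule Fb[OF measurable_snd measurable_fst])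
      \<comment> \<open>With u innermost, the shift \<open>?c w\<close>, which depends on w, is
        removed by a translation. Swapping back afterwards leaves the integral over w, which is
        g.\<close>
      also have "(\<integral>\<^sup>+u. (\<integral>\<^sup>+w. ?F w (s + t + qf ?N (u + ?c w)) \<partial>?M) \<partial>?M) =
          (\<integral>\<^sup>+w. (\<integral>\<^sup>+u. ?F w (s + t + qf ?N (u + ?c w)) \<partial>?M) \<partial>?M)"
        by (rule MM.Fubini', unfold split_beta', rule Fb[OF measurable_fst measurable_snd])
      also have "\<dots> = (\<integral>\<^sup>+w. (\<integral>\<^sup>+u. ?F w (s + t + qf ?N u) \<partial>?M) \<partial>?M)"
        by (intro nn_integral_cong nn_integral_mats_translate[OF d] cm Fm[OF cst id]) simp_all
      also have "\<dots> = (\<integral>\<^sup>+u. (\<integral>\<^sup>+w. ?F w (s + t + qf ?N u) \<partial>?M) \<partial>?M)"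
        by (rule MM.Fubini', unfold split_beta', rule Fm[OF measurable_snd measurable_fst])
      also have "\<dots> = (\<integral>\<^sup>+u. g ?Z (s + t + qf ?N u) \<partial>?M)"
        unfolding g_def using qN s t by (intro nn_integral_cong) (simp add: add_pos_nonneg)
      also have "\<dots> = ennreal (rdet ?N powr (- (real d / 2))) * (\<integral>\<^sup>+u. g ?Z (s + t + ?q u) \<partial>?M)"
      proof (rule nn_integral_qf[OF N(1), of "\<lambda>x. g ?Z (s + t + x)"])
        show "(\<lambda>x. g ?Z (s + t + x)) \<in> borel_measurable borel"
          by (rule measurable_compose[OF _ g_borel[OF Z]]) simp
      qed
      finally have "(\<integral>\<^sup>+u. (\<integral>\<^sup>+v. H X s u Y t v \<partial>?M) \<partial>?M) =
          ennreal ((rdet X * s) powr a * (rdet Y * t) powr b * rdet ?N powr (- (real d / 2))) * (\<integral>\<^sup>+u. g ?Z (s + t + ?q u) \<partial>?M)"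
        by (simp add: ennreal_mult mult.assoc)
      \<comment> \<open>\<open>rdet_minv_add\<close> expresses the determinant of N through X, Y and
        their sum. This is the source of the extra d / 2 in the exponents of X and Y and of the
        power - d / 2 of their sum.\<close>
      also have "(rdet X * s) powr a * (rdet Y * t) powr b * rdet ?N powr (- (real d / 2)) =
          (rdet X powr (a + real d / 2) * rdet Y powr (b + real d / 2)) * (rdet ?Z powr (- (real d / 2)) * (s powr a * t powr b))"
        using rdet_pos[OF X] rdet_pos[OF Y] rdet_pos[OF Z] s t unfolding N(2)
        unfolding powr_add[of _ a] powr_add[of _ b] powr_minus
        by (simp add: powr_mult powr_divide divide_simps)
      finally show "(\<integral>\<^sup>+u. (\<integral>\<^sup>+v. H X s u Y t v \<partial>?M) \<partial>?M) =
          ennreal (rdet X powr (a + real d / 2) * rdet Y powr (b + real d / 2)) *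
          (ennreal (rdet ?Z powr (- (real d / 2))) * (ennreal (s powr a * t powr b) * (\<integral>\<^sup>+u. g ?Z (s + t + ?q u) \<partial>?M)))"
        by (simp add: ennreal_mult mult.assoc)
    qed
    \<comment> \<open>For fixed X and Y what remains in s, t and u is the scalar convolution with
      constant \<open>C'\<close>; bringing Y outside the integral over s isolates it.\<close>
    also have "\<dots> = (\<integral>\<^sup>+X. (\<integral>\<^sup>+Y. ennreal (rdet X powr (a + real d / 2) * rdet Y powr (b + real d / 2)) *
        (ennreal (rdet (X + Y) powr (- (real d / 2))) * (C' * (\<integral>\<^sup>+\<sigma>. ennreal (\<sigma> powr ?e) * g (X + Y) \<sigma> \<partial>HL))) \<partial>?P) \<partial>?P)"
    proof (rule nn_integral_cong)
      fix X assume X: "X \<in> space ?P"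
      let ?W = "\<lambda>Y. ennreal (rdet X powr (a + real d / 2) * rdet Y powr (b + real d / 2))"
        and ?D = "\<lambda>Y. ennreal (rdet (X + Y) powr (- (real d / 2)))"
      let ?G = "\<lambda>s Y t. \<integral>\<^sup>+u. g (X + Y) (s + t + ?q u) \<partial>?M"
      have Gm: "(\<lambda>p. ?G (s p) (Y p) (t p)) \<in> borel_measurable N"
        if s: "s \<in> N \<rightarrow>\<^sub>M HL" and Y: "Y \<in> N \<rightarrow>\<^sub>M ?P" and t: "t \<in> N \<rightarrow>\<^sub>M HL" for s Y t and N :: "'z measure"
      proof (rule M.borel_measurable_nn_integral, unfold split_beta')
        let ?N = "N \<Otimes>\<^sub>M ?M"
        have sg: "(\<lambda>p. s (fst p) + t (fst p) + ?q (snd p)) \<in> ?N \<rightarrow>\<^sub>M HL"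
        proof -
          have 0: "0 \<le> ?q u" if "u \<in> mats d m 1" for u
            unfolding qf_one_nonneg[OF matsD[OF that]] by (intro sum_nonneg) simp
          have [measurable]: "(\<lambda>p. s (fst p)) \<in> borel_measurable ?N" "(\<lambda>p. t (fst p)) \<in> borel_measurable ?N"
            by (rule measurable_compose[OF measurable_fst meas_HL_real[OF s]] measurable_compose[OF measurable_fst meas_HL_real[OF t]])+
          have [measurable]: "(\<lambda>p. ?q (snd p)) \<in> borel_measurable ?N"
            by (rule measurable_compose[OF measurable_snd meas_qf_const[OF herm_one, of "\<lambda>x. x"]]) simp
          have "(\<lambda>p. s (fst p) + t (fst p) + ?q (snd p)) \<in> borel_measurable ?N" by measurable
          moreover have "0 < s (fst p) + t (fst p) + ?q (snd p)" if "p \<in> space ?N" for p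
            using measurable_space[OF s, of "fst p"] measurable_space[OF t, of "fst p"] 0[of "snd p"] that
            by (auto simp: space_pair_measure add_pos_nonneg)
          ultimately show ?thesis unfolding HL_def by (simp add: measurable_restrict_space2_iff)
        qed
        have Z: "(\<lambda>p. X + Y (fst p)) \<in> ?N \<rightarrow>\<^sub>M ?P"
          by (intro meas_add_PD measurable_compose[OF measurable_fst Y] measurable_const X)
        have "(\<lambda>p. (\<integral>\<^sup>+w. f (blkB (X + Y (fst p)) w (mat1 (s (fst p) + t (fst p) + ?q (snd p)))) \<partial>?M)) \<in> borel_measurable ?N"
          by (rule gHL[OF Z sg])
        then show "(\<lambda>p. g (X + Y (fst p)) (s (fst p) + t (fst p) + ?q (snd p))) \<in> borel_measurable ?N"
          by (rule borel_cong[rotated]) (use measurable_space[OF sg] in \<open>simp add: g_def\<close>)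
      qed
      have Tm: "(\<lambda>p. ?W (Y p) * (?D (Y p) * (ennreal (s p powr a * t p powr b) * ?G (s p) (Y p) (t p)))) \<in> borel_measurable N"
        if s: "s \<in> N \<rightarrow>\<^sub>M HL" and Y: "Y \<in> N \<rightarrow>\<^sub>M ?P" and t: "t \<in> N \<rightarrow>\<^sub>M HL" for s Y t and N :: "'z measure"
      proof -
        have Z: "(\<lambda>p. X + Y p) \<in> N \<rightarrow>\<^sub>M ?P" by (intro meas_add_PD Y measurable_const X)
        note [measurable] = rdet[OF Y] rdet[OF Z] meas_HL_real[OF s] meas_HL_real[OF t]
        show ?thesis by (intro borel_measurable_times_ennreal Gm[OF s Y t]) measurable
      qed
      have Gm': "(\<lambda>p. ennreal (s p powr a * t p powr b) * ?G (s p) (Y p) (t p)) \<in> borel_measurable N"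
        if s: "s \<in> N \<rightarrow>\<^sub>M HL" and Y: "Y \<in> N \<rightarrow>\<^sub>M ?P" and t: "t \<in> N \<rightarrow>\<^sub>M HL" for s Y t and N :: "'z measure"
      proof -
        note [measurable] = meas_HL_real[OF s] meas_HL_real[OF t]
        show ?thesis by (intro borel_measurable_times_ennreal Gm[OF s Y t]) measurable
      qed
      have "(\<integral>\<^sup>+s. (\<integral>\<^sup>+Y. (\<integral>\<^sup>+t. ?W Y * (?D Y * (ennreal (s powr a * t powr b) * ?G s Y t)) \<partial>HL) \<partial>?P) \<partial>HL) =
          (\<integral>\<^sup>+Y. (\<integral>\<^sup>+s. (\<integral>\<^sup>+t. ?W Y * (?D Y * (ennreal (s powr a * t powr b) * ?G s Y t)) \<partial>HL) \<partial>HL) \<partial>?P)"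
        apply (rule PH.Fubini')
        apply (unfold split_beta')
        apply (rule HL.borel_measurable_nn_integral, unfold split_beta')
        by (rule Tm) auto
      also have "\<dots> = (\<integral>\<^sup>+Y. ?W Y * (?D Y * (C' * (\<integral>\<^sup>+\<sigma>. ennreal (\<sigma> powr ?e) * g (X + Y) \<sigma> \<partial>HL))) \<partial>?P)"
      proof (rule nn_integral_cong)
        fix Y assume Y: "Y \<in> space ?P"
        have Z: "X + Y \<in> posdef d m" using X Y by (intro posdef_add) auto
        have m2: "(\<lambda>t. ennreal (s powr a * t powr b) * ?G s Y t) \<in> borel_measurable HL" if "s \<in> space HL" for s
          by (rule Gm') (use Y that in auto)
        have m1: "(\<lambda>s. \<integral>\<^sup>+t. ennreal (s powr a * t powr b) * ?G s Y t \<partial>HL) \<in> borel_measurable HL"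
          by (rule HL.borel_measurable_nn_integral, unfold split_beta', rule Gm') (use Y in auto)
        have "(\<integral>\<^sup>+s. (\<integral>\<^sup>+t. ?W Y * (?D Y * (ennreal (s powr a * t powr b) * ?G s Y t)) \<partial>HL) \<partial>HL) =
            (\<integral>\<^sup>+s. (?W Y * ?D Y) * (\<integral>\<^sup>+t. ennreal (s powr a * t powr b) * ?G s Y t \<partial>HL) \<partial>HL)"
        proof (rule nn_integral_cong)
          fix s assume s: "s \<in> space HL"
          show "(\<integral>\<^sup>+t. ?W Y * (?D Y * (ennreal (s powr a * t powr b) * ?G s Y t)) \<partial>HL) =
              (?W Y * ?D Y) * (\<integral>\<^sup>+t. ennreal (s powr a * t powr b) * ?G s Y t \<partial>HL)"
            unfolding nn_integral_cmult[OF m2[OF s], symmetric] by (simp only: mult.assoc)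
        qed
        also have "\<dots> = (?W Y * ?D Y) * (\<integral>\<^sup>+s. (\<integral>\<^sup>+t. ennreal (s powr a * t powr b) * ?G s Y t \<partial>HL) \<partial>HL)"
          by (rule nn_integral_cmult[OF m1])
        finally show "(\<integral>\<^sup>+s. (\<integral>\<^sup>+t. ?W Y * (?D Y * (ennreal (s powr a * t powr b) * ?G s Y t)) \<partial>HL) \<partial>HL) =
            ?W Y * (?D Y * (C' * (\<integral>\<^sup>+\<sigma>. ennreal (\<sigma> powr ?e) * g (X + Y) \<sigma> \<partial>HL)))"
          unfolding C'[OF g_borel[OF Z]] by (simp only: mult.assoc)
      qed
      finally show "(\<integral>\<^sup>+s. (\<integral>\<^sup>+Y. (\<integral>\<^sup>+t. ?W Y * (?D Y * (ennreal (s powr a * t powr b) * ?G s Y t)) \<partial>HL) \<partial>?P) \<partial>HL) =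
          (\<integral>\<^sup>+Y. ?W Y * (?D Y * (C' * (\<integral>\<^sup>+\<sigma>. ennreal (\<sigma> powr ?e) * g (X + Y) \<sigma> \<partial>HL))) \<partial>?P)" .
    qed
    also have "\<dots> = C * (\<integral>\<^sup>+Z. ennreal (rdet Z powr (a + real d / 2 + (b + real d / 2) + 1 + (real m - 1) * real d / 2)) *
        (ennreal (rdet Z powr (- (real d / 2))) * (C' * (\<integral>\<^sup>+\<sigma>. ennreal (\<sigma> powr ?e) * g Z \<sigma> \<partial>HL))) \<partial>?P)"
    proof (rule C)
      have id: "(\<lambda>x. x) \<in> ?P \<rightarrow>\<^sub>M ?P" by simp
      have g2: "(\<lambda>p. g (fst p) (snd p)) \<in> borel_measurable (?P \<Otimes>\<^sub>M HL)"
        using gHL[OF measurable_fst[of ?P HL] measurable_snd[of ?P HL]]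
        by (rule borel_cong[rotated]) (auto simp: g_def space_pair_measure)
      have id': "(\<lambda>p. snd p) \<in> borel_measurable (?P \<Otimes>\<^sub>M HL)" by (rule meas_HL_real[OF measurable_snd])
      note [measurable] = rdet[OF id]
      have "(\<lambda>Z. \<integral>\<^sup>+\<sigma>. ennreal (\<sigma> powr ?e) * g Z \<sigma> \<partial>HL) \<in> borel_measurable ?P"
        by (rule HL.borel_measurable_nn_integral, unfold split_beta')
           (intro borel_measurable_times_ennreal g2 measurable_compose[OF id', of "\<lambda>x. ennreal (x powr ?e)"], simp)
      then show "(\<lambda>Z. ennreal (rdet Z powr (- (real d / 2))) * (C' * (\<integral>\<^sup>+\<sigma>. ennreal (\<sigma> powr ?e) * g Z \<sigma> \<partial>HL))) \<in> borel_measurable ?P"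
        by measurable
    qed
    also have "\<dots> = C * (\<integral>\<^sup>+Z. C' * (\<integral>\<^sup>+\<sigma>. (\<integral>\<^sup>+w. ennreal (rdet (blkB Z w (mat1 \<sigma>)) powr ?e) * f (blkB Z w (mat1 \<sigma>)) \<partial>?M) \<partial>HL) \<partial>?P)"
    proof (intro arg_cong[where f="\<lambda>x. C * x"] nn_integral_cong)
      fix Z assume "Z \<in> space ?P"
      then have Z: "Z \<in> posdef d m" by simp
      have dz: "rdet (blkB Z u (mat1 s)) = rdet Z * s" if "u \<in> mats d m 1" for u s
        using det_blkB(2)[OF Z matsD[OF that] mat1_herm] by simp
      \<comment> \<open>The induction hypothesis delivers \<open>?e + d / 2\<close>; the factor with
        power - d / 2 brings it down to \<open>?e\<close>, the exponent demanded for size m + 1 and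
        already the one attached to the pivot \<sigma>.\<close>
      let ?E = "a + real d / 2 + (b + real d / 2) + 1 + (real m - 1) * real d / 2"
      have E: "rdet Z powr ?E * rdet Z powr (- (real d / 2)) = rdet Z powr ?e"
      proof -
        have "?E + - (real d / 2) = ?e" by (simp add: field_simps)
        then show ?thesis by (simp only: powr_add[symmetric])
      qed
      have fw: "(\<lambda>w. f (blkB Z w (mat1 \<sigma>))) \<in> borel_measurable ?M" if "\<sigma> \<in> space HL" for \<sigma>
        by (rule measurable_compose[OF meas_blkB_PD f]) (use Z that in \<open>auto simp: mat1_posdef_iff\<close>)
      have mg: "(\<lambda>\<sigma>. ennreal (\<sigma> powr ?e) * g Z \<sigma>) \<in> borel_measurable HL"
        by (rule borel_HL) (use g_borel[OF Z] in measurable)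
      have "(\<integral>\<^sup>+\<sigma>. (\<integral>\<^sup>+w. ennreal (rdet (blkB Z w (mat1 \<sigma>)) powr ?e) * f (blkB Z w (mat1 \<sigma>)) \<partial>?M) \<partial>HL) =
          (\<integral>\<^sup>+\<sigma>. ennreal (rdet Z powr ?e) * (ennreal (\<sigma> powr ?e) * g Z \<sigma>) \<partial>HL)"
      proof (rule nn_integral_cong)
        fix \<sigma> assume \<sigma>: "\<sigma> \<in> space HL"
        have "(\<integral>\<^sup>+w. ennreal (rdet (blkB Z w (mat1 \<sigma>)) powr ?e) * f (blkB Z w (mat1 \<sigma>)) \<partial>?M) =
            (\<integral>\<^sup>+w. ennreal ((rdet Z * \<sigma>) powr ?e) * f (blkB Z w (mat1 \<sigma>)) \<partial>?M)"
          by (intro nn_integral_cong) (simp add: dz)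
        also have "\<dots> = ennreal ((rdet Z * \<sigma>) powr ?e) * (\<integral>\<^sup>+w. f (blkB Z w (mat1 \<sigma>)) \<partial>?M)"
          by (rule nn_integral_cmult[OF fw[OF \<sigma>]])
        finally show "(\<integral>\<^sup>+w. ennreal (rdet (blkB Z w (mat1 \<sigma>)) powr ?e) * f (blkB Z w (mat1 \<sigma>)) \<partial>?M) =
            ennreal (rdet Z powr ?e) * (ennreal (\<sigma> powr ?e) * g Z \<sigma>)"
          using rdet_pos[OF Z] \<sigma> by (simp add: g_def powr_mult ennreal_mult mult.assoc)
      qed
      also have "\<dots> = ennreal (rdet Z powr ?e) * (\<integral>\<^sup>+\<sigma>. ennreal (\<sigma> powr ?e) * g Z \<sigma> \<partial>HL)"
        by (rule nn_integral_cmult[OF mg])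
      finally show "ennreal (rdet Z powr ?E) * (ennreal (rdet Z powr (- (real d / 2))) * (C' * (\<integral>\<^sup>+\<sigma>. ennreal (\<sigma> powr ?e) * g Z \<sigma> \<partial>HL))) =
          C' * (\<integral>\<^sup>+\<sigma>. (\<integral>\<^sup>+w. ennreal (rdet (blkB Z w (mat1 \<sigma>)) powr ?e) * f (blkB Z w (mat1 \<sigma>)) \<partial>?M) \<partial>HL)"
        unfolding ennreal_mult_assoc'[OF powr_ge_zero powr_ge_zero] E by (simp only: mult_ac)
    qed
    also have "\<dots> = C * (C' * (\<integral>\<^sup>+Z. (\<integral>\<^sup>+\<sigma>. (\<integral>\<^sup>+w. ennreal (rdet (blkB Z w (mat1 \<sigma>)) powr ?e) * f (blkB Z w (mat1 \<sigma>)) \<partial>?M) \<partial>HL) \<partial>?P))"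
    proof (intro arg_cong[where f="\<lambda>x. C * x"] nn_integral_cmult)
      have x: "(\<lambda>p. blkB (fst (fst p)) (snd p) (mat1 (snd (fst p)))) \<in> (?P \<Otimes>\<^sub>M HL) \<Otimes>\<^sub>M ?M \<rightarrow>\<^sub>M ?P1"
        by (intro meas_blkB_PD meas_mat1_PD) auto
      have m: "(\<lambda>p. ennreal (rdet (blkB (fst (fst p)) (snd p) (mat1 (snd (fst p)))) powr ?e)) \<in> borel_measurable ((?P \<Otimes>\<^sub>M HL) \<Otimes>\<^sub>M ?M)"
        by (rule measurable_compose[OF rdet[OF x], of "\<lambda>x. ennreal (x powr ?e)"]) simp
      show "(\<lambda>Z. (\<integral>\<^sup>+\<sigma>. (\<integral>\<^sup>+w. ennreal (rdet (blkB Z w (mat1 \<sigma>)) powr ?e) * f (blkB Z w (mat1 \<sigma>)) \<partial>?M) \<partial>HL)) \<in> borel_measurable ?P"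
        apply (rule HL.borel_measurable_nn_integral, unfold split_beta')
        apply (rule M.borel_measurable_nn_integral, unfold split_beta')
        by (intro borel_measurable_times_ennreal m measurable_compose[OF x f])
    qed
    also have "(\<integral>\<^sup>+Z. (\<integral>\<^sup>+\<sigma>. (\<integral>\<^sup>+w. ennreal (rdet (blkB Z w (mat1 \<sigma>)) powr ?e) * f (blkB Z w (mat1 \<sigma>)) \<partial>?M) \<partial>HL) \<partial>?P) =
        (\<integral>\<^sup>+z. ennreal (rdet z powr ?e) * f z \<partial>?P1)"
    proof (rule nn_integral_PD_Suc[symmetric])
      have id: "(\<lambda>x. x) \<in> ?P1 \<rightarrow>\<^sub>M ?P1" by simp
      note [measurable] = rdet[OF id] f
      show "(\<lambda>z. ennreal (rdet z powr ?e) * f z) \<in> borel_measurable ?P1" by measurable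
    qed
    finally show ?thesis by (simp only: mult.assoc)
  qed
  then show ?case by (intro exI[of _ "C * C'"]) (simp add: Suc_eq_plus1)
qed

lemma rtrace_mult_add:
  assumes "\<xi> \<in> carrier_mat m m" "x \<in> carrier_mat m m" "y \<in> carrier_mat m m"
  shows "rtrace (\<xi> * (x + y)) = rtrace (\<xi> * x) + rtrace (\<xi> * y)"
  unfolding mult_add_distrib_mat[OF assms]
  by (rule rtrace_add[OF mult_carrier_mat[OF assms(1,2)] mult_carrier_mat[OF assms(1,3)]])

lemma wparam_add: "wparam m \<mu> \<Longrightarrow> wparam m \<nu> \<Longrightarrow> wparam m (\<mu> + \<nu>)"
  unfolding wparam_def
proof (intro allI impI)
  fix j assume a: "\<forall>j<m. 0 < \<mu> - real j * real d / 2" "\<forall>j<m. 0 < \<nu> - real j * real d / 2" and j: "j < m"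
  have "0 \<le> real j * real d / 2" by simp
  then show "0 < \<mu> + \<nu> - real j * real d / 2" using a j by (smt (verit))
qed

lemma ennreal_mult_mult3:
  "0 \<le> a \<Longrightarrow> 0 \<le> b \<Longrightarrow> 0 \<le> c \<Longrightarrow> ennreal (a * (b * c)) * z = ennreal a * (ennreal b * (ennreal c * z))"
  by (simp add: ennreal_mult mult.assoc)

lemma wishart_convolution:
  assumes \<xi>: "\<xi> \<in> posdef d m" and \<mu>: "wparam m \<mu>" and \<nu>: "wparam m \<nu>" and f: "f \<in> borel_measurable (PD d m)"
  shows "(\<integral>\<^sup>+x. (\<integral>\<^sup>+y. f (x + y) * ennreal (wdens m \<nu> \<xi> y) \<partial>PD d m) * ennreal (wdens m \<mu> \<xi> x) \<partial>PD d m) =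
    (\<integral>\<^sup>+z. f z * ennreal (wdens m (\<mu> + \<nu>) \<xi> z) \<partial>PD d m)"
proof -
  let ?P = "PD d m"
  let ?k = "\<lambda>\<mu>. \<mu> - 1 - (real m - 1) * real d / 2" and ?c = "\<lambda>\<mu>. rdet \<xi> powr \<mu> / wconst m \<mu>"
  interpret P: sigma_finite_measure ?P by (rule sigma_finite_PD)
  note \<mu>\<nu> = wparam_add[OF \<mu> \<nu>]
  have cpos: "0 < ?c \<mu>" if "wparam m \<mu>" for \<mu> using wconst_pos[OF that] rdet_pos[OF \<xi>] by simp
  have w: "wdens m \<mu> \<xi> x = ?c \<mu> * (rdet x powr ?k \<mu> * exp (- rtrace (\<xi> * x)))" for \<mu> x
    by (simp add: wdens_def wkernel_def)
  obtain C where C: "\<And>f. f \<in> borel_measurable ?P \<Longrightarrow>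
    (\<integral>\<^sup>+x. (\<integral>\<^sup>+y. ennreal (rdet x powr ?k \<mu> * rdet y powr ?k \<nu>) * f (x + y) \<partial>?P) \<partial>?P) =
    C * (\<integral>\<^sup>+z. ennreal (rdet z powr (?k \<mu> + ?k \<nu> + 1 + (real m - 1) * real d / 2)) * f z \<partial>?P)"
    using wishart_convolution_kernel[of m "?k \<mu>" "?k \<nu>"] by blast
  have id: "(\<lambda>x. x) \<in> ?P \<rightarrow>\<^sub>M ?P" by simp
  have m1 [measurable]: "(\<lambda>x. ennreal (wdens m \<mu> \<xi> x)) \<in> borel_measurable ?P" for \<mu>
    by (rule measurable_compose[OF meas_wdens[OF \<xi> id] measurable_ennreal])
  have m2 [measurable]: "(\<lambda>x. rtrace (\<xi> * x)) \<in> borel_measurable ?P"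
    by (rule meas_trace_prod[OF meas_mats_of_PD[OF measurable_const] meas_mats_of_PD[OF id]]) (use \<xi> in simp)
  have e: "?k \<mu> + ?k \<nu> + 1 + (real m - 1) * real d / 2 = ?k (\<mu> + \<nu>)" by (simp add: algebra_simps)
  define K where "K = ennreal (?c \<mu> * ?c \<nu> / ?c (\<mu> + \<nu>)) * C"
  have key: "(\<integral>\<^sup>+x. (\<integral>\<^sup>+y. f (x + y) * ennreal (wdens m \<nu> \<xi> y) \<partial>?P) * ennreal (wdens m \<mu> \<xi> x) \<partial>?P) =
      K * (\<integral>\<^sup>+z. f z * ennreal (wdens m (\<mu> + \<nu>) \<xi> z) \<partial>?P)"
    if f [measurable]: "f \<in> borel_measurable ?P" for f
  proof -
    define g where "g z = ennreal (exp (- rtrace (\<xi> * z))) * f z" for z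
    have g [measurable]: "g \<in> borel_measurable ?P" unfolding g_def by measurable
    have r: "(\<lambda>x. rdet (A x)) \<in> borel_measurable N" if "A \<in> N \<rightarrow>\<^sub>M ?P" for A and N :: "'z measure"
      by (rule meas_rdet[OF meas_mats_of_PD[OF that]])
    have fy: "(\<lambda>y. f (x + y)) \<in> borel_measurable ?P" "(\<lambda>y. g (x + y)) \<in> borel_measurable ?P" if "x \<in> posdef d m" for x
    proof -
      have a: "(\<lambda>y. x + y) \<in> ?P \<rightarrow>\<^sub>M ?P" by (rule meas_add_PD[OF measurable_const id]) (use that in simp)
      show "(\<lambda>y. f (x + y)) \<in> borel_measurable ?P" "(\<lambda>y. g (x + y)) \<in> borel_measurable ?P"
        by (rule measurable_compose[OF a f] measurable_compose[OF a g])+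
    qed
    have r2: "(\<lambda>y. ennreal (rdet x powr ?k \<mu> * rdet y powr ?k \<nu>) * g (x + y)) \<in> borel_measurable ?P" if "x \<in> posdef d m" for x
    proof -
      note [measurable] = r[OF id]
      show ?thesis by (intro borel_measurable_times_ennreal fy(2)[OF that]) measurable
    qed
    have r3: "(\<lambda>x. \<integral>\<^sup>+y. ennreal (rdet x powr ?k \<mu> * rdet y powr ?k \<nu>) * g (x + y) \<partial>?P) \<in> borel_measurable ?P"
    proof (rule P.borel_measurable_nn_integral)
      note [measurable] = r[OF measurable_fst] r[OF measurable_snd]
      show "(\<lambda>(x, y). ennreal (rdet x powr ?k \<mu> * rdet y powr ?k \<nu>) * g (x + y)) \<in> borel_measurable (?P \<Otimes>\<^sub>M ?P)"
        unfolding split_beta'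
        by (intro borel_measurable_times_ennreal measurable_compose[OF meas_add_PD[OF measurable_fst measurable_snd] g]) measurable
    qed
    have "(\<integral>\<^sup>+x. (\<integral>\<^sup>+y. f (x + y) * ennreal (wdens m \<nu> \<xi> y) \<partial>?P) * ennreal (wdens m \<mu> \<xi> x) \<partial>?P) =
        (\<integral>\<^sup>+x. ennreal (?c \<mu> * ?c \<nu>) * (\<integral>\<^sup>+y. ennreal (rdet x powr ?k \<mu> * rdet y powr ?k \<nu>) * g (x + y) \<partial>?P) \<partial>?P)"
    proof (rule nn_integral_cong)
      fix x assume "x \<in> space ?P"
      then have x: "x \<in> posdef d m" by simp
      have "(\<integral>\<^sup>+y. f (x + y) * ennreal (wdens m \<nu> \<xi> y) \<partial>?P) * ennreal (wdens m \<mu> \<xi> x) =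
          (\<integral>\<^sup>+y. f (x + y) * ennreal (wdens m \<nu> \<xi> y) * ennreal (wdens m \<mu> \<xi> x) \<partial>?P)"
        by (rule nn_integral_multc[symmetric]) (intro borel_measurable_times_ennreal fy(1)[OF x] m1)
      also have "\<dots> = (\<integral>\<^sup>+y. ennreal (?c \<mu> * ?c \<nu>) * (ennreal (rdet x powr ?k \<mu> * rdet y powr ?k \<nu>) * g (x + y)) \<partial>?P)"
      proof (rule nn_integral_cong)
        fix y assume "y \<in> space ?P"
        then have y: "y \<in> posdef d m" by simp
        have "wdens m \<nu> \<xi> y * wdens m \<mu> \<xi> x =
            (?c \<mu> * ?c \<nu>) * ((rdet x powr ?k \<mu> * rdet y powr ?k \<nu>) * exp (- rtrace (\<xi> * (x + y))))"
          unfolding w rtrace_mult_add[OF posdef_carrier[OF \<xi>] posdef_carrier[OF x] posdef_carrier[OF y]]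
          by (simp add: exp_add[symmetric] exp_minus exp_diff field_simps)
        then have "f (x + y) * ennreal (wdens m \<nu> \<xi> y) * ennreal (wdens m \<mu> \<xi> x) =
            ennreal ((?c \<mu> * ?c \<nu>) * ((rdet x powr ?k \<mu> * rdet y powr ?k \<nu>) * exp (- rtrace (\<xi> * (x + y))))) * f (x + y)"
          using ennreal_mult[OF wdens_nonneg[OF \<nu>] wdens_nonneg[OF \<mu>], of \<xi> y \<xi> x] by (simp only: mult_ac)
        also have "\<dots> = ennreal (?c \<mu> * ?c \<nu>) * (ennreal (rdet x powr ?k \<mu> * rdet y powr ?k \<nu>) * g (x + y))"
          unfolding g_def
          by (intro ennreal_mult_mult3 mult_nonneg_nonneg[OF less_imp_le[OF cpos[OF \<mu>]] less_imp_le[OF cpos[OF \<nu>]]]) simp_all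
        finally show "f (x + y) * ennreal (wdens m \<nu> \<xi> y) * ennreal (wdens m \<mu> \<xi> x) =
            ennreal (?c \<mu> * ?c \<nu>) * (ennreal (rdet x powr ?k \<mu> * rdet y powr ?k \<nu>) * g (x + y))" .
      qed
      also have "\<dots> = ennreal (?c \<mu> * ?c \<nu>) * (\<integral>\<^sup>+y. ennreal (rdet x powr ?k \<mu> * rdet y powr ?k \<nu>) * g (x + y) \<partial>?P)"
        by (rule nn_integral_cmult[OF r2[OF x]])
      finally show "(\<integral>\<^sup>+y. f (x + y) * ennreal (wdens m \<nu> \<xi> y) \<partial>?P) * ennreal (wdens m \<mu> \<xi> x) =
        ennreal (?c \<mu> * ?c \<nu>) * (\<integral>\<^sup>+y. ennreal (rdet x powr ?k \<mu> * rdet y powr ?k \<nu>) * g (x + y) \<partial>?P)" .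
    qed
    also have "\<dots> = ennreal (?c \<mu> * ?c \<nu>) * (C * (\<integral>\<^sup>+z. ennreal (rdet z powr ?k (\<mu> + \<nu>)) * g z \<partial>?P))"
      unfolding nn_integral_cmult[OF r3] C[OF g] e ..
    also have "(\<integral>\<^sup>+z. ennreal (rdet z powr ?k (\<mu> + \<nu>)) * g z \<partial>?P) =
        (\<integral>\<^sup>+z. ennreal (1 / ?c (\<mu> + \<nu>)) * (f z * ennreal (wdens m (\<mu> + \<nu>) \<xi> z)) \<partial>?P)"
    proof (rule nn_integral_cong)
      fix z
      have "ennreal (rdet z powr ?k (\<mu> + \<nu>)) * ennreal (exp (- rtrace (\<xi> * z))) =
          ennreal (1 / ?c (\<mu> + \<nu>)) * ennreal (wdens m (\<mu> + \<nu>) \<xi> z)"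
      proof -
        have "rdet z powr ?k (\<mu> + \<nu>) * exp (- rtrace (\<xi> * z)) = 1 / ?c (\<mu> + \<nu>) * wdens m (\<mu> + \<nu>) \<xi> z"
          unfolding w using wconst_pos[OF \<mu>\<nu>] rdet_pos[OF \<xi>] by (simp add: field_simps)
        then show ?thesis
          using ennreal_mult[of "1 / ?c (\<mu> + \<nu>)" "wdens m (\<mu> + \<nu>) \<xi> z"] wdens_nonneg[OF \<mu>\<nu>, of \<xi> z]
            less_imp_le[OF cpos[OF \<mu>\<nu>]] ennreal_mult[of "rdet z powr ?k (\<mu> + \<nu>)" "exp (- rtrace (\<xi> * z))"]
          by (simp only: zero_le_divide_1_iff powr_ge_zero exp_ge_zero)
      qed
      then show "ennreal (rdet z powr ?k (\<mu> + \<nu>)) * g z = ennreal (1 / ?c (\<mu> + \<nu>)) * (f z * ennreal (wdens m (\<mu> + \<nu>) \<xi> z))"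
        unfolding g_def by (simp add: mult.assoc[symmetric]) (simp add: mult_ac)
    qed
    also have "\<dots> = ennreal (1 / ?c (\<mu> + \<nu>)) * (\<integral>\<^sup>+z. f z * ennreal (wdens m (\<mu> + \<nu>) \<xi> z) \<partial>?P)"
      by (rule nn_integral_cmult[OF borel_measurable_times_ennreal[OF f m1]])
    also have "ennreal (?c \<mu> * ?c \<nu>) * (C * (ennreal (1 / ?c (\<mu> + \<nu>)) * (\<integral>\<^sup>+z. f z * ennreal (wdens m (\<mu> + \<nu>) \<xi> z) \<partial>?P))) =
        (ennreal (?c \<mu> * ?c \<nu>) * ennreal (1 / ?c (\<mu> + \<nu>))) * C * (\<integral>\<^sup>+z. f z * ennreal (wdens m (\<mu> + \<nu>) \<xi> z) \<partial>?P)"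
      by (simp only: mult_ac)
    also have "ennreal (?c \<mu> * ?c \<nu>) * ennreal (1 / ?c (\<mu> + \<nu>)) = ennreal ((?c \<mu> * ?c \<nu>) * (1 / ?c (\<mu> + \<nu>)))"
      by (intro ennreal_mult[symmetric] mult_nonneg_nonneg zero_le_divide_1_iff[THEN iffD2] less_imp_le cpos \<mu> \<nu> \<mu>\<nu>)
    finally show ?thesis unfolding K_def by simp
  qed
  \<comment> \<open>Testing with f = 1: all three densities have total mass 1, so the anonymous
    constant is determined without evaluating any Beta integral.\<close>
  have "K = 1" using key[of "\<lambda>_. 1"] nn_integral_wdens[OF \<xi> \<mu>] nn_integral_wdens[OF \<xi> \<nu>] nn_integral_wdens[OF \<xi> \<mu>\<nu>] by simp
  then show ?thesis using key[OF f] by simp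
qed

subsection \<open>Wishart densities\<close>

lemma dimE_div: "0 < m \<Longrightarrow> dimE d m / real m = 1 + (real m - 1) * real d / 2"
  by (simp add: dimE_def field_simps)

text \<open>The defining integral of \<open>Gamma_mat\<close> is the total mass of the Wishart
  kernel at the unit matrix.\<close>

lemma Gamma_mat_eq:
  assumes m: "0 < m" and \<mu>: "wparam m \<mu>"
  shows "Gamma_mat d m \<mu> = wconst m \<mu>"
proof -
  let ?f = "\<lambda>x. rdet x powr (\<mu> - dimE d m / real m) * exp (- rtrace x)"
  note one = one_posdef[of m]
  have id: "(\<lambda>x. x) \<in> PD d m \<rightarrow>\<^sub>M PD d m" by simp
  have [measurable]: "(\<lambda>x. rdet x) \<in> borel_measurable (PD d m)" "(\<lambda>x. rtrace x) \<in> borel_measurable (PD d m)"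
    by (rule meas_rdet[OF meas_mats_of_PD[OF id]] meas_rtrace[OF meas_mats_of_PD[OF id]])+
  have eq: "?f x = wconst m \<mu> * wdens m \<mu> (1\<^sub>m m) x" if "x \<in> posdef d m" for x
    using posdef_carrier[OF that] wconst_pos[OF \<mu>] one(2) dimE_div[OF m]
    by (simp add: wdens_def wkernel_def diff_diff_eq)
  have "Gamma_mat d m \<mu> = (\<integral>x. ?f x \<partial>PD d m)"
    unfolding Gamma_mat_def PD_def set_lebesgue_integral_def by (rule integral_restrict_space[symmetric]) (simp add: posdef_sets)
  also have "\<dots> = enn2real (\<integral>\<^sup>+x. ennreal (?f x) \<partial>PD d m)"
    by (rule integral_eq_nn_integral) simp_all
  also have "(\<integral>\<^sup>+x. ennreal (?f x) \<partial>PD d m) = (\<integral>\<^sup>+x. ennreal (wconst m \<mu>) * ennreal (wdens m \<mu> (1\<^sub>m m) x) \<partial>PD d m)"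
    using wconst_pos[OF \<mu>] wdens_nonneg[OF \<mu>] by (intro nn_integral_cong) (simp add: eq ennreal_mult)
  also have "\<dots> = ennreal (wconst m \<mu>) * (\<integral>\<^sup>+x. ennreal (wdens m \<mu> (1\<^sub>m m) x) \<partial>PD d m)"
    by (rule nn_integral_cmult) (rule measurable_compose[OF meas_wdens[OF one(1) id] measurable_ennreal])
  also have "\<dots> = ennreal (wconst m \<mu>)" by (simp add: nn_integral_wdens[OF one(1) \<mu>])
  finally show ?thesis using wconst_pos[OF \<mu>] by simp
qed

lemma wishart_density_eq: "0 < m \<Longrightarrow> wparam m \<mu> \<Longrightarrow> wishart_density d m \<mu> = wdens m \<mu>"
  by (intro ext) (simp add: wishart_density_def wdens_def wkernel_def Gamma_mat_eq dimE_div diff_diff_eq)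

lemma wishart_eq: "0 < m \<Longrightarrow> wparam m \<mu> \<Longrightarrow> wishart d m \<mu> \<xi> = density (PD d m) (\<lambda>x. ennreal (wdens m \<mu> \<xi> x))"
  by (simp add: wishart_def PD_def wishart_density_eq)

context
  fixes m \<mu> \<xi>
  assumes m: "0 < m" and \<mu>: "wparam m \<mu>" and \<xi>: "\<xi> \<in> posdef d m"
begin

lemma meas_wdens_ennreal: "(\<lambda>x. ennreal (wdens m \<mu> \<xi> x)) \<in> borel_measurable (PD d m)"
  by (rule measurable_compose[OF meas_wdens[OF \<xi>] measurable_ennreal]) simp

lemma sets_wishart: "sets (wishart d m \<mu> \<xi>) = sets (PD d m)" and space_wishart: "space (wishart d m \<mu> \<xi>) = posdef d m"
  by (simp_all add: wishart_eq m \<mu>)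

lemma nn_integral_wishart:
  assumes f: "f \<in> borel_measurable (PD d m)"
  shows "(\<integral>\<^sup>+x. f x \<partial>wishart d m \<mu> \<xi>) = (\<integral>\<^sup>+x. f x * ennreal (wdens m \<mu> \<xi> x) \<partial>PD d m)"
  unfolding wishart_eq[OF m \<mu>] by (simp add: nn_integral_density[OF meas_wdens_ennreal f] mult.commute)

lemma prob_space_wishart: "prob_space (wishart d m \<mu> \<xi>)"
  using nn_integral_wishart[of "\<lambda>_. 1"] by (intro prob_spaceI) (simp add: nn_integral_wdens[OF \<xi> \<mu>])

end

subsection \<open>Integrals over the lower right block\<close>

text \<open>\<open>rint\<close> is the contribution of a block \<open>(W, C)\<close> of the parameter. It is computed by peeling
  single rows off \<open>lint\<close>, the integral over all of \<open>PD d (p + k)\<close>, and cancelling \<open>lint\<close> for \<open>k = 0\<close>.\<close>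

definition rint :: "nat \<Rightarrow> nat \<Rightarrow> real \<Rightarrow> complex mat \<Rightarrow> ennreal" where
  "rint p k \<alpha> x = (\<integral>\<^sup>+W. (\<integral>\<^sup>+C. ennreal (rdet C powr \<alpha> * exp (- rtrace (blkA (0\<^sub>m p p) W C * x))) \<partial>PD d k)
     \<partial>mats_lebesgue d p k)"

definition lint :: "nat \<Rightarrow> nat \<Rightarrow> real \<Rightarrow> complex mat \<Rightarrow> ennreal" where
  "lint p k \<alpha> x = (\<integral>\<^sup>+\<xi>. ennreal (rdet (lr p k \<xi>) powr \<alpha> * exp (- rtrace (\<xi> * x))) \<partial>PD d (p + k))"

lemma posdef_blocks:
  assumes x: "x \<in> posdef d (p + k)"
  obtains U V S where "U \<in> carrier_mat p k" "V \<in> carrier_mat k p" "S \<in> carrier_mat k k"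
    "x = four_block_mat (ul p x) U V S"
  using herm_blocks[OF posdef_herm[OF x]] by (metis blocks_carrier mat_adjoint_carrier)

lemma rtrace_blkA_ul:
  assumes Z: "Z \<in> posdef d p" and W: "W \<in> mats d p k" and C: "C \<in> posdef d k" and x: "x \<in> posdef d (p + k)"
  shows "rtrace (blkA Z W C * x) = rtrace (Z * ul p x) + rtrace (blkA (0\<^sub>m p p) W C * x)"
proof -
  obtain U V S where *: "U \<in> carrier_mat p k" "V \<in> carrier_mat k p" "S \<in> carrier_mat k k"
    "x = four_block_mat (ul p x) U V S" using posdef_blocks[OF x] .
  show ?thesis
    using rtrace_blkA_split[OF posdef_carrier[OF Z] matsD[OF W] C blocks_carrier(1)[of p x] *(1-3)] *(4) by simp
qed

lemma lr_blkA: "Z \<in> carrier_mat p p \<Longrightarrow> W \<in> carrier_mat p k \<Longrightarrow> C \<in> carrier_mat k k \<Longrightarrow> minv C \<in> carrier_mat k k \<Longrightarrow>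
    lr p k (blkA Z W C) = C"
  unfolding blkA_def by (intro blocks_four_block(3)[where W=W and V="mat_adjoint W"]) auto

text \<open>Restricting to the lower right block commutes with the Schur complement of the last
  corner, because that complement is computed entry by entry from the last column.\<close>

lemma lr_blkA_1:
  assumes Z: "Z \<in> carrier_mat (p + k) (p + k)" and W: "W \<in> carrier_mat (p + k) 1" and c: "c \<noteq> 0"
  shows "lr p (k + 1) (blkA Z W (mat1 c)) = blkA (lr p k Z) (mat k 1 (\<lambda>(i, j). W $$ (p + i, j))) (mat1 c)"
    (is "_ = blkA _ ?W _")
proof -
  have 1: "minv (mat1 c) = mat1 (1 / c)" by (rule minv_mat1[OF c])
  have W': "?W \<in> carrier_mat k 1" by simp
  have b: "W * mat1 (1 / c) * mat_adjoint W \<in> carrier_mat (p + k) (p + k)" "?W * mat1 (1 / c) * mat_adjoint ?W \<in> carrier_mat k k"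
    by (rule mult_carrier_mat[OF mult_carrier_mat[OF W mat1_carrier] mat_adjoint_carrier[OF W]]
        mult_carrier_mat[OF mult_carrier_mat[OF W' mat1_carrier] mat_adjoint_carrier[OF W']])+
  have e: "(W * mat1 (1 / c) * mat_adjoint W) $$ (p + i, p + j) = (?W * mat1 (1 / c) * mat_adjoint ?W) $$ (i, j)"
    if "i < k" "j < k" for i j
    using that W by (simp add: scalar_prod_def mat1_def One_nat_def del: assoc_mult_mat)
  show ?thesis unfolding blkA_def 1
    by (rule eq_matI) (use Z W b e in \<open>auto simp: lr_def mat1_def simp del: assoc_mult_mat index_mult_mat(1)\<close>)
qed

lemma meas_lr_PD: "(\<lambda>\<xi>. lr p k \<xi>) \<in> PD d (p + k) \<rightarrow>\<^sub>M herm_lebesgue d k"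
  by (rule meas_lr[OF meas_herm_of_PD]) simp

lemma meas_lint:
  assumes x: "x \<in> posdef d (p + k)"
  shows "(\<lambda>\<xi>. ennreal (rdet (lr p k \<xi>) powr \<alpha> * exp (- rtrace (\<xi> * x)))) \<in> borel_measurable (PD d (p + k))"
proof -
  have id: "(\<lambda>x. x) \<in> PD d (p + k) \<rightarrow>\<^sub>M PD d (p + k)" by simp
  have [measurable]: "(\<lambda>\<xi>. rdet (lr p k \<xi>)) \<in> borel_measurable (PD d (p + k))"
    by (rule meas_rdet[OF meas_mats_of_herm[OF meas_lr_PD]])
  have [measurable]: "(\<lambda>\<xi>. rtrace (\<xi> * x)) \<in> borel_measurable (PD d (p + k))"
    by (rule meas_trace_prod[OF meas_mats_of_PD[OF id] meas_mats_of_PD[OF measurable_const]]) (use x in simp)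
  show ?thesis by measurable
qed

lemma meas_rint:
  assumes x: "x \<in> posdef d (p + k)"
  shows "(\<lambda>(W, C). ennreal (rdet C powr \<alpha> * exp (- rtrace (blkA (0\<^sub>m p p) W C * x)))) \<in> borel_measurable (mats_lebesgue d p k \<Otimes>\<^sub>M PD d k)"
proof -
  let ?N = "mats_lebesgue d p k \<Otimes>\<^sub>M PD d k"
  have z: "0\<^sub>m p p \<in> herm d p" by (rule hermI) (auto simp: scalars_def)
  have "(\<lambda>y. blkA (0\<^sub>m p p) (fst y) (snd y)) \<in> ?N \<rightarrow>\<^sub>M herm_lebesgue d (p + k)"
    by (rule meas_blkA[OF measurable_const measurable_fst measurable_snd]) (use z in simp)
  then have [measurable]: "(\<lambda>y. rtrace (blkA (0\<^sub>m p p) (fst y) (snd y) * x)) \<in> borel_measurable ?N"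
    by (rule meas_trace_prod[OF meas_mats_of_herm meas_mats_of_PD[OF measurable_const]]) (use x in simp)
  have [measurable]: "(\<lambda>y. rdet (snd y)) \<in> borel_measurable ?N"
    by (rule meas_rdet[OF meas_mats_of_PD[OF measurable_snd]])
  show ?thesis unfolding split_beta' by measurable
qed

text \<open>The trace splits into a part with Z alone and a part with W and C, and the power of the
  determinant involves C alone; the integral over the cone is therefore a product.\<close>

lemma lint_split:
  assumes x: "x \<in> posdef d (p + k)"
  shows "lint p k \<alpha> x = lint p 0 \<alpha> (ul p x) * rint p k \<alpha> x"
proof -
  let ?e = "\<lambda>W C. ennreal (rdet C powr \<alpha> * exp (- rtrace (blkA (0\<^sub>m p p) W C * x)))"
  interpret PDk: sigma_finite_measure "PD d k" by (rule sigma_finite_PD)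
  have X: "ul p x \<in> posdef d (p + 0)" using ul_posdef[OF x, of p] by simp
  have me: "(\<lambda>Z. ennreal (exp (- rtrace (Z * ul p x)))) \<in> borel_measurable (PD d p)"
    using meas_lint[OF X, of 0, unfolded add_0_right] by (rule borel_cong[rotated]) (simp add: lr_def rdet_def)
  have l0: "lint p 0 \<alpha> (ul p x) = (\<integral>\<^sup>+Z. ennreal (exp (- rtrace (Z * ul p x))) \<partial>PD d p)"
    unfolding lint_def by (simp add: lr_def rdet_def)
  have mC: "(\<lambda>C. ?e W C) \<in> borel_measurable (PD d k)" if "W \<in> mats d p k" for W
    using measurable_compose[OF measurable_Pair1'[of W "mats_lebesgue d p k" "PD d k"] meas_rint[OF x, of \<alpha>]] that by simp
  have mW: "(\<lambda>W. \<integral>\<^sup>+C. ?e W C \<partial>PD d k) \<in> borel_measurable (mats_lebesgue d p k)"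
    by (rule PDk.borel_measurable_nn_integral[OF meas_rint[OF x]])
  have "lint p k \<alpha> x = (\<integral>\<^sup>+W. (\<integral>\<^sup>+C. (\<integral>\<^sup>+Z. ?e W C * ennreal (exp (- rtrace (Z * ul p x))) \<partial>PD d p) \<partial>PD d k) \<partial>mats_lebesgue d p k)"
    unfolding lint_def nn_integral_PD_blkA[OF meas_lint[OF x]]
  proof (intro nn_integral_cong)
    fix W C Z assume "W \<in> space (mats_lebesgue d p k)" "C \<in> space (PD d k)" "Z \<in> space (PD d p)"
    then have W: "W \<in> mats d p k" and C: "C \<in> posdef d k" and Z: "Z \<in> posdef d p" by auto
    show "ennreal (rdet (lr p k (blkA Z W C)) powr \<alpha> * exp (- rtrace (blkA Z W C * x))) =
        ?e W C * ennreal (exp (- rtrace (Z * ul p x)))"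
      unfolding rtrace_blkA_ul[OF Z W C x] lr_blkA[OF posdef_carrier[OF Z] matsD[OF W] posdef_carrier[OF C] minv_posdef_carrier(1)[OF d C]]
      by (simp add: ennreal_mult[symmetric] exp_add[symmetric] mult.assoc)
  qed
  also have "\<dots> = (\<integral>\<^sup>+W. (\<integral>\<^sup>+C. ?e W C \<partial>PD d k) * lint p 0 \<alpha> (ul p x) \<partial>mats_lebesgue d p k)"
    by (intro nn_integral_cong) (simp add: nn_integral_cmult[OF me] l0[symmetric] nn_integral_multc[OF mC])
  also have "\<dots> = rint p k \<alpha> x * lint p 0 \<alpha> (ul p x)"
    unfolding rint_def by (rule nn_integral_multc[OF mW])
  finally show ?thesis by (simp add: mult.commute)
qed

text \<open>The same splitting with only the last row removed. By \<open>lr_blkA_1\<close> the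
  determinant of the larger lower right block is that of the smaller one times the corner, so that
  both factors keep the exponent \<alpha>.\<close>

lemma lint_Suc:
  assumes x: "x \<in> posdef d (p + (k + 1))"
  shows "lint p (k + 1) \<alpha> x = lint p k \<alpha> (ul (p + k) x) * rint (p + k) 1 \<alpha> x"
proof -
  let ?m = "p + k"
  have x': "x \<in> posdef d (?m + 1)" using x by (simp add: add.assoc)
  let ?e = "\<lambda>W C. ennreal (rdet C powr \<alpha> * exp (- rtrace (blkA (0\<^sub>m ?m ?m) W C * x)))"
  let ?f = "\<lambda>Z. ennreal (rdet (lr p k Z) powr \<alpha> * exp (- rtrace (Z * ul ?m x)))"
  interpret PDk: sigma_finite_measure "PD d 1" by (rule sigma_finite_PD)
  have X: "ul ?m x \<in> posdef d ?m" using ul_posdef[OF x', of ?m] by simp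
  have me: "?f \<in> borel_measurable (PD d ?m)" by (rule meas_lint[OF X])
  have mC: "(\<lambda>C. ?e W C) \<in> borel_measurable (PD d 1)" if "W \<in> mats d ?m 1" for W
    using measurable_compose[OF measurable_Pair1'[of W "mats_lebesgue d ?m 1" "PD d 1"] meas_rint[OF x', of \<alpha>]] that by simp
  have mW: "(\<lambda>W. \<integral>\<^sup>+C. ?e W C \<partial>PD d 1) \<in> borel_measurable (mats_lebesgue d ?m 1)"
    by (rule PDk.borel_measurable_nn_integral[OF meas_rint[OF x']])
  have ml: "(\<lambda>\<xi>. ennreal (rdet (lr p (k + 1) \<xi>) powr \<alpha> * exp (- rtrace (\<xi> * x)))) \<in> borel_measurable (PD d (?m + 1))"
    using meas_lint[OF x] by (simp add: add.assoc)
  have "lint p (k + 1) \<alpha> x = (\<integral>\<^sup>+\<xi>. ennreal (rdet (lr p (k + 1) \<xi>) powr \<alpha> * exp (- rtrace (\<xi> * x))) \<partial>PD d (?m + 1))"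
    unfolding lint_def by (simp add: add.assoc)
  also have "\<dots> = (\<integral>\<^sup>+W. (\<integral>\<^sup>+C. (\<integral>\<^sup>+Z. ?e W C * ?f Z \<partial>PD d ?m) \<partial>PD d 1) \<partial>mats_lebesgue d ?m 1)"
    unfolding nn_integral_PD_blkA[OF ml]
  proof (intro nn_integral_cong)
    fix W C Z assume "W \<in> space (mats_lebesgue d ?m 1)" "C \<in> space (PD d 1)" "Z \<in> space (PD d ?m)"
    then have W: "W \<in> mats d ?m 1" and C: "C \<in> posdef d 1" and Z: "Z \<in> posdef d ?m" by auto
    obtain c where c: "0 < c" "C = mat1 c" using posdef_1_cases[OF C] .
    have l: "lr p k Z \<in> herm d k" by (rule herm_blocks(3)[OF posdef_herm[OF Z]])
    have r: "rdet (lr p (k + 1) (blkA Z W C)) = rdet (lr p k Z) * rdet C"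
      unfolding c(2) lr_blkA_1[OF posdef_carrier[OF Z] matsD[OF W] less_imp_neq[OF c(1), symmetric]]
      by (rule det_blkA(2)[OF l]) (use c C in auto)
    have pos: "0 < rdet C" by (rule rdet_pos[OF C])
    have lp: "0 \<le> rdet (lr p k Z)"
    proof -
      obtain Z' W' C' where *: "Z' \<in> posdef d p" "W' \<in> mats d p k" "C' \<in> posdef d k" "Z = blkA Z' W' C'"
        using posdef_blkA_cases[OF Z] .
      show ?thesis
        unfolding *(4) lr_blkA[OF posdef_carrier[OF *(1)] matsD[OF *(2)] posdef_carrier[OF *(3)] minv_posdef_carrier(1)[OF d *(3)]]
        using rdet_pos[OF *(3)] by simp
    qed
    show "ennreal (rdet (lr p (k + 1) (blkA Z W C)) powr \<alpha> * exp (- rtrace (blkA Z W C * x))) = ?e W C * ?f Z"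
      unfolding r rtrace_blkA_ul[OF Z W C x'] using pos lp
      by (simp add: ennreal_mult[symmetric] exp_add[symmetric] powr_mult mult_ac)
  qed
  also have "\<dots> = (\<integral>\<^sup>+W. (\<integral>\<^sup>+C. ?e W C \<partial>PD d 1) * lint p k \<alpha> (ul ?m x) \<partial>mats_lebesgue d ?m 1)"
    by (intro nn_integral_cong) (simp add: nn_integral_cmult[OF me] lint_def[of p k, symmetric] nn_integral_multc[OF mC])
  also have "\<dots> = rint ?m 1 \<alpha> x * lint p k \<alpha> (ul ?m x)"
    unfolding rint_def by (rule nn_integral_multc[OF mW])
  finally show ?thesis by (simp add: mult.commute)
qed

text \<open>The contribution of row m of the parameter: a Gaussian integral over its off-diagonal
  part, then a gamma integral over its corner with the pivot of x as rate.\<close>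

definition rfac :: "nat \<Rightarrow> real \<Rightarrow> complex mat \<Rightarrow> real" where
  "rfac m \<alpha> x = gauss m * rdet (ul m x) powr (- (real d / 2)) * Gamma (\<alpha> + real m * real d / 2 + 1) *
     pivot m x powr (- (\<alpha> + real m * real d / 2 + 1))"

lemma zero_herm: "0\<^sub>m m m \<in> herm d m"
  by (rule hermI) (auto simp: scalars_def)

text \<open>The Gaussian integral over W has inverse width 1 / c and yields
  \<open>c powr (m * d / 2)\<close>. This raises \<alpha> to the exponent in the gamma integral over
  c, whose rate is the pivot s.\<close>

lemma rint_1:
  assumes x: "x \<in> posdef d (m + 1)" and \<alpha>: "0 < \<alpha> + real m * real d / 2 + 1"
  shows "rint m 1 \<alpha> x = ennreal (rfac m \<alpha> x)"
proof -
  let ?M = "mats_lebesgue d m 1" and ?a = "\<alpha> + real m * real d / 2"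
  obtain X u S where *: "X \<in> posdef d m" "u \<in> mats d m 1" "S \<in> posdef d 1" "x = blkB X u S"
    using posdef_blkB_cases[OF x] .
  obtain s where s: "0 < s" "S = mat1 s" using posdef_1_cases[OF *(3)] .
  note X = *(1) and u = *(2) and xs = *(4)[unfolded s(2)]
  have ulx: "ul m x = X" unfolding *(4)
    by (rule ul_blkB[OF posdef_carrier[OF X] matsD[OF u] posdef_carrier[OF *(3)] minv_posdef_carrier(1)[OF d X]])
  have piv: "pivot m x = s"
    using det_blkB(2)[OF X matsD[OF u] mat1_herm, of s] rdet_pos[OF X] posdef_carrier[OF x]
    by (simp add: pivot_def ulx[unfolded xs] Suc_eq_plus1 ul_self xs)
  interpret M: sigma_finite_measure ?M by (rule sigma_finite_mats[OF d])
  interpret P: sigma_finite_measure "PD d 1" by (rule sigma_finite_PD)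
  interpret MP: pair_sigma_finite ?M "PD d 1" ..
  let ?e = "\<lambda>W C. ennreal (rdet C powr \<alpha> * exp (- rtrace (blkA (0\<^sub>m m m) W C * x)))"
  have mW: "(\<lambda>C. \<integral>\<^sup>+W. ?e W C \<partial>?M) \<in> borel_measurable (PD d 1)"
    using measurable_pair_swap[OF meas_rint[OF x, of \<alpha>]] by (intro M.borel_measurable_nn_integral) (simp add: split_beta')
  have "rint m 1 \<alpha> x = (\<integral>\<^sup>+C. (\<integral>\<^sup>+W. ?e W C \<partial>?M) \<partial>PD d 1)"
    unfolding rint_def using MP.Fubini'[of ?e] meas_rint[OF x, of \<alpha>] by simp
  also have "\<dots> = (\<integral>\<^sup>+c. (\<integral>\<^sup>+W. ?e W (mat1 c) \<partial>?M) * indicator {0<..} c \<partial>lborel)"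
    by (rule nn_integral_PD_1[OF mW])
  also have "\<dots> = (\<integral>\<^sup>+c. ennreal (rdet X powr (- (real d / 2)) * gauss m) * (ennreal (c powr ?a * exp (- (s * c))) * indicator {0<..} c) \<partial>lborel)"
  proof (rule nn_integral_cong)
    fix c :: real
    show "(\<integral>\<^sup>+W. ?e W (mat1 c) \<partial>?M) * indicator {0<..} c =
        ennreal (rdet X powr (- (real d / 2)) * gauss m) * (ennreal (c powr ?a * exp (- (s * c))) * indicator {0<..} c)"
    proof (cases "0 < c")
      case c: True
      let ?b = "minv X * u * mat1 c"
      have b: "?b \<in> mats d m 1"
        by (intro mats_mult[where q=1] mats_mult[where q=m] hermD(1)[OF minv_herm[OF d X]] u hermD(1)[OF mat1_herm])
      have tr0: "rtrace (0\<^sub>m m m * X) = 0" using posdef_carrier[OF X] by (simp add: rtrace_def)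
      have "(\<integral>\<^sup>+W. ?e W (mat1 c) \<partial>?M) = (\<integral>\<^sup>+W. ennreal (c powr \<alpha> * exp (- (s * c))) * ennreal (exp (- (1 / c * qf X (W + ?b)))) \<partial>?M)"
      proof (rule nn_integral_cong)
        fix W assume "W \<in> space ?M"
        then have W: "W \<in> mats d m 1" by simp
        show "?e W (mat1 c) = ennreal (c powr \<alpha> * exp (- (s * c))) * ennreal (exp (- (1 / c * qf X (W + ?b))))"
          unfolding xs rtrace_blkA_blkB(1)[OF zero_herm W c X u] tr0
          by (simp add: ennreal_mult[symmetric] exp_add[symmetric] mult_ac rdet_mat1)
      qed
      also have "\<dots> = ennreal (c powr \<alpha> * exp (- (s * c))) * (\<integral>\<^sup>+W. ennreal (exp (- (1 / c * qf X (W + ?b)))) \<partial>?M)"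
      proof (rule nn_integral_cmult)
        have a: "(\<lambda>W. W + ?b) \<in> ?M \<rightarrow>\<^sub>M ?M" by (rule meas_add[OF _ measurable_const]) (use b in simp_all)
        have [measurable]: "(\<lambda>W. qf X (W + ?b)) \<in> borel_measurable ?M"
          by (rule meas_qf[OF measurable_const a]) (use hermD(1)[OF posdef_herm[OF X]] in simp)
        show "(\<lambda>W. ennreal (exp (- (1 / c * qf X (W + ?b))))) \<in> borel_measurable ?M" by measurable
      qed
      also have "(\<integral>\<^sup>+W. ennreal (exp (- (1 / c * qf X (W + ?b)))) \<partial>?M) =
          ennreal (rdet X powr (- (real d / 2)) * (1 / c) powr (- (real m * real d / 2)) * gauss m)"
        by (rule nn_integral_gauss[OF X _ b]) (use c in simp)
      also have "ennreal (c powr \<alpha> * exp (- (s * c))) * ennreal (rdet X powr (- (real d / 2)) * (1 / c) powr (- (real m * real d / 2)) * gauss m) =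
          ennreal (rdet X powr (- (real d / 2)) * gauss m) * ennreal (c powr ?a * exp (- (s * c)))"
      proof -
        have "(1 / c) powr (- (real m * real d / 2)) = c powr (real m * real d / 2)"
          using c by (simp add: powr_divide powr_minus_divide)
        then show ?thesis using gauss_pos[of m] by (simp add: ennreal_mult[symmetric] powr_add mult_ac)
      qed
      finally show ?thesis using c by (simp add: mult.assoc)
    qed simp
  qed
  also have "\<dots> = ennreal (rdet X powr (- (real d / 2)) * gauss m) * ennreal (Gamma (?a + 1) * s powr (- (?a + 1)))"
  proof -
    have m: "(\<lambda>c. ennreal (c powr ?a * exp (- (s * c))) * indicator {0<..} c) \<in> borel_measurable lborel" by measurable
    show ?thesis unfolding nn_integral_cmult[OF m] using nn_integral_gamma[of ?a s] \<alpha> s(1) by simp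
  qed
  also have "\<dots> = ennreal (rfac m \<alpha> x)"
    unfolding rfac_def ulx piv using gauss_pos[of m] Gamma_real_pos[OF \<alpha>] by (simp add: ennreal_mult[symmetric] mult_ac)
  finally show ?thesis .
qed

lemma rfac_pos: "x \<in> posdef d n \<Longrightarrow> m < n \<Longrightarrow> 0 < \<alpha> + real m * real d / 2 + 1 \<Longrightarrow> 0 < rfac m \<alpha> x"
  unfolding rfac_def using gauss_pos[of m] rdet_pos[OF ul_posdef[of x n m]] pivot_pos[of x n m]
  by (intro mult_pos_pos Gamma_real_pos) auto

lemma rfac_ul: "m < n \<Longrightarrow> rfac m \<alpha> (ul n x) = rfac m \<alpha> x"
  by (simp add: rfac_def pivot_def ul_ul)

lemma lint_eq:
  assumes \<alpha>: "0 < \<alpha> + real p * real d / 2 + 1"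
  shows "x \<in> posdef d (p + k) \<Longrightarrow> lint p k \<alpha> x = lint p 0 \<alpha> (ul p x) * ennreal (\<Prod>l<k. rfac (p + l) \<alpha> x)"
proof (induction k arbitrary: x)
  case 0
  then show ?case using posdef_carrier[of x d p] by (simp add: ul_self)
next
  case (Suc k)
  have x: "x \<in> posdef d (p + (k + 1))" using Suc.prems by (simp add: Suc_eq_plus1)
  have x': "x \<in> posdef d (p + k + 1)" using x by (simp add: add.assoc)
  have X: "ul (p + k) x \<in> posdef d (p + k)" by (rule ul_posdef[OF x]) simp
  have \<alpha>': "0 < \<alpha> + real (p + l) * real d / 2 + 1" for l
  proof -
    have "real p * real d / 2 \<le> real (p + l) * real d / 2" by (simp add: mult_right_mono)
    then show ?thesis using \<alpha> by linarith
  qed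
  have p: "(\<Prod>l<k. rfac (p + l) \<alpha> (ul (p + k) x)) = (\<Prod>l<k. rfac (p + l) \<alpha> x)"
    by (intro prod.cong refl rfac_ul) simp
  have nn: "0 \<le> (\<Prod>l<k. rfac (p + l) \<alpha> x)"
    by (intro prod_nonneg ballI less_imp_le rfac_pos[OF x] \<alpha>') simp
  have "lint p (k + 1) \<alpha> x = lint p 0 \<alpha> (ul p x) * ennreal (\<Prod>l<k. rfac (p + l) \<alpha> x) * ennreal (rfac (p + k) \<alpha> x)"
    unfolding lint_Suc[OF x] rint_1[OF x' \<alpha>'] Suc.IH[OF X] p by (simp add: ul_ul)
  then show ?case using nn rfac_pos[OF x _ \<alpha>', of k]
    by (simp add: Suc_eq_plus1[symmetric] ennreal_mult mult.assoc del: Suc_eq_plus1)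
qed

text \<open>Needed to cancel the factor \<open>lint p 0\<close> in the comparison of the two
  decompositions. The roles of parameter and variable are exchanged: \<xi> is Wishart distributed
  with parameter X.\<close>

lemma lint_0:
  assumes X: "X \<in> posdef d p"
  shows "lint p 0 \<alpha> X \<noteq> 0" "lint p 0 \<alpha> X \<noteq> \<top>"
proof -
  \<comment> \<open>For this value the exponent of the determinant in \<open>wdens\<close> is 0, so
    the density is a multiple of the exponential alone.\<close>
  let ?\<mu> = "1 + (real p - 1) * real d / 2"
  have \<mu>: "wparam p ?\<mu>" by (rule wparamI) simp
  have pos: "0 < wconst p ?\<mu> / rdet X powr ?\<mu>" using wconst_pos[OF \<mu>] rdet_pos[OF X] by simp
  have "lint p 0 \<alpha> X = (\<integral>\<^sup>+\<xi>. ennreal (wconst p ?\<mu> / rdet X powr ?\<mu>) * ennreal (wdens p ?\<mu> X \<xi>) \<partial>PD d p)"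
    unfolding lint_def
  proof (simp, rule nn_integral_cong)
    fix \<xi> assume "\<xi> \<in> space (PD d p)"
    then have \<xi>: "\<xi> \<in> posdef d p" by simp
    have "rdet (lr p 0 \<xi>) = 1" by (simp add: lr_def rdet_def)
    then show "ennreal (rdet (lr p 0 \<xi>) powr \<alpha> * exp (- rtrace (\<xi> * X))) =
        ennreal (wconst p ?\<mu> / rdet X powr ?\<mu>) * ennreal (wdens p ?\<mu> X \<xi>)"
      using pos wdens_nonneg[OF \<mu>, of X \<xi>] rdet_pos[OF X] rdet_pos[OF \<xi>] wconst_pos[OF \<mu>]
      by (simp add: ennreal_mult[symmetric] wdens_def wkernel_def rtrace_comm[OF posdef_carrier[OF X] posdef_carrier[OF \<xi>]])
  qed
  also have "\<dots> = ennreal (wconst p ?\<mu> / rdet X powr ?\<mu>)"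
    by (subst nn_integral_cmult) (simp_all add: nn_integral_wdens[OF X \<mu>] measurable_compose[OF meas_wdens[OF X] measurable_ennreal])
  finally have "lint p 0 \<alpha> X = ennreal (wconst p ?\<mu> / rdet X powr ?\<mu>)" .
  moreover have "ennreal (wconst p ?\<mu> / rdet X powr ?\<mu>) \<noteq> 0" using pos by (simp only: ennreal_eq_0_iff not_le)
  ultimately show "lint p 0 \<alpha> X \<noteq> 0" "lint p 0 \<alpha> X \<noteq> \<top>" by (simp_all only: ennreal_neq_top not_False_eq_True)
qed

lemma rint_eq:
  assumes x: "x \<in> posdef d (p + k)" and \<alpha>: "0 < \<alpha> + real p * real d / 2 + 1"
  shows "rint p k \<alpha> x = ennreal (\<Prod>l<k. rfac (p + l) \<alpha> x)"
proof -
  have "ul p x \<in> posdef d p" by (rule ul_posdef[OF x]) simp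
  from lint_0[OF this] show ?thesis
    using lint_eq[OF \<alpha> x] lint_split[OF x, of \<alpha>] by (simp add: ennreal_mult_cancel_left)
qed

end

subsection \<open>The parametrization by blocks\<close>

lemma rsum_0 [simp]: "rsum k 0 = 0"
  by (simp add: rsum_def One_nat_def)

lemma rsum_Suc [simp]: "rsum k (Suc h) = rsum k h + k (Suc h)"
  by (simp add: rsum_def One_nat_def)

lemma rsum_mono: "i \<le> h \<Longrightarrow> rsum k i \<le> rsum k h"
  unfolding rsum_def by (intro sum_mono2) auto

text \<open>The recursion appends its steps at the inner end. Moving the first step to the front
  makes induction on the number of blocks possible, with the last block peeled off first.\<close>

lemma zeta_iter_Suc: "zeta_iter k (Suc h) \<xi> (Suc j) = zeta_iter k h (schur_step (rsum k h) \<xi>) j"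
  by (induction j) auto

lemma zeta_Suc: "i \<le> h \<Longrightarrow> zeta k (Suc h) \<xi> i = zeta k h (schur_step (rsum k h) \<xi>) i"
  unfolding zeta_def by (simp add: Suc_diff_le zeta_iter_Suc del: zeta_iter.simps)

lemma split_block_four_block:
  assumes "A \<in> carrier_mat p p" "B \<in> carrier_mat p k" "C \<in> carrier_mat k p" "D \<in> carrier_mat k k"
  shows "split_block (four_block_mat A B C D) p p = (A, B, C, D)"
proof -
  obtain A' B' C' D' where s: "split_block (four_block_mat A B C D) p p = (A', B', C', D')" by (metis surj_pair)
  have dims: "dim_row (four_block_mat A B C D) = p + k" "dim_col (four_block_mat A B C D) = p + k" using assms by auto
  note b = split_block[OF s dims]
  have "A' = A" "B' = B" "C' = C" "D' = D"
    using s assms unfolding split_block_def by (auto simp: Let_def intro!: eq_matI)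
  then show ?thesis using s by simp
qed

text \<open>The inverse of \<open>phi_of\<close> in closed form: starting from the empty matrix,
  each block pair is attached by undoing one Schur complement.\<close>

primrec xi_rec :: "(nat \<Rightarrow> nat) \<Rightarrow> nat \<Rightarrow> param \<Rightarrow> complex mat" where
  "xi_rec k 0 \<phi> = 1\<^sub>m 0"
| "xi_rec k (Suc h) \<phi> = blkA (xi_rec k h \<phi>) (fst (\<phi> (Suc h))) (snd (\<phi> (Suc h)))"

lemma xi_rec_cong: "(\<And>i. i \<in> {1..h} \<Longrightarrow> \<phi> i = \<psi> i) \<Longrightarrow> xi_rec k h \<phi> = xi_rec k h \<psi>"
proof (induction h)
  case (Suc h)
  have "xi_rec k h \<phi> = xi_rec k h \<psi>" by (rule Suc.IH) (rule Suc.prems, simp)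
  moreover have "\<phi> (Suc h) = \<psi> (Suc h)" by (rule Suc.prems) simp
  ultimately show ?case by simp
qed simp

text \<open>The image of the cone as a product set. The off-diagonal parts are free and the only
  constraint on a block is that its lower right part be positive definite; by \<open>Phi_eq\<close>
  this is all of \<open>Phi\<close>.\<close>

definition phi_space :: "nat \<Rightarrow> (nat \<Rightarrow> nat) \<Rightarrow> nat \<Rightarrow> param set" where
  "phi_space d k h = (\<Pi>\<^sub>E i\<in>{1..h}. mats d (rsum k (i - 1)) (k i) \<times> posdef d (k i))"

lemma atLeastAtMost_Suc: "{1..Suc h} = insert (Suc h) {1..h}" "Suc h \<notin> {1..h}"
  by auto

lemma phi_space_Suc:
  assumes "\<phi> \<in> phi_space d k (Suc h)"
  shows "restrict \<phi> {1..h} \<in> phi_space d k h" "fst (\<phi> (Suc h)) \<in> mats d (rsum k h) (k (Suc h))"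
    "snd (\<phi> (Suc h)) \<in> posdef d (k (Suc h))"
proof -
  have a: "\<forall>i\<in>{1..Suc h}. fst (\<phi> i) \<in> mats d (rsum k (i - 1)) (k i) \<and> snd (\<phi> i) \<in> posdef d (k i)"
    using assms by (auto simp: phi_space_def PiE_iff mem_Times_iff)
  then show "restrict \<phi> {1..h} \<in> phi_space d k h" by (auto simp: phi_space_def PiE_iff mem_Times_iff)
  show "fst (\<phi> (Suc h)) \<in> mats d (rsum k h) (k (Suc h))" "snd (\<phi> (Suc h)) \<in> posdef d (k (Suc h))"
    using bspec[OF a, of "Suc h"] by simp_all
qed

lemma phi_space_upd:
  assumes "\<phi> \<in> phi_space d k h" "W \<in> mats d (rsum k h) (k (Suc h))" "C \<in> posdef d (k (Suc h))"
  shows "\<phi>(Suc h := (W, C)) \<in> phi_space d k (Suc h)"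
  using assms unfolding phi_space_def by (auto simp: PiE_iff mem_Times_iff extensional_def)

context field_dim
begin

lemma schur_step_blkA:
  assumes Z: "Z \<in> carrier_mat p p" and W: "W \<in> carrier_mat p k" and C: "C \<in> posdef d k"
  shows "split_block (blkA Z W C) p p = (Z + W * minv C * mat_adjoint W, W, mat_adjoint W, C)"
    "schur_step p (blkA Z W C) = Z"
proof -
  have c: "W * minv C * mat_adjoint W \<in> carrier_mat p p"
    by (rule mult_carrier_mat[OF mult_carrier_mat[OF W minv_posdef_carrier(1)[OF d C]] mat_adjoint_carrier[OF W]])
  show s: "split_block (blkA Z W C) p p = (Z + W * minv C * mat_adjoint W, W, mat_adjoint W, C)"
    unfolding blkA_def by (rule split_block_four_block) (use Z W c posdef_carrier[OF C] in auto)
  have "Z + W * minv C * mat_adjoint W - W * minv C * mat_adjoint W = Z"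
    by (rule eq_matI) (use Z c in \<open>auto simp del: assoc_mult_mat index_mult_mat(1)\<close>)
  then show "schur_step p (blkA Z W C) = Z" unfolding schur_step_def s by simp
qed

lemma phi_of_Suc:
  assumes "Z \<in> carrier_mat (rsum k h) (rsum k h)" "W \<in> carrier_mat (rsum k h) (k (Suc h))" "C \<in> posdef d (k (Suc h))"
  shows "phi_of k (Suc h) (blkA Z W C) = (phi_of k h Z)(Suc h := (W, C))"
proof
  fix i
  note s = schur_step_blkA[OF assms]
  show "phi_of k (Suc h) (blkA Z W C) i = ((phi_of k h Z)(Suc h := (W, C))) i"
  proof (cases "i = Suc h")
    case True
    then show ?thesis using s(1) by (simp add: phi_of_def zeta_top)
  next
    case False
    then show ?thesis using s(2) by (simp add: phi_of_def restrict_def zeta_Suc)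
  qed
qed

lemma phi_of_0: "phi_of k 0 \<xi> = (\<lambda>_. undefined)"
  by (simp add: phi_of_def restrict_def fun_eq_iff)

lemma phi_space_0: "phi_space d k 0 = {\<lambda>_. undefined}"
  by (simp add: phi_space_def)

lemma xi_rec_restrict: "xi_rec k h (restrict \<phi> {1..h}) = xi_rec k h \<phi>"
  by (rule xi_rec_cong) simp

lemma xi_rec_upd: "xi_rec k h (\<phi>(Suc h := y)) = xi_rec k h \<phi>"
  by (rule xi_rec_cong) simp

lemma xi_rec_posdef: "\<phi> \<in> phi_space d k h \<Longrightarrow> xi_rec k h \<phi> \<in> posdef d (rsum k h)"
proof (induction h arbitrary: \<phi>)
  case 0
  show ?case using one_posdef(1)[of 0] by simp
next
  case (Suc h)
  note * = phi_space_Suc[OF Suc.prems]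
  have "xi_rec k h \<phi> \<in> posdef d (rsum k h)" using Suc.IH[OF *(1)] by (simp only: xi_rec_restrict)
  then show ?case using posdef_blkA_iff[OF posdef_herm *(2,3)] by simp
qed

lemma phi_of_xi_rec: "\<phi> \<in> phi_space d k h \<Longrightarrow> phi_of k h (xi_rec k h \<phi>) = \<phi>"
proof (induction h arbitrary: \<phi>)
  case 0
  then show ?case by (simp add: phi_of_0 phi_space_0)
next
  case (Suc h)
  note * = phi_space_Suc[OF Suc.prems]
  have "xi_rec k h \<phi> \<in> posdef d (rsum k h)" using xi_rec_posdef[OF *(1)] by (simp only: xi_rec_restrict)
  then have 1: "phi_of k (Suc h) (xi_rec k (Suc h) \<phi>) = (phi_of k h (xi_rec k h \<phi>))(Suc h := (fst (\<phi> (Suc h)), snd (\<phi> (Suc h))))"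
    by (simp add: phi_of_Suc[OF posdef_carrier matsD[OF *(2)] *(3)])
  have 2: "phi_of k h (xi_rec k h \<phi>) = restrict \<phi> {1..h}"
    using Suc.IH[OF *(1)] by (simp only: xi_rec_restrict)
  show ?case unfolding 1 2
  proof
    fix i
    have "\<phi> i = undefined" if "i \<noteq> Suc h" "i \<notin> {1..h}"
      using Suc.prems that unfolding phi_space_def by (auto simp: PiE_iff extensional_def)
    then show "((restrict \<phi> {1..h})(Suc h := (fst (\<phi> (Suc h)), snd (\<phi> (Suc h))))) i = \<phi> i" by auto
  qed
qed

lemma xi_rec_phi_of: "\<xi> \<in> posdef d (rsum k h) \<Longrightarrow> phi_of k h \<xi> \<in> phi_space d k h \<and> xi_rec k h (phi_of k h \<xi>) = \<xi>"
proof (induction h arbitrary: \<xi>)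
  case 0
  then show ?case using PD_0[of \<xi>] by (simp add: phi_of_0 phi_space_0)
next
  case (Suc h)
  obtain Z W C where *: "Z \<in> posdef d (rsum k h)" "W \<in> mats d (rsum k h) (k (Suc h))" "C \<in> posdef d (k (Suc h))" "\<xi> = blkA Z W C"
    using posdef_blkA_cases[of \<xi> "rsum k h" "k (Suc h)"] Suc.prems by auto
  note IH = Suc.IH[OF *(1)]
  show ?case unfolding *(4) phi_of_Suc[OF posdef_carrier[OF *(1)] matsD[OF *(2)] *(3)]
    using phi_space_upd[OF IH[THEN conjunct1] *(2,3)] IH by (simp add: xi_rec_upd fun_upd_same del: fun_upd_apply)
qed

lemma Phi_eq: "Phi d k h = phi_space d k h"
  unfolding Phi_def
proof (intro equalityI subsetI)
  fix \<phi> assume "\<phi> \<in> phi_of k h ` posdef d (rsum k h)"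
  then show "\<phi> \<in> phi_space d k h" using xi_rec_phi_of by auto
next
  fix \<phi> assume "\<phi> \<in> phi_space d k h"
  then show "\<phi> \<in> phi_of k h ` posdef d (rsum k h)"
    using phi_of_xi_rec[of \<phi> k h] xi_rec_posdef[of \<phi> k h] by (metis image_eqI)
qed

lemma xi_of_eq:
  assumes "\<phi> \<in> Phi d k h"
  shows "xi_of d k h \<phi> = xi_rec k h \<phi>" "xi_of d k h \<phi> \<in> posdef d (rsum k h)"
proof -
  have p: "\<phi> \<in> phi_space d k h" using assms by (simp add: Phi_eq)
  have "inj_on (phi_of k h) (posdef d (rsum k h))"
    by (rule inj_on_inverseI[where g="xi_rec k h"]) (use xi_rec_phi_of in blast)
  then show e: "xi_of d k h \<phi> = xi_rec k h \<phi>"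
    unfolding xi_of_def using phi_of_xi_rec[OF p] xi_rec_posdef[OF p] by (metis the_inv_into_f_f)
  show "xi_of d k h \<phi> \<in> posdef d (rsum k h)" unfolding e by (rule xi_rec_posdef[OF p])
qed

subsection \<open>Integrals over the parameter space\<close>

definition phi_comp :: "(nat \<Rightarrow> nat) \<Rightarrow> nat \<Rightarrow> (complex mat \<times> complex mat) measure" where
  "phi_comp k i = mats_lebesgue d (rsum k (i - 1)) (k i) \<Otimes>\<^sub>M herm_lebesgue d (k i)"

lemma phi_lebesgue_eq: "phi_lebesgue d k h = PiM {1..h} (phi_comp k)"
proof -
  have "phi_comp k = (\<lambda>i. mats_lebesgue d (rsum k (i - 1)) (k i) \<Otimes>\<^sub>M herm_lebesgue d (k i))"
    by (rule ext) (rule phi_comp_def)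
  then show ?thesis by (simp add: phi_lebesgue_def)
qed

lemma space_phi_comp: "space (phi_comp k i) = mats d (rsum k (i - 1)) (k i) \<times> herm d (k i)"
  by (simp add: phi_comp_def space_pair_measure)

lemma product_sigma_finite_phi_comp: "product_sigma_finite (phi_comp k)"
  unfolding product_sigma_finite_def
proof (rule allI)
  fix i
  interpret A: sigma_finite_measure "mats_lebesgue d (rsum k (i - 1)) (k i)" by (rule sigma_finite_mats[OF d])
  interpret B: sigma_finite_measure "herm_lebesgue d (k i)" by (rule sigma_finite_herm[OF d])
  interpret AB: pair_sigma_finite "mats_lebesgue d (rsum k (i - 1)) (k i)" "herm_lebesgue d (k i)" ..
  show "sigma_finite_measure (phi_comp k i)" unfolding phi_comp_def by (rule AB.sigma_finite_measure_axioms)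
qed

text \<open>Replacing a lower right block that is not positive definite by the unit matrix makes
  \<open>xi_rec\<close> measurable on the whole coordinate space.\<close>

definition pd_part :: "nat \<Rightarrow> complex mat \<Rightarrow> complex mat" where
  "pd_part m C = (if C \<in> posdef d m then C else 1\<^sub>m m)"

lemma pd_part [simp]: "pd_part m C \<in> posdef d m"
  by (simp add: pd_part_def one_posdef)

lemma meas_pd_part: "C \<in> N \<rightarrow>\<^sub>M herm_lebesgue d m \<Longrightarrow> (\<lambda>x. pd_part m (C x)) \<in> N \<rightarrow>\<^sub>M PD d m"
proof -
  assume C: "C \<in> N \<rightarrow>\<^sub>M herm_lebesgue d m"
  have "(\<lambda>x. if C x \<in> posdef d m then C x else 1\<^sub>m m) \<in> N \<rightarrow>\<^sub>M herm_lebesgue d m"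
  proof (rule measurable_If[OF C measurable_const])
    show "1\<^sub>m m \<in> space (herm_lebesgue d m)" using posdef_herm[OF one_posdef(1)] by simp
    show "{x \<in> space N. C x \<in> posdef d m} \<in> sets N"
      using measurable_sets[OF C posdef_sets] by (simp add: vimage_def Int_def conj_commute)
  qed
  then show ?thesis unfolding pd_part_def[symmetric] by (rule meas_PD_of_herm) simp
qed

definition pd_param :: "(nat \<Rightarrow> nat) \<Rightarrow> param \<Rightarrow> param" where
  "pd_param k \<phi> = (\<lambda>i. (fst (\<phi> i), pd_part (k i) (snd (\<phi> i))))"

lemma meas_param:
  assumes "i \<in> {1..h}"
  shows "(\<lambda>\<phi>. fst (\<phi> i)) \<in> PiM {1..h} (phi_comp k) \<rightarrow>\<^sub>M mats_lebesgue d (rsum k (i - 1)) (k i)"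
    "(\<lambda>\<phi>. snd (pd_param k \<phi> i)) \<in> PiM {1..h} (phi_comp k) \<rightarrow>\<^sub>M PD d (k i)"
proof -
  have c: "(\<lambda>\<phi>. \<phi> i) \<in> PiM {1..h} (phi_comp k) \<rightarrow>\<^sub>M mats_lebesgue d (rsum k (i - 1)) (k i) \<Otimes>\<^sub>M herm_lebesgue d (k i)"
    using measurable_component_singleton[OF assms, of "phi_comp k"] by (simp add: phi_comp_def)
  show "(\<lambda>\<phi>. fst (\<phi> i)) \<in> PiM {1..h} (phi_comp k) \<rightarrow>\<^sub>M mats_lebesgue d (rsum k (i - 1)) (k i)"
    by (rule measurable_compose[OF c measurable_fst])
  show "(\<lambda>\<phi>. snd (pd_param k \<phi> i)) \<in> PiM {1..h} (phi_comp k) \<rightarrow>\<^sub>M PD d (k i)"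
    unfolding pd_param_def snd_conv by (rule meas_pd_part[OF measurable_compose[OF c measurable_snd]])
qed

lemma meas_xi_rec: "j \<le> h \<Longrightarrow> (\<lambda>\<phi>. xi_rec k j (pd_param k \<phi>)) \<in> PiM {1..h} (phi_comp k) \<rightarrow>\<^sub>M PD d (rsum k j)"
proof (induction j)
  case 0
  show ?case using one_posdef(1)[of 0] by simp
next
  case (Suc j)
  have i: "Suc j \<in> {1..h}" using Suc.prems by simp
  have a: "(\<lambda>\<phi>. fst (pd_param k \<phi> (Suc j))) \<in> PiM {1..h} (phi_comp k) \<rightarrow>\<^sub>M mats_lebesgue d (rsum k j) (k (Suc j))"
    using meas_param(1)[OF i, of k] by (simp add: pd_param_def)
  show ?case unfolding xi_rec.simps rsum_Suc
    by (rule meas_blkA_PD[OF Suc.IH a meas_param(2)[OF i]]) (use Suc.prems in simp)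
qed

lemma pd_param_Phi: "\<phi> \<in> Phi d k h \<Longrightarrow> i \<in> {1..h} \<Longrightarrow> pd_param k \<phi> i = \<phi> i"
  unfolding Phi_eq phi_space_def pd_param_def pd_part_def by (auto simp: PiE_iff mem_Times_iff intro: prod_eqI)

lemma Phi_iff: "\<phi> \<in> space (PiM {1..h} (phi_comp k)) \<Longrightarrow> \<phi> \<in> Phi d k h \<longleftrightarrow> (\<forall>i\<in>{1..h}. snd (\<phi> i) \<in> posdef d (k i))"
  unfolding Phi_eq phi_space_def space_PiM by (auto simp: PiE_iff mem_Times_iff space_phi_comp)

lemma Phi_sets: "Phi d k h \<in> sets (phi_lebesgue d k h)"
proof -
  let ?N = "PiM {1..h} (phi_comp k)"
  have 1: "{\<phi> \<in> space ?N. snd (\<phi> i) \<in> posdef d (k i)} \<in> sets ?N" if i: "i \<in> {1..h}" for i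
  proof -
    have "(\<lambda>\<phi>. \<phi> i) \<in> ?N \<rightarrow>\<^sub>M mats_lebesgue d (rsum k (i - 1)) (k i) \<Otimes>\<^sub>M herm_lebesgue d (k i)"
      using measurable_component_singleton[OF i, of "phi_comp k"] by (simp add: phi_comp_def)
    then have "(\<lambda>\<phi>. snd (\<phi> i)) \<in> ?N \<rightarrow>\<^sub>M herm_lebesgue d (k i)" by (rule measurable_compose[OF _ measurable_snd])
    from measurable_sets[OF this posdef_sets] show ?thesis by (simp add: vimage_def Int_def conj_commute)
  qed
  have "Phi d k h \<subseteq> space ?N"
    unfolding Phi_eq phi_space_def space_PiM by (intro PiE_mono) (auto simp: space_phi_comp posdef_herm)
  then have "Phi d k h = {\<phi> \<in> space ?N. \<forall>i\<in>{1..h}. snd (\<phi> i) \<in> posdef d (k i)}"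
    using Phi_iff[of _ h k] by blast
  also have "\<dots> \<in> sets ?N" by (rule sets.sets_Collect_finite_All) (use 1 in auto)
  finally show ?thesis by (simp only: phi_lebesgue_eq)
qed

text \<open>Likelihood times prior, stripped of the factors that depend on the observation alone.
  Multiplying two likelihoods adds the exponents \<kappa> and the observations x, which keeps the
  family closed.\<close>

definition pint :: "(nat \<Rightarrow> nat) \<Rightarrow> nat \<Rightarrow> (nat \<Rightarrow> real) \<Rightarrow> real \<Rightarrow> complex mat \<Rightarrow> param \<Rightarrow> real" where
  "pint k h t \<kappa> x \<phi> = rdet (xi_rec k h \<phi>) powr \<kappa> * exp (- rtrace (xi_rec k h \<phi> * x)) * prior h t \<phi>"

lemma pint_nonneg: "0 \<le> pint k h t \<kappa> x \<phi>"
  by (simp add: pint_def prior_def prod_nonneg)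

lemma meas_pint:
  assumes x: "x \<in> posdef d (rsum k h)"
  shows "(\<lambda>\<phi>. pint k h t \<kappa> x \<phi> * indicator (Phi d k h) \<phi>) \<in> borel_measurable (phi_lebesgue d k h)"
proof -
  let ?N = "PiM {1..h} (phi_comp k)"
  note xi = meas_mats_of_PD[OF meas_xi_rec[of h h k, OF order.refl]]
  have [measurable]: "(\<lambda>\<phi>. rdet (xi_rec k h (pd_param k \<phi>))) \<in> borel_measurable ?N" by (rule meas_rdet[OF xi])
  have [measurable]: "(\<lambda>\<phi>. rtrace (xi_rec k h (pd_param k \<phi>) * x)) \<in> borel_measurable ?N"
    by (rule meas_trace_prod[OF xi meas_mats_of_PD[OF measurable_const]]) (use x in simp)
  have [measurable]: "(\<lambda>\<phi>. prior h t (pd_param k \<phi>)) \<in> borel_measurable ?N" unfolding prior_def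
  proof (rule borel_measurable_prod)
    fix i assume "i \<in> {1..h}"
    then have [measurable]: "(\<lambda>\<phi>. rdet (snd (pd_param k \<phi> i))) \<in> borel_measurable ?N"
      by (rule meas_rdet[OF meas_mats_of_PD[OF meas_param(2)]])
    show "(\<lambda>\<phi>. rdet (snd (pd_param k \<phi> i)) powr t i) \<in> borel_measurable ?N" by measurable
  qed
  have [measurable]: "Phi d k h \<in> sets ?N" using Phi_sets by (simp only: phi_lebesgue_eq)
  have "(\<lambda>\<phi>. pint k h t \<kappa> x (pd_param k \<phi>) * indicator (Phi d k h) \<phi>) \<in> borel_measurable ?N"
    unfolding pint_def by measurable
  moreover have "pint k h t \<kappa> x (pd_param k \<phi>) * indicator (Phi d k h) \<phi> = pint k h t \<kappa> x \<phi> * indicator (Phi d k h) \<phi>" for \<phi>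
  proof (cases "\<phi> \<in> Phi d k h")
    case True
    have 1: "xi_rec k h (pd_param k \<phi>) = xi_rec k h \<phi>" by (rule xi_rec_cong) (rule pd_param_Phi[OF True])
    have 2: "prior h t (pd_param k \<phi>) = prior h t \<phi>" unfolding prior_def
      by (intro prod.cong refl) (simp add: pd_param_Phi[OF True])
    show ?thesis by (simp add: pint_def 1 2)
  qed simp
  ultimately show ?thesis by (simp add: phi_lebesgue_eq)
qed

text \<open>The last block is integrated out first. What remains is an integrand of the same form
  for fewer blocks and the leading block of x, and the factors \<open>rfac\<close> of earlier rows
  see only leading minors of x anyway.\<close>

lemma nn_integral_pint:
  "x \<in> posdef d (rsum k h) \<Longrightarrow>
    (\<And>i. i \<in> {1..h} \<Longrightarrow> 0 < \<kappa> + t i + real (rsum k (i - 1)) * real d / 2 + 1) \<Longrightarrow>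
    (\<integral>\<^sup>+\<phi>. ennreal (pint k h t \<kappa> x \<phi> * indicator (Phi d k h) \<phi>) \<partial>phi_lebesgue d k h) =
    ennreal (\<Prod>i=1..h. \<Prod>l<k i. rfac (rsum k (i - 1) + l) (\<kappa> + t i) x)"
proof (induction h arbitrary: x)
  case 0
  interpret product_sigma_finite "phi_comp k" by (rule product_sigma_finite_phi_comp)
  have "pint k 0 t \<kappa> x (\<lambda>_. undefined) = 1"
    using 0 posdef_carrier[of x d 0] by (simp add: pint_def prior_def rdet_def rtrace_def)
  then show ?case unfolding phi_lebesgue_eq
    by (simp add: PiM_empty nn_integral_count_space_finite Phi_eq phi_space_0)
next
  case (Suc h)
  let ?p = "rsum k h" and ?k = "k (Suc h)" and ?\<alpha> = "\<kappa> + t (Suc h)"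
  let ?N = "phi_lebesgue d k h"
  interpret product_sigma_finite "phi_comp k" by (rule product_sigma_finite_phi_comp)
  interpret H: sigma_finite_measure "herm_lebesgue d ?k" by (rule sigma_finite_herm[OF d])
  have x: "x \<in> posdef d (?p + ?k)" using Suc.prems(1) by simp
  have X: "ul ?p x \<in> posdef d ?p" by (rule ul_posdef[OF x]) simp
  let ?f = "\<lambda>\<phi>. pint k (Suc h) t \<kappa> x \<phi> * indicator (Phi d k (Suc h)) \<phi>"
  let ?g = "\<lambda>\<phi>. pint k h t \<kappa> (ul ?p x) \<phi> * indicator (Phi d k h) \<phi>"
  let ?e = "\<lambda>(W, C). ennreal (rdet C powr ?\<alpha> * exp (- rtrace (blkA (0\<^sub>m ?p ?p) W C * x)))"
  have mf: "(\<lambda>\<phi>. ennreal (?f \<phi>)) \<in> borel_measurable (PiM (insert (Suc h) {1..h}) (phi_comp k))"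
    using meas_pint[of x k "Suc h" t \<kappa>] Suc.prems(1) unfolding phi_lebesgue_eq atLeastAtMost_Suc(1) by measurable
  have mg: "(\<lambda>\<phi>. ennreal (?g \<phi>)) \<in> borel_measurable ?N" using meas_pint[OF X, of t \<kappa>] by measurable
  have me: "(\<lambda>y. ?e y * indicator (posdef d ?k) (snd y)) \<in> borel_measurable (phi_comp k (Suc h))"
  proof -
    have p: "(\<lambda>y. (fst y, pd_part ?k (snd y))) \<in> phi_comp k (Suc h) \<rightarrow>\<^sub>M mats_lebesgue d ?p ?k \<Otimes>\<^sub>M PD d ?k"
      unfolding phi_comp_def diff_Suc_1 by (intro measurable_Pair measurable_fst meas_pd_part measurable_snd)
    have s [measurable]: "(\<lambda>y. indicator (posdef d ?k) (snd y) :: ennreal) \<in> borel_measurable (phi_comp k (Suc h))"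
      unfolding phi_comp_def by (rule measurable_compose[OF measurable_snd borel_measurable_indicator[OF posdef_sets]])
    have "(\<lambda>y. ?e (fst y, pd_part ?k (snd y)) * indicator (posdef d ?k) (snd y)) \<in> borel_measurable (phi_comp k (Suc h))"
      by (intro borel_measurable_times_ennreal measurable_compose[OF p meas_rint[OF x, of ?\<alpha>]] s)
    then show ?thesis by (rule borel_cong[rotated]) (auto simp: pd_part_def split_beta' indicator_def)
  qed
  have ie: "(\<integral>\<^sup>+y. ?e y * indicator (posdef d ?k) (snd y) \<partial>phi_comp k (Suc h)) = rint ?p ?k ?\<alpha> x"
  proof -
    have "(\<integral>\<^sup>+y. ?e y * indicator (posdef d ?k) (snd y) \<partial>phi_comp k (Suc h)) =
        (\<integral>\<^sup>+W. (\<integral>\<^sup>+C. ?e (W, C) * indicator (posdef d ?k) C \<partial>herm_lebesgue d ?k) \<partial>mats_lebesgue d ?p ?k)"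
      using H.nn_integral_fst[of "\<lambda>y. ?e y * indicator (posdef d ?k) (snd y)" "mats_lebesgue d ?p ?k"] me
      unfolding phi_comp_def diff_Suc_1 by simp
    then show ?thesis unfolding rint_def nn_integral_PD by simp
  qed
  \<comment> \<open>Determinant, trace and prior all split off the last block: the power of
    \<open>rdet C\<close> collects \<kappa> from the likelihood and \<open>t (Suc h)\<close> from
    the prior.\<close>
  have step: "ennreal (?f (\<phi>(Suc h := y))) = ennreal (?g \<phi>) * (?e y * indicator (posdef d ?k) (snd y))"
    if \<phi>: "\<phi> \<in> space ?N" and y: "y \<in> space (phi_comp k (Suc h))" for \<phi> y
  proof -
    obtain W C where yy: "y = (W, C)" by (cases y)
    have W: "W \<in> mats d ?p ?k" and C: "C \<in> herm d ?k" using y by (auto simp: yy space_phi_comp)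
    have \<phi>s: "\<phi> \<in> space (PiM {1..h} (phi_comp k))" using \<phi> by (simp only: phi_lebesgue_eq)
    have us: "\<phi>(Suc h := y) \<in> space (PiM {1..Suc h} (phi_comp k))"
      using \<phi>s y unfolding space_PiM atLeastAtMost_Suc(1) by (intro PiE_fun_upd)
    have iff: "\<phi>(Suc h := y) \<in> Phi d k (Suc h) \<longleftrightarrow> \<phi> \<in> Phi d k h \<and> C \<in> posdef d ?k"
      unfolding Phi_iff[OF us] Phi_iff[OF \<phi>s] atLeastAtMost_Suc(1) by (auto simp: yy)
    show ?thesis
    proof (cases "\<phi> \<in> Phi d k h \<and> C \<in> posdef d ?k")
      case True
      then have C': "C \<in> posdef d ?k" and p: "\<phi> \<in> phi_space d k h" by (auto simp: Phi_eq)
      note Z = xi_rec_posdef[OF p]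
      have pr: "prior (Suc h) t (\<phi>(Suc h := (W, C))) = prior h t \<phi> * rdet C powr t (Suc h)"
      proof -
        have "(\<Prod>i=1..h. rdet (snd ((\<phi>(Suc h := (W, C))) i)) powr t i) = (\<Prod>i=1..h. rdet (snd (\<phi> i)) powr t i)"
          by (intro prod.cong) auto
        then show ?thesis unfolding prior_def atLeastAtMost_Suc(1)
          by (subst prod.insert) (simp_all add: mult.commute fun_upd_same del: fun_upd_apply)
      qed
      have "pint k (Suc h) t \<kappa> x (\<phi>(Suc h := y)) =
          pint k h t \<kappa> (ul ?p x) \<phi> * (rdet C powr ?\<alpha> * exp (- rtrace (blkA (0\<^sub>m ?p ?p) W C * x)))"
        unfolding pint_def yy pr xi_rec.simps xi_rec_upd fun_upd_same fst_conv snd_conv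
          det_blkA(2)[OF posdef_herm[OF Z] matsD[OF W] C'] rtrace_blkA_ul[OF Z W C' x]
        using rdet_pos[OF Z] rdet_pos[OF C']
        by (simp add: powr_mult powr_add exp_add[symmetric] mult_ac)
      then show ?thesis using True iff pint_nonneg[of k h t \<kappa> "ul ?p x" \<phi>] by (simp add: yy ennreal_mult)
    next
      case False
      then show ?thesis using iff by (auto simp: yy indicator_def)
    qed
  qed
  have "(\<integral>\<^sup>+\<phi>. ennreal (?f \<phi>) \<partial>phi_lebesgue d k (Suc h)) =
      (\<integral>\<^sup>+\<phi>. (\<integral>\<^sup>+y. ennreal (?f (\<phi>(Suc h := y))) \<partial>phi_comp k (Suc h)) \<partial>?N)"
    unfolding phi_lebesgue_eq atLeastAtMost_Suc(1)
    by (rule product_nn_integral_insert[OF _ atLeastAtMost_Suc(2) mf]) simp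
  also have "\<dots> = (\<integral>\<^sup>+\<phi>. ennreal (?g \<phi>) * rint ?p ?k ?\<alpha> x \<partial>?N)"
  proof (rule nn_integral_cong)
    fix \<phi> assume \<phi>: "\<phi> \<in> space ?N"
    have "(\<integral>\<^sup>+y. ennreal (?f (\<phi>(Suc h := y))) \<partial>phi_comp k (Suc h)) =
        (\<integral>\<^sup>+y. ennreal (?g \<phi>) * (?e y * indicator (posdef d ?k) (snd y)) \<partial>phi_comp k (Suc h))"
      by (rule nn_integral_cong) (rule step[OF \<phi>])
    also have "\<dots> = ennreal (?g \<phi>) * rint ?p ?k ?\<alpha> x" unfolding nn_integral_cmult[OF me] ie ..
    finally show "(\<integral>\<^sup>+y. ennreal (?f (\<phi>(Suc h := y))) \<partial>phi_comp k (Suc h)) = ennreal (?g \<phi>) * rint ?p ?k ?\<alpha> x" .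
  qed
  also have "\<dots> = (\<integral>\<^sup>+\<phi>. ennreal (?g \<phi>) \<partial>?N) * rint ?p ?k ?\<alpha> x" by (rule nn_integral_multc[OF mg])
  also have "(\<integral>\<^sup>+\<phi>. ennreal (?g \<phi>) \<partial>?N) = ennreal (\<Prod>i=1..h. \<Prod>l<k i. rfac (rsum k (i - 1) + l) (\<kappa> + t i) (ul ?p x))"
    by (rule Suc.IH[OF X]) (rule Suc.prems(2), simp)
  also have "(\<Prod>i=1..h. \<Prod>l<k i. rfac (rsum k (i - 1) + l) (\<kappa> + t i) (ul ?p x)) =
      (\<Prod>i=1..h. \<Prod>l<k i. rfac (rsum k (i - 1) + l) (\<kappa> + t i) x)"
  proof (intro prod.cong refl rfac_ul)
    fix i l assume i: "i \<in> {1..h}" and l: "l \<in> {..<k i}"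
    then obtain i' where i': "i = Suc i'" by (cases i) auto
    then have "rsum k (i - 1) + l < rsum k i" using l by simp
    also have "\<dots> \<le> ?p" by (rule rsum_mono) (use i in simp)
    finally show "rsum k (i - 1) + l < ?p" .
  qed
  also have "rint ?p ?k ?\<alpha> x = ennreal (\<Prod>l<?k. rfac (?p + l) ?\<alpha> x)"
    by (rule rint_eq[OF x]) (use Suc.prems(2)[of "Suc h"] in simp)
  finally show ?case
  proof -
    assume eq: "(\<integral>\<^sup>+\<phi>. ennreal (?f \<phi>) \<partial>phi_lebesgue d k (Suc h)) =
      ennreal (\<Prod>i=1..h. \<Prod>l<k i. rfac (rsum k (i - 1) + l) (\<kappa> + t i) x) * ennreal (\<Prod>l<?k. rfac (?p + l) ?\<alpha> x)"
    have a: "0 < ?\<alpha> + real (?p + l) * real d / 2 + 1" for l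
    proof -
      have "real ?p * real d / 2 \<le> real (?p + l) * real d / 2" by (simp add: mult_right_mono)
      then show ?thesis using Suc.prems(2)[of "Suc h"] by simp
    qed
    have nn: "0 \<le> (\<Prod>l<?k. rfac (?p + l) ?\<alpha> x)"
      by (intro prod_nonneg ballI less_imp_le rfac_pos[OF x] a) simp
    show ?thesis unfolding eq ennreal_mult''[OF nn, symmetric] atLeastAtMost_Suc(1)
      by (subst prod.insert) (simp_all add: mult.commute)
  qed
qed

subsection \<open>Predictive densities\<close>

definition pval :: "(nat \<Rightarrow> nat) \<Rightarrow> nat \<Rightarrow> (nat \<Rightarrow> real) \<Rightarrow> real \<Rightarrow> complex mat \<Rightarrow> real" where
  "pval k h t \<kappa> x = (\<Prod>i=1..h. \<Prod>l<k i. rfac (rsum k (i - 1) + l) (\<kappa> + t i) x)"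

definition pparam :: "(nat \<Rightarrow> nat) \<Rightarrow> nat \<Rightarrow> (nat \<Rightarrow> real) \<Rightarrow> real \<Rightarrow> bool" where
  "pparam k h t \<kappa> \<longleftrightarrow> (\<forall>i\<in>{1..h}. 0 < \<kappa> + t i + real (rsum k (i - 1)) * real d / 2 + 1)"

lemma block_index:
  assumes "i \<in> {1..h}" "l < k i"
  shows "rsum k (i - 1) + l < rsum k h"
proof -
  obtain i' where i': "i = Suc i'" using assms(1) by (cases i) auto
  then have "rsum k (i - 1) + l < rsum k i" using assms(2) by simp
  also have "\<dots> \<le> rsum k h" by (rule rsum_mono) (use assms(1) in simp)
  finally show ?thesis .
qed

lemma pparam_block:
  assumes "pparam k h t \<kappa>" "i \<in> {1..h}"
  shows "0 < \<kappa> + t i + real (rsum k (i - 1) + l) * real d / 2 + 1"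
proof -
  have "real (rsum k (i - 1)) * real d / 2 \<le> real (rsum k (i - 1) + l) * real d / 2" by (simp add: mult_right_mono)
  then show ?thesis using assms unfolding pparam_def by (smt (verit))
qed

lemma pparam_mono: "pparam k h t \<kappa> \<Longrightarrow> 0 \<le> \<nu> \<Longrightarrow> pparam k h t (\<kappa> + \<nu>)"
  unfolding pparam_def by (smt (verit))

lemma rfac_block_pos:
  assumes "x \<in> posdef d (rsum k h)" "pparam k h t \<kappa>" "i \<in> {1..h}" "l < k i"
  shows "0 < rfac (rsum k (i - 1) + l) (\<kappa> + t i) x"
proof -
  have a: "rsum k (i - 1) + l < rsum k h" by (rule block_index[of i h l k, OF assms(3,4)])
  have b: "0 < \<kappa> + t i + real (rsum k (i - 1) + l) * real d / 2 + 1" by (rule pparam_block[OF assms(2,3)])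
  show ?thesis
    by (rule rfac_pos[where n="rsum k h" and m="rsum k (i - 1) + l" and \<alpha>="\<kappa> + t i", OF assms(1) a b])
qed

lemma pval_pos: "x \<in> posdef d (rsum k h) \<Longrightarrow> pparam k h t \<kappa> \<Longrightarrow> 0 < pval k h t \<kappa> x"
  unfolding pval_def by (intro prod_pos ballI rfac_block_pos[where h=h]) auto

lemma set_integral_pint:
  assumes x: "x \<in> posdef d (rsum k h)" and p: "pparam k h t \<kappa>"
  shows "(LINT \<phi>:Phi d k h|phi_lebesgue d k h. c * pint k h t \<kappa> x \<phi>) = c * pval k h t \<kappa> x"
proof -
  have "(\<integral>\<phi>. pint k h t \<kappa> x \<phi> * indicator (Phi d k h) \<phi> \<partial>phi_lebesgue d k h) =
      enn2real (\<integral>\<^sup>+\<phi>. ennreal (pint k h t \<kappa> x \<phi> * indicator (Phi d k h) \<phi>) \<partial>phi_lebesgue d k h)"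
    by (rule integral_eq_nn_integral[OF meas_pint[OF x]]) (simp add: pint_nonneg)
  also have "\<dots> = pval k h t \<kappa> x"
    using nn_integral_pint[OF x, of \<kappa> t] p less_imp_le[OF pval_pos[OF x p]] by (simp add: pparam_def pval_def)
  finally have I: "(\<integral>\<phi>. pint k h t \<kappa> x \<phi> * indicator (Phi d k h) \<phi> \<partial>phi_lebesgue d k h) = pval k h t \<kappa> x" .
  have "(LINT \<phi>:Phi d k h|phi_lebesgue d k h. c * pint k h t \<kappa> x \<phi>) =
      (\<integral>\<phi>. c * (pint k h t \<kappa> x \<phi> * indicator (Phi d k h) \<phi>) \<partial>phi_lebesgue d k h)"
    unfolding set_lebesgue_integral_def by (intro Bochner_Integration.integral_cong refl) simp
  then show ?thesis by (simp only: integral_mult_right_zero I)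
qed

definition lpiv :: "nat \<Rightarrow> complex mat \<Rightarrow> real" where
  "lpiv j x = ln (pivot j x)"

lemma ln_rdet_ul:
  assumes "x \<in> posdef d n" "j \<le> n"
  shows "ln (rdet (ul j x)) = (\<Sum>l<j. lpiv l x)"
  using assms(2)
proof (induction j)
  case 0
  have "rdet (ul 0 x) = 1" by (simp add: ul_def rdet_def)
  then show ?case by simp
next
  case (Suc j)
  have p: "0 < rdet (ul j x)" "0 < rdet (ul (Suc j) x)"
    using Suc.prems by (auto intro!: rdet_pos[OF ul_posdef[OF assms(1)]])
  have "ln (rdet (ul (Suc j) x)) = ln (rdet (ul j x)) + lpiv j x"
    unfolding lpiv_def pivot_def using p by (simp add: ln_div)
  then show ?case using Suc by simp
qed

text \<open>The shape of the gamma integral over row l of block i; l counts from 0 inside the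
  block.\<close>

definition shape :: "(nat \<Rightarrow> nat) \<Rightarrow> (nat \<Rightarrow> real) \<Rightarrow> real \<Rightarrow> nat \<Rightarrow> nat \<Rightarrow> real" where
  "shape k t \<kappa> i l = \<kappa> + t i + real (rsum k (i - 1) + l) * real d / 2 + 1"

text \<open>The part of \<open>ln (pval k h t \<kappa> x)\<close> that involves neither the prior
  exponents nor \<kappa>. It cancels when the risks of two priors are compared.\<close>

definition common :: "(nat \<Rightarrow> nat) \<Rightarrow> nat \<Rightarrow> complex mat \<Rightarrow> real" where
  "common k h x = (\<Sum>i=1..h. \<Sum>l<k i. ln (gauss (rsum k (i - 1) + l)) - real d / 2 * (\<Sum>j<rsum k (i - 1) + l. lpiv j x))"

text \<open>The factor of the Wishart density that is free of the parameter. The one belonging to x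
  cancels against the normalization of the posterior, the one belonging to y against the numerator
  of the logarithmic ratio.\<close>

definition wfac :: "(nat \<Rightarrow> nat) \<Rightarrow> nat \<Rightarrow> real \<Rightarrow> complex mat \<Rightarrow> real" where
  "wfac k h \<mu> x = rdet x powr (\<mu> - 1 - (real (rsum k h) - 1) * real d / 2) / wconst (rsum k h) \<mu>"

context
  fixes k :: "nat \<Rightarrow> nat" and h :: nat
  assumes r: "0 < rsum k h"
begin

lemma model_density_eq:
  assumes \<phi>: "\<phi> \<in> Phi d k h" and \<mu>: "wparam (rsum k h) \<mu>"
  shows "model_density d k h \<mu> \<phi> x = wdens (rsum k h) \<mu> (xi_rec k h \<phi>) x"
  unfolding model_density_def wishart_density_eq[OF r \<mu>] xi_of_eq(1)[OF \<phi>] ..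

lemma wfac_pos:
  assumes "wparam (rsum k h) \<mu>" "x \<in> posdef d (rsum k h)"
  shows "0 < wfac k h \<mu> x"
  unfolding wfac_def using wconst_pos[OF assms(1)] rdet_pos[OF assms(2)] by simp

text \<open>The traces for x and y add up to that for x + y and the determinant powers to \<mu> +
  \<nu>, so numerator and normalization are two values of the same integral
  \<open>pval\<close>.\<close>

lemma predictive_eq:
  assumes \<mu>: "wparam (rsum k h) \<mu>" and \<nu>: "wparam (rsum k h) \<nu>" and p: "pparam k h t \<mu>" and \<nu>0: "0 \<le> \<nu>"
    and x: "x \<in> posdef d (rsum k h)" and y: "y \<in> posdef d (rsum k h)"
  shows "predictive d k h t \<mu> \<nu> x y = wfac k h \<nu> y * pval k h t (\<mu> + \<nu>) (x + y) / pval k h t \<mu> x"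
proof -
  note xy = posdef_add[OF x y] and p' = pparam_mono[OF p \<nu>0]
  have m: "Phi d k h \<in> sets (phi_lebesgue d k h)" by (rule Phi_sets)
  have 1: "model_density d k h \<mu> \<phi> x * prior h t \<phi> = wfac k h \<mu> x * pint k h t \<mu> x \<phi>" if "\<phi> \<in> Phi d k h" for \<phi>
    unfolding model_density_eq[OF that \<mu>] by (simp add: wfac_def pint_def wdens_def wkernel_def)
  have D: "(LINT \<psi>:Phi d k h|phi_lebesgue d k h. model_density d k h \<mu> \<psi> x * prior h t \<psi>) = wfac k h \<mu> x * pval k h t \<mu> x"
    using set_lebesgue_integral_cong[OF m, of "\<lambda>\<psi>. model_density d k h \<mu> \<psi> x * prior h t \<psi>" "\<lambda>\<psi>. wfac k h \<mu> x * pint k h t \<mu> x \<psi>"] 1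
      set_integral_pint[OF x p] by simp
  have 2: "model_density d k h \<nu> \<phi> y * posterior d k h t \<mu> x \<phi> = (wfac k h \<nu> y / pval k h t \<mu> x) * pint k h t (\<mu> + \<nu>) (x + y) \<phi>"
    if \<phi>: "\<phi> \<in> Phi d k h" for \<phi>
  proof -
    have \<xi>: "xi_rec k h \<phi> \<in> posdef d (rsum k h)" using xi_of_eq[OF \<phi>] by simp
    show ?thesis unfolding posterior_def D 1[OF \<phi>] model_density_eq[OF \<phi> \<nu>]
      unfolding pint_def rtrace_mult_add[OF posdef_carrier[OF \<xi>] posdef_carrier[OF x] posdef_carrier[OF y]]
      using wfac_pos[OF \<mu> x] pval_pos[OF x p]
      by (simp add: wdens_def wkernel_def wfac_def[of k h \<nu>] powr_add exp_diff exp_minus exp_add field_simps)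
  qed
  have "predictive d k h t \<mu> \<nu> x y = (LINT \<phi>:Phi d k h|phi_lebesgue d k h. (wfac k h \<nu> y / pval k h t \<mu> x) * pint k h t (\<mu> + \<nu>) (x + y) \<phi>)"
    unfolding predictive_def using 2 by (intro set_lebesgue_integral_cong[OF m]) auto
  then show ?thesis unfolding set_integral_pint[OF xy p'] by simp
qed

lemma ln_pval:
  assumes x: "x \<in> posdef d (rsum k h)" and p: "pparam k h t \<kappa>"
  shows "ln (pval k h t \<kappa> x) = common k h x +
    (\<Sum>i=1..h. \<Sum>l<k i. ln_Gamma (shape k t \<kappa> i l) - shape k t \<kappa> i l * lpiv (rsum k (i - 1) + l) x)"
proof -
  have rp: "0 < rfac (rsum k (i - 1) + l) (\<kappa> + t i) x" if "i \<in> {1..h}" "l < k i" for i l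
    by (rule rfac_block_pos[OF x p that])
  have rp0: "rfac (rsum k (i - 1) + l) (\<kappa> + t i) x \<noteq> 0" if "i \<in> {1..h}" "l < k i" for i l
    using rp[OF that] by simp
  have pp: "0 < (\<Prod>l<k i. rfac (rsum k (i - 1) + l) (\<kappa> + t i) x)" if "i \<in> {1..h}" for i
    by (intro prod_pos ballI rp that) simp
  have pp0: "(\<Prod>l<k i. rfac (rsum k (i - 1) + l) (\<kappa> + t i) x) \<noteq> 0" if "i \<in> {1..h}" for i
    by (rule less_imp_neq[OF pp[OF that], symmetric])
  have "ln (pval k h t \<kappa> x) = (\<Sum>i=1..h. ln (\<Prod>l<k i. rfac (rsum k (i - 1) + l) (\<kappa> + t i) x))"
    unfolding pval_def using pp pp0 by (intro ln_prod) blast+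
  also have "\<dots> = (\<Sum>i=1..h. \<Sum>l<k i. ln (rfac (rsum k (i - 1) + l) (\<kappa> + t i) x))"
    using rp rp0 by (intro sum.cong refl ln_prod) (blast intro: lessThan_iff[THEN iffD1])+
  also have "\<dots> = (\<Sum>i=1..h. \<Sum>l<k i. (ln (gauss (rsum k (i - 1) + l)) - real d / 2 * (\<Sum>j<rsum k (i - 1) + l. lpiv j x)) +
      (ln_Gamma (shape k t \<kappa> i l) - shape k t \<kappa> i l * lpiv (rsum k (i - 1) + l) x))"
  proof (intro sum.cong refl)
    fix i l assume i: "i \<in> {1..h}" and l: "l \<in> {..<k i}"
    let ?m = "rsum k (i - 1) + l"
    have m: "?m < rsum k h" by (rule block_index) (use i l in auto)
    have sh: "0 < shape k t \<kappa> i l" unfolding shape_def by (rule pparam_block[OF p i])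
    have pos: "0 < rdet (ul ?m x)" "0 < pivot ?m x" "0 < gauss ?m" "0 < Gamma (shape k t \<kappa> i l)"
      using m by (auto intro!: rdet_pos[OF ul_posdef[OF x]] pivot_pos[OF x] gauss_pos Gamma_real_pos sh)
    have "rfac ?m (\<kappa> + t i) x = gauss ?m * rdet (ul ?m x) powr (- (real d / 2)) * Gamma (shape k t \<kappa> i l) * pivot ?m x powr (- shape k t \<kappa> i l)"
      by (simp add: rfac_def shape_def)
    moreover have "ln (\<dots>) = ln (gauss ?m) - real d / 2 * ln (rdet (ul ?m x)) + ln (Gamma (shape k t \<kappa> i l)) - shape k t \<kappa> i l * ln (pivot ?m x)"
      using pos by (simp add: ln_mult ln_powr)
    ultimately show "ln (rfac ?m (\<kappa> + t i) x) = (ln (gauss ?m) - real d / 2 * (\<Sum>j<?m. lpiv j x)) +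
        (ln_Gamma (shape k t \<kappa> i l) - shape k t \<kappa> i l * lpiv ?m x)"
      using ln_rdet_ul[OF x less_imp_le[OF m]] sh by (simp add: ln_Gamma_real_pos lpiv_def)
  qed
  finally show ?thesis by (simp add: sum.distrib common_def)
qed

lemma ln_ratio:
  assumes \<mu>: "wparam (rsum k h) \<mu>" and \<nu>: "wparam (rsum k h) \<nu>" and p: "pparam k h t \<mu>" and \<nu>0: "0 \<le> \<nu>"
    and \<phi>: "\<phi> \<in> Phi d k h" and x: "x \<in> posdef d (rsum k h)" and y: "y \<in> posdef d (rsum k h)"
  shows "ln (model_density d k h \<nu> \<phi> y / predictive d k h t \<mu> \<nu> x y) =
    \<nu> * ln (rdet (xi_rec k h \<phi>)) - rtrace (xi_rec k h \<phi> * y) + common k h x - common k h (x + y) +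
    (\<Sum>i=1..h. \<Sum>l<k i. ln_Gamma (shape k t \<mu> i l) - ln_Gamma (shape k t (\<mu> + \<nu>) i l)
       - shape k t \<mu> i l * lpiv (rsum k (i - 1) + l) x + shape k t (\<mu> + \<nu>) i l * lpiv (rsum k (i - 1) + l) (x + y))"
proof -
  note xy = posdef_add[OF x y] and p' = pparam_mono[OF p \<nu>0]
  have \<xi>: "xi_rec k h \<phi> \<in> posdef d (rsum k h)" using xi_of_eq[OF \<phi>] by simp
  have e: "model_density d k h \<nu> \<phi> y / predictive d k h t \<mu> \<nu> x y =
      rdet (xi_rec k h \<phi>) powr \<nu> * exp (- rtrace (xi_rec k h \<phi> * y)) * pval k h t \<mu> x / pval k h t (\<mu> + \<nu>) (x + y)"
  proof -
    have "model_density d k h \<nu> \<phi> y = wfac k h \<nu> y * (rdet (xi_rec k h \<phi>) powr \<nu> * exp (- rtrace (xi_rec k h \<phi> * y)))"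
      unfolding model_density_eq[OF \<phi> \<nu>] by (simp add: wdens_def wkernel_def wfac_def)
    then show ?thesis unfolding predictive_eq[OF \<mu> \<nu> p \<nu>0 x y] using wfac_pos[OF \<nu> y] by simp
  qed
  have "ln (model_density d k h \<nu> \<phi> y / predictive d k h t \<mu> \<nu> x y) =
      \<nu> * ln (rdet (xi_rec k h \<phi>)) - rtrace (xi_rec k h \<phi> * y) + ln (pval k h t \<mu> x) - ln (pval k h t (\<mu> + \<nu>) (x + y))"
    unfolding e using rdet_pos[OF \<xi>] pval_pos[OF x p] pval_pos[OF xy p'] by (simp add: ln_mult ln_div ln_powr)
  then show ?thesis unfolding ln_pval[OF x p] ln_pval[OF xy p'] by (simp add: sum_subtractf sum.distrib)
qed

end

end

subsection \<open>Expectation of logarithms\<close>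

lemma powr_ge_tangent: "0 < s \<Longrightarrow> 1 + u * ln s \<le> s powr (u :: real)"
  using exp_ge_add_one_self[of "u * ln s"] by (simp add: powr_def mult.commute)

text \<open>The \<open>u\<close>-th moment of \<open>s\<close> minus \<open>1 + u * L\<close>, with \<open>L\<close> the expectation of \<open>ln s\<close>, is nonnegative
  and vanishes at \<open>u = 0\<close>; hence its derivative there is zero.\<close>

lemma (in prob_space) expectation_ln_gamma:
  assumes s: "s \<in> borel_measurable M" and pos: "\<And>x. x \<in> space M \<Longrightarrow> 0 < s x" and a: "0 < a" and c: "0 < c"
    and mom: "\<And>u. \<bar>u\<bar> < a \<Longrightarrow> (\<integral>\<^sup>+x. ennreal (s x powr u) \<partial>M) = ennreal (Gamma (a + u) / Gamma a * c powr (- u))"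
  shows "integrable M (\<lambda>x. ln (s x))" "(\<integral>x. ln (s x) \<partial>M) = Digamma a - ln (c :: real)"
proof -
  note [measurable] = s
  define G where "G u = Gamma (a + u) / Gamma a * c powr (- u)" for u
  have Gpos: "0 \<le> G u" if "\<bar>u\<bar> < a" for u
    unfolding G_def using that a c Gamma_real_pos[of "a + u"] Gamma_real_pos[of a] by simp
  have int: "integrable M (\<lambda>x. s x powr u)" and val: "(\<integral>x. s x powr u \<partial>M) = G u" if u: "\<bar>u\<bar> < a" for u
  proof -
    show "integrable M (\<lambda>x. s x powr u)" using mom[OF u] by (intro integrableI_bounded) auto
    have "(\<integral>x. s x powr u \<partial>M) = enn2real (\<integral>\<^sup>+x. ennreal (s x powr u) \<partial>M)" by (rule integral_eq_nn_integral) auto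
    then show "(\<integral>x. s x powr u \<partial>M) = G u" unfolding mom[OF u] using Gpos[OF u] by (simp add: G_def)
  qed
  \<comment> \<open>Half of a, so that the moments of both orders e and - e are finite; together
    they dominate the absolute value of the logarithm on both sides of 1.\<close>
  let ?e = "a / 2"
  have e: "\<bar>?e\<bar> < a" "\<bar>- ?e\<bar> < a" "0 < ?e" using a by auto
  show il: "integrable M (\<lambda>x. ln (s x))"
  proof (rule Bochner_Integration.integrable_bound)
    show "integrable M (\<lambda>x. (s x powr ?e + s x powr (- ?e)) / ?e)"
      by (intro integrable_divide Bochner_Integration.integrable_add int e)
    have "norm (ln (s x)) \<le> norm ((s x powr ?e + s x powr (- ?e)) / ?e)" if "x \<in> space M" for x
    proof -
      note t = powr_ge_tangent[OF pos[OF that], of ?e] powr_ge_tangent[OF pos[OF that], of "- ?e"]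
      have p: "0 < s x powr ?e" "0 < s x powr (- ?e)" using pos[OF that] by auto
      define z where "z = ln (s x) * ?e"
      have "1 + z \<le> s x powr ?e" "1 + - z \<le> s x powr (- ?e)" using t by (simp_all add: z_def mult.commute)
      then have "\<bar>z\<bar> \<le> s x powr ?e + s x powr (- ?e)" using p by linarith
      moreover have "\<bar>z\<bar> = \<bar>ln (s x)\<bar> * ?e" unfolding z_def abs_mult using e(3) by simp
      ultimately have "\<bar>ln (s x)\<bar> \<le> (s x powr ?e + s x powr (- ?e)) / ?e" using e(3) by (simp only: pos_le_divide_eq)
      moreover have nn: "0 \<le> (s x powr ?e + s x powr (- ?e)) / ?e" using p e(3) by (intro divide_nonneg_pos) linarith+
      ultimately show ?thesis by (simp only: real_norm_def abs_of_nonneg[OF nn])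
    qed
    then show "AE x in M. norm (ln (s x)) \<le> norm ((s x powr ?e + s x powr (- ?e)) / ?e)" by (rule AE_I2)
  qed measurable
  define L where "L = (\<integral>x. ln (s x) \<partial>M)"
  have ge: "1 + u * L \<le> G u" if u: "\<bar>u\<bar> < a" for u
  proof -
    have "(\<integral>x. 1 + u * ln (s x) \<partial>M) \<le> (\<integral>x. s x powr u \<partial>M)"
      by (rule integral_mono) (use il int[OF u] powr_ge_tangent[OF pos] in auto)
    then show ?thesis using il by (simp add: val[OF u] L_def prob_space)
  qed
  have a': "a \<notin> \<int>\<^sub>\<le>\<^sub>0" using a by (auto elim: nonpos_Ints_cases)
  \<comment> \<open>By the derivative of Gamma, \<open>G\<close> has slope
    \<open>Digamma a - ln c\<close> at 0, while the tangent line to be compared has slope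
    \<open>L\<close>.\<close>
  have GD: "(G has_real_derivative (Digamma a - ln c)) (at 0)"
    unfolding G_def using a' c Gamma_real_pos[OF a]
    by (auto intro!: derivative_eq_intros simp: field_simps)
  have "((\<lambda>u. G u - (1 + u * L)) has_real_derivative (Digamma a - ln c - L)) (at 0)"
    using GD by (auto intro!: derivative_eq_intros)
  moreover have "G 0 = 1" using c Gamma_real_pos[OF a] by (simp add: G_def)
  then have "\<forall>u. \<bar>0 - u\<bar> < a \<longrightarrow> G 0 - (1 + 0 * L) \<le> G u - (1 + u * L)"
    using ge by auto
  ultimately have "Digamma a - ln c - L = 0" using a by (intro DERIV_local_min)
  then show "(\<integral>x. ln (s x) \<partial>M) = Digamma a - ln c" by (simp add: L_def)
qed

context field_dim
begin

lemma posdef_smult: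
  assumes A: "A \<in> posdef d m" and c: "0 < c"
  shows "complex_of_real c \<cdot>\<^sub>m A \<in> posdef d m"
proof -
  have Ac: "A \<in> carrier_mat m m" by (rule posdef_carrier[OF A])
  have sc: "complex_of_real c * z \<in> scalars d" if "z \<in> scalars d" for z
    using that by (auto simp: scalars_def split: if_splits)
  have "complex_of_real c \<cdot>\<^sub>m A \<in> mats d m m"
    using hermD(1)[OF posdef_herm[OF A]] by (auto simp: mats_def sc)
  moreover have "mat_adjoint (complex_of_real c \<cdot>\<^sub>m A) = complex_of_real c \<cdot>\<^sub>m mat_adjoint A"
    by (rule eq_matI) (use Ac in auto)
  ultimately have "complex_of_real c \<cdot>\<^sub>m A \<in> herm d m"
    using hermD(3)[OF posdef_herm[OF A]] by (simp add: herm_def)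
  then show ?thesis using A c unfolding posdef_iff_qf by (auto simp: qf_smult[OF Ac matsD])
qed

lemma rtrace_smult:
  assumes "A \<in> carrier_mat m m" "x \<in> carrier_mat m m"
  shows "rtrace ((complex_of_real c \<cdot>\<^sub>m A) * x) = c * rtrace (A * x)"
proof -
  have "(complex_of_real c \<cdot>\<^sub>m A) * x = complex_of_real c \<cdot>\<^sub>m (A * x)" by (rule mult_smult_assoc_mat[OF assms])
  then show ?thesis using assms by (simp add: rtrace_def sum_distrib_left Re_sum)
qed

text \<open>Exponential tilting: the factor replaces \<xi> by c times \<xi>, again a Wishart density
  up to a constant. Taking c on both sides of 1 gives exponential moments of the trace of either
  sign.\<close>

lemma wdens_exp_trace:
  assumes \<xi>: "\<xi> \<in> posdef d m" and \<mu>: "wparam m \<mu>" and c: "0 < c"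
  obtains K where "0 \<le> K" "(\<integral>\<^sup>+x. ennreal (exp (- ((c - 1) * rtrace (\<xi> * x)))) * ennreal (wdens m \<mu> \<xi> x) \<partial>PD d m) = ennreal K"
proof
  let ?\<eta> = "complex_of_real c \<cdot>\<^sub>m \<xi>"
  let ?K = "rdet \<xi> powr \<mu> / rdet ?\<eta> powr \<mu>"
  note \<eta> = posdef_smult[OF \<xi> c]
  show K: "0 \<le> ?K" by simp
  have "(\<integral>\<^sup>+x. ennreal (exp (- ((c - 1) * rtrace (\<xi> * x)))) * ennreal (wdens m \<mu> \<xi> x) \<partial>PD d m) =
      (\<integral>\<^sup>+x. ennreal ?K * ennreal (wdens m \<mu> ?\<eta> x) \<partial>PD d m)"
  proof (rule nn_integral_cong)
    fix x assume "x \<in> space (PD d m)"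
    then have x: "x \<in> posdef d m" by simp
    have "exp (- ((c - 1) * rtrace (\<xi> * x))) * exp (- rtrace (\<xi> * x)) = exp (- (c * rtrace (\<xi> * x)))"
      by (simp add: exp_add[symmetric] algebra_simps)
    then have "exp (- ((c - 1) * rtrace (\<xi> * x))) * wdens m \<mu> \<xi> x = ?K * wdens m \<mu> ?\<eta> x"
      unfolding wdens_def wkernel_def rtrace_smult[OF posdef_carrier[OF \<xi>] posdef_carrier[OF x]]
      using rdet_pos[OF \<eta>] by (simp add: field_simps)
    then show "ennreal (exp (- ((c - 1) * rtrace (\<xi> * x)))) * ennreal (wdens m \<mu> \<xi> x) = ennreal ?K * ennreal (wdens m \<mu> ?\<eta> x)"
      using wdens_nonneg[OF \<mu>] K by (simp add: ennreal_mult[symmetric])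
  qed
  also have "\<dots> = ennreal ?K"
    by (subst nn_integral_cmult) (simp_all add: nn_integral_wdens[OF \<eta> \<mu>] measurable_compose[OF meas_wdens[OF \<eta>] measurable_ennreal])
  finally show "(\<integral>\<^sup>+x. ennreal (exp (- ((c - 1) * rtrace (\<xi> * x)))) * ennreal (wdens m \<mu> \<xi> x) \<partial>PD d m) = ennreal ?K" .
qed

lemma pivot_moments:
  assumes \<xi>: "\<xi> \<in> posdef d m" and j: "j < m"
  obtains c where "0 < c" "\<And>\<mu> u. wparam m \<mu> \<Longrightarrow> \<bar>u\<bar> < \<mu> - real j * real d / 2 \<Longrightarrow>
    (\<integral>\<^sup>+x. ennreal (pivot j x powr u) * ennreal (wdens m \<mu> \<xi> x) \<partial>PD d m) =
    ennreal (Gamma (\<mu> - real j * real d / 2 + u) / Gamma (\<mu> - real j * real d / 2) * c powr (- u))"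
proof -
  obtain c where c: "0 < c" "\<And>\<mu> g. wparam m \<mu> \<Longrightarrow> g \<in> borel_measurable borel \<Longrightarrow>
    (\<integral>\<^sup>+x. g (pivot j x) * ennreal (wdens m \<mu> \<xi> x) \<partial>PD d m) =
    (\<integral>\<^sup>+s. g s * ennreal (gamma_dens (\<mu> - real j * real d / 2) c s) \<partial>HL)"
    using pivot_distribution[OF \<xi> j] by blast
  show thesis
  proof (rule that[OF c(1)])
    fix \<mu> u assume \<mu>: "wparam m \<mu>" and u: "\<bar>u\<bar> < \<mu> - real j * real d / 2"
    let ?a = "\<mu> - real j * real d / 2"
    have a: "0 < ?a" "0 < ?a + u" using u by auto
    have "(\<integral>\<^sup>+x. ennreal (pivot j x powr u) * ennreal (wdens m \<mu> \<xi> x) \<partial>PD d m) =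
        (\<integral>\<^sup>+s. ennreal (s powr u) * ennreal (gamma_dens ?a c s) \<partial>HL)" by (rule c(2)[OF \<mu>]) simp
    also have "\<dots> = (\<integral>\<^sup>+s. ennreal (c powr ?a / Gamma ?a) * (ennreal (s powr (?a + u - 1) * exp (- (c * s))) * indicator {0<..} s) \<partial>lborel)"
      unfolding nn_integral_HL
    proof (rule nn_integral_cong)
      fix s :: real
      have e: "s powr (?a + u - 1) = s powr u * s powr (?a - 1)"
        unfolding powr_add[symmetric] by (rule arg_cong[where f="\<lambda>x. s powr x"]) simp
      show "ennreal (s powr u) * ennreal (gamma_dens ?a c s) * indicator {0<..} s =
          ennreal (c powr ?a / Gamma ?a) * (ennreal (s powr (?a + u - 1) * exp (- (c * s))) * indicator {0<..} s)"
        unfolding e gamma_dens_def using Gamma_real_pos[OF a(1)]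
        by (cases "0 < s") (simp_all add: ennreal_mult[symmetric] mult_ac)
    qed
    also have "\<dots> = ennreal (c powr ?a / Gamma ?a) * ennreal (Gamma (?a + u) * c powr (- (?a + u)))"
      using nn_integral_gamma[of "?a + u - 1" c] a c(1) by (subst nn_integral_cmult) simp_all
    also have "\<dots> = ennreal (Gamma (?a + u) / Gamma ?a * c powr (- u))"
    proof -
      have e: "c powr ?a * c powr (- (?a + u)) = c powr (- u)" unfolding powr_add[symmetric] by simp
      have "c powr ?a / Gamma ?a * (Gamma (?a + u) * c powr (- (?a + u))) = Gamma (?a + u) / Gamma ?a * (c powr ?a * c powr (- (?a + u)))"
        by simp
      then have "c powr ?a / Gamma ?a * (Gamma (?a + u) * c powr (- (?a + u))) = Gamma (?a + u) / Gamma ?a * c powr (- u)"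
        by (simp only: e)
      then show ?thesis using Gamma_real_pos[OF a(1)] Gamma_real_pos[OF a(2)] by (simp only: ennreal_mult[symmetric] powr_ge_zero
          divide_nonneg_pos mult_nonneg_nonneg less_imp_le)
    qed
    finally show "(\<integral>\<^sup>+x. ennreal (pivot j x powr u) * ennreal (wdens m \<mu> \<xi> x) \<partial>PD d m) =
      ennreal (Gamma (?a + u) / Gamma ?a * c powr (- u))" .
  qed
qed

section \<open>The joint law of two independent Wishart matrices\<close>

lemma nn_integral_wishart_pair:
  assumes m: "0 < m" and \<mu>: "wparam m \<mu>" and \<nu>: "wparam m \<nu>" and \<xi>: "\<xi> \<in> posdef d m"
    and f: "f \<in> borel_measurable (PD d m \<Otimes>\<^sub>M PD d m)"
  shows "(\<integral>\<^sup>+p. f p \<partial>(wishart d m \<mu> \<xi> \<Otimes>\<^sub>M wishart d m \<nu> \<xi>)) =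
    (\<integral>\<^sup>+x. (\<integral>\<^sup>+y. f (x, y) * ennreal (wdens m \<nu> \<xi> y) \<partial>PD d m) * ennreal (wdens m \<mu> \<xi> x) \<partial>PD d m)"
proof -
  let ?A = "wishart d m \<mu> \<xi>" and ?B = "wishart d m \<nu> \<xi>"
  interpret A: prob_space ?A by (rule prob_space_wishart[OF m \<mu> \<xi>])
  interpret B: prob_space ?B by (rule prob_space_wishart[OF m \<nu> \<xi>])
  interpret P: sigma_finite_measure "PD d m" by (rule sigma_finite_PD)
  have s: "sets (?A \<Otimes>\<^sub>M ?B) = sets (PD d m \<Otimes>\<^sub>M PD d m)"
    by (rule sets_pair_measure_cong[OF sets_wishart[OF m \<mu> \<xi>] sets_wishart[OF m \<nu> \<xi>]])
  have f': "f \<in> borel_measurable (?A \<Otimes>\<^sub>M ?B)" using f by (simp only: measurable_cong_sets[OF s refl])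
  have fx: "(\<lambda>y. f (x, y)) \<in> borel_measurable (PD d m)" if "x \<in> posdef d m" for x
    using measurable_compose[OF measurable_Pair1'[of x "PD d m" "PD d m"] f] that by simp
  have w: "(\<lambda>p. ennreal (wdens m \<nu> \<xi> (snd p))) \<in> borel_measurable (PD d m \<Otimes>\<^sub>M PD d m)"
    by (rule measurable_compose[OF meas_wdens[OF \<xi> measurable_snd] measurable_ennreal])
  have g: "(\<lambda>x. \<integral>\<^sup>+y. f (x, y) * ennreal (wdens m \<nu> \<xi> y) \<partial>PD d m) \<in> borel_measurable (PD d m)"
    using borel_measurable_times_ennreal[OF f w] by (intro P.borel_measurable_nn_integral) (simp add: split_beta')
  have "(\<integral>\<^sup>+p. f p \<partial>(?A \<Otimes>\<^sub>M ?B)) = (\<integral>\<^sup>+x. (\<integral>\<^sup>+y. f (x, y) \<partial>?B) \<partial>?A)"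
    by (rule B.nn_integral_fst[OF f', symmetric])
  also have "\<dots> = (\<integral>\<^sup>+x. (\<integral>\<^sup>+y. f (x, y) * ennreal (wdens m \<nu> \<xi> y) \<partial>PD d m) \<partial>?A)"
    by (intro nn_integral_cong nn_integral_wishart[OF m \<nu> \<xi>] fx) (simp add: space_wishart[OF m \<mu> \<xi>])
  also have "\<dots> = (\<integral>\<^sup>+x. (\<integral>\<^sup>+y. f (x, y) * ennreal (wdens m \<nu> \<xi> y) \<partial>PD d m) * ennreal (wdens m \<mu> \<xi> x) \<partial>PD d m)"
    by (rule nn_integral_wishart[OF m \<mu> \<xi> g])
  finally show ?thesis .
qed

lemma wishart_pair:
  assumes m: "0 < m" and \<mu>: "wparam m \<mu>" and \<nu>: "wparam m \<nu>" and \<xi>: "\<xi> \<in> posdef d m"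
  defines "Q \<equiv> wishart d m \<mu> \<xi> \<Otimes>\<^sub>M wishart d m \<nu> \<xi>"
  shows "prob_space Q" "space Q = posdef d m \<times> posdef d m" "sets Q = sets (PD d m \<Otimes>\<^sub>M PD d m)"
    and "f \<in> borel_measurable (PD d m) \<Longrightarrow> (\<integral>\<^sup>+p. f (fst p) \<partial>Q) = (\<integral>\<^sup>+x. f x * ennreal (wdens m \<mu> \<xi> x) \<partial>PD d m)"
    and "f \<in> borel_measurable (PD d m) \<Longrightarrow> (\<integral>\<^sup>+p. f (snd p) \<partial>Q) = (\<integral>\<^sup>+x. f x * ennreal (wdens m \<nu> \<xi> x) \<partial>PD d m)"
    and "f \<in> borel_measurable (PD d m) \<Longrightarrow> (\<integral>\<^sup>+p. f (fst p + snd p) \<partial>Q) = (\<integral>\<^sup>+x. f x * ennreal (wdens m (\<mu> + \<nu>) \<xi> x) \<partial>PD d m)"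
proof -
  interpret A: prob_space "wishart d m \<mu> \<xi>" by (rule prob_space_wishart[OF m \<mu> \<xi>])
  interpret B: prob_space "wishart d m \<nu> \<xi>" by (rule prob_space_wishart[OF m \<nu> \<xi>])
  interpret AB: pair_prob_space "wishart d m \<mu> \<xi>" "wishart d m \<nu> \<xi>" ..
  show "prob_space Q" unfolding Q_def by (rule AB.prob_space_axioms)
  show "space Q = posdef d m \<times> posdef d m"
    by (simp add: Q_def space_pair_measure space_wishart[OF m \<mu> \<xi>] space_wishart[OF m \<nu> \<xi>])
  show "sets Q = sets (PD d m \<Otimes>\<^sub>M PD d m)"
    unfolding Q_def by (rule sets_pair_measure_cong[OF sets_wishart[OF m \<mu> \<xi>] sets_wishart[OF m \<nu> \<xi>]])
  note pair = nn_integral_wishart_pair[OF m \<mu> \<nu> \<xi>, folded Q_def]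
  show "(\<integral>\<^sup>+p. f (fst p) \<partial>Q) = (\<integral>\<^sup>+x. f x * ennreal (wdens m \<mu> \<xi> x) \<partial>PD d m)" if f: "f \<in> borel_measurable (PD d m)"
    using pair[OF measurable_compose[OF measurable_fst f]]
    by (simp add: nn_integral_cmult[OF meas_wdens_ennreal[OF m \<nu> \<xi>]] nn_integral_wdens[OF \<xi> \<nu>])
  show "(\<integral>\<^sup>+p. f (snd p) \<partial>Q) = (\<integral>\<^sup>+x. f x * ennreal (wdens m \<nu> \<xi> x) \<partial>PD d m)" if f: "f \<in> borel_measurable (PD d m)"
    using pair[OF measurable_compose[OF measurable_snd f]]
    by (simp add: nn_integral_cmult[OF meas_wdens_ennreal[OF m \<mu> \<xi>]] nn_integral_wdens[OF \<xi> \<mu>])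
  show "(\<integral>\<^sup>+p. f (fst p + snd p) \<partial>Q) = (\<integral>\<^sup>+x. f x * ennreal (wdens m (\<mu> + \<nu>) \<xi> x) \<partial>PD d m)" if f: "f \<in> borel_measurable (PD d m)"
    using pair[OF measurable_compose[OF meas_add_PD[OF measurable_fst measurable_snd] f]] wishart_convolution[OF \<xi> \<mu> \<nu> f] by simp
qed

text \<open>The sum is Wishart distributed with \<mu> + \<nu> and the same \<xi>, so its pivot has
  the same rate c as that of x and \<open>ln c\<close> cancels in the difference.\<close>

lemma pivot_expectation:
  assumes m: "0 < m" and \<mu>: "wparam m \<mu>" and \<nu>: "wparam m \<nu>" and \<xi>: "\<xi> \<in> posdef d m" and j: "j < m"
  defines "Q \<equiv> wishart d m \<mu> \<xi> \<Otimes>\<^sub>M wishart d m \<nu> \<xi>"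
  shows "integrable Q (\<lambda>p. lpiv j (fst p))" "integrable Q (\<lambda>p. lpiv j (fst p + snd p))"
    and "(\<integral>p. lpiv j (fst p + snd p) \<partial>Q) - (\<integral>p. lpiv j (fst p) \<partial>Q) =
      Digamma (\<mu> + \<nu> - real j * real d / 2) - Digamma (\<mu> - real j * real d / 2)"
proof -
  let ?P = "PD d m"
  note Q = wishart_pair[OF m \<mu> \<nu> \<xi>, folded Q_def]
  interpret Q: prob_space Q by (rule Q(1))
  obtain c where c: "0 < c" "\<And>\<mu> u. wparam m \<mu> \<Longrightarrow> \<bar>u\<bar> < \<mu> - real j * real d / 2 \<Longrightarrow>
    (\<integral>\<^sup>+x. ennreal (pivot j x powr u) * ennreal (wdens m \<mu> \<xi> x) \<partial>PD d m) =
    ennreal (Gamma (\<mu> - real j * real d / 2 + u) / Gamma (\<mu> - real j * real d / 2) * c powr (- u))"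
    using pivot_moments[OF \<xi> j] by blast
  have id: "(\<lambda>x. x) \<in> ?P \<rightarrow>\<^sub>M ?P" by simp
  have mu: "(\<lambda>x. ennreal (pivot j x powr u)) \<in> borel_measurable ?P" for u
  proof -
    note [measurable] = meas_HL_real[OF meas_pivot[OF id j]]
    show ?thesis by measurable
  qed
  have m1: "(\<lambda>p. pivot j (fst p)) \<in> borel_measurable Q"
    unfolding measurable_cong_sets[OF Q(3) refl] by (rule meas_HL_real[OF meas_pivot[OF measurable_fst j]])
  have m2: "(\<lambda>p. pivot j (fst p + snd p)) \<in> borel_measurable Q"
    unfolding measurable_cong_sets[OF Q(3) refl]
    by (rule meas_HL_real[OF meas_pivot[OF meas_add_PD[OF measurable_fst measurable_snd] j]])
  note \<mu>\<nu> = wparam_add[OF \<mu> \<nu>]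
  have a1: "0 < \<mu> - real j * real d / 2" and a2: "0 < \<mu> + \<nu> - real j * real d / 2"
    using \<mu> \<mu>\<nu> j by (auto simp: wparam_def)
  have p1: "0 < pivot j (fst p)" if "p \<in> space Q" for p
    using that j by (auto simp: Q(2) intro: pivot_pos)
  have p2: "0 < pivot j (fst p + snd p)" if "p \<in> space Q" for p
    using that j by (auto simp: Q(2) intro!: pivot_pos posdef_add)
  have e1: "(\<integral>\<^sup>+p. ennreal (pivot j (fst p) powr u) \<partial>Q) =
      ennreal (Gamma (\<mu> - real j * real d / 2 + u) / Gamma (\<mu> - real j * real d / 2) * c powr (- u))"
    if "\<bar>u\<bar> < \<mu> - real j * real d / 2" for u
    using Q(4)[OF mu[of u]] c(2)[OF \<mu> that] by simp
  have e2: "(\<integral>\<^sup>+p. ennreal (pivot j (fst p + snd p) powr u) \<partial>Q) =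
      ennreal (Gamma (\<mu> + \<nu> - real j * real d / 2 + u) / Gamma (\<mu> + \<nu> - real j * real d / 2) * c powr (- u))"
    if "\<bar>u\<bar> < \<mu> + \<nu> - real j * real d / 2" for u
    using Q(6)[OF mu[of u]] c(2)[OF \<mu>\<nu> that] by simp
  note E1 = Q.expectation_ln_gamma[OF m1 p1 a1 c(1) e1] and E2 = Q.expectation_ln_gamma[OF m2 p2 a2 c(1) e2]
  show "integrable Q (\<lambda>p. lpiv j (fst p))" unfolding lpiv_def by (rule E1(1))
  show "integrable Q (\<lambda>p. lpiv j (fst p + snd p))" unfolding lpiv_def by (rule E2(1))
  have v1: "(\<integral>p. lpiv j (fst p) \<partial>Q) = Digamma (\<mu> - real j * real d / 2) - ln c"
    unfolding lpiv_def by (rule E1(2))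
  have v2: "(\<integral>p. lpiv j (fst p + snd p) \<partial>Q) = Digamma (\<mu> + \<nu> - real j * real d / 2) - ln c"
    unfolding lpiv_def by (rule E2(2))
  show "(\<integral>p. lpiv j (fst p + snd p) \<partial>Q) - (\<integral>p. lpiv j (fst p) \<partial>Q) =
      Digamma (\<mu> + \<nu> - real j * real d / 2) - Digamma (\<mu> - real j * real d / 2)"
    unfolding v1 v2 by simp
qed

lemma integrable_trace:
  assumes m: "0 < m" and \<mu>: "wparam m \<mu>" and \<nu>: "wparam m \<nu>" and \<xi>: "\<xi> \<in> posdef d m"
  defines "Q \<equiv> wishart d m \<mu> \<xi> \<Otimes>\<^sub>M wishart d m \<nu> \<xi>"
  shows "integrable Q (\<lambda>p. rtrace (\<xi> * snd p))"
proof -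
  note Q = wishart_pair[OF m \<mu> \<nu> \<xi>, folded Q_def]
  have id: "(\<lambda>x. x) \<in> PD d m \<rightarrow>\<^sub>M PD d m" by simp
  have tr: "(\<lambda>x. rtrace (\<xi> * x)) \<in> borel_measurable (PD d m)"
    by (rule meas_trace_prod[OF meas_mats_of_PD[OF measurable_const] meas_mats_of_PD[OF id]]) (use \<xi> in simp)
  have trQ [measurable]: "(\<lambda>p. rtrace (\<xi> * snd p)) \<in> borel_measurable Q"
    unfolding measurable_cong_sets[OF Q(3) refl] by (rule measurable_compose[OF measurable_snd tr])
  have int: "integrable Q (\<lambda>p. exp (- ((c - 1) * rtrace (\<xi> * snd p))))" if c: "0 < c" for c :: real
  proof (rule integrableI_bounded)
    obtain K where K: "(\<integral>\<^sup>+x. ennreal (exp (- ((c - 1) * rtrace (\<xi> * x)))) * ennreal (wdens m \<nu> \<xi> x) \<partial>PD d m) = ennreal K"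
      using wdens_exp_trace[OF \<xi> \<nu> c] by blast
    have "(\<lambda>x. ennreal (exp (- ((c - 1) * rtrace (\<xi> * x))))) \<in> borel_measurable (PD d m)" using tr by measurable
    from Q(5)[OF this] show "(\<integral>\<^sup>+p. ennreal (norm (exp (- ((c - 1) * rtrace (\<xi> * snd p))))) \<partial>Q) < \<infinity>"
      by (simp add: K)
  qed measurable
  show ?thesis
  proof (rule Bochner_Integration.integrable_bound)
    \<comment> \<open>Tilting by 1/2 and 3/2 gives the exponentials of plus and minus half the
      trace, whose sum dominates its absolute value.\<close>
    let ?b = "\<lambda>p. 2 * (exp (- ((1 / 2 - 1) * rtrace (\<xi> * snd p))) + exp (- ((3 / 2 - 1) * rtrace (\<xi> * snd p))))"
    show "integrable Q ?b" by (intro integrable_mult_right Bochner_Integration.integrable_add int) simp_all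
    have "norm (rtrace (\<xi> * snd p)) \<le> norm (?b p)" for p
    proof -
      define w where "w = rtrace (\<xi> * snd p)"
      define E F where "E = exp (w / 2)" and "F = exp (- (w / 2))"
      have "1 + w / 2 \<le> E" "1 + - (w / 2) \<le> F" unfolding E_def F_def by (rule exp_ge_add_one_self)+
      moreover have "0 < E" "0 < F" by (simp_all add: E_def F_def)
      ultimately have "\<bar>w\<bar> \<le> 2 * (E + F)" by (intro abs_leI) (simp_all add: field_simps)
      then have "\<bar>w\<bar> \<le> 2 * (exp (w / 2) + exp (- (w / 2)))" unfolding E_def F_def .
      then show ?thesis unfolding w_def[symmetric] by (simp add: field_simps)
    qed
    then show "AE p in Q. norm (rtrace (\<xi> * snd p)) \<le> norm (?b p)" by (rule AE_I2)
  qed measurable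
qed

section \<open>The risk in terms of expected logarithms of pivots\<close>

context
  fixes k :: "nat \<Rightarrow> nat" and h :: nat and \<mu> \<nu> :: real and \<phi> :: param
  assumes r: "0 < rsum k h" and \<mu>: "wparam (rsum k h) \<mu>" and \<nu>: "wparam (rsum k h) \<nu>" and \<nu>0: "0 \<le> \<nu>"
    and \<phi>: "\<phi> \<in> Phi d k h"
begin

abbreviation "Q \<equiv> wishart d (rsum k h) \<mu> (xi_rec k h \<phi>) \<Otimes>\<^sub>M wishart d (rsum k h) \<nu> (xi_rec k h \<phi>)"

abbreviation "E1 j \<equiv> \<integral>p. lpiv j (fst p) \<partial>Q"
abbreviation "E2 j \<equiv> \<integral>p. lpiv j (fst p + snd p) \<partial>Q"

lemma xi_pd: "xi_rec k h \<phi> \<in> posdef d (rsum k h)"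
  using xi_of_eq[OF \<phi>] by simp

lemmas lpiv_int = pivot_expectation(1,2)[OF r \<mu> \<nu> xi_pd]

lemma integrable_common:
  "integrable Q (\<lambda>p. common k h (fst p))" "integrable Q (\<lambda>p. common k h (fst p + snd p))"
proof -
  interpret Q: prob_space Q by (rule wishart_pair(1)[OF r \<mu> \<nu> xi_pd])
  have j: "j < rsum k h" if "i \<in> {1..h}" "l < k i" "j < rsum k (i - 1) + l" for i l j
    using block_index[of i h l k, OF that(1,2)] that(3) by simp
  show "integrable Q (\<lambda>p. common k h (fst p))" "integrable Q (\<lambda>p. common k h (fst p + snd p))"
    unfolding common_def
    by (intro Bochner_Integration.integrable_sum Bochner_Integration.integrable_diff integrable_mult_right
        Q.integrable_const lpiv_int j; simp)+
qed

abbreviation "base p \<equiv> \<nu> * ln (rdet (xi_rec k h \<phi>)) - rtrace (xi_rec k h \<phi> * snd p) +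
    common k h (fst p) - common k h (fst p + snd p)"

lemma risk_eq:
  assumes p: "pparam k h t \<mu>"
  shows "risk d k h \<mu> \<nu> \<phi> (predictive d k h t \<mu> \<nu>) = (\<integral>p. base p \<partial>Q) +
    (\<Sum>i=1..h. \<Sum>l<k i. ln_Gamma (shape k t \<mu> i l) - ln_Gamma (shape k t (\<mu> + \<nu>) i l)
       - shape k t \<mu> i l * E1 (rsum k (i - 1) + l) + shape k t (\<mu> + \<nu>) i l * E2 (rsum k (i - 1) + l))"
proof -
  interpret Q: prob_space Q by (rule wishart_pair(1)[OF r \<mu> \<nu> xi_pd])
  let ?T = "\<lambda>i l p. ln_Gamma (shape k t \<mu> i l) - ln_Gamma (shape k t (\<mu> + \<nu>) i l)
       - shape k t \<mu> i l * lpiv (rsum k (i - 1) + l) (fst p) + shape k t (\<mu> + \<nu>) i l * lpiv (rsum k (i - 1) + l) (fst p + snd p)"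
  have ib: "integrable Q base"
    by (intro Bochner_Integration.integrable_diff Bochner_Integration.integrable_add integrable_common Q.integrable_const
        integrable_trace[OF r \<mu> \<nu> xi_pd])
  have iT: "integrable Q (?T i l)" and vT: "(\<integral>p. ?T i l p \<partial>Q) = ln_Gamma (shape k t \<mu> i l) - ln_Gamma (shape k t (\<mu> + \<nu>) i l)
       - shape k t \<mu> i l * E1 (rsum k (i - 1) + l) + shape k t (\<mu> + \<nu>) i l * E2 (rsum k (i - 1) + l)"
    if i: "i \<in> {1..h}" and l: "l \<in> {..<k i}" for i l
  proof -
    have j: "rsum k (i - 1) + l < rsum k h" by (rule block_index) (use i l in auto)
    note I = lpiv_int[OF j]
    show "integrable Q (?T i l)"
      by (intro Bochner_Integration.integrable_diff Bochner_Integration.integrable_add integrable_mult_right Q.integrable_const I)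
    show "(\<integral>p. ?T i l p \<partial>Q) = ln_Gamma (shape k t \<mu> i l) - ln_Gamma (shape k t (\<mu> + \<nu>) i l)
       - shape k t \<mu> i l * E1 (rsum k (i - 1) + l) + shape k t (\<mu> + \<nu>) i l * E2 (rsum k (i - 1) + l)"
      using I by (simp add: Q.prob_space)
  qed
  have "risk d k h \<mu> \<nu> \<phi> (predictive d k h t \<mu> \<nu>) = (\<integral>p. base p + (\<Sum>i=1..h. \<Sum>l<k i. ?T i l p) \<partial>Q)"
    unfolding risk_def xi_of_eq(1)[OF \<phi>] split_beta'
  proof (rule Bochner_Integration.integral_cong[OF refl])
    fix p assume "p \<in> space Q"
    then have "fst p \<in> posdef d (rsum k h)" "snd p \<in> posdef d (rsum k h)"
      by (auto simp: wishart_pair(2)[OF r \<mu> \<nu> xi_pd])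
    from ln_ratio[OF r \<mu> \<nu> p \<nu>0 \<phi> this]
    show "ln (model_density d k h \<nu> \<phi> (snd p) / predictive d k h t \<mu> \<nu> (fst p) (snd p)) =
        base p + (\<Sum>i=1..h. \<Sum>l<k i. ?T i l p)" by simp
  qed
  also have "\<dots> = (\<integral>p. base p \<partial>Q) + (\<integral>p. (\<Sum>i=1..h. \<Sum>l<k i. ?T i l p) \<partial>Q)"
    by (rule Bochner_Integration.integral_add[OF ib]) (intro Bochner_Integration.integrable_sum iT)
  also have "(\<integral>p. (\<Sum>i=1..h. \<Sum>l<k i. ?T i l p) \<partial>Q) = (\<Sum>i=1..h. \<integral>p. (\<Sum>l<k i. ?T i l p) \<partial>Q)"
    by (rule Bochner_Integration.integral_sum) (intro Bochner_Integration.integrable_sum iT)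
  also have "\<dots> = (\<Sum>i=1..h. \<Sum>l<k i. \<integral>p. ?T i l p \<partial>Q)"
    by (intro sum.cong refl Bochner_Integration.integral_sum iT)
  also have "\<dots> = (\<Sum>i=1..h. \<Sum>l<k i. ln_Gamma (shape k t \<mu> i l) - ln_Gamma (shape k t (\<mu> + \<nu>) i l)
       - shape k t \<mu> i l * E1 (rsum k (i - 1) + l) + shape k t (\<mu> + \<nu>) i l * E2 (rsum k (i - 1) + l))"
    by (intro sum.cong refl vT)
  finally show ?thesis .
qed

text \<open>\<open>base\<close> is the same for both priors. The two shapes differ by
  \<open>t i - t' i\<close> independently of \<kappa> and l, so the expected logarithms enter only
  through their increment from x to x + y, where the unknown rates have gone.\<close>

lemma risk_diff:
  assumes p: "pparam k h t \<mu>" and p': "pparam k h t' \<mu>"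
  shows "risk d k h \<mu> \<nu> \<phi> (predictive d k h t \<mu> \<nu>) - risk d k h \<mu> \<nu> \<phi> (predictive d k h t' \<mu> \<nu>) =
    (\<Sum>i=1..h. \<Sum>l<k i. ln_Gamma (shape k t \<mu> i l) - ln_Gamma (shape k t' \<mu> i l)
       - (ln_Gamma (shape k t (\<mu> + \<nu>) i l) - ln_Gamma (shape k t' (\<mu> + \<nu>) i l))
       + (t i - t' i) * (Digamma (\<mu> + \<nu> - real (rsum k (i - 1) + l) * real d / 2) - Digamma (\<mu> - real (rsum k (i - 1) + l) * real d / 2)))"
  unfolding risk_eq[OF p] risk_eq[OF p'] add_diff_cancel_left sum_subtractf[symmetric]
proof (intro sum.cong refl)
  fix i l assume i: "i \<in> {1..h}" and l: "l \<in> {..<k i}"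
  have j: "rsum k (i - 1) + l < rsum k h" by (rule block_index) (use i l in auto)
  let ?e1 = "E1 (rsum k (i - 1) + l)" and ?e2 = "E2 (rsum k (i - 1) + l)"
  have s: "shape k t \<kappa> i l = shape k t' \<kappa> i l + (t i - t' i)" for \<kappa> by (simp add: shape_def)
  note D = pivot_expectation(3)[OF r \<mu> \<nu> xi_pd j, symmetric]
  show "ln_Gamma (shape k t \<mu> i l) - ln_Gamma (shape k t (\<mu> + \<nu>) i l) - shape k t \<mu> i l * ?e1 + shape k t (\<mu> + \<nu>) i l * ?e2 -
      (ln_Gamma (shape k t' \<mu> i l) - ln_Gamma (shape k t' (\<mu> + \<nu>) i l) - shape k t' \<mu> i l * ?e1 + shape k t' (\<mu> + \<nu>) i l * ?e2) =
      ln_Gamma (shape k t \<mu> i l) - ln_Gamma (shape k t' \<mu> i l) - (ln_Gamma (shape k t (\<mu> + \<nu>) i l) - ln_Gamma (shape k t' (\<mu> + \<nu>) i l))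
       + (t i - t' i) * (Digamma (\<mu> + \<nu> - real (rsum k (i - 1) + l) * real d / 2) - Digamma (\<mu> - real (rsum k (i - 1) + l) * real d / 2))"
  proof -
    have "shape k t \<mu> i l * ?e1 - shape k t' \<mu> i l * ?e1 = (t i - t' i) * ?e1"
      "shape k t (\<mu> + \<nu>) i l * ?e2 - shape k t' (\<mu> + \<nu>) i l * ?e2 = (t i - t' i) * ?e2"
      unfolding s by (simp_all add: distrib_right)
    then show ?thesis unfolding D right_diff_distrib by linarith
  qed
qed

end

end

subsection \<open>Asymptotics\<close>

text \<open>Minus the increment over [\<mu> - b, \<mu> + \<nu> - b] of ln Gamma(z + u) - ln Gamma(z)
  - u Digamma(z), with b standing for j * d / 2. It is the contribution of one row to the difference
  of risks.\<close>

definition digap :: "real \<Rightarrow> real \<Rightarrow> real \<Rightarrow> real \<Rightarrow> real" where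
  "digap \<nu> u b \<mu> = ln_Gamma (\<mu> - b + u) - ln_Gamma (\<mu> - b) - (ln_Gamma (\<mu> + \<nu> - b + u) - ln_Gamma (\<mu> + \<nu> - b)) +
     u * (Digamma (\<mu> + \<nu> - b) - Digamma (\<mu> - b))"

lemma pos_not_nonpos_Int: "0 < x \<Longrightarrow> (x :: real) \<notin> \<int>\<^sub>\<le>\<^sub>0"
  by (auto elim: nonpos_Ints_cases)

lemma frac_le_frac: "0 < b \<Longrightarrow> 0 < e \<Longrightarrow> a * e \<le> c * b \<Longrightarrow> a / b \<le> c / (e :: real)"
  by (simp add: pos_divide_le_eq pos_le_divide_eq)

text \<open>Compare \<open>2 / y\<^sup>3\<close> with \<open>1 / y\<^sup>2 - 1 / (y + 1)\<^sup>2\<close> and \<open>1 / (y - 1)\<^sup>2 - 1 / y\<^sup>2\<close> at \<open>y = x, x + 1, \<dots>\<close>.\<close>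

lemma Polygamma_2_bounds:
  fixes x :: real
  assumes x: "1 < x"
  shows "1 / x\<^sup>2 \<le> - Polygamma 2 x" "- Polygamma 2 x \<le> 1 / (x - 1)\<^sup>2"
proof -
  let ?y = "\<lambda>n. x + real n"
  have y: "1 < ?y n" for n using x by simp
  have "(\<lambda>n. inverse (?y n ^ Suc 2)) sums ((-1) ^ Suc 2 * Polygamma 2 x / fact 2)"
    using x by (intro Polygamma_LIMSEQ) auto
  from sums_mult[OF this, of 2] have S: "(\<lambda>n. 2 * inverse (?y n ^ 3)) sums (- Polygamma 2 x)"
    by (simp add: numeral_3_eq_3 numeral_2_eq_2)
  have lim: "(\<lambda>n. 1 / (?y n - c)\<^sup>2) \<longlonglongrightarrow> 0" for c by real_asymp
  have 1: "(\<lambda>n. 1 / (?y n - 0)\<^sup>2 - 1 / (?y (Suc n) - 0)\<^sup>2) sums (1 / (?y 0 - 0)\<^sup>2 - 0)"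
    by (rule telescope_sums'[OF lim])
  have 2: "(\<lambda>n. 1 / (?y n - 1)\<^sup>2 - 1 / (?y (Suc n) - 1)\<^sup>2) sums (1 / (?y 0 - 1)\<^sup>2 - 0)"
    by (rule telescope_sums'[OF lim])
  have l: "1 / y\<^sup>2 - 1 / (y + 1)\<^sup>2 \<le> 2 * inverse (y ^ 3)" if "1 < y" for y :: real
  proof -
    have p: "0 < y\<^sup>2 * (y + 1)\<^sup>2" "0 < y ^ 3" using that by auto
    have "1 / y\<^sup>2 - 1 / (y + 1)\<^sup>2 = (2 * y + 1) / (y\<^sup>2 * (y + 1)\<^sup>2)"
      using that by (simp add: divide_simps) (simp add: power2_eq_square algebra_simps)
    also have "\<dots> \<le> 2 / y ^ 3"
    proof (rule frac_le_frac[OF p])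
      have "(2 * y + 1) * y \<le> 2 * (y + 1)\<^sup>2" using that by (simp add: power2_eq_square algebra_simps)
      then have "((2 * y + 1) * y) * y\<^sup>2 \<le> (2 * (y + 1)\<^sup>2) * y\<^sup>2" by (rule mult_right_mono) simp
      then show "(2 * y + 1) * y ^ 3 \<le> 2 * (y\<^sup>2 * (y + 1)\<^sup>2)" by (simp add: power2_eq_square power3_eq_cube mult_ac)
    qed
    finally show ?thesis by (simp add: divide_inverse)
  qed
  have u: "2 * inverse (y ^ 3) \<le> 1 / (y - 1)\<^sup>2 - 1 / y\<^sup>2" if "1 < y" for y :: real
  proof -
    have p: "0 < y ^ 3" "0 < y\<^sup>2 * (y - 1)\<^sup>2" using that by auto
    have "2 / y ^ 3 \<le> (2 * y - 1) / (y\<^sup>2 * (y - 1)\<^sup>2)"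
    proof (rule frac_le_frac[OF p])
      have "2 * (y - 1)\<^sup>2 \<le> (2 * y - 1) * y" using that by (simp add: power2_eq_square algebra_simps)
      then have "(2 * (y - 1)\<^sup>2) * y\<^sup>2 \<le> ((2 * y - 1) * y) * y\<^sup>2" by (rule mult_right_mono) simp
      then show "2 * (y\<^sup>2 * (y - 1)\<^sup>2) \<le> (2 * y - 1) * y ^ 3" by (simp add: power2_eq_square power3_eq_cube mult_ac)
    qed
    also have "\<dots> = 1 / (y - 1)\<^sup>2 - 1 / y\<^sup>2"
      using that by (simp add: divide_simps) (simp add: power2_eq_square algebra_simps)
    finally show ?thesis by (simp add: divide_inverse)
  qed
  show "1 / x\<^sup>2 \<le> - Polygamma 2 x"
    using sums_le[OF _ 1 S] l[OF y] by (simp add: add_ac)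
  show "- Polygamma 2 x \<le> 1 / (x - 1)\<^sup>2"
    using sums_le[OF _ S 2] u[OF y] by (simp add: algebra_simps)
qed

text \<open>Lagrange's form of the Taylor remainder at second order: q is minus
  \<open>Polygamma 2\<close> at an intermediate point s. The margins |u| + 1 cover both signs of u
  and the shift by 1 in \<open>Polygamma_2_bounds\<close>.\<close>

lemma Digamma_remainder:
  fixes x u :: real
  assumes x: "\<bar>u\<bar> + 1 < x" and u: "u \<noteq> 0"
  shows "\<exists>q. Digamma (x + u) - Digamma x - u * Polygamma 1 x = - (u\<^sup>2 / 2) * q \<and>
    1 / (x + \<bar>u\<bar> + 1)\<^sup>2 \<le> q \<and> q \<le> 1 / (x - \<bar>u\<bar> - 1)\<^sup>2"
proof -
  let ?a = "min x (x + u)" and ?b = "max x (x + u)"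
  have der: "\<forall>(m::nat) t. m < 2 \<and> ?a \<le> t \<and> t \<le> ?b \<longrightarrow> DERIV (Polygamma m) t :> Polygamma (Suc m) t"
  proof (intro allI impI)
    fix m :: nat and t assume "m < 2 \<and> ?a \<le> t \<and> t \<le> ?b"
    then have "0 < t" using x by (auto simp: min_def split: if_splits)
    then show "DERIV (Polygamma m) t :> Polygamma (Suc m) t"
      by (intro has_field_derivative_Polygamma pos_not_nonpos_Int)
  qed
  obtain s where s: "if x + u < x then x + u < s \<and> s < x else x < s \<and> s < x + u"
    and eq: "Digamma (x + u) = (\<Sum>m<2. Polygamma m x / fact m * (x + u - x) ^ m) + Polygamma 2 s / fact 2 * (x + u - x) ^ 2"
    using Taylor[of 2 Polygamma Digamma ?a ?b x "x + u"] der u by auto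
  have "(\<Sum>m<2. Polygamma m x / fact m * (x + u - x) ^ m) = Digamma x + Polygamma 1 x * u"
    by (simp add: numeral_2_eq_2 One_nat_def)
  then have e: "Digamma (x + u) - Digamma x - u * Polygamma 1 x = - (u\<^sup>2 / 2) * (- Polygamma 2 s)"
    unfolding eq by (simp add: numeral_2_eq_2 mult.commute)
  have sb: "x - \<bar>u\<bar> \<le> s" "s \<le> x + \<bar>u\<bar>" "1 < s" using s x by (auto split: if_splits)
  note b = Polygamma_2_bounds[OF sb(3)]
  have "1 / (x + \<bar>u\<bar> + 1)\<^sup>2 \<le> 1 / s\<^sup>2" using sb by (intro divide_left_mono power_mono mult_pos_pos) auto
  moreover have "1 / (s - 1)\<^sup>2 \<le> 1 / (x - \<bar>u\<bar> - 1)\<^sup>2"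
    using sb x by (intro divide_left_mono power_mono mult_pos_pos zero_less_power) auto
  ultimately show ?thesis using e b by (intro exI[of _ "- Polygamma 2 s"]) linarith
qed

text \<open>The mean value theorem over an interval of length \<nu> produces the factor \<nu>, and
  the derivative met there is the remainder of \<open>Digamma_remainder\<close>. The constant |u| +
  1 + |b| + \<nu> combines the margin |u| + 1 with the distance of the intermediate point z from
  \<mu>.\<close>

lemma digap_bounds:
  fixes \<nu> u b \<mu> :: real
  assumes \<nu>: "0 < \<nu>" and u: "u \<noteq> 0" and \<mu>: "\<bar>u\<bar> + 1 + \<bar>b\<bar> + \<nu> < \<mu>"
  shows "\<exists>q. digap \<nu> u b \<mu> = \<nu> * u\<^sup>2 / 2 * q \<and> 1 / (\<mu> + (\<bar>u\<bar> + 1 + \<bar>b\<bar> + \<nu>))\<^sup>2 \<le> q \<and> q \<le> 1 / (\<mu> - (\<bar>u\<bar> + 1 + \<bar>b\<bar> + \<nu>))\<^sup>2"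
proof -
  define D where "D x = ln_Gamma (x + u) - ln_Gamma x - u * Digamma x" for x :: real
  define D' where "D' x = Digamma (x + u) - Digamma x - u * Polygamma 1 x" for x :: real
  have "(D has_real_derivative D' x) (at x)" if "\<mu> - b \<le> x" "x \<le> \<mu> + \<nu> - b" for x
  proof -
    have p: "0 < x" "0 < x + u" using that \<mu> by linarith+
    have 1: "((\<lambda>x. ln_Gamma (x + u)) has_real_derivative Digamma (x + u)) (at x)"
      using DERIV_chain'[OF DERIV_add[OF DERIV_ident DERIV_const[of u]] has_field_derivative_ln_Gamma_real[OF p(2)]] by simp
    have 2: "(Polygamma 0 has_real_derivative Polygamma (Suc 0) x) (at x)"
      by (rule has_field_derivative_Polygamma[OF pos_not_nonpos_Int[OF p(1)]])
    show ?thesis unfolding D_def D'_def One_nat_def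
      by (intro DERIV_diff 1 has_field_derivative_ln_Gamma_real[OF p(1)] DERIV_cmult 2)
  qed
  then obtain z where z: "\<mu> - b < z" "z < \<mu> + \<nu> - b" "D (\<mu> + \<nu> - b) - D (\<mu> - b) = (\<mu> + \<nu> - b - (\<mu> - b)) * D' z"
    using MVT2[of "\<mu> - b" "\<mu> + \<nu> - b" D D'] \<nu> by auto
  have xz: "\<bar>u\<bar> + 1 < z" using z(1) \<mu> \<nu> by linarith
  obtain q where q: "D' z = - (u\<^sup>2 / 2) * q" "1 / (z + \<bar>u\<bar> + 1)\<^sup>2 \<le> q" "q \<le> 1 / (z - \<bar>u\<bar> - 1)\<^sup>2"
    using Digamma_remainder[OF xz u] unfolding D'_def by blast
  have "digap \<nu> u b \<mu> = - (D (\<mu> + \<nu> - b) - D (\<mu> - b))" by (simp add: digap_def D_def algebra_simps)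
  also have "\<dots> = \<nu> * u\<^sup>2 / 2 * q" unfolding z(3) q(1) by simp
  finally have eq: "digap \<nu> u b \<mu> = \<nu> * u\<^sup>2 / 2 * q" .
  have "1 / (\<mu> + (\<bar>u\<bar> + 1 + \<bar>b\<bar> + \<nu>))\<^sup>2 \<le> 1 / (z + \<bar>u\<bar> + 1)\<^sup>2"
    using z(1,2) xz \<mu> \<nu> by (intro divide_left_mono power_mono mult_pos_pos zero_less_power) (auto simp: abs_if split: if_splits)
  moreover have "1 / (z - \<bar>u\<bar> - 1)\<^sup>2 \<le> 1 / (\<mu> - (\<bar>u\<bar> + 1 + \<bar>b\<bar> + \<nu>))\<^sup>2"
    using z(1,2) xz \<mu> \<nu> by (intro divide_left_mono power_mono mult_pos_pos zero_less_power) (auto simp: abs_if split: if_splits)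
  ultimately show ?thesis using eq q(2,3) by (intro exI[of _ q]) linarith
qed

lemma digap_asymp:
  fixes \<nu> u b :: real
  assumes \<nu>: "0 < \<nu>"
  shows "(\<lambda>\<mu>. digap \<nu> u b \<mu> - \<nu> / \<mu>\<^sup>2 * (u\<^sup>2 / 2)) \<in> O[at_top](\<lambda>\<mu>. \<mu> powr (-5/2))"
\<comment> \<open>For u = 0 both terms vanish identically; the Taylor formula compares two distinct
  points.\<close>
proof (cases "u = 0")
  case True
  then show ?thesis by (simp add: digap_def)
next
  case u: False
  define B where "B = \<bar>u\<bar> + 1 + \<bar>b\<bar> + \<nu>"
  have B: "0 < B" using \<nu> by (simp add: B_def add_pos_nonneg)
  have "\<forall>\<^sub>F \<mu> in at_top. norm (digap \<nu> u b \<mu> - \<nu> / \<mu>\<^sup>2 * (u\<^sup>2 / 2)) \<le> norm (\<nu> * u\<^sup>2 / 2 * (1 / (\<mu> - B)\<^sup>2 - 1 / (\<mu> + B)\<^sup>2))"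
    using eventually_gt_at_top[of B]
  proof eventually_elim
    case (elim \<mu>)
    obtain q where q: "digap \<nu> u b \<mu> = \<nu> * u\<^sup>2 / 2 * q" "1 / (\<mu> + B)\<^sup>2 \<le> q" "q \<le> 1 / (\<mu> - B)\<^sup>2"
      using digap_bounds[OF \<nu> u, of b \<mu>] elim unfolding B_def by blast
    \<comment> \<open>Both q and the target \<open>1 / \<mu>\<^sup>2\<close> lie between these two
      bounds, so their distance is at most the length of the interval.\<close>
    have "1 / (\<mu> + B)\<^sup>2 \<le> 1 / \<mu>\<^sup>2" "1 / \<mu>\<^sup>2 \<le> 1 / (\<mu> - B)\<^sup>2"
      using elim B by (intro divide_left_mono power_mono mult_pos_pos zero_less_power; simp)+
    then have "\<bar>q - 1 / \<mu>\<^sup>2\<bar> \<le> \<bar>1 / (\<mu> - B)\<^sup>2 - 1 / (\<mu> + B)\<^sup>2\<bar>" using q by linarith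
    then have "\<nu> * u\<^sup>2 / 2 * \<bar>q - 1 / \<mu>\<^sup>2\<bar> \<le> \<nu> * u\<^sup>2 / 2 * \<bar>1 / (\<mu> - B)\<^sup>2 - 1 / (\<mu> + B)\<^sup>2\<bar>"
      using \<nu> by (intro mult_left_mono) auto
    moreover have "digap \<nu> u b \<mu> - \<nu> / \<mu>\<^sup>2 * (u\<^sup>2 / 2) = \<nu> * u\<^sup>2 / 2 * (q - 1 / \<mu>\<^sup>2)"
      unfolding q(1) by (simp add: algebra_simps)
    moreover have "\<bar>\<nu> * u\<^sup>2 / 2\<bar> = \<nu> * u\<^sup>2 / 2" using \<nu> by simp
    ultimately show ?case unfolding real_norm_def by (simp only: abs_mult)
  qed
  then have "(\<lambda>\<mu>. digap \<nu> u b \<mu> - \<nu> / \<mu>\<^sup>2 * (u\<^sup>2 / 2)) \<in> O[at_top](\<lambda>\<mu>. \<nu> * u\<^sup>2 / 2 * (1 / (\<mu> - B)\<^sup>2 - 1 / (\<mu> + B)\<^sup>2))"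
    by (rule landau_o.big_mono)
  also have "(\<lambda>\<mu>. \<nu> * u\<^sup>2 / 2 * (1 / (\<mu> - B)\<^sup>2 - 1 / (\<mu> + B)\<^sup>2)) \<in> O[at_top](\<lambda>\<mu>. \<mu> powr (-5/2))"
  proof -
    \<comment> \<open>The difference behaves like 4 B / \<mu>^3, which is below the required
      order.\<close>
    have "(\<lambda>\<mu>. 1 / (\<mu> - B)\<^sup>2 - 1 / (\<mu> + B)\<^sup>2) \<in> O[at_top](\<lambda>\<mu>. \<mu> powr (-5/2))" using B by real_asymp
    then show ?thesis by simp
  qed
  finally show ?thesis .
qed

theorem theorem1:
  fixes d h r :: nat and k :: "nat \<Rightarrow> nat" and t :: "nat \<Rightarrow> real" and \<nu> :: real and \<phi> :: param
  assumes "d \<in> {1, 2}"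
    and "h \<ge> 2"
    and "\<forall>i\<in>{1..h}. k i > 0"
    and "(\<Sum>i=1..h. k i) = r"
    and "\<nu> > (real r - 1) * real d / 2"
    and "\<phi> \<in> Phi d k h"
  shows "(\<lambda>\<mu>::real. risk d k h \<mu> \<nu> \<phi> (predictive d k h t \<mu> \<nu>)
            - (risk d k h \<mu> \<nu> \<phi> (predictive d k h (tR d k) \<mu> \<nu>)
               + \<nu> / \<mu>^2 * (\<Sum>i=1..h. 1/2 * real (k i) * (t i - tR d k i)^2)))
         \<in> O[at_top](\<lambda>\<mu>. \<mu> powr (-5/2))"
proof -
  interpret field_dim d by unfold_locales (rule assms(1))
  have r: "rsum k h = r" using assms(4) by (simp only: rsum_def)
  have "k 1 \<le> rsum k h" unfolding rsum_def using assms(2) by (intro member_le_sum) auto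
  then have r0: "0 < rsum k h" using assms(2,3) by force
  have "0 \<le> (real r - 1) * real d / 2" using r0 r by simp
  then have \<nu>0: "0 < \<nu>" using assms(5) by linarith
  have \<nu>: "wparam (rsum k h) \<nu>" using assms(5) r by (intro wparamI) simp
  let ?u = "\<lambda>i. t i - tR d k i" and ?b = "\<lambda>i l. real (rsum k (i - 1) + l) * real d / 2"
  \<comment> \<open>Only large \<mu> matter: the integrals against each of the two priors are finite
    once all shapes are positive, which holds eventually.\<close>
  have pp: "\<forall>\<^sub>F \<mu> in at_top. pparam k h s \<mu>" for s
    unfolding pparam_def
  proof (rule eventually_ball_finite, simp, intro ballI)
    fix i
    show "\<forall>\<^sub>F \<mu> in at_top. 0 < \<mu> + s i + real (rsum k (i - 1)) * real d / 2 + 1"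
      using eventually_gt_at_top[of "- (s i + real (rsum k (i - 1)) * real d / 2 + 1)"] by eventually_elim linarith
  qed
  have "\<forall>\<^sub>F \<mu> in at_top. risk d k h \<mu> \<nu> \<phi> (predictive d k h t \<mu> \<nu>)
      - (risk d k h \<mu> \<nu> \<phi> (predictive d k h (tR d k) \<mu> \<nu>) + \<nu> / \<mu>^2 * (\<Sum>i=1..h. 1/2 * real (k i) * (?u i)^2)) =
      (\<Sum>i=1..h. \<Sum>l<k i. digap \<nu> (?u i) (?b i l) \<mu> - \<nu> / \<mu>\<^sup>2 * ((?u i)\<^sup>2 / 2))"
    using pp[of t] pp[of "tR d k"] eventually_gt_at_top[of "(real (rsum k h) - 1) * real d / 2"]
  proof eventually_elim
    case (elim \<mu>)
    have \<mu>: "wparam (rsum k h) \<mu>" by (rule wparamI[OF elim(3)])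
    \<comment> \<open>The reflection behind \<open>tR\<close>: inserting
      \<open>rsum k i = rsum k (i - 1) + k i\<close> turns the shape of row l into that of the pivot
      at position \<open>k i - 1 - l\<close> of the same block.\<close>
    have sR: "shape k (tR d k) \<kappa> i l = \<kappa> - ?b i (k i - Suc l)" if i: "i \<in> {1..h}" and l: "l < k i" for \<kappa> i l
    proof -
      obtain i' where i': "i = Suc i'" using i by (cases i) auto
      have "real (k i - Suc l) = real (k i) - 1 - real l" using l by (simp add: of_nat_diff)
      then show ?thesis unfolding shape_def tR_def by (simp add: i' field_simps)
    qed
    have sT: "shape k t \<kappa> i l = shape k (tR d k) \<kappa> i l + ?u i" for \<kappa> i l by (simp add: shape_def)
    let ?G = "\<lambda>i b. ln_Gamma (\<mu> - b + ?u i) - ln_Gamma (\<mu> - b) - (ln_Gamma (\<mu> + \<nu> - b + ?u i) - ln_Gamma (\<mu> + \<nu> - b))"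
    let ?P = "\<lambda>i b. ?u i * (Digamma (\<mu> + \<nu> - b) - Digamma (\<mu> - b))"
    have "risk d k h \<mu> \<nu> \<phi> (predictive d k h t \<mu> \<nu>) - risk d k h \<mu> \<nu> \<phi> (predictive d k h (tR d k) \<mu> \<nu>) =
        (\<Sum>i=1..h. \<Sum>l<k i. ?G i (?b i (k i - Suc l)) + ?P i (?b i l))"
      unfolding risk_diff[OF r0 \<mu> \<nu> less_imp_le[OF \<nu>0] assms(6) elim(1,2)]
      by (intro sum.cong refl) (simp add: sT sR)
    \<comment> \<open>The ln Gamma terms sit at mirrored positions while the Digamma terms do not.
      Reversing the sum of the former over the block aligns them, and only the sums over a whole
      block agree.\<close>
    also have "\<dots> = (\<Sum>i=1..h. \<Sum>l<k i. ?G i (?b i l) + ?P i (?b i l))"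
    proof (rule sum.cong[OF refl])
      fix i
      have "(\<Sum>l<k i. ?G i (?b i (k i - Suc l))) = (\<Sum>l<k i. ?G i (?b i l))"
        by (rule sum.nat_diff_reindex)
      then show "(\<Sum>l<k i. ?G i (?b i (k i - Suc l)) + ?P i (?b i l)) = (\<Sum>l<k i. ?G i (?b i l) + ?P i (?b i l))"
        by (simp only: sum.distrib)
    qed
    also have "\<dots> = (\<Sum>i=1..h. \<Sum>l<k i. digap \<nu> (?u i) (?b i l) \<mu>)" by (simp only: digap_def)
    finally have 1: "risk d k h \<mu> \<nu> \<phi> (predictive d k h t \<mu> \<nu>) - risk d k h \<mu> \<nu> \<phi> (predictive d k h (tR d k) \<mu> \<nu>) =
        (\<Sum>i=1..h. \<Sum>l<k i. digap \<nu> (?u i) (?b i l) \<mu>)" .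
    \<comment> \<open>The summand does not depend on l, so summing over the rows of block i gives
      the weight \<open>k i\<close>.\<close>
    have 2: "\<nu> / \<mu>^2 * (\<Sum>i=1..h. 1/2 * real (k i) * (?u i)^2) = (\<Sum>i=1..h. \<Sum>l<k i. \<nu> / \<mu>\<^sup>2 * ((?u i)\<^sup>2 / 2))"
      unfolding sum_distrib_left by (intro sum.cong refl) simp
    show ?case unfolding 2 sum_subtractf using 1 by linarith
  qed
  moreover have "(\<lambda>\<mu>. \<Sum>i=1..h. \<Sum>l<k i. digap \<nu> (?u i) (?b i l) \<mu> - \<nu> / \<mu>\<^sup>2 * ((?u i)\<^sup>2 / 2)) \<in> O[at_top](\<lambda>\<mu>. \<mu> powr (-5/2))"
    by (intro big_sum_in_bigo digap_asymp \<nu>0)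
  ultimately show ?thesis by (subst landau_o.big.in_cong)
qed

end
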